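(* Let $N\geq 2$ be an integer, and let $k,l\in\mathbb{R}$ satisfy $k+N-1>0$, $l+N>0$ and $$l\,\frac{N-1}{N}\leq k\leq\min\{0,l+1\}.$$ Then $C_{k,l,N}=C_{k,l,N}^{rad}$. Moreover, $\mathcal{R}_{k,l,N}(M)=C_{k,l,N}^{rad}$ for some measurable set $M\subset\mathbb{R}^N$ with $0<\mu_l(M)<+\infty$ holds only if $M=B_R$ for some $R>0$.
   Context: $B_R$ is the open ball of radius $R$ centered at the origin of $\mathbb{R}^N$, $\omega_N$ is the Lebesgue measure of $B_1$, and $d\mu_l(x)=|x|^l\,dx$. The $\mu_k$-perimeter of a measurable set $M\subset\mathbb{R}^N$ is $$P_{\mu_k}(M):=\sup\left\{\int_M \mathrm{div}(|x|^k\mathbf{v})\,dx:\ \mathbf{v}\in C_0^1(\mathbb{R}^N,\mathbb{R}^N),\ |\mathbf{v}|\leq 1 \text{ in } M\right\}.$$ For measurable $M$ with $0<\mu_l(M)<+\infty$ set $$\mathcal{R}_{k,l,N}(M):=\frac{P_{\mu_k}(M)}{(\mu_l(M))^{(k+N-1)/(l+N)}},$$ and $C_{k,l,N}:=\inf\{\mathcal{R}_{k,l,N}(M): M \text{ measurable},\ 0<\mu_l(M)<+\infty\}$. Further $$C_{k,l,N}^{rad}:=(N\omega_N)^{(l-k+1)/(l+N)}(l+N)^{(k+N-1)/(l+N)}=\mathcal{R}_{k,l,N}(B_1).$$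
   Formalization: M is shown to equal a ball only up to a Lebesgue null set (the closed ball also attains equality), and for k=l=0 the ball may have any centre, since the ratio is then translation invariant; in all other cases the ball is centred at the origin. *)

theory Defs
  imports "HOL-Analysis.Analysis"
begin

definition divergence :: "(real^'n::finite \<Rightarrow> real^'n) \<Rightarrow> real^'n \<Rightarrow> real" where
  "divergence F x = (\<Sum>i\<in>UNIV. frechet_derivative F (at x) (axis i 1) $ i)"

definition C1_compact_support :: "(real^'n::finite \<Rightarrow> real^'n) set" where
  "C1_compact_support =
    {v. (\<exists>v'. (\<forall>x. (v has_derivative blinfun_apply (v' x)) (at x)) \<and> continuous_on UNIV v') \<and>
        compact (closure {x. v x \<noteq> 0})}"

definition weighted_measure :: "real \<Rightarrow> (real^'n::finite) measure" where
  "weighted_measure l = density lebesgue (\<lambda>x. ennreal (norm x powr l))"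

text \<open>The field need not be differentiable at the origin, where \<^const>\<open>frechet_derivative\<close> is
  unspecified; a single point does not affect the integral. The integrand is Lebesgue integrable
  whenever the sum of the exponent and the dimension exceeds one. For other exponents
  integrability may fail, and the Bochner integral then is 0 by convention.\<close>

definition weighted_perimeter :: "real \<Rightarrow> (real^'n::finite) set \<Rightarrow> ereal" where
  "weighted_perimeter k M =
    (SUP v \<in> {v \<in> C1_compact_support. \<forall>x\<in>M. norm (v x) \<le> 1}.
       ereal (LINT x:M|lebesgue. divergence (\<lambda>y. (norm y powr k) *\<^sub>R v y) x))"

definition admissible_sets :: "real \<Rightarrow> (real^'n::finite) set set" where
  "admissible_sets l =
    {M \<in> sets lebesgue. 0 < emeasure (weighted_measure l) M \<and> emeasure (weighted_measure l) M < \<infinity>}"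

definition isoperimetric_ratio :: "real \<Rightarrow> real \<Rightarrow> (real^'n::finite) set \<Rightarrow> ereal" where
  "isoperimetric_ratio k l M =
    weighted_perimeter k M /
    ereal (measure (weighted_measure l) M powr ((k + real CARD('n) - 1) / (l + real CARD('n))))"

definition isoperimetric_const :: "'n::finite itself \<Rightarrow> real \<Rightarrow> real \<Rightarrow> ereal" where
  "isoperimetric_const _ k l =
    (INF M \<in> (admissible_sets l :: (real^'n) set set). isoperimetric_ratio k l M)"

definition radial_const :: "'n::finite itself \<Rightarrow> real \<Rightarrow> real \<Rightarrow> real" where
  "radial_const _ k l =
    (let N = real CARD('n); \<omega> = measure lebesgue (ball (0 :: real^'n) 1)
     in (N * \<omega>) powr ((l - k + 1) / (l + N)) * (l + N) powr ((k + N - 1) / (l + N)))"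

end

theory Submission
  imports Defs
begin

text \<open>Put \<open>s = k / (N - 1)\<close> and \<open>\<Phi> x = |x|\<^sup>s x\<close>. The Piola transform under \<open>\<Phi>\<close> turns unweighted test fields into
  admissible fields for the weight \<open>|x|\<^sup>k\<close>, because \<open>- 1 < s \<le> 0\<close> makes it contract tangentially. Hence the
  \<open>k\<close>-perimeter of \<open>M\<close> dominates the Euclidean perimeter of \<open>E = \<Phi> M\<close>, whereas the weighted volume becomes
  a multiple of the integral of \<open>|y|\<^sup>\<gamma>\<close> over \<open>E\<close> for some \<open>\<gamma>\<close> in \<open>[- 1, 0]\<close>, which among sets of given volume
  is largest for the centred ball. The inequality follows from the Euclidean isoperimetric inequality.

  In the case of equality \<open>E\<close> is the centred ball if \<open>\<gamma> < 0\<close>. If \<open>\<gamma> = 0\<close>, then \<open>E\<close> is an equality case of the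
  Euclidean inequality. Cutting such a set and the ball of equal volume into slabs of equal volume orthogonal to a
  coordinate axis, and enlarging only the middle slab of the ball, one finds that matching slabs of \<open>E\<close> are not
  wider than those of the ball. So about a suitable centre the second moment of \<open>E\<close> is at most that of
  the ball, and \<open>E\<close> is a ball. If \<open>k < 0\<close> and the centre \<open>a\<close> is not the origin, then the field obtained from
  \<open>(y - a) / \<rho>\<close> shows that the \<open>k\<close>-perimeter is too large.\<close>

section \<open>The Brunn--Minkowski inequality\<close>

text \<open>The bounds on \<open>k\<close> are bounds on \<gamma>, where
  \<open>(1 + s) * \<gamma> = l - s * N\<close>: the left one says \<gamma> \<le> 0, and
  \<open>k \<le> l + 1\<close> says -1 \<le> \<gamma>. Together they make |y|^\<gamma> dominate 1/(1
  + |y|), which is all the control at infinity there is before \<open>E\<close> is known to have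
  finite volume; it suffices for truncating \<open>E\<close>, and the isoperimetric inequality then
  yields the finiteness. The condition \<open>k + N - 1 > 0\<close> makes |x|^(k - 1) integrable at
  the origin, so that test fields may be cut off where \<Phi> is singular. Sets of finite perimeter
  are reached only through C^1 approximations, for which equality holds only in the limit, so
  equality cases of Brunn-Minkowski are out of reach. Thickening one slab of the ball by
  \<open>h\<close> instead gains volume to first order, at the price of the perimeter inside the
  matching slab of \<open>E\<close> and the areas of its two faces. Averaged over the position of a
  slab of width \<alpha>, the perimeter part is at most \<alpha> P and vanishes as \<alpha> tends to
  0; what remains bounds the volume of \<open>E\<close> between two hyperplanes from below by
  sections of the ball.\<close>

definition minkowski_sum :: "'a::ab_group_add set \<Rightarrow> 'a set \<Rightarrow> 'a set" where
  "minkowski_sum A B = (\<Union>x\<in>A. \<Union>y\<in>B. {x + y})"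

lemma mem_minkowski_sum: "z \<in> minkowski_sum A B \<longleftrightarrow> (\<exists>x\<in>A. \<exists>y\<in>B. z = x + y)"
  by (auto simp: minkowski_sum_def)

lemma minkowski_sum_mono: "A \<subseteq> A' \<Longrightarrow> B \<subseteq> B' \<Longrightarrow> minkowski_sum A B \<subseteq> minkowski_sum A' B'"
  by (auto simp: minkowski_sum_def)

lemma open_minkowski_sum:
  fixes A B :: "'a::real_normed_vector set"
  shows "open A \<Longrightarrow> open (minkowski_sum A B)"
  unfolding minkowski_sum_def by (rule open_sums) simp

lemma bounded_minkowski_sum:
  fixes A B :: "'a::real_normed_vector set"
  assumes "bounded A" "bounded B"
  shows "bounded (minkowski_sum A B)"
  using bounded_sums[OF assms] unfolding minkowski_sum_def by (rule bounded_subset) auto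

text \<open>AM-GM for the ratios \<open>a i / (a i + b i)\<close> and for
  \<open>b i / (a i + b i)\<close>: the two arithmetic means add up to 1. For the side lengths of
  boxes this is the Brunn-Minkowski inequality.\<close>

lemma root_prod_add_le:
  fixes a b :: "'i \<Rightarrow> real"
  assumes fin: "finite I" "I \<noteq> {}" and pos: "\<And>i. i \<in> I \<Longrightarrow> a i > 0" "\<And>i. i \<in> I \<Longrightarrow> b i > 0"
  shows "root (card I) (\<Prod>i\<in>I. a i) + root (card I) (\<Prod>i\<in>I. b i) \<le> root (card I) (\<Prod>i\<in>I. a i + b i)"
proof -
  let ?n = "card I"
  have n: "?n > 0" using fin by (simp add: card_gt_0_iff)
  have w: "(\<Prod>i\<in>I. a i + b i) > 0" using pos by (intro prod_pos) (simp add: add_pos_pos)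
  have quot: "root ?n (\<Prod>i\<in>I. c i) / root ?n (\<Prod>i\<in>I. a i + b i) \<le> (\<Sum>i\<in>I. c i / (a i + b i)) / ?n"
    if c: "\<And>i. i \<in> I \<Longrightarrow> c i > 0" for c
  proof -
    have "root ?n (\<Prod>i\<in>I. c i) / root ?n (\<Prod>i\<in>I. a i + b i) = root ?n (\<Prod>i\<in>I. c i / (a i + b i))"
      by (simp add: prod_dividef real_root_divide)
    also have "\<dots> = (\<Prod>i\<in>I. c i / (a i + b i)) powr (1 / ?n)"
      using n c pos by (subst root_powr_inverse) (auto intro!: prod_nonneg simp: less_imp_le add_nonneg_nonneg)
    also have "\<dots> \<le> (\<Sum>i\<in>I. (c i / (a i + b i)) / ?n)"
      by (intro arith_geom_mean fin) (use c pos in \<open>simp add: add_pos_pos less_imp_le\<close>)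
    finally show ?thesis by (simp add: sum_divide_distrib)
  qed
  have "(root ?n (\<Prod>i\<in>I. a i) + root ?n (\<Prod>i\<in>I. b i)) / root ?n (\<Prod>i\<in>I. a i + b i)
      \<le> (\<Sum>i\<in>I. a i / (a i + b i)) / ?n + (\<Sum>i\<in>I. b i / (a i + b i)) / ?n"
    using quot[of a] quot[of b] pos by (simp add: add_divide_distrib)
  also have "\<dots> = (\<Sum>i\<in>I. (a i + b i) / (a i + b i)) / ?n"
    by (simp only: sum.distrib add_divide_distrib)
  also have "(\<Sum>i\<in>I. (a i + b i) / (a i + b i)) = (\<Sum>i\<in>I. 1)"
    by (intro sum.cong refl) (use pos in \<open>metis add_pos_pos divide_self less_irrefl\<close>)
  finally have "(root ?n (\<Prod>i\<in>I. a i) + root ?n (\<Prod>i\<in>I. b i)) / root ?n (\<Prod>i\<in>I. a i + b i) \<le> 1"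
    using n by simp
  then show ?thesis using w n by (simp add: divide_le_eq real_root_gt_zero)
qed

lemma negligible_hyperplane: "i \<in> Basis \<Longrightarrow> negligible {x::'a::euclidean_space. x \<bullet> i = c}"
  by (rule negligible_standard_hyperplane)

lemma halfspace_measurable [measurable]:
  "{x::'a::euclidean_space. x \<bullet> i < c} \<in> sets lebesgue" "{x::'a::euclidean_space. c < x \<bullet> i} \<in> sets lebesgue"
proof -
  have "open {x::'a. x \<bullet> i < c}" "open {x::'a. c < x \<bullet> i}"
    by (auto intro!: open_Collect_less continuous_intros)
  then show "{x::'a. x \<bullet> i < c} \<in> sets lebesgue" "{x::'a. c < x \<bullet> i} \<in> sets lebesgue"
    by (simp_all add: borel_open)
qed

lemma measure_halfspace_split:
  fixes A :: "'a::euclidean_space set"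
  assumes A: "A \<in> lmeasurable" and i: "i \<in> Basis"
  shows "measure lebesgue A = measure lebesgue (A \<inter> {x. x \<bullet> i < c}) + measure lebesgue (A \<inter> {x. c < x \<bullet> i})"
proof -
  let ?L = "A \<inter> {x. x \<bullet> i < c}" and ?R = "A \<inter> {x. c < x \<bullet> i}"
  have LR: "?L \<in> lmeasurable" "?R \<in> lmeasurable"
    by (auto intro!: fmeasurable_Int_fmeasurable A)
  have "measure lebesgue A = measure lebesgue (?L \<union> ?R)"
  proof (rule measure_negligible_symdiff[symmetric])
    show "negligible (A - (?L \<union> ?R) \<union> (?L \<union> ?R - A))"
      by (rule negligible_subset[OF negligible_hyperplane[OF i, of c]]) auto
  qed (use A in auto)
  also have "\<dots> = measure lebesgue ?L + measure lebesgue ?R"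
    using LR by (intro measure_Un2[THEN trans]) (auto intro: arg_cong[where f="measure lebesgue"])
  finally show ?thesis .
qed

text \<open>Hyperplanes are null, so the volume below a cut depends continuously on its height; this
  lets a set be cut in a prescribed volume ratio.\<close>

lemma continuous_on_measure_halfspace:
  fixes A :: "'a::euclidean_space set"
  assumes A: "A \<in> lmeasurable" and i: "i \<in> Basis"
  shows "continuous_on UNIV (\<lambda>c. measure lebesgue (A \<inter> {x. x \<bullet> i < c}))"
  unfolding continuous_on_sequentially
proof (intro allI ballI impI, elim conjE)
  fix X :: "nat \<Rightarrow> real" and c assume X: "X \<longlonglongrightarrow> c"
  have "(\<lambda>n. LINT x|lebesgue. indicator (A \<inter> {x. x \<bullet> i < X n}) x :: real)
      \<longlonglongrightarrow> (LINT x|lebesgue. indicator (A \<inter> {x. x \<bullet> i < c}) x)"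
  proof (rule integral_dominated_convergence[where w="indicator A"])
    have "AE x in lebesgue. x \<notin> {x::'a. x \<bullet> i = c}"
      by (rule AE_not_in) (use negligible_hyperplane[OF i] in \<open>simp add: negligible_iff_null_sets\<close>)
    then show "AE x in lebesgue. (\<lambda>n. indicat_real (A \<inter> {x. x \<bullet> i < X n}) x) \<longlonglongrightarrow> indicator (A \<inter> {x. x \<bullet> i < c}) x"
    proof eventually_elim
      case (elim x)
      then consider "x \<bullet> i < c" | "x \<bullet> i > c" by fastforce
      then show ?case
      proof cases
        case 1
        then have "eventually (\<lambda>n. x \<bullet> i < X n) sequentially" by (rule order_tendstoD[OF X])
        then show ?thesis using 1
          by (intro tendsto_eventually) (auto elim!: eventually_mono simp: indicator_def)
      next
        case 2
        then have "eventually (\<lambda>n. X n < x \<bullet> i) sequentially" by (rule order_tendstoD[OF X])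
        then show ?thesis using 2
          by (intro tendsto_eventually) (auto elim!: eventually_mono simp: indicator_def)
      qed
    qed
    have [measurable]: "A \<in> sets lebesgue" using A by auto
    show "indicat_real (A \<inter> {x. x \<bullet> i < c}) \<in> borel_measurable lebesgue"
      "indicat_real (A \<inter> {x. x \<bullet> i < X n}) \<in> borel_measurable lebesgue" for n
      by measurable
    show "integrable lebesgue (indicat_real A)" using A by (simp add: lmeasurable_iff_integrable)
  qed (auto simp: indicator_def)
  then show "((\<lambda>c. measure lebesgue (A \<inter> {x. x \<bullet> i < c})) \<circ> X) \<longlonglongrightarrow> measure lebesgue (A \<inter> {x. x \<bullet> i < c})"
    by (simp add: o_def)
qed

text \<open>Disjoint nonempty open boxes: a coordinate hyperplane separates any two of them, so
  cutting along it leaves strictly fewer boxes on either side, which drives an induction on their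
  number.\<close>

definition box_family :: "'a::euclidean_space set set \<Rightarrow> bool" where
  "box_family \<A> \<longleftrightarrow> finite \<A> \<and> (\<forall>X\<in>\<A>. X \<noteq> {} \<and> (\<exists>a b. X = box a b)) \<and> pairwise disjnt \<A>"

lemma box_family_open_bounded:
  assumes "box_family \<A>" shows "open (\<Union>\<A>)" "bounded (\<Union>\<A>)" "\<Union>\<A> \<in> lmeasurable"
proof -
  show o: "open (\<Union>\<A>)" and b: "bounded (\<Union>\<A>)"
    using assms unfolding box_family_def by (metis open_Union open_box, metis bounded_Union bounded_box)
  show "\<Union>\<A> \<in> lmeasurable" by (rule lmeasurable_open[OF b o])
qed

lemma box_Int_halfspace:
  fixes i :: "'a::euclidean_space"
  assumes i: "i \<in> Basis"
  shows "\<exists>a' b'. box a b \<inter> {x. x \<bullet> i < c} = box a' b'" "\<exists>a' b'. box a b \<inter> {x. c < x \<bullet> i} = box a' b'"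
proof -
  have "box a b \<inter> {x. x \<bullet> i < c} = box a (\<Sum>j\<in>Basis. (if j = i then min (b \<bullet> i) c else b \<bullet> j) *\<^sub>R j)"
    using i by (auto simp: box_def split: if_splits)
  then show "\<exists>a' b'. box a b \<inter> {x. x \<bullet> i < c} = box a' b'" by blast
  have "box a b \<inter> {x. c < x \<bullet> i} = box (\<Sum>j\<in>Basis. (if j = i then max (a \<bullet> i) c else a \<bullet> j) *\<^sub>R j) b"
    using i by (auto simp: box_def split: if_splits)
  then show "\<exists>a' b'. box a b \<inter> {x. c < x \<bullet> i} = box a' b'" by blast
qed

lemma box_family_cut:
  assumes fam: "box_family \<A>" and H: "\<And>a b. \<exists>a' b'. box a b \<inter> H = box a' b'"
  shows "\<exists>\<A>'. box_family \<A>' \<and> \<Union>\<A>' = \<Union>\<A> \<inter> H \<and> card \<A>' \<le> card \<A> \<and>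
    ((\<exists>X\<in>\<A>. X \<inter> H = {}) \<longrightarrow> card \<A>' < card \<A>)"
proof -
  define \<A>' where "\<A>' = (\<lambda>X. X \<inter> H) ` {X\<in>\<A>. X \<inter> H \<noteq> {}}"
  have fin: "finite \<A>" using fam by (simp add: box_family_def)
  have "box_family \<A>'"
    unfolding box_family_def
  proof (intro conjI ballI)
    show "finite \<A>'" using fin by (simp add: \<A>'_def)
    show "X \<noteq> {}" if "X \<in> \<A>'" for X using that by (auto simp: \<A>'_def)
    show "\<exists>a b. X = box a b" if "X \<in> \<A>'" for X
      using that fam H by (fastforce simp: \<A>'_def box_family_def)
    show "pairwise disjnt \<A>'"
      using fam unfolding box_family_def pairwise_def disjnt_def \<A>'_def by blast
  qed
  moreover have "\<Union>\<A>' = \<Union>\<A> \<inter> H" by (auto simp: \<A>'_def)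
  moreover have le: "card \<A>' \<le> card {X\<in>\<A>. X \<inter> H \<noteq> {}}"
    unfolding \<A>'_def using fin by (intro card_image_le) simp
  moreover have "card {X\<in>\<A>. X \<inter> H \<noteq> {}} \<le> card \<A>"
    using fin by (intro card_mono) auto
  moreover have "card {X\<in>\<A>. X \<inter> H \<noteq> {}} < card \<A>" if "\<exists>X\<in>\<A>. X \<inter> H = {}"
    using fin that by (intro psubset_card_mono) auto
  ultimately show ?thesis by (meson dual_order.trans le_less_trans)
qed

lemma disjoint_boxes_separated:
  fixes a b c d :: "'a::euclidean_space"
  assumes "box a b \<inter> box c d = {}" "box a b \<noteq> {}" "box c d \<noteq> {}"
  shows "\<exists>i\<in>Basis. b \<bullet> i \<le> c \<bullet> i \<or> d \<bullet> i \<le> a \<bullet> i"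
proof (rule ccontr)
  assume neg: "\<not> ?thesis"
  have "box a b \<inter> box c d =
    box (\<Sum>i\<in>Basis. max (a \<bullet> i) (c \<bullet> i) *\<^sub>R i) (\<Sum>i\<in>Basis. min (b \<bullet> i) (d \<bullet> i) *\<^sub>R i)"
    by (simp add: box_Int_box)
  also have "\<dots> \<noteq> {}"
    using neg assms(2,3) by (auto simp: box_ne_empty not_le)
  finally show False using assms(1) by simp
qed

lemma box_subset_minkowski_sum:
  fixes a b c d :: "'a::euclidean_space"
  assumes "box a b \<noteq> {}" "box c d \<noteq> {}"
  shows "box (a + c) (b + d) \<subseteq> minkowski_sum (box a b) (box c d)"
proof
  fix z assume z: "z \<in> box (a + c) (b + d)"
  \<comment> \<open>\<open>t i\<close> is the relative position of \<open>z\<close> in the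
    \<open>i\<close>-th side of the sum box; \<open>x\<close> and \<open>z - x\<close> take the same
    relative position in the two summands.\<close>
  define t where "t i = (z \<bullet> i - a \<bullet> i - c \<bullet> i) / (b \<bullet> i - a \<bullet> i + d \<bullet> i - c \<bullet> i)" for i
  define x where "x = (\<Sum>i\<in>Basis. (a \<bullet> i + t i * (b \<bullet> i - a \<bullet> i)) *\<^sub>R i)"
  have ab: "a \<bullet> i < b \<bullet> i" "c \<bullet> i < d \<bullet> i" if "i \<in> Basis" for i
    using that assms by (auto simp: box_ne_empty)
  have t: "0 < t i" "t i < 1" "z \<bullet> i = a \<bullet> i + c \<bullet> i + t i * (b \<bullet> i - a \<bullet> i + d \<bullet> i - c \<bullet> i)" if "i \<in> Basis" for i
  proof -
    have "a \<bullet> i + c \<bullet> i < z \<bullet> i" "z \<bullet> i < b \<bullet> i + d \<bullet> i" using z that by (auto simp: box_def inner_add_left)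
    then show "0 < t i" "t i < 1" "z \<bullet> i = a \<bullet> i + c \<bullet> i + t i * (b \<bullet> i - a \<bullet> i + d \<bullet> i - c \<bullet> i)"
      using ab[OF that] by (auto simp: t_def field_simps)
  qed
  have lin: "p < p + u * (q - p)" "p + u * (q - p) < q" if "0 < u" "u < 1" "p < q" for p q u :: real
  proof -
    have "0 < u * (q - p)" "0 < (1 - u) * (q - p)" using that by auto
    then show "p < p + u * (q - p)" "p + u * (q - p) < q" by (simp_all add: left_diff_distrib)
  qed
  have "x \<in> box a b"
    using lin[OF t(1,2) ab(1)] by (auto simp: box_def x_def)
  moreover have "z - x \<in> box c d"
  proof -
    have "x \<bullet> i = a \<bullet> i + t i * (b \<bullet> i - a \<bullet> i)" if "i \<in> Basis" for i
      using that by (simp add: x_def)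
    from t(3) this have "(z - x) \<bullet> i = c \<bullet> i + t i * (d \<bullet> i - c \<bullet> i)" if "i \<in> Basis" for i
      using that by (simp add: inner_diff_left ring_distribs)
    then show ?thesis using lin[OF t(1,2) ab(2)] by (auto simp: box_def)
  qed
  ultimately show "z \<in> minkowski_sum (box a b) (box c d)"
    unfolding mem_minkowski_sum by (intro bexI[of _ x] bexI[of _ "z - x"]) auto
qed

lemma measure_box_positive:
  fixes a b :: "'a::euclidean_space"
  assumes "box a b \<noteq> {}" shows "measure lebesgue (box a b) = (\<Prod>i\<in>Basis. (b - a) \<bullet> i)" "measure lebesgue (box a b) > 0"
proof -
  show 1: "measure lebesgue (box a b) = (\<Prod>i\<in>Basis. (b - a) \<bullet> i)"
    using assms measure_lborel_box[of a b] by (auto simp: box_ne_empty less_imp_le)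
  show "measure lebesgue (box a b) > 0"
    unfolding 1 using assms by (intro prod_pos) (auto simp: box_ne_empty inner_diff_left)
qed

lemma box_family_measure_pos:
  assumes "box_family \<A>" "\<A> \<noteq> {}" shows "measure lebesgue (\<Union>\<A>) > 0"
proof -
  obtain a b where X: "box a b \<in> \<A>" "box a b \<noteq> {}" using assms by (force simp: box_family_def)
  have "measure lebesgue (box a b) \<le> measure lebesgue (\<Union>\<A>)"
    using box_family_open_bounded(3)[OF assms(1)] X by (intro measure_mono_fmeasurable) auto
  then show ?thesis using measure_box_positive(2)[OF X(2)] by simp
qed

lemma brunn_minkowski_box:
  fixes a b c d :: "'a::euclidean_space"
  assumes ne: "box a b \<noteq> {}" "box c d \<noteq> {}"
  shows "root DIM('a) (measure lebesgue (box a b)) + root DIM('a) (measure lebesgue (box c d))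
     \<le> root DIM('a) (measure lebesgue (minkowski_sum (box a b) (box c d)))"
proof -
  have ne': "box (a + c) (b + d) \<noteq> {}" using ne by (auto simp: box_ne_empty inner_add_left add_strict_mono)
  have "root DIM('a) (measure lebesgue (box a b)) + root DIM('a) (measure lebesgue (box c d))
     \<le> root DIM('a) (\<Prod>i\<in>Basis. (b - a) \<bullet> i + (d - c) \<bullet> i)"
    unfolding measure_box_positive(1)[OF ne(1)] measure_box_positive(1)[OF ne(2)]
    using ne by (intro root_prod_add_le) (auto simp: box_ne_empty inner_diff_left)
  also have "(\<Prod>i\<in>Basis. (b - a) \<bullet> i + (d - c) \<bullet> i) = measure lebesgue (box (a + c) (b + d))"
    unfolding measure_box_positive(1)[OF ne'] by (intro prod.cong) (auto simp: algebra_simps)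
  also have "root DIM('a) \<dots> \<le> root DIM('a) (measure lebesgue (minkowski_sum (box a b) (box c d)))"
    using box_subset_minkowski_sum[OF ne]
    by (intro real_root_le_mono DIM_positive measure_mono_fmeasurable lmeasurable_open open_minkowski_sum bounded_minkowski_sum) auto
  finally show ?thesis .
qed

text \<open>The Hadwiger-Ohmann argument, by induction on the total number of boxes. One family is
  cut by a hyperplane separating two of its boxes, the other by a parallel hyperplane that divides
  its volume in the same ratio. The sums of the lower halves and of the upper halves are disjoint,
  so their volumes add.\<close>

lemma brunn_minkowski_box_family:
  fixes \<A> \<B> :: "'a::euclidean_space set set"
  assumes "box_family \<A>" "\<A> \<noteq> {}" "box_family \<B>" "\<B> \<noteq> {}"
  shows "(root DIM('a) (measure lebesgue (\<Union>\<A>)) + root DIM('a) (measure lebesgue (\<Union>\<B>))) ^ DIM('a)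
     \<le> measure lebesgue (minkowski_sum (\<Union>\<A>) (\<Union>\<B>))"
  using assms
proof (induction "card \<A> + card \<B>" arbitrary: \<A> \<B> rule: less_induct)
  case less
  define n where "n = DIM('a)"
  have n: "n > 0" by (simp add: n_def)
  let ?m = "measure lebesgue :: 'a set \<Rightarrow> real"
  \<comment> \<open>Stated for any family with two distinct boxes, so that it also serves with the
    roles of the two families exchanged.\<close>
  have step: "(root n (?m (\<Union>\<A>)) + root n (?m (\<Union>\<B>))) ^ n \<le> ?m (minkowski_sum (\<Union>\<A>) (\<Union>\<B>))"
    if fA: "box_family \<A>" "\<A> \<noteq> {}" and fB: "box_family \<B>" "\<B> \<noteq> {}" and two: "X \<in> \<A>" "Y \<in> \<A>" "X \<noteq> Y"
      and IH: "\<And>\<A>' \<B>'. card \<A>' < card \<A> \<Longrightarrow> card \<B>' \<le> card \<B> \<Longrightarrow> box_family \<A>' \<Longrightarrow> \<A>' \<noteq> {} \<Longrightarrow> box_family \<B>' \<Longrightarrow> \<B>' \<noteq> {} \<Longrightarrow>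
        (root n (?m (\<Union>\<A>')) + root n (?m (\<Union>\<B>'))) ^ n \<le> ?m (minkowski_sum (\<Union>\<A>') (\<Union>\<B>'))"
    for \<A> \<B> :: "'a set set" and X Y
  proof -
    obtain a b where X: "X = box a b" "X \<noteq> {}" using fA two unfolding box_family_def by blast
    obtain c d where Y: "Y = box c d" "Y \<noteq> {}" using fA two unfolding box_family_def by blast
    have XY: "X \<inter> Y = {}" using fA(1) two unfolding box_family_def pairwise_def disjnt_def by blast
    obtain i where i: "i \<in> Basis" "b \<bullet> i \<le> c \<bullet> i \<or> d \<bullet> i \<le> a \<bullet> i"
      using disjoint_boxes_separated[of a b c d] X Y XY by auto
    have "\<exists>t. \<exists>X\<in>\<A>. \<exists>Y\<in>\<A>. X \<inter> {x. t < x \<bullet> i} = {} \<and> Y \<inter> {x. x \<bullet> i < t} = {}"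
      using i(2)
    proof
      assume h: "b \<bullet> i \<le> c \<bullet> i"
      have "X \<inter> {x. b \<bullet> i < x \<bullet> i} = {}" "Y \<inter> {x. x \<bullet> i < b \<bullet> i} = {}"
        using h i(1) by (fastforce simp: X Y box_def)+
      then show ?thesis using two by blast
    next
      assume h: "d \<bullet> i \<le> a \<bullet> i"
      have "Y \<inter> {x. d \<bullet> i < x \<bullet> i} = {}" "X \<inter> {x. x \<bullet> i < d \<bullet> i} = {}"
        using h i(1) by (fastforce simp: X Y box_def)+
      then show ?thesis using two by blast
    qed
    then obtain t P Q where P: "P \<in> \<A>" "P \<inter> {x. t < x \<bullet> i} = {}" and Q: "Q \<in> \<A>" "Q \<inter> {x. x \<bullet> i < t} = {}"
      by blast
    let ?Lo = "\<lambda>t. {x::'a. x \<bullet> i < t}" and ?Up = "\<lambda>t. {x::'a. t < x \<bullet> i}"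
    note cuts = box_family_cut[OF _ box_Int_halfspace(1)[OF i(1)]] box_family_cut[OF _ box_Int_halfspace(2)[OF i(1)]]
    obtain A1 where A1: "box_family A1" "\<Union>A1 = \<Union>\<A> \<inter> ?Lo t" "card A1 < card \<A>"
      using cuts(1)[OF fA(1), of t] Q by blast
    obtain A2 where A2: "box_family A2" "\<Union>A2 = \<Union>\<A> \<inter> ?Up t" "card A2 < card \<A>"
      using cuts(2)[OF fA(1), of t] P by blast
    have op: "open Z \<and> Z \<noteq> {}" if "Z \<in> \<A>" for Z
      using fA(1) that unfolding box_family_def by (metis open_box)
    \<comment> \<open>A box of the family is open, hence not null, so it cannot lie in the cutting
      hyperplane; therefore neither half is empty.\<close>
    have Plo: "P \<inter> ?Lo t \<noteq> {}"
    proof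
      assume "P \<inter> ?Lo t = {}"
      then have "P \<subseteq> {x. x \<bullet> i = t}" using P by force
      then have "negligible P" using negligible_hyperplane[OF i(1)] negligible_subset by blast
      then show False using op[OF P(1)] open_not_negligible by blast
    qed
    have Qup: "Q \<inter> ?Up t \<noteq> {}"
    proof
      assume "Q \<inter> ?Up t = {}"
      then have "Q \<subseteq> {x. x \<bullet> i = t}" using Q by force
      then have "negligible Q" using negligible_hyperplane[OF i(1)] negligible_subset by blast
      then show False using op[OF Q(1)] open_not_negligible by blast
    qed
    have ne: "A1 \<noteq> {}" "A2 \<noteq> {}" using A1(2) A2(2) Plo Qup P(1) Q(1) by auto
    have splitA: "?m (\<Union>\<A>) = ?m (\<Union>A1) + ?m (\<Union>A2)"
      unfolding A1 A2 using box_family_open_bounded[OF fA(1)] by (intro measure_halfspace_split i)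
    have posA: "?m (\<Union>A1) > 0" "?m (\<Union>A2) > 0" using box_family_measure_pos[OF A1(1) ne(1)] box_family_measure_pos[OF A2(1) ne(2)] by auto
    define \<theta> where "\<theta> = ?m (\<Union>A1) / ?m (\<Union>\<A>)"
    have th: "0 < \<theta>" "\<theta> < 1" "?m (\<Union>A1) = \<theta> * ?m (\<Union>\<A>)" "?m (\<Union>A2) = (1-\<theta>) * ?m (\<Union>\<A>)"
      using posA splitA by (auto simp: \<theta>_def field_simps)
    let ?B = "\<Union>\<B>"
    have B: "?B \<in> lmeasurable" "bounded ?B" "?m ?B > 0"
      using box_family_open_bounded[OF fB(1)] box_family_measure_pos[OF fB] by auto
    obtain r where r: "\<And>x. x \<in> ?B \<Longrightarrow> norm x < r" using B(2) by (auto simp: bounded_pos_less)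
    have xr: "\<bar>x \<bullet> i\<bar> < r" if "x \<in> ?B" for x using r[OF that] Basis_le_norm[OF i(1), of x] by linarith
    have "r > 0" using fB r by (force simp: box_family_def intro: le_less_trans[OF norm_ge_zero])
    moreover have "?B \<inter> ?Lo (-r) = {}" "?B \<inter> ?Lo r = ?B" using xr by fastforce+
    \<comment> \<open>The height \<open>s\<close> divides the volume of the second family in the
      ratio \<theta> found for the first. The intermediate value theorem applies because the whole
      bounded set lies between -r and r.\<close>
    ultimately obtain s where s: "?m (?B \<inter> ?Lo s) = \<theta> * ?m ?B"
      using IVT'[of "\<lambda>c. ?m (?B \<inter> ?Lo c)" "-r" "\<theta> * ?m ?B" r] th B
        continuous_on_subset[OF continuous_on_measure_halfspace[OF B(1) i(1)]] by auto
    obtain B1 where B1: "box_family B1" "\<Union>B1 = \<Union>\<B> \<inter> ?Lo s" "card B1 \<le> card \<B>"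
      using cuts(1)[OF fB(1), of s] by blast
    obtain B2 where B2: "box_family B2" "\<Union>B2 = \<Union>\<B> \<inter> ?Up s" "card B2 \<le> card \<B>"
      using cuts(2)[OF fB(1), of s] by blast
    have mB: "?m (\<Union>B1) = \<theta> * ?m ?B" "?m (\<Union>B2) = (1-\<theta>) * ?m ?B"
      using measure_halfspace_split[OF B(1) i(1), of s] s by (auto simp: B1 B2 algebra_simps)
    have neB: "B1 \<noteq> {}" "B2 \<noteq> {}" using mB th B by auto
    define S where "S = root n (?m (\<Union>\<A>)) + root n (?m ?B)"
    \<comment> \<open>Both volumes of a half carry the same factor \<open>p\<close>, so the two
      halves contribute \<theta> S^n and (1 - \<theta>) S^n, with no loss.\<close>
    have scale: "(root n (p * ?m (\<Union>\<A>)) + root n (p * ?m ?B)) ^ n = p * S ^ n" if "p > 0" for p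
    proof -
      have "root n (p * ?m (\<Union>\<A>)) + root n (p * ?m ?B) = root n p * S"
        by (simp add: S_def real_root_mult algebra_simps)
      then show ?thesis using n that by (simp add: power_mult_distrib)
    qed
    have "S ^ n = \<theta> * S ^ n + (1 - \<theta>) * S ^ n" by (simp add: algebra_simps)
    also have "\<dots> \<le> ?m (minkowski_sum (\<Union>A1) (\<Union>B1)) + ?m (minkowski_sum (\<Union>A2) (\<Union>B2))"
      using IH[OF A1(3) B1(3) A1(1) ne(1) B1(1) neB(1)] IH[OF A2(3) B2(3) A2(1) ne(2) B2(1) neB(2)]
      unfolding th mB using scale[of \<theta>] scale[of "1-\<theta>"] th by simp
    \<comment> \<open>Heights add: sums of lower halves lie below \<open>t + s\<close> and sums of
      upper halves above it.\<close>
    also have "\<dots> \<le> ?m (minkowski_sum (\<Union>\<A>) ?B \<inter> ?Lo (t + s)) + ?m (minkowski_sum (\<Union>\<A>) ?B \<inter> ?Up (t + s))"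
    proof (intro add_mono measure_mono_fmeasurable)
      have meas: "minkowski_sum (\<Union>\<A>) ?B \<in> lmeasurable"
        using box_family_open_bounded[OF fA(1)] box_family_open_bounded[OF fB(1)]
        by (intro lmeasurable_open open_minkowski_sum bounded_minkowski_sum)
      show "minkowski_sum (\<Union>\<A>) ?B \<inter> ?Lo (t + s) \<in> lmeasurable" "minkowski_sum (\<Union>\<A>) ?B \<inter> ?Up (t + s) \<in> lmeasurable"
        by (auto intro!: fmeasurable_Int_fmeasurable meas)
      show "minkowski_sum (\<Union>A1) (\<Union>B1) \<in> sets lebesgue" "minkowski_sum (\<Union>A2) (\<Union>B2) \<in> sets lebesgue"
        using box_family_open_bounded A1 B1 A2 B2
        by (metis open_minkowski_sum borel_open sets_completionI_sets sets_lborel)+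
      show "minkowski_sum (\<Union>A1) (\<Union>B1) \<subseteq> minkowski_sum (\<Union>\<A>) ?B \<inter> ?Lo (t + s)"
        unfolding A1 B1 by (auto simp: minkowski_sum_def inner_add_left add_strict_mono)
      show "minkowski_sum (\<Union>A2) (\<Union>B2) \<subseteq> minkowski_sum (\<Union>\<A>) ?B \<inter> ?Up (t + s)"
        unfolding A2 B2 by (auto simp: minkowski_sum_def inner_add_left add_strict_mono)
    qed
    also have "\<dots> = ?m (minkowski_sum (\<Union>\<A>) ?B)"
      using box_family_open_bounded[OF fA(1)] box_family_open_bounded[OF fB(1)]
      by (intro measure_halfspace_split[symmetric] i lmeasurable_open open_minkowski_sum bounded_minkowski_sum)
    finally show ?thesis by (simp add: S_def)
  qed
  have comm: "minkowski_sum A B = minkowski_sum B A" for A B :: "'a set"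
    by (auto simp: mem_minkowski_sum) (metis add.commute)+
  show ?case
  proof (cases "\<exists>X\<in>\<A>. \<exists>Y\<in>\<A>. X \<noteq> Y")
    case True
    then obtain X Y where XY: "X \<in> \<A>" "Y \<in> \<A>" "X \<noteq> Y" by blast
    show ?thesis unfolding n_def[symmetric]
    proof (rule step[OF less.prems XY])
      fix \<A>' \<B>' :: "'a set set" assume "card \<A>' < card \<A>" "card \<B>' \<le> card \<B>" and fam: "box_family \<A>'" "\<A>' \<noteq> {}" "box_family \<B>'" "\<B>' \<noteq> {}"
      then have "card \<A>' + card \<B>' < card \<A> + card \<B>" by linarith
      from less.hyps[OF this fam] show "(root n (?m (\<Union>\<A>')) + root n (?m (\<Union>\<B>'))) ^ n \<le> ?m (minkowski_sum (\<Union>\<A>') (\<Union>\<B>'))"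
        by (simp add: n_def)
    qed
  next
    case A: False
    show ?thesis
    proof (cases "\<exists>X\<in>\<B>. \<exists>Y\<in>\<B>. X \<noteq> Y")
      case True
      then obtain X Y where XY: "X \<in> \<B>" "Y \<in> \<B>" "X \<noteq> Y" by blast
      have "(root n (?m (\<Union>\<B>)) + root n (?m (\<Union>\<A>))) ^ n \<le> ?m (minkowski_sum (\<Union>\<B>) (\<Union>\<A>))"
      proof (rule step[OF less.prems(3,4,1,2) XY])
        fix \<A>' \<B>' :: "'a set set" assume "card \<A>' < card \<B>" "card \<B>' \<le> card \<A>" and fam: "box_family \<A>'" "\<A>' \<noteq> {}" "box_family \<B>'" "\<B>' \<noteq> {}"
        then have "card \<A>' + card \<B>' < card \<A> + card \<B>" by linarith
        from less.hyps[OF this fam] show "(root n (?m (\<Union>\<A>')) + root n (?m (\<Union>\<B>'))) ^ n \<le> ?m (minkowski_sum (\<Union>\<A>') (\<Union>\<B>'))"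
          by (simp add: n_def)
      qed
      then show ?thesis by (simp add: n_def comm[of "\<Union>\<A>"] add.commute)
    next
      case B: False
      obtain X where X: "\<A> = {X}" using A less.prems(2) by blast
      obtain Y where Y: "\<B> = {Y}" using B less.prems(4) by blast
      obtain a b where ab: "X = box a b" "X \<noteq> {}"
        using less.prems(1) unfolding X box_family_def by blast
      obtain c d where cd: "Y = box c d" "Y \<noteq> {}"
        using less.prems(3) unfolding Y box_family_def by blast
      have "(root n (?m X) + root n (?m Y)) ^ n \<le> root n (?m (minkowski_sum X Y)) ^ n"
        using brunn_minkowski_box[of a b c d] ab cd n unfolding n_def
        by (intro power_mono) (auto intro!: add_nonneg_nonneg)
      then show ?thesis using n by (simp add: X Y n_def)
    qed
  qed
qed

text \<open>A compact subset carrying almost all the volume is covered by finitely many intervals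
  inside \<open>S\<close>. Their union has a division into non-overlapping intervals, and passing to
  the interiors loses only null frontiers.\<close>

lemma open_inner_box_family:
  fixes S :: "'a::euclidean_space set"
  assumes S: "open S" "bounded S" and m: "m < measure lebesgue S"
  shows "\<exists>\<A>. box_family \<A> \<and> \<Union>\<A> \<subseteq> S \<and> m < measure lebesgue (\<Union>\<A>)"
proof -
  have Sm: "S \<in> lmeasurable" by (rule lmeasurable_open[OF S(2,1)])
  obtain K where K: "compact K" "K \<subseteq> S" "m < measure lebesgue K"
  proof -
    obtain T where T: "closed T" "T \<subseteq> S" "S - T \<in> lmeasurable" "emeasure lebesgue (S - T) < ennreal (measure lebesgue S - m)"
      using sets_lebesgue_inner_closed[of S "measure lebesgue S - m"] Sm m by (auto simp: fmeasurableD)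
    have "compact T" using T S by (simp add: compact_eq_bounded_closed bounded_subset)
    moreover have "measure lebesgue (S - T) < measure lebesgue S - m"
      using T m by (simp add: emeasure_eq_measure2 ennreal_less_iff)
    moreover have "measure lebesgue (S - T) = measure lebesgue S - measure lebesgue T"
      using T \<open>compact T\<close> Sm by (intro measurable_measure_Diff) (auto simp: lmeasurable_compact fmeasurableD)
    ultimately show ?thesis using that T by auto
  qed
  have "\<exists>a b. x \<in> box a b \<and> cbox a b \<subseteq> S" if "x \<in> K" for x
  proof -
    have "x \<in> S" using that K by blast
    from open_contains_cbox[OF S(1) this] show ?thesis by metis
  qed
  then obtain a b where ab: "\<And>x. x \<in> K \<Longrightarrow> x \<in> box (a x) (b x) \<and> cbox (a x) (b x) \<subseteq> S" by metis
  obtain D where D: "D \<subseteq> K" "finite D" "K \<subseteq> (\<Union>x\<in>D. box (a x) (b x))"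
  proof (rule compactE_image[OF K(1), of K "\<lambda>x. box (a x) (b x)"])
    show "K \<subseteq> (\<Union>x\<in>K. box (a x) (b x))" using ab by blast
  qed auto
  let ?F = "(\<lambda>x. cbox (a x) (b x)) ` D"
  obtain p where p: "p division_of (\<Union>?F)"
    using elementary_unions_intervals[of ?F] D by auto
  define \<A> where "\<A> = interior ` p - {{}}"
  have fam: "box_family \<A>"
    unfolding box_family_def
  proof (intro conjI ballI)
    show "finite \<A>" using p by (auto simp: \<A>_def)
    show "X \<noteq> {}" if "X \<in> \<A>" for X using that by (auto simp: \<A>_def)
    show "\<exists>a b. X = box a b" if "X \<in> \<A>" for X
      using that division_ofD(4)[OF p] by (fastforce simp: \<A>_def)
    show "pairwise disjnt \<A>"
      using division_ofD(5)[OF p] unfolding \<A>_def pairwise_def disjnt_def by blast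
  qed
  have FS: "\<Union>?F \<subseteq> S" using ab D by auto
  have sub: "\<Union>\<A> \<subseteq> \<Union>?F" using division_ofD(6)[OF p] interior_subset by (fastforce simp: \<A>_def)
  have "\<Union>?F - \<Union>\<A> \<subseteq> (\<Union>X\<in>p. frontier X)"
  proof
    fix x assume x: "x \<in> \<Union>?F - \<Union>\<A>"
    then obtain X where X: "X \<in> p" "x \<in> X" using division_ofD(6)[OF p] by blast
    then have "x \<notin> interior X" using x by (auto simp: \<A>_def)
    then show "x \<in> (\<Union>X\<in>p. frontier X)"
      using X closure_subset unfolding frontier_def by blast
  qed
  moreover have "negligible (\<Union>X\<in>p. frontier X)"
  proof (rule negligible_Union)
    show "finite (frontier ` p)" using p by auto
    show "negligible t" if t: "t \<in> frontier ` p" for t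
    proof -
      obtain X where X: "X \<in> p" "t = frontier X" using t by blast
      obtain a b where "X = cbox a b" using division_ofD(4)[OF p X(1)] by blast
      then show ?thesis using X by (simp add: negligible_convex_frontier)
    qed
  qed
  ultimately have "measure lebesgue (\<Union>\<A>) = measure lebesgue (\<Union>?F)"
    using sub lmeasurable_division[OF p]
    by (intro measure_negligible_symdiff) (auto intro: negligible_subset)
  moreover have "measure lebesgue K \<le> measure lebesgue (\<Union>?F)"
  proof (rule measure_mono_fmeasurable)
    show "K \<subseteq> \<Union>?F" using D(3) box_subset_cbox by fastforce
    show "\<Union>?F \<in> lmeasurable" using lmeasurable_division[OF p] .
  qed (use K lmeasurable_compact in \<open>auto simp: fmeasurableD\<close>)
  ultimately show ?thesis using fam K(3) sub FS by (intro exI[of _ \<A>]) auto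
qed

theorem brunn_minkowski:
  fixes A B :: "'a::euclidean_space set"
  assumes A: "open A" "bounded A" "A \<noteq> {}" and B: "open B" "bounded B" "B \<noteq> {}"
  shows "(root DIM('a) (measure lebesgue A) + root DIM('a) (measure lebesgue B)) ^ DIM('a)
     \<le> measure lebesgue (minkowski_sum A B)"
proof -
  let ?n = "DIM('a)" and ?m = "measure lebesgue :: 'a set \<Rightarrow> real"
  have pos: "?m S > 0" if "open S" "bounded S" "S \<noteq> {}" for S
    using that lmeasurable_open[OF that(2,1)]
    by (metis negligible_iff_measure open_not_negligible order_less_le measure_nonneg)
  let ?M = "?m (minkowski_sum A B)"
  have ineq: "(root ?n a + root ?n b) ^ ?n \<le> ?M" if ab: "0 < a" "a < ?m A" "0 < b" "b < ?m B" for a b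
  proof -
    obtain \<A> where X: "box_family \<A>" "\<Union>\<A> \<subseteq> A" "a < ?m (\<Union>\<A>)"
      using open_inner_box_family[OF A(1,2) ab(2)] by blast
    obtain \<B> where Y: "box_family \<B>" "\<Union>\<B> \<subseteq> B" "b < ?m (\<Union>\<B>)"
      using open_inner_box_family[OF B(1,2) ab(4)] by blast
    have ne: "\<A> \<noteq> {}" "\<B> \<noteq> {}" using X Y ab by auto
    have "(root ?n a + root ?n b) ^ ?n \<le> (root ?n (?m (\<Union>\<A>)) + root ?n (?m (\<Union>\<B>))) ^ ?n"
      using X Y ab by (intro power_mono add_mono add_nonneg_nonneg) auto
    also have "\<dots> \<le> ?m (minkowski_sum (\<Union>\<A>) (\<Union>\<B>))"
      by (rule brunn_minkowski_box_family) (use X Y ne in auto)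
    also have "\<dots> \<le> ?M"
      using X Y A B box_family_open_bounded[OF X(1)] box_family_open_bounded[OF Y(1)]
      by (intro measure_mono_fmeasurable minkowski_sum_mono lmeasurable_open open_minkowski_sum bounded_minkowski_sum)
        (auto intro!: open_minkowski_sum borel_open sets_completionI_sets)
    finally show ?thesis .
  qed
  \<comment> \<open>Inner box families need volumes strictly below those of \<open>A\<close> and
    \<open>B\<close>; shrinking both by a factor t < 1 and letting t tend to 1 removes the
    strictness.\<close>
  let ?f = "\<lambda>t. (root ?n (t * ?m A) + root ?n (t * ?m B)) ^ ?n"
  have "(?f \<longlongrightarrow> ?f 1) (at_left 1)"
    by (intro tendsto_intros)
  moreover have "eventually (\<lambda>t::real. 0 < t \<and> t < 1) (at_left 1)"
    using eventually_at_left_real[of 0 1] by (auto elim: eventually_mono)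
  then have "eventually (\<lambda>t. ?f t \<le> ?M) (at_left 1)"
  proof eventually_elim
    case (elim t)
    then show ?case using pos[OF A] pos[OF B] by (intro ineq) auto
  qed
  ultimately have "?f 1 \<le> ?M" by (intro tendsto_upperbound) auto
  then show ?thesis by simp
qed

section \<open>The Wulff inequality for C^1 functions\<close>

definition C1_gradient :: "('a::euclidean_space \<Rightarrow> real) \<Rightarrow> ('a \<Rightarrow> 'a) \<Rightarrow> bool" where
  "C1_gradient w w' \<longleftrightarrow> (\<forall>x. (w has_derivative (\<lambda>h. w' x \<bullet> h)) (at x)) \<and> continuous_on UNIV w'"

lemma C1_gradientD:
  assumes "C1_gradient w w'"
  shows "(w has_derivative (\<lambda>h. w' x \<bullet> h)) (at x within S)" "continuous_on S w'" "continuous_on S w"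
    "w \<in> borel_measurable borel" "w' \<in> borel_measurable borel"
proof -
  have d: "(w has_derivative (\<lambda>h. w' x \<bullet> h)) (at x)" for x using assms by (simp add: C1_gradient_def)
  then show "(w has_derivative (\<lambda>h. w' x \<bullet> h)) (at x within S)" by (rule has_derivative_at_withinI)
  have c: "continuous_on UNIV w'" using assms by (simp add: C1_gradient_def)
  then show "continuous_on S w'" using continuous_on_subset by blast
  have cw: "continuous_on UNIV w"
    using d by (intro continuous_at_imp_continuous_on ballI has_derivative_continuous)
  then show "continuous_on S w" using continuous_on_subset by blast
  show "w \<in> borel_measurable borel" "w' \<in> borel_measurable borel"
    using c cw by (auto intro: borel_measurable_continuous_onI)
qed

lemma bernoulli_power:
  fixes r s :: real
  assumes "r \<ge> 0" "s \<ge> 0"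
  shows "r ^ n + n * s * r ^ (n - 1) \<le> (r + s) ^ n"
proof (induction n)
  case (Suc n)
  have "r ^ Suc n + Suc n * s * r ^ n \<le> (r + s) * (r ^ n + n * s * r ^ (n - 1))"
  proof (cases n)
    case (Suc m)
    have "(r + s) * (r ^ n + n * s * r ^ (n - 1)) = r ^ Suc n + Suc n * s * r ^ n + s * n * s * r ^ m"
      by (simp add: Suc algebra_simps)
    then show ?thesis using assms by (simp add: Suc)
  qed simp
  also have "\<dots> \<le> (r + s) * (r + s) ^ n"
    using Suc.IH assms by (intro mult_left_mono) auto
  finally show ?case by simp
qed simp

lemma emeasure_lborel_eq_measure_lebesgue:
  assumes "S \<in> sets borel" "bounded S"
  shows "emeasure lborel S = ennreal (measure lebesgue S)"
proof -
  have "emeasure lborel S < \<infinity>" by (rule emeasure_bounded_finite[OF assms(2)])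
  then show ?thesis using assms(1) by (simp add: emeasure_eq_ennreal_measure)
qed

lemma (in sigma_finite_measure) nn_integral_layer_cake:
  fixes f :: "'a \<Rightarrow> real"
  assumes [measurable]: "f \<in> borel_measurable M"
  shows "(\<integral>\<^sup>+x. ennreal (f x) \<partial>M) = (\<integral>\<^sup>+t\<in>{0<..}. emeasure M {x\<in>space M. t < f x} \<partial>lborel)"
proof -
  interpret pair_sigma_finite M "lborel :: real measure" ..
  have [measurable]: "(\<lambda>(x, t). of_bool (0 < t \<and> t < f x) :: ennreal) \<in> borel_measurable (M \<Otimes>\<^sub>M lborel)"
    by measurable
  have "(\<integral>\<^sup>+x. ennreal (f x) \<partial>M) = (\<integral>\<^sup>+x. (\<integral>\<^sup>+t. of_bool (0 < t \<and> t < f x) \<partial>lborel) \<partial>M)"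
  proof (rule nn_integral_cong)
    fix x
    have "(\<integral>\<^sup>+t. of_bool (0 < t \<and> t < f x) \<partial>lborel) = (\<integral>\<^sup>+t. indicator {0<..<f x} t \<partial>lborel)"
      by (intro nn_integral_cong) (auto simp: indicator_def)
    also have "\<dots> = ennreal (f x)"
      by (cases "0 \<le> f x") (auto simp: ennreal_neg)
    finally show "ennreal (f x) = (\<integral>\<^sup>+t. of_bool (0 < t \<and> t < f x) \<partial>lborel)" ..
  qed
  also have "\<dots> = (\<integral>\<^sup>+t. (\<integral>\<^sup>+x. of_bool (0 < t \<and> t < f x) \<partial>M) \<partial>lborel)"
    by (rule Fubini'[symmetric]) measurable
  also have "\<dots> = (\<integral>\<^sup>+t\<in>{0<..}. emeasure M {x\<in>space M. t < f x} \<partial>lborel)"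
  proof (rule nn_integral_cong)
    fix t :: real
    have "(\<integral>\<^sup>+x. of_bool (0 < t \<and> t < f x) \<partial>M) = (\<integral>\<^sup>+x. indicator {0<..} t * indicator {x\<in>space M. t < f x} x \<partial>M)"
      by (intro nn_integral_cong) (auto simp: indicator_def)
    also have "\<dots> = indicator {0<..} t * emeasure M {x\<in>space M. t < f x}"
      by (subst nn_integral_cmult) auto
    finally show "(\<integral>\<^sup>+x. of_bool (0 < t \<and> t < f x) \<partial>M) = emeasure M {x\<in>space M. t < f x} * indicator {0<..} t"
      by (simp add: mult.commute)
  qed
  finally show ?thesis .
qed

text \<open>Brunn--Minkowski applied to the superlevel sets of \<^term>\<open>w\<close>; the right-hand side is the first
  variation of the integral of the sup-convolution of \<^term>\<open>w\<close> with a dilate of \<^term>\<open>K\<close>.\<close>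

lemma wulff_inequality:
  fixes w :: "'a::euclidean_space \<Rightarrow> real" and K :: "'a set" and lv :: real
  assumes dim: "DIM('a) \<ge> 2"
    and w: "C1_gradient w w'" and nonneg: "\<And>x. 0 \<le> w x" and supp: "\<And>x. R \<le> norm x \<Longrightarrow> w x = 0"
    and K: "open K" "bounded K" "K \<noteq> {}"
    and g: "integrable lborel g" and wg: "\<And>x y. y \<in> K \<Longrightarrow> - (w' x \<bullet> y) \<le> g x"
    and lam: "0 < lv"
  shows "lv * DIM('a) * root DIM('a) (measure lebesgue K) * root DIM('a) (measure lebesgue {x. lv < w x}) ^ (DIM('a) - 1)
    \<le> (LINT x|lborel. g x)"
proof -
  let ?n = "DIM('a)" and ?m = "measure lebesgue :: 'a set \<Rightarrow> real"
  obtain \<rho> where \<rho>: "\<rho> > 0" "\<And>y. y \<in> K \<Longrightarrow> norm y \<le> \<rho>" using K(2) by (auto simp: bounded_pos)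
  define A where "A t = {x. t < w x}" for t
  have w_meas [measurable]: "w \<in> borel_measurable borel" and cw: "continuous_on UNIV w" using C1_gradientD[OF w] by auto
  have g_meas [measurable]: "g \<in> borel_measurable borel" using g by auto
  have A: "open (A t)" "bounded (A t)" if "t \<ge> 0" for t
  proof -
    show "open (A t)" unfolding A_def by (intro open_Collect_less continuous_intros cw)
    have "A t \<subseteq> ball 0 R"
    proof
      fix x assume "x \<in> A t"
      then have "w x \<noteq> 0" using that by (auto simp: A_def)
      then show "x \<in> ball 0 R" using supp[of x] by (auto simp: not_le[symmetric])
    qed
    then show "bounded (A t)" using bounded_ball bounded_subset by blast
  qed
  define c where "c = ?n * root ?n (?m K) * root ?n (?m (A lv)) ^ (?n - 1)"
  have c0: "c \<ge> 0" by (simp add: c_def)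
  define D where "D = cball (0::'a) (R + \<rho>)"
  have zero_grad: "w' x = 0" if "x \<notin> D" for x
  proof -
    have "R < norm x" using that \<rho> by (auto simp: D_def)
    then have "w x = 0" using supp by simp
    \<comment> \<open>\<open>w\<close> is nonnegative, so each of its zeros is a minimum.\<close>
    have "(\<lambda>h. w' x \<bullet> h) = (\<lambda>h. 0)"
      by (rule differential_zero_maxmin[of x UNIV w]) (use C1_gradientD(1)[OF w] nonneg \<open>w x = 0\<close> in auto)
    then show ?thesis by (metis inner_eq_zero_iff)
  qed
  obtain y0 where y0: "y0 \<in> K" using K by blast
  have g0: "0 \<le> g x" if "x \<notin> D" for x using wg[OF y0, of x] zero_grad[OF that] by simp
  \<comment> \<open>Here \<delta> bounds the oscillation of \<open>w'\<close> at the scale of the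
    dilation; it is sent to 0 at the end.\<close>
  have main: "lv * c \<le> (LINT x|lborel. g x) + \<delta> * (\<rho> * measure lborel D)" if \<delta>: "\<delta> > 0" for \<delta>
  proof -
    have "uniformly_continuous_on (cball 0 (R + 2 * \<rho>)) w'"
      by (intro compact_uniformly_continuous C1_gradientD[OF w] compact_cball)
    then obtain d where d: "d > 0" and dd: "\<And>x y. x \<in> cball 0 (R + 2 * \<rho>) \<Longrightarrow> y \<in> cball 0 (R + 2 * \<rho>) \<Longrightarrow>
        dist y x < d \<Longrightarrow> dist (w' y) (w' x) < \<delta>"
      using \<delta> unfolding uniformly_continuous_on_def by blast
    \<comment> \<open>\<open>e \<le> 1\<close> keeps shifts of points of \<open>D\<close> by
      \<open>e K\<close> within radius R + 2 \<rho>, and \<open>e * \<rho> < d\<close> keeps them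
      within the modulus of continuity.\<close>
    define e where "e = min 1 (d / (2 * \<rho>))"
    have e: "0 < e" "e \<le> 1" "e * \<rho> < d" using d \<rho>(1) by (auto simp: e_def min_def field_simps)
    \<comment> \<open>Bounds the sup-convolution of \<open>w\<close> with the dilate
      \<open>e K\<close> from above: \<open>g\<close> pays for the first-order change and the
      \<delta> term for the Taylor error.\<close>
    define G where "G x = w x + e * (g x + \<delta> * \<rho> * indicator D x)" for x
    have shift: "w (x - e *\<^sub>R y) \<le> G x" if y: "y \<in> K" for x y
    proof (cases "x \<in> D")
      case False
      have "norm x \<le> norm (x - e *\<^sub>R y) + norm (e *\<^sub>R y)"
        using norm_triangle_sub[of x "e *\<^sub>R y"] by simp
      moreover have "norm (e *\<^sub>R y) \<le> \<rho>" using e \<rho>(1) \<rho>(2)[OF y] mult_mono[of e 1 "norm y" \<rho>] by simp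
      moreover have "norm x > R + \<rho>" using False by (simp add: D_def)
      ultimately have "w (x - e *\<^sub>R y) = 0" by (intro supp) linarith
      then show ?thesis using nonneg[of x] g0[OF False] e False by (simp add: G_def)
    next
      case True
      let ?S = "ball x d \<inter> cball 0 (R + 2 * \<rho>)"
      have ny: "norm (e *\<^sub>R y) \<le> e * \<rho>" using e \<rho>(2)[OF y] by simp
      have nx: "norm x \<le> R + \<rho>" using True by (simp add: D_def)
      have "norm (w (x - e *\<^sub>R y) - w x - w' x \<bullet> ((x - e *\<^sub>R y) - x)) \<le> norm ((x - e *\<^sub>R y) - x) * \<delta>"
      proof (rule differentiable_bound_linearization[where S="?S" and f'="\<lambda>x h. w' x \<bullet> h"])
        show "x + t *\<^sub>R (x - e *\<^sub>R y - x) \<in> ?S" if "t \<in> {0..1}" for t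
        proof -
          have n: "norm (t *\<^sub>R (e *\<^sub>R y)) \<le> e * \<rho>"
            using that ny mult_mono[of t 1 "norm (e *\<^sub>R y)" "e * \<rho>"] by (auto simp: abs_mult mult.assoc)
          then have "norm (t *\<^sub>R (e *\<^sub>R y)) \<le> \<rho>" using e \<rho>(1) mult_right_mono[of e 1 \<rho>] by linarith
          moreover have "norm (x - t *\<^sub>R (e *\<^sub>R y)) \<le> norm x + norm (t *\<^sub>R (e *\<^sub>R y))"
            by (rule norm_triangle_ineq4)
          ultimately show ?thesis using n e nx by (simp add: dist_norm norm_minus_commute)
        qed
        show "x \<in> ?S" using d nx \<rho>(1) by simp
        show "(w has_derivative (\<bullet>) (w' z)) (at z within ?S)" for z by (rule C1_gradientD(1)[OF w])
        show "onorm ((\<bullet>) (w' z) - (\<bullet>) (w' x)) \<le> \<delta>" if "z \<in> ?S" for z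
        proof (rule onorm_bound)
          have "norm (w' z - w' x) \<le> \<delta>"
            using dd[of x z] that nx \<rho>(1) by (auto simp: dist_norm norm_minus_commute less_imp_le)
          then show "norm (((\<bullet>) (w' z) - (\<bullet>) (w' x)) h) \<le> \<delta> * norm h" for h
            using Cauchy_Schwarz_ineq2[of "w' z - w' x" h] mult_right_mono[of "norm (w' z - w' x)" \<delta> "norm h"]
            by (simp add: inner_diff_left)
        qed (use \<delta> in simp)
      qed
      then have "w (x - e *\<^sub>R y) \<le> w x + e * (- (w' x \<bullet> y)) + norm (e *\<^sub>R y) * \<delta>" by (simp add: abs_le_iff)
      also have "\<dots> \<le> w x + e * g x + (e * \<rho>) * \<delta>"
        using wg[OF y, of x] e ny \<delta> by (intro add_mono mult_left_mono mult_right_mono) auto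
      finally show ?thesis using True by (simp add: G_def algebra_simps)
    qed
    define S where "S t = {x. \<exists>y\<in>K. t < w (x - e *\<^sub>R y)}" for t
    have S_eq: "S t = minkowski_sum (A t) ((\<lambda>y. e *\<^sub>R y + 0) ` K)" for t
    proof (intro set_eqI iffI)
      fix x assume "x \<in> S t"
      then obtain y where "y \<in> K" "x - e *\<^sub>R y \<in> A t" by (auto simp: S_def A_def)
      then show "x \<in> minkowski_sum (A t) ((\<lambda>y. e *\<^sub>R y + 0) ` K)"
        unfolding mem_minkowski_sum by (intro bexI[of _ "x - e *\<^sub>R y"] bexI[of _ "e *\<^sub>R y + 0"]) auto
    next
      fix x assume "x \<in> minkowski_sum (A t) ((\<lambda>y. e *\<^sub>R y + 0) ` K)"
      then obtain a y where "a \<in> A t" "y \<in> K" "x - e *\<^sub>R y = a" by (auto simp: minkowski_sum_def)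
      then show "x \<in> S t" by (auto simp: S_def A_def)
    qed
    have eK: "open ((\<lambda>y. e *\<^sub>R y + 0) ` K)" "bounded ((\<lambda>y. e *\<^sub>R y + 0) ` K)" "(\<lambda>y. e *\<^sub>R y + 0) ` K \<noteq> {}"
      using K e open_scaling[of e K] bounded_scaling[of K e] by auto
    have mK: "?m ((\<lambda>y. e *\<^sub>R y + 0) ` K) = e ^ ?n * ?m K"
      using e measure_lebesgue_affine[of e 0 K] by simp
    \<comment> \<open>Brunn-Minkowski and \<open>bernoulli_power\<close> gain at least
      \<open>e * c\<close> at each level below \<open>lv\<close>, since the superlevel set there
      contains the one at \<open>lv\<close>. Integrated over the levels, the gain is
      \<open>e * c * lv\<close>.\<close>
    have lower: "emeasure lborel (A t) + ennreal (e * c) * indicator {0<..<lv} t \<le> emeasure lborel (S t)" if t: "t > 0" for t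
    proof (cases "A t = {}")
      case True
      moreover have "A lv \<subseteq> A t" if "t < lv" using that by (auto simp: A_def)
      ultimately have "A lv = {}" if "t < lv" using that by auto
      then have "c = 0" if "t < lv" using that dim by (simp add: c_def)
      then show ?thesis using \<open>A t = {}\<close> by (auto simp: indicator_def)
    next
      case False
      have "?m (A t) + e * c * indicator {0<..<lv} t \<le> ?m (S t)"
      proof -
        let ?r = "root ?n (?m (A t))" and ?s = "root ?n (?m K)"
        have "e * c * indicator {0<..<lv} t \<le> ?n * (e * ?s) * ?r ^ (?n - 1)"
        proof (cases "t < lv")
          case True
          then have "?m (A lv) \<le> ?m (A t)"
            using A[of t] A[of lv] t lam by (intro measure_mono_fmeasurable lmeasurable_open) (auto simp: A_def)
          then have "root ?n (?m (A lv)) ^ (?n - 1) \<le> ?r ^ (?n - 1)" by (intro power_mono) auto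
          then have "(e * ?n * ?s) * root ?n (?m (A lv)) ^ (?n - 1) \<le> (e * ?n * ?s) * ?r ^ (?n - 1)"
            using e by (intro mult_left_mono) auto
          then show ?thesis using True t by (simp add: c_def mult_ac)
        qed (use e in simp)
        moreover have "?r ^ ?n + ?n * (e * ?s) * ?r ^ (?n - 1) \<le> (?r + e * ?s) ^ ?n"
          using e by (intro bernoulli_power) auto
        moreover have "(?r + e * ?s) ^ ?n \<le> ?m (S t)"
          using brunn_minkowski[OF A(1)[of t] A(2)[of t] False eK] t e unfolding S_eq mK
          by (simp add: real_root_mult real_root_power_cancel)
        moreover have "?r ^ ?n = ?m (A t)" by simp
        ultimately show ?thesis by linarith
      qed
      moreover have "emeasure lborel (A t) = ennreal (?m (A t))"
        using A[of t] t by (intro emeasure_lborel_eq_measure_lebesgue) auto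
      moreover have "emeasure lborel (S t) = ennreal (?m (S t))"
        using A[of t] t eK unfolding S_eq
        by (intro emeasure_lborel_eq_measure_lebesgue bounded_minkowski_sum borel_open open_minkowski_sum) auto
      moreover have "ennreal (e * c) * indicator {0<..<lv} t = ennreal (e * c * indicator {0<..<lv} t)"
        by (simp add: indicator_def)
      ultimately show ?thesis using e c0 by (simp flip: ennreal_plus)
    qed
    \<comment> \<open>The open region under the graph of the sup-convolution; using it as a set
      avoids the measurability of an uncountable supremum.\<close>
    define E where "E = {(x, t). 0 < t \<and> (\<exists>y\<in>K. t < w (x - e *\<^sub>R y))}"
    have "E = (\<Union>y\<in>K. {p. 0 < snd p \<and> snd p < w (fst p - e *\<^sub>R y)})" by (auto simp: E_def)
    moreover have "open {p. 0 < snd p \<and> snd p < w (fst p - e *\<^sub>R y)}" for y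
      by (intro open_Collect_conj open_Collect_less continuous_intros continuous_on_compose2[OF cw]) auto
    ultimately have "open E" by auto
    then have "E \<in> sets (borel \<Otimes>\<^sub>M borel)" unfolding borel_prod by (rule borel_open)
    then have E_meas [measurable]: "(\<lambda>(x, t). indicator E (x, t) :: ennreal) \<in> borel_measurable (lborel \<Otimes>\<^sub>M lborel)"
      by simp
    have G0: "0 \<le> G x" for x using shift[OF y0, of x] nonneg[of "x - e *\<^sub>R y0"] by linarith
    have wint: "integrable lborel w"
    proof -
      have "integrable lborel (\<lambda>x. indicator (cball 0 R) x *\<^sub>R w x)"
        using borel_integrable_compact[of "cball 0 R" w] cw continuous_on_subset by (simp add: set_integrable_def) blast
      moreover have "(\<lambda>x. indicator (cball 0 R) x *\<^sub>R w x) = w" using supp by (auto simp: indicator_def fun_eq_iff)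
      ultimately show ?thesis by simp
    qed
    have Dint: "integrable lborel (indicator D :: 'a \<Rightarrow> real)"
      unfolding D_def by (rule integrable_real_indicator) (simp_all add: emeasure_lborel_cball_finite[unfolded infinity_ennreal_def])
    have Gint: "integrable lborel G"
      unfolding G_def using wint g Dint by auto
    have Gval: "(LINT x|lborel. G x) = (LINT x|lborel. w x) + e * ((LINT x|lborel. g x) + \<delta> * \<rho> * measure lborel D)"
      unfolding G_def using wint g Dint by simp
    have "(\<integral>\<^sup>+x. ennreal (w x) \<partial>lborel) + ennreal (e * c) * ennreal lv
        = (\<integral>\<^sup>+t. (emeasure lborel (A t) * indicator {0<..} t) + ennreal (e * c) * indicator {0<..<lv} t \<partial>lborel)"
    proof -
      have Ameas: "(\<lambda>t. emeasure lborel (A t)) \<in> borel_measurable borel"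
        unfolding A_def by measurable
      have cake: "(\<integral>\<^sup>+x. ennreal (w x) \<partial>lborel) = (\<integral>\<^sup>+t\<in>{0<..}. emeasure lborel (A t) \<partial>lborel)"
        using lborel.nn_integral_layer_cake[of w] by (simp add: A_def)
      show ?thesis
        unfolding cake using lam Ameas by (subst nn_integral_add) (auto simp: nn_integral_cmult)
    qed
    also have "\<dots> \<le> (\<integral>\<^sup>+t. emeasure lborel (S t) * indicator {0<..} t \<partial>lborel)"
      using lower by (intro nn_integral_mono) (auto simp: indicator_def)
    also have "\<dots> = (\<integral>\<^sup>+t. (\<integral>\<^sup>+x. indicator E (x, t) \<partial>lborel) \<partial>lborel)"
    proof (rule nn_integral_cong)
      fix t
      have "S t \<in> sets borel" if "t > 0" using A[of t] that eK unfolding S_eq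
        by (intro borel_open open_minkowski_sum) auto
      moreover have "(\<integral>\<^sup>+x. indicator E (x, t) \<partial>lborel) = (\<integral>\<^sup>+x. indicator {0<..} t * indicator (S t) x \<partial>lborel)"
        by (intro nn_integral_cong) (auto simp: E_def S_def indicator_def)
      ultimately show "emeasure lborel (S t) * indicator {0<..} t = (\<integral>\<^sup>+x. indicator E (x, t) \<partial>lborel)"
        by (cases "t > 0") auto
    qed
    also have "\<dots> = (\<integral>\<^sup>+x. (\<integral>\<^sup>+t. indicator E (x, t) \<partial>lborel) \<partial>lborel)"
      by (rule lborel_pair.Fubini'[OF E_meas])
    also have "\<dots> \<le> (\<integral>\<^sup>+x. ennreal (G x) \<partial>lborel)"
    proof (rule nn_integral_mono)
      fix x
      have "(\<integral>\<^sup>+t. indicator E (x, t) \<partial>lborel) \<le> (\<integral>\<^sup>+t. indicator {0..G x} t \<partial>lborel)"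
        proof (intro nn_integral_mono)
        fix t show "indicator E (x, t) \<le> (indicator {0..G x} t :: ennreal)"
        proof (cases "(x, t) \<in> E")
          case True
          then obtain y where "0 < t" "y \<in> K" "t < w (x - e *\<^sub>R y)" by (auto simp: E_def)
          with shift[of y x] have "t \<in> {0..G x}" by auto
          then show ?thesis by (simp add: indicator_def)
        qed simp
      qed
      then show "(\<integral>\<^sup>+t. indicator E (x, t) \<partial>lborel) \<le> ennreal (G x)"
        using G0[of x] by simp
    qed
    also have "(\<integral>\<^sup>+x. ennreal (G x) \<partial>lborel) = ennreal (LINT x|lborel. G x)"
      using Gint G0 by (intro nn_integral_eq_integral) auto
    also have "(\<integral>\<^sup>+x. ennreal (w x) \<partial>lborel) = ennreal (LINT x|lborel. w x)"
      using wint nonneg by (intro nn_integral_eq_integral) auto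
    finally have "(LINT x|lborel. w x) + e * c * lv \<le> (LINT x|lborel. G x)"
      using lam e c0 nonneg G0
      by (simp add: ennreal_mult'[symmetric] integral_nonneg flip: ennreal_plus)
    \<comment> \<open>The integral of \<open>w\<close> cancels, and division by \<open>e\<close>
      leaves the first variation.\<close>
    then have "e * (c * lv) \<le> e * ((LINT x|lborel. g x) + \<delta> * \<rho> * measure lborel D)"
      unfolding Gval by simp
    then show ?thesis using e by (simp add: mult_ac)
  qed
  have "lv * c \<le> (LINT x|lborel. g x)"
  proof (rule field_le_epsilon)
    fix \<eta> :: real assume "\<eta> > 0"
    define q where "q = \<rho> * measure lborel D + 1"
    have q: "q > 0" using \<rho> by (simp add: q_def add_nonneg_pos)
    have "lv * c \<le> (LINT x|lborel. g x) + (\<eta> / q) * (\<rho> * measure lborel D)" using \<open>\<eta> > 0\<close> q by (intro main) auto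
    also have "\<dots> \<le> (LINT x|lborel. g x) + (\<eta> / q) * q"
      using \<open>\<eta> > 0\<close> q by (intro add_left_mono mult_left_mono) (auto simp: q_def)
    finally show "lv * c \<le> (LINT x|lborel. g x) + \<eta>" using q by simp
  qed
  then show ?thesis by (simp add: c_def A_def mult_ac)
qed

section \<open>Cutoffs, mollifiers and continuously differentiable fields\<close>

text \<open>The simplest C^1 function that vanishes on a half-line; steps, cutoffs and mollifiers
  are all built from it, since C^1 is the smoothness of the test fields.\<close>

definition relu_sq :: "real \<Rightarrow> real" where "relu_sq t = (max 0 t)\<^sup>2"

lemma relu_sq_simps: "t \<le> 0 \<Longrightarrow> relu_sq t = 0" "t \<ge> 0 \<Longrightarrow> relu_sq t = t\<^sup>2" "relu_sq t \<ge> 0" "t > 0 \<Longrightarrow> relu_sq t > 0"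
  by (auto simp: relu_sq_def)

lemma DERIV_relu_sq: "(relu_sq has_real_derivative 2 * max 0 t) (at t)"
proof -
  consider "t < 0" | "t > 0" | "t = 0" by linarith
  then show ?thesis
  proof cases
    case 1
    have "((\<lambda>_. 0) has_real_derivative 2 * max 0 t) (at t)" using 1 by (auto intro!: derivative_eq_intros)
    then show ?thesis
      by (rule has_field_derivative_transform_within_open[where S="{..<0}"]) (use 1 in \<open>auto simp: relu_sq_simps\<close>)
  next
    case 2
    have "((\<lambda>t. t\<^sup>2) has_real_derivative 2 * max 0 t) (at t)" using 2 by (auto intro!: derivative_eq_intros)
    then show ?thesis
      by (rule has_field_derivative_transform_within_open[where S="{0<..}"]) (use 2 in \<open>auto simp: relu_sq_simps\<close>)
  next
    case 3
    have "((\<lambda>h. (relu_sq h - relu_sq 0) / (h - 0)) \<longlongrightarrow> 0) (at 0)"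
    proof (rule tendsto_rabs_zero_cancel, rule tendsto_sandwich[where f="\<lambda>_. 0" and h="\<lambda>h. \<bar>h\<bar>"])
      show "\<forall>\<^sub>F h in at 0. \<bar>(relu_sq h - relu_sq 0) / (h - 0)\<bar> \<le> \<bar>h\<bar>"
        by (intro always_eventually allI) (auto simp: relu_sq_def max_def power2_eq_square)
      show "((\<lambda>h::real. \<bar>h\<bar>) \<longlongrightarrow> 0) (at 0)" by (intro tendsto_rabs_zero tendsto_ident_at)
    qed auto
    then show ?thesis using 3 by (simp add: has_field_derivative_iff)
  qed
qed

definition smooth_step :: "real \<Rightarrow> real" where
  "smooth_step t = relu_sq t / (relu_sq t + relu_sq (1 - t))"

definition smooth_step' :: "real \<Rightarrow> real" where
  "smooth_step' t = 2 * (max 0 t * relu_sq (1 - t) + relu_sq t * max 0 (1 - t)) / (relu_sq t + relu_sq (1 - t))\<^sup>2"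

lemma smooth_step_denominator: "relu_sq t + relu_sq (1 - t) > 0"
proof -
  have "t > 0 \<or> 1 - t > 0" by linarith
  then show ?thesis using relu_sq_simps(3,4)[of t] relu_sq_simps(3,4)[of "1-t"] by auto
qed

lemma DERIV_smooth_step: "(smooth_step has_real_derivative smooth_step' t) (at t)"
proof -
  have "((\<lambda>t. relu_sq t + relu_sq (1 - t)) has_real_derivative 2 * max 0 t + 2 * max 0 (1 - t) * (0 - 1)) (at t)"
    by (intro DERIV_add DERIV_relu_sq DERIV_chain2[OF DERIV_relu_sq] DERIV_diff DERIV_const DERIV_ident)
  moreover have "relu_sq t + relu_sq (1 - t) \<noteq> 0" using smooth_step_denominator[of t] by simp
  ultimately show ?thesis
    unfolding smooth_step_def[abs_def] smooth_step'_def
    by (rule DERIV_cong[OF DERIV_quotient[OF DERIV_relu_sq]]) (simp add: power2_eq_square algebra_simps)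
qed

lemma continuous_on_smooth_step': "continuous_on S smooth_step'"
proof -
  have "continuous_on UNIV relu_sq"
    using DERIV_relu_sq DERIV_isCont by (intro continuous_at_imp_continuous_on) blast
  moreover from this have "continuous_on UNIV (\<lambda>t. relu_sq (1 - t))"
    by (rule continuous_on_compose2) (auto intro!: continuous_intros)
  moreover have "(relu_sq t + relu_sq (1 - t))\<^sup>2 \<noteq> 0" for t using smooth_step_denominator[of t] by simp
  ultimately have "continuous_on UNIV smooth_step'"
    unfolding smooth_step'_def[abs_def]
    by (intro continuous_on_divide continuous_on_mult continuous_on_add continuous_on_power continuous_on_max
        continuous_on_const continuous_on_id continuous_on_diff ballI)
  then show ?thesis using continuous_on_subset by blast
qed

lemma smooth_step_simps [simp]: "t \<le> 0 \<Longrightarrow> smooth_step t = 0" "1 \<le> t \<Longrightarrow> smooth_step t = 1"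
  "0 \<le> smooth_step t" "smooth_step t \<le> 1" "0 \<le> smooth_step' t" "t \<le> 0 \<Longrightarrow> smooth_step' t = 0" "1 \<le> t \<Longrightarrow> smooth_step' t = 0"
proof -
  let ?D = "relu_sq t + relu_sq (1 - t)"
  have D: "?D > 0" by (rule smooth_step_denominator)
  have nn: "relu_sq t \<ge> 0" "relu_sq (1 - t) \<ge> 0" by (auto simp: relu_sq_simps)
  show "smooth_step t = 0" "smooth_step' t = 0" if "t \<le> 0"
    using that by (auto simp: smooth_step_def smooth_step'_def relu_sq_simps)
  show "smooth_step t = 1" "smooth_step' t = 0" if "1 \<le> t"
    using that D by (auto simp: smooth_step_def smooth_step'_def relu_sq_simps)
  show "0 \<le> smooth_step t" "smooth_step t \<le> 1" "0 \<le> smooth_step' t"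
    using D nn by (auto simp: smooth_step_def smooth_step'_def)
qed

lemma smooth_step'_bounded: "\<exists>C>0. \<forall>t. smooth_step' t \<le> C"
proof -
  have "bounded (smooth_step' ` {0..1})"
    by (intro compact_imp_bounded compact_continuous_image continuous_on_smooth_step') auto
  then obtain C where C: "C > 0" "\<And>t. t \<in> {0..1} \<Longrightarrow> norm (smooth_step' t) \<le> C"
    unfolding bounded_pos by auto
  have "smooth_step' t \<le> C" for t
    using C(1) C(2)[of t] by (cases "t \<in> {0..1}") (auto simp: not_le)
  then show ?thesis using C(1) by blast
qed

lemma C1_gradient_compose:
  assumes f: "\<And>t. (f has_real_derivative f' t) (at t)" "continuous_on UNIV f'"
    and q: "C1_gradient q q'"
  shows "C1_gradient (\<lambda>x. f (q x)) (\<lambda>x. f' (q x) *\<^sub>R q' x)"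
  unfolding C1_gradient_def
proof
  show "\<forall>x. ((\<lambda>x. f (q x)) has_derivative (\<bullet>) (f' (q x) *\<^sub>R q' x)) (at x)"
  proof
    fix x
    have "((\<lambda>x. f (q x)) has_derivative (\<lambda>h. f' (q x) * (q' x \<bullet> h))) (at x)"
      using has_derivative_compose[OF C1_gradientD(1)[OF q] f(1)[of "q x", unfolded has_field_derivative_def]]
      by simp
    then show "((\<lambda>x. f (q x)) has_derivative (\<bullet>) (f' (q x) *\<^sub>R q' x)) (at x)" by (simp add: inner_scaleR_left[abs_def])
  qed
  show "continuous_on UNIV (\<lambda>x. f' (q x) *\<^sub>R q' x)"
    using C1_gradientD[OF q] f(2) by (intro continuous_intros continuous_on_compose2[OF f(2)]) auto
qed

lemma C1_gradient_intros:
  assumes f: "C1_gradient f f'" and g: "C1_gradient g g'"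
  shows "C1_gradient (\<lambda>x. f x + g x) (\<lambda>x. f' x + g' x)"
    and "C1_gradient (\<lambda>x. f x - g x) (\<lambda>x. f' x - g' x)"
    and "C1_gradient (\<lambda>x. f x * g x) (\<lambda>x. f x *\<^sub>R g' x + g x *\<^sub>R f' x)"
    and "C1_gradient (\<lambda>x. c * f x) (\<lambda>x. c *\<^sub>R f' x)"
    and "C1_gradient (\<lambda>x. 1 - f x) (\<lambda>x. - f' x)"
proof -
  note df = C1_gradientD(1)[OF f, of _ UNIV] and dg = C1_gradientD(1)[OF g, of _ UNIV]
  note c = C1_gradientD(2,3)[OF f, of UNIV] C1_gradientD(2,3)[OF g, of UNIV]
  show "C1_gradient (\<lambda>x. f x + g x) (\<lambda>x. f' x + g' x)"
    unfolding C1_gradient_def using c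
    by (auto intro!: has_derivative_eq_rhs[OF has_derivative_add[OF df dg]] continuous_intros simp: inner_add_left)
  show "C1_gradient (\<lambda>x. f x - g x) (\<lambda>x. f' x - g' x)"
    unfolding C1_gradient_def using c
    by (auto intro!: has_derivative_eq_rhs[OF has_derivative_diff[OF df dg]] continuous_intros simp: inner_diff_left)
  show "C1_gradient (\<lambda>x. f x * g x) (\<lambda>x. f x *\<^sub>R g' x + g x *\<^sub>R f' x)"
    unfolding C1_gradient_def using c
    by (auto intro!: has_derivative_eq_rhs[OF has_derivative_mult[OF df dg]] continuous_intros simp: inner_add_left mult.commute)
  show "C1_gradient (\<lambda>x. c * f x) (\<lambda>x. c *\<^sub>R f' x)"
    unfolding C1_gradient_def using c
    by (auto intro!: has_derivative_eq_rhs[OF has_derivative_mult_right[OF df]] continuous_intros)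
  show "C1_gradient (\<lambda>x. 1 - f x) (\<lambda>x. - f' x)"
    unfolding C1_gradient_def using c
    by (auto intro!: has_derivative_eq_rhs[OF has_derivative_diff[OF has_derivative_const df]] continuous_intros)
qed

lemma C1_gradient_square: "C1_gradient (\<lambda>x. (x \<bullet> x - c) / d) (\<lambda>x. (2 / d) *\<^sub>R x)"
  unfolding C1_gradient_def
  unfolding divide_inverse by (auto intro!: derivative_eq_intros continuous_intros simp: inner_commute)

lemma C1_gradient_inner: "C1_gradient (\<lambda>x. (x \<bullet> a - c) / d) (\<lambda>x. (1 / d) *\<^sub>R a)"
  unfolding C1_gradient_def
  unfolding divide_inverse by (auto intro!: derivative_eq_intros continuous_intros simp: inner_commute)

text \<open>A function of |x|^2, hence C^1 at the origin. The length \<open>3 * r\<^sup>2\<close> is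
  (2r)^2 - r^2, so the values drop from 1 to 0 between the radii r and 2r.\<close>

definition cutoff :: "real \<Rightarrow> 'a::euclidean_space \<Rightarrow> real" where
  "cutoff r x = 1 - smooth_step ((x \<bullet> x - r\<^sup>2) / (3 * r\<^sup>2))"

definition cutoff' :: "real \<Rightarrow> 'a::euclidean_space \<Rightarrow> 'a" where
  "cutoff' r x = - (smooth_step' ((x \<bullet> x - r\<^sup>2) / (3 * r\<^sup>2)) *\<^sub>R (2 / (3 * r\<^sup>2)) *\<^sub>R x)"

lemma C1_gradient_cutoff: "C1_gradient (cutoff r) (cutoff' r)"
  unfolding cutoff_def[abs_def] cutoff'_def[abs_def]
  by (intro C1_gradient_intros(5)[OF _ C1_gradient_square] C1_gradient_compose C1_gradient_square
      DERIV_smooth_step continuous_on_smooth_step')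

lemma cutoff_simps:
  assumes r: "r > 0"
  shows "0 \<le> cutoff r x" "cutoff r x \<le> 1" "norm x \<le> r \<Longrightarrow> cutoff r x = 1" "2 * r \<le> norm x \<Longrightarrow> cutoff r x = 0"
    "norm x \<le> r \<Longrightarrow> cutoff' r x = 0" "2 * r \<le> norm x \<Longrightarrow> cutoff' r x = 0"
proof -
  show "0 \<le> cutoff r x" "cutoff r x \<le> 1" by (auto simp: cutoff_def)
  { assume "norm x \<le> r"
    then have "x \<bullet> x \<le> r\<^sup>2" using r by (simp add: power2_norm_eq_inner[symmetric] power_mono)
    then have "(x \<bullet> x - r\<^sup>2) / (3 * r\<^sup>2) \<le> 0" using r by (simp add: divide_nonpos_pos)
    then show "cutoff r x = 1" "cutoff' r x = 0" by (auto simp: cutoff_def cutoff'_def) }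
  { assume "2 * r \<le> norm x"
    then have "(2 * r)\<^sup>2 \<le> x \<bullet> x" using r by (simp only: power2_norm_eq_inner[symmetric]) (intro power_mono; simp)
    then have "1 \<le> (x \<bullet> x - r\<^sup>2) / (3 * r\<^sup>2)" using r by (simp add: field_simps)
    then show "cutoff r x = 0" "cutoff' r x = 0" by (auto simp: cutoff_def cutoff'_def) }
qed

text \<open>One constant serves all radii, so the bound can be used both for r tending to infinity
  and for r tending to 0.\<close>

lemma cutoff'_bound: "\<exists>C>0. \<forall>r>0. \<forall>x::'a::euclidean_space. norm (cutoff' r x) \<le> C / r"
proof -
  obtain C where C: "C > 0" "\<And>t. smooth_step' t \<le> C" using smooth_step'_bounded by blast
  have "norm (cutoff' r x) \<le> (C * 2) / r" if r: "r > 0" for r and x :: 'a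
  proof (cases "2 * r \<le> norm x")
    case True
    then show ?thesis using cutoff_simps(6)[OF r True] C r by simp
  next
    case False
    have "norm (cutoff' r x) = smooth_step' ((x \<bullet> x - r\<^sup>2) / (3 * r\<^sup>2)) * (2 / (3 * r\<^sup>2) * norm x)"
      by (simp add: cutoff'_def)
    also have "\<dots> \<le> C * (2 / (3 * r\<^sup>2) * (2 * r))"
      using C False r by (intro mult_mono) auto
    also have "\<dots> \<le> (C * 2) / r" using r C by (simp add: field_simps power2_eq_square)
    finally show ?thesis .
  qed
  then show ?thesis using C by (intro exI[of _ "C * 2"]) auto
qed

lemma integrable_continuous_bounded_support:
  fixes f :: "'a::euclidean_space \<Rightarrow> 'b::euclidean_space"
  assumes f: "continuous_on UNIV f" and supp: "\<And>x. R \<le> norm x \<Longrightarrow> f x = 0"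
  shows "integrable lborel f"
proof -
  have "integrable lborel (\<lambda>x. indicator (cball 0 R) x *\<^sub>R f x)"
    by (intro borel_integrable_compact compact_cball continuous_on_subset[OF f]) simp
  moreover have "(\<lambda>x. indicator (cball 0 R) x *\<^sub>R f x) = f" using supp by (auto simp: indicator_def fun_eq_iff)
  ultimately show ?thesis by simp
qed

lemma bounded_by_indicator_ball:
  fixes f :: "'a::euclidean_space \<Rightarrow> 'b::real_normed_vector"
  assumes f: "continuous_on UNIV f" and supp: "\<And>x. R \<le> norm x \<Longrightarrow> f x = 0"
  obtains K where "K \<ge> 0" "\<And>x. norm (f x) \<le> K * indicator (ball 0 R) x"
proof -
  have "compact (f ` cball 0 R)" by (intro compact_continuous_image continuous_on_subset[OF f]) auto
  then obtain K where K: "K > 0" "\<forall>y\<in>f ` cball 0 R. norm y \<le> K" using compact_imp_bounded bounded_pos by metis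
  have "norm (f x) \<le> K * indicator (ball 0 R) x" for x
  proof (cases "norm x < R")
    case True
    then have "f x \<in> f ` cball 0 R" by auto
    with K(2) True show ?thesis by auto
  next
    case False
    then show ?thesis using supp[of x] by simp
  qed
  then show ?thesis using K(1) by (intro that[of K]) auto
qed

lemma mollifier_exists:
  assumes e: "e > 0"
  shows "\<exists>k k'. C1_gradient k (k' :: 'a::euclidean_space \<Rightarrow> 'a) \<and> (\<forall>x. 0 \<le> k x) \<and> (\<forall>x. k (- x) = k x) \<and> (\<forall>x. k' (- x) = - k' x) \<and>
    (\<forall>x. e \<le> norm x \<longrightarrow> k x = 0 \<and> k' x = 0) \<and> integrable lborel k \<and> (LINT x|lborel. k x) = 1"
proof -
  \<comment> \<open>The divisor -1 turns the form of \<open>C1_gradient_square\<close> into the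
    profile e^2 - |x|^2, whose squared positive part is C^1 and lives on the ball of radius
    \<open>e\<close>.\<close>
  define q where "q x = relu_sq ((x \<bullet> x - e\<^sup>2) / (-1))" for x :: 'a
  define q' where "q' x = (2 * max 0 ((x \<bullet> x - e\<^sup>2) / (-1))) *\<^sub>R (2 / (-1)) *\<^sub>R x" for x :: 'a
  have C1: "C1_gradient q q'"
    unfolding q_def q'_def
    by (rule C1_gradient_compose[OF DERIV_relu_sq _ C1_gradient_square]) (intro continuous_intros)
  have supp: "q x = 0 \<and> q' x = 0" if "e \<le> norm x" for x
  proof -
    have "e\<^sup>2 \<le> x \<bullet> x" using e that by (simp add: power2_norm_eq_inner[symmetric] power_mono)
    then show ?thesis by (simp add: q_def q'_def relu_sq_simps)
  qed
  have int: "integrable lborel q"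
    by (rule integrable_continuous_bounded_support[OF C1_gradientD(3)[OF C1]]) (use supp in auto)
  have nn: "0 \<le> q x" for x by (simp add: q_def relu_sq_simps)
  have "0 < (LINT x|lborel. q x)"
  proof (rule ccontr)
    assume "\<not> 0 < (LINT x|lborel. q x)"
    then have "(LINT x|lborel. q x) = 0" using nn by (simp add: integral_nonneg antisym not_less)
    then have "AE x in lborel. q x = 0" using int nn by (subst (asm) integral_nonneg_eq_0_iff_AE) auto
    then have "AE x in lborel. x \<notin> ball (0::'a) e"
    proof eventually_elim
      case (elim x)
      show ?case
      proof
        assume "x \<in> ball 0 e"
        then have "norm x ^ 2 < e ^ 2" using e by (intro power_strict_mono) auto
        then have "q x > 0" unfolding q_def by (intro relu_sq_simps) (simp add: power2_norm_eq_inner)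
        then show False using elim by simp
      qed
    qed
    then have "ball (0::'a) e \<in> null_sets lborel" by (subst (asm) AE_iff_null_sets[symmetric]) auto
    then have "negligible (ball (0::'a) e)" by (simp add: negligible_iff_null_sets null_sets_completionI)
    then show False using e open_not_negligible[of "ball (0::'a) e"] by simp
  qed
  define c where "c = 1 / (LINT x|lborel. q x)"
  have c: "c > 0" using \<open>0 < (LINT x|lborel. q x)\<close> by (simp add: c_def)
  show ?thesis
  proof (intro exI[of _ "\<lambda>x. c * q x"] exI[of _ "\<lambda>x. c *\<^sub>R q' x"] conjI allI impI)
    show "C1_gradient (\<lambda>x. c * q x) (\<lambda>x. c *\<^sub>R q' x)" by (rule C1_gradient_intros(4)[OF C1 C1])
    show "(LINT x|lborel. c * q x) = 1" using \<open>0 < (LINT x|lborel. q x)\<close> by (simp add: c_def)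
    show "integrable lborel (\<lambda>x. c * q x)" using int by simp
    show "0 \<le> c * q x" for x using c nn by simp
    show "c * q (- x) = c * q x" "c *\<^sub>R q' (- x) = - (c *\<^sub>R q' x)" for x by (simp_all add: q_def q'_def)
    show "c * q x = 0" "c *\<^sub>R q' x = 0" if "e \<le> norm x" for x using supp[OF that] by simp_all
  qed
qed

text \<open>Uniform in \<open>x\<close> over the whole space: \<open>w'\<close> is uniformly
  continuous on a large ball, and away from that ball \<open>w\<close> and \<open>w'\<close>
  vanish.\<close>

lemma C1_gradient_uniform_taylor:
  assumes w: "C1_gradient w w'" and supp: "\<And>x. R \<le> norm x \<Longrightarrow> w x = 0 \<and> w' x = 0" and d: "\<delta> > 0"
  shows "\<exists>d>0. \<forall>x h. norm h < d \<longrightarrow> \<bar>w (x + h) - w x - w' x \<bullet> h\<bar> \<le> \<delta> * norm h \<and> norm (w' (x + h) - w' x) \<le> \<delta>"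
proof -
  have "uniformly_continuous_on (cball 0 (R + 2)) w'"
    by (intro compact_uniformly_continuous C1_gradientD[OF w] compact_cball)
  then obtain d0 where d0: "d0 > 0" "\<And>x y. x \<in> cball 0 (R + 2) \<Longrightarrow> y \<in> cball 0 (R + 2) \<Longrightarrow>
      dist y x < d0 \<Longrightarrow> dist (w' y) (w' x) < \<delta>"
    using d unfolding uniformly_continuous_on_def by blast
  define d1 where "d1 = min 1 d0"
  have d1: "d1 > 0" "d1 \<le> 1" "d1 \<le> d0" using d0 by (auto simp: d1_def)
  have unif: "norm (w' (x + h) - w' x) \<le> \<delta>" if h: "norm h < d1" for x h
  proof (cases "norm x \<le> R + 1")
    case True
    then have "norm (x + h) \<le> R + 2" using norm_triangle_ineq[of x h] h d1 by linarith
    then show ?thesis using d0(2)[of x "x + h", unfolded mem_cball_0 dist_norm] True h d1 by auto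
  next
    case False
    then have "norm (x + h) \<ge> R" using norm_triangle_ineq2[of x "- h"] h d1 by simp
    then show ?thesis using supp[of x] supp[of "x + h"] False d by auto
  qed
  have "\<bar>w (x + h) - w x - w' x \<bullet> h\<bar> \<le> \<delta> * norm h" if h: "norm h < d1" for x h
  proof -
    have "norm (w (x + h) - w x - w' x \<bullet> ((x + h) - x)) \<le> norm ((x + h) - x) * \<delta>"
    proof (rule differentiable_bound_linearization[where S="ball x d1" and f'="\<lambda>x h. w' x \<bullet> h"])
      show "x + t *\<^sub>R (x + h - x) \<in> ball x d1" if "t \<in> {0..1}" for t
        using that h mult_mono[of t 1 "norm h" "norm h"] by (auto simp: dist_norm)
      show "x \<in> ball x d1" using d1 by simp
      show "(w has_derivative (\<bullet>) (w' z)) (at z within ball x d1)" for z by (rule C1_gradientD(1)[OF w])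
      show "onorm ((\<bullet>) (w' z) - (\<bullet>) (w' x)) \<le> \<delta>" if "z \<in> ball x d1" for z
      proof (rule onorm_bound)
        have "norm (w' z - w' x) \<le> \<delta>"
          using unif[of "z - x" x] that by (auto simp: dist_norm norm_minus_commute)
        then show "norm (((\<bullet>) (w' z) - (\<bullet>) (w' x)) h) \<le> \<delta> * norm h" for h
          using Cauchy_Schwarz_ineq2[of "w' z - w' x" h] mult_right_mono[of "norm (w' z - w' x)" \<delta> "norm h"]
          by (simp add: inner_diff_left)
      qed (use d in simp)
    qed
    then show ?thesis by (simp only: add_diff_cancel_left' real_norm_def mult.commute)
  qed
  with unif d1(1) show ?thesis by (intro exI[of _ d1] conjI allI impI)
qed

text \<open>In finite dimension, continuity of the derivative in operator norm reduces to continuity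
  of each directional derivative, which is what concrete fields provide.\<close>

lemma C1_compact_supportI:
  fixes v :: "real^'n::finite \<Rightarrow> real^'n"
  assumes der: "\<And>x. (v has_derivative D x) (at x)" and cont: "\<And>h. continuous_on UNIV (\<lambda>x. D x h)"
    and supp: "\<And>x. R \<le> norm x \<Longrightarrow> v x = 0"
  shows "v \<in> C1_compact_support"
proof -
  have D: "blinfun_apply (Blinfun (D x)) = D x" for x
    by (rule bounded_linear_Blinfun_apply) (rule has_derivative_bounded_linear[OF der])
  have "{x. v x \<noteq> 0} \<subseteq> ball 0 R" using supp by (auto simp: not_le[symmetric])
  then have "bounded {x. v x \<noteq> 0}" using bounded_ball bounded_subset by metis
  then have "compact (closure {x. v x \<noteq> 0})" by (simp add: compact_closure)
  moreover have "continuous_on UNIV (\<lambda>x. Blinfun (D x))"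
    by (intro continuous_on_blinfun_componentwise) (simp add: D cont)
  ultimately show ?thesis
    unfolding C1_compact_support_def using der D by (intro CollectI conjI exI[of _ "\<lambda>x. Blinfun (D x)"]) auto
qed

lemma C1_compact_supportE:
  fixes v :: "real^'n::finite \<Rightarrow> real^'n"
  assumes "v \<in> C1_compact_support"
  obtains D R where "\<And>x. (v has_derivative D x) (at x)" "\<And>h. continuous_on UNIV (\<lambda>x. D x h)"
    "R > 0" "\<And>x. R \<le> norm x \<Longrightarrow> v x = 0" "\<And>x h. R \<le> norm x \<Longrightarrow> D x h = 0" "continuous_on UNIV v"
proof -
  obtain v' where v': "\<And>x. (v has_derivative blinfun_apply (v' x)) (at x)" "continuous_on UNIV v'"
    and comp: "compact (closure {x. v x \<noteq> 0})"
    using assms by (auto simp: C1_compact_support_def)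
  obtain R where R: "R > 0" "\<And>x. x \<in> closure {x. v x \<noteq> 0} \<Longrightarrow> norm x \<le> R"
    using compact_imp_bounded[OF comp] by (auto simp: bounded_pos)
  have z: "v x = 0" if "R < norm x" for x
    using R(2)[of x] that closure_subset[of "{x. v x \<noteq> 0}"] by force
  have zD: "blinfun_apply (v' x) h = 0" if x: "R < norm x" for x h
  proof -
    have "open {x::real^'n. R < norm x}" by (intro open_Collect_less continuous_intros)
    then have "((\<lambda>_. 0) has_derivative blinfun_apply (v' x)) (at x)"
      using has_derivative_transform_within_open[OF v'(1)[of x], of "{x. R < norm x}" "\<lambda>_. 0"] x z by auto
    then have "blinfun_apply (v' x) = (\<lambda>h. 0)" using has_derivative_unique has_derivative_const by blast
    then show ?thesis by simp
  qed
  show ?thesis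
  \<comment> \<open>\<open>v\<close> and its derivative are known to vanish only where the norm
    exceeds \<open>R\<close>; the larger radius turns the strict inequality into a weak one.\<close>
  proof (rule that[of "\<lambda>x. blinfun_apply (v' x)" "R + 1"])
    show "continuous_on UNIV (\<lambda>x. blinfun_apply (v' x) h)" for h
      using v'(2) by (intro continuous_intros)
    show "continuous_on UNIV v" using v'(1) by (intro continuous_at_imp_continuous_on ballI has_derivative_continuous)
  qed (use v' R(1) z zD in auto)
qed

lemma linear_axis_sum:
  fixes f :: "real^'n::finite \<Rightarrow> 'b::real_vector"
  assumes "linear f"
  shows "f h = (\<Sum>i\<in>UNIV. (h $ i) *\<^sub>R f (axis i 1))"
proof -
  have "f h = f (\<Sum>i\<in>UNIV. (h $ i) *\<^sub>R axis i 1)"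
    by (subst basis_expansion[of h, symmetric]) (simp add: scalar_mult_eq_scaleR)
  then show ?thesis by (simp add: linear_sum[OF assms] linear_scale[OF assms])
qed

lemma divergence_eq:
  assumes "(F has_derivative D) (at x)"
  shows "divergence F x = (\<Sum>i\<in>UNIV. D (axis i 1) $ i)"
  using frechet_derivative_at[OF assms] by (simp add: divergence_def)

lemma continuous_on_divergence:
  fixes v :: "real^'n::finite \<Rightarrow> real^'n"
  assumes "v \<in> C1_compact_support"
  shows "continuous_on UNIV (divergence v)" "integrable lborel (divergence v)"
proof -
  obtain D R where D: "\<And>x. (v has_derivative D x) (at x)" "\<And>h. continuous_on UNIV (\<lambda>x. D x h)"
    "\<And>x h. R \<le> norm x \<Longrightarrow> D x h = 0"
    using C1_compact_supportE[OF assms] by metis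
  have eq: "divergence v = (\<lambda>x. \<Sum>i\<in>UNIV. D x (axis i 1) $ i)" using divergence_eq[OF D(1)] by auto
  show c: "continuous_on UNIV (divergence v)" unfolding eq by (intro continuous_intros D(2))
  show "integrable lborel (divergence v)"
    by (rule integrable_continuous_bounded_support[OF c, of R]) (simp add: eq D(3))
qed

lemma divergence_scaleR:
  fixes v :: "real^'n::finite \<Rightarrow> real^'n"
  assumes f: "(f has_derivative (\<lambda>h. f' \<bullet> h)) (at x)" and v: "(v has_derivative D) (at x)"
  shows "((\<lambda>x. f x *\<^sub>R v x) has_derivative (\<lambda>h. f x *\<^sub>R D h + (f' \<bullet> h) *\<^sub>R v x)) (at x)"
    and "divergence (\<lambda>x. f x *\<^sub>R v x) x = f x * divergence v x + f' \<bullet> v x"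
proof -
  show d: "((\<lambda>x. f x *\<^sub>R v x) has_derivative (\<lambda>h. f x *\<^sub>R D h + (f' \<bullet> h) *\<^sub>R v x)) (at x)"
    by (rule has_derivative_scaleR[OF f v])
  show "divergence (\<lambda>x. f x *\<^sub>R v x) x = f x * divergence v x + f' \<bullet> v x"
    unfolding divergence_eq[OF d] divergence_eq[OF v]
    by (simp add: sum.distrib sum_distrib_left inner_axis) (simp add: inner_vec_def)
qed

lemma C1_compact_support_scaleR:
  fixes v :: "real^'n::finite \<Rightarrow> real^'n"
  assumes f: "C1_gradient f f'" and v: "v \<in> C1_compact_support"
  shows "(\<lambda>x. f x *\<^sub>R v x) \<in> C1_compact_support"
    and "divergence (\<lambda>x. f x *\<^sub>R v x) x = f x * divergence v x + f' x \<bullet> v x"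
proof -
  obtain D R where D: "\<And>x. (v has_derivative D x) (at x)" "\<And>h. continuous_on UNIV (\<lambda>x. D x h)"
    "\<And>x. R \<le> norm x \<Longrightarrow> v x = 0" "continuous_on UNIV v"
    using C1_compact_supportE[OF v] by metis
  note df = C1_gradientD(1)[OF f, of _ UNIV] and c = C1_gradientD(2,3)[OF f, of UNIV]
  show "(\<lambda>x. f x *\<^sub>R v x) \<in> C1_compact_support"
  proof (rule C1_compact_supportI[OF divergence_scaleR(1)[OF df D(1)]])
    show "continuous_on UNIV (\<lambda>x. f x *\<^sub>R D x h + (f' x \<bullet> h) *\<^sub>R v x)" for h
      using c D by (intro continuous_intros) auto
    show "f x *\<^sub>R v x = 0" if "R \<le> norm x" for x using D(3)[OF that] by simp
  qed
  show "divergence (\<lambda>x. f x *\<^sub>R v x) x = f x * divergence v x + f' x \<bullet> v x"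
    by (rule divergence_scaleR(2)[OF df D(1)])
qed

section \<open>Convolution of a bounded function with a C^1 kernel\<close>

lemma integrable_convolution:
  fixes g :: "'a::euclidean_space \<Rightarrow> real" and f :: "'a \<Rightarrow> 'b::euclidean_space"
  assumes g: "continuous_on UNIV g" and supp: "\<And>z. e \<le> norm z \<Longrightarrow> g z = 0"
    and f [measurable]: "f \<in> borel_measurable borel" and bd: "\<And>y. norm (f y) \<le> 1"
  shows "integrable lborel (\<lambda>y. g (x - y) *\<^sub>R f y)"
proof (rule Bochner_Integration.integrable_bound)
  have gx: "continuous_on UNIV (\<lambda>y. g (x - y))" by (rule continuous_on_compose2[OF g]) (auto intro!: continuous_intros)
  show "integrable lborel (\<lambda>y. g (x - y))"
  proof (rule integrable_continuous_bounded_support[OF gx])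
    fix y :: 'a assume "norm x + e \<le> norm y"
    then show "g (x - y) = 0" using norm_triangle_ineq2[of y x] by (intro supp) (simp add: norm_minus_commute)
  qed
  have [measurable]: "g \<in> borel_measurable borel" using g by (rule borel_measurable_continuous_onI)
  show "(\<lambda>y. g (x - y) *\<^sub>R f y) \<in> borel_measurable lborel" by measurable
  show "AE y in lborel. norm (g (x - y) *\<^sub>R f y) \<le> norm (g (x - y))"
    using bd by (auto simp: mult_left_le)
qed

lemma norm_integral_le_cball:
  fixes F :: "'a::euclidean_space \<Rightarrow> 'b::euclidean_space"
  assumes F: "integrable lborel F" and bd: "\<And>y. norm (F y) \<le> c * indicator (cball x r) y"
  shows "norm (LINT y|lborel. F y) \<le> c * measure lborel (cball x r)"
proof -
  have i: "integrable lborel (\<lambda>y. c * indicat_real (cball x r) y)"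
    by (intro integrable_mult_right integrable_real_indicator) (simp_all add: emeasure_lborel_cball_finite[unfolded infinity_ennreal_def])
  have "norm (LINT y|lborel. F y) \<le> (LINT y|lborel. norm (F y))" by (rule integral_norm_bound)
  also have "\<dots> \<le> (LINT y|lborel. c * indicat_real (cball x r) y)"
    using F i bd by (intro integral_mono) auto
  finally show ?thesis by simp
qed

context
  fixes k :: "'a::euclidean_space \<Rightarrow> real" and k' :: "'a \<Rightarrow> 'a" and e :: real and f :: "'a \<Rightarrow> 'b::euclidean_space"
  assumes k: "C1_gradient k k'" and supp: "\<And>z. e \<le> norm z \<Longrightarrow> k z = 0 \<and> k' z = 0"
    and f: "f \<in> borel_measurable borel" and bd: "\<And>y. norm (f y) \<le> 1"
begin

lemma integrable_convolution_kernel: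
  "integrable lborel (\<lambda>y. k (x - y) *\<^sub>R f y)" "integrable lborel (\<lambda>y. (k' (x - y) \<bullet> h) *\<^sub>R f y)"
proof -
  show "integrable lborel (\<lambda>y. k (x - y) *\<^sub>R f y)"
    by (rule integrable_convolution[where e=e, OF C1_gradientD(3)[OF k] _ f bd]) (use supp in auto)
  have c: "continuous_on UNIV (\<lambda>z. k' z \<bullet> h)" using C1_gradientD(2)[OF k] by (intro continuous_intros)
  show "integrable lborel (\<lambda>y. (k' (x - y) \<bullet> h) *\<^sub>R f y)"
    by (rule integrable_convolution[where e=e, OF c _ f bd]) (use supp in auto)
qed

abbreviation (input) "conv x \<equiv> LINT y|lborel. k (x - y) *\<^sub>R f y"
abbreviation (input) "conv' x h \<equiv> LINT y|lborel. (k' (x - y) \<bullet> h) *\<^sub>R f y"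

text \<open>The Taylor expansion of the kernel is uniform, and for |h| < 1 the integrands live on
  the ball of radius \<open>e + 1\<close> about \<open>x\<close>, so it survives integration against
  a merely bounded \<open>f\<close>. One radius \<open>d\<close> serves both differentiability and
  continuity of the derivative.\<close>

lemma convolution_taylor:
  assumes "\<eta> > 0"
  shows "\<exists>d. 0 < d \<and> (\<forall>h. norm h < d \<longrightarrow> norm (conv (x + h) - conv x - conv' x h) \<le> \<eta> * norm h \<and>
    (\<forall>b. norm b \<le> 1 \<longrightarrow> norm (conv' (x + h) b - conv' x b) \<le> \<eta>))"
proof -
  define C where "C = measure lborel (cball x (e + 1)) + 1"
  have C: "C > 0" by (simp add: C_def add_nonneg_pos)
  have "\<eta> / C > 0" using assms C by simp
  from C1_gradient_uniform_taylor[OF k supp this]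
  obtain d where d: "d > 0" "\<And>z h. norm h < d \<Longrightarrow> \<bar>k (z + h) - k z - k' z \<bullet> h\<bar> \<le> \<eta> / C * norm h"
    "\<And>z h. norm h < d \<Longrightarrow> norm (k' (z + h) - k' z) \<le> \<eta> / C"
    by metis
  have q: "\<eta> / C * c * measure lborel (cball x (e + 1)) \<le> \<eta> * c" if "c \<ge> 0" for c
  proof -
    have "\<eta> / C * c * measure lborel (cball x (e + 1)) \<le> \<eta> / C * c * C"
      using assms C that by (intro mult_left_mono) (auto simp: C_def)
    then show ?thesis using C by simp
  qed
  have far: "k (x - y) = 0 \<and> k' (x - y) = 0 \<and> k (x + h - y) = 0 \<and> k' (x + h - y) = 0"
    if "norm h < 1" "y \<notin> cball x (e + 1)" for h y
  proof -
    have "norm (x - y) > e + 1" using that by (simp add: dist_norm)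
    moreover have "norm (x - y) \<le> norm (x + h - y) + norm h" using norm_triangle_ineq4[of "x + h - y" h] by simp
    ultimately show ?thesis using that supp[of "x - y"] supp[of "x + h - y"] by auto
  qed
  show ?thesis
  proof (intro exI[of _ "min 1 d"] conjI allI impI)
    show "min 1 d > 0" using d by simp
    fix h :: 'a assume "norm h < min 1 d"
    then have h: "norm h < 1" "norm h < d" by auto
    have "norm (LINT y|lborel. k (x + h - y) *\<^sub>R f y - k (x - y) *\<^sub>R f y - (k' (x - y) \<bullet> h) *\<^sub>R f y) \<le> (\<eta> / C * norm h) * measure lborel (cball x (e + 1))"
    proof (rule norm_integral_le_cball)
      show "integrable lborel (\<lambda>y. k (x + h - y) *\<^sub>R f y - k (x - y) *\<^sub>R f y - (k' (x - y) \<bullet> h) *\<^sub>R f y)"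
        by (intro Bochner_Integration.integrable_diff integrable_convolution_kernel)
      fix y
      have "norm (k (x + h - y) *\<^sub>R f y - k (x - y) *\<^sub>R f y - (k' (x - y) \<bullet> h) *\<^sub>R f y) = \<bar>k (x - y + h) - k (x - y) - k' (x - y) \<bullet> h\<bar> * norm (f y)"
        by (simp only: scaleR_diff_left[symmetric] norm_scaleR) (simp add: algebra_simps)
      also have "\<dots> \<le> \<bar>k (x - y + h) - k (x - y) - k' (x - y) \<bullet> h\<bar>" using bd[of y] by (simp add: mult_left_le)
      also have "\<dots> \<le> \<eta> / C * norm h * indicator (cball x (e + 1)) y"
        using d(2)[OF h(2), of "x - y"] far[OF h(1), of y]
        by (cases "y \<in> cball x (e + 1)") (auto simp: algebra_simps)
      finally show "norm (k (x + h - y) *\<^sub>R f y - k (x - y) *\<^sub>R f y - (k' (x - y) \<bullet> h) *\<^sub>R f y) \<le> \<eta> / C * norm h * indicator (cball x (e + 1)) y" .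
    qed
    also have "\<dots> \<le> \<eta> * norm h" using q[of "norm h"] by simp
    finally show "norm ((LINT y|lborel. k (x + h - y) *\<^sub>R f y) - (LINT y|lborel. k (x - y) *\<^sub>R f y) - (LINT y|lborel. (k' (x - y) \<bullet> h) *\<^sub>R f y)) \<le> \<eta> * norm h"
      by (simp add: Bochner_Integration.integral_diff integrable_convolution_kernel)
    fix b :: 'a assume b: "norm b \<le> 1"
    have "norm (LINT y|lborel. (k' (x + h - y) \<bullet> b) *\<^sub>R f y - (k' (x - y) \<bullet> b) *\<^sub>R f y) \<le> \<eta> / C * measure lborel (cball x (e + 1))"
    proof (rule norm_integral_le_cball)
      show "integrable lborel (\<lambda>y. (k' (x + h - y) \<bullet> b) *\<^sub>R f y - (k' (x - y) \<bullet> b) *\<^sub>R f y)"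
        by (intro Bochner_Integration.integrable_diff integrable_convolution_kernel)
      fix y
      have "norm ((k' (x + h - y) \<bullet> b) *\<^sub>R f y - (k' (x - y) \<bullet> b) *\<^sub>R f y) = \<bar>(k' (x - y + h) - k' (x - y)) \<bullet> b\<bar> * norm (f y)"
        by (simp only: scaleR_diff_left[symmetric] norm_scaleR inner_diff_left[symmetric]) (simp add: algebra_simps)
      also have "\<dots> \<le> \<bar>(k' (x - y + h) - k' (x - y)) \<bullet> b\<bar>" using bd[of y] by (simp add: mult_left_le)
      also have "\<dots> \<le> norm (k' (x - y + h) - k' (x - y)) * norm b" by (rule Cauchy_Schwarz_ineq2)
      also have "\<dots> \<le> norm (k' (x - y + h) - k' (x - y))" using b by (simp add: mult_left_le)
      also have "\<dots> \<le> \<eta> / C * indicator (cball x (e + 1)) y"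
        using d(3)[OF h(2), of "x - y"] far[OF h(1), of y]
        by (cases "y \<in> cball x (e + 1)") (auto simp: algebra_simps)
      finally show "norm ((k' (x + h - y) \<bullet> b) *\<^sub>R f y - (k' (x - y) \<bullet> b) *\<^sub>R f y) \<le> \<eta> / C * indicator (cball x (e + 1)) y" .
    qed
    also have "\<dots> \<le> \<eta>" using q[of 1] by simp
    finally show "norm ((LINT y|lborel. (k' (x + h - y) \<bullet> b) *\<^sub>R f y) - (LINT y|lborel. (k' (x - y) \<bullet> b) *\<^sub>R f y)) \<le> \<eta>"
      by (simp add: Bochner_Integration.integral_diff integrable_convolution_kernel)
  qed
qed

lemma has_derivative_convolution:
  "((\<lambda>x. LINT y|lborel. k (x - y) *\<^sub>R f y) has_derivative (\<lambda>h. LINT y|lborel. (k' (x - y) \<bullet> h) *\<^sub>R f y)) (at x)"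
  unfolding has_derivative_at_alt
proof (intro conjI allI impI)
  define A where "A h = (LINT y|lborel. (k' (x - y) \<bullet> h) *\<^sub>R f y)" for h
  have "linear A"
  proof (rule linearI)
    show "A (h1 + h2) = A h1 + A h2" for h1 h2
      by (simp add: A_def inner_add_right scaleR_add_left integrable_convolution_kernel)
    show "A (c *\<^sub>R h) = c *\<^sub>R A h" for c h
      by (simp add: A_def flip: scaleR_scaleR)
  qed
  then show "bounded_linear A" by (rule linear_conv_bounded_linear[THEN iffD1])
  fix \<eta> :: real assume "\<eta> > 0"
  from convolution_taylor[OF this, of x]
  obtain d where "0 < d \<and> (\<forall>h. norm h < d \<longrightarrow> norm (conv (x + h) - conv x - conv' x h) \<le> \<eta> * norm h \<and>
    (\<forall>b. norm b \<le> 1 \<longrightarrow> norm (conv' (x + h) b - conv' x b) \<le> \<eta>))"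
    by (rule exE)
  then have d: "d > 0" "\<And>h. norm h < d \<Longrightarrow> norm (conv (x + h) - conv x - A h) \<le> \<eta> * norm h"
    unfolding A_def by auto
  show "\<exists>d>0. \<forall>y. norm (y - x) < d \<longrightarrow> norm ((LINT ya|lborel. k (y - ya) *\<^sub>R f ya) - (LINT y|lborel. k (x - y) *\<^sub>R f y) - A (y - x)) \<le> \<eta> * norm (y - x)"
  proof (intro exI[of _ d] conjI allI impI d(1))
    fix z assume "norm (z - x) < d"
    from d(2)[OF this] show "norm ((LINT ya|lborel. k (z - ya) *\<^sub>R f ya) - (LINT y|lborel. k (x - y) *\<^sub>R f y) - A (z - x)) \<le> \<eta> * norm (z - x)"
      by simp
  qed
qed

lemma continuous_on_convolution_derivative:
  "continuous_on UNIV (\<lambda>x. LINT y|lborel. (k' (x - y) \<bullet> h) *\<^sub>R f y)"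
proof -
  define b where "b = h /\<^sub>R norm h"
  have b: "norm b \<le> 1" by (cases "h = 0") (auto simp: b_def)
  have h: "h = norm h *\<^sub>R b" by (cases "h = 0") (auto simp: b_def)
  have "continuous_on UNIV (\<lambda>x. LINT y|lborel. (k' (x - y) \<bullet> b) *\<^sub>R f y)"
    unfolding continuous_on_iff
  proof (intro ballI allI impI)
    fix x :: 'a and \<eta> :: real assume "\<eta> > 0"
    then have "\<eta> / 2 > 0" by simp
    from convolution_taylor[OF this, of x]
    obtain d where "0 < d \<and> (\<forall>h. norm h < d \<longrightarrow> norm (conv (x + h) - conv x - conv' x h) \<le> \<eta> / 2 * norm h \<and>
      (\<forall>b. norm b \<le> 1 \<longrightarrow> norm (conv' (x + h) b - conv' x b) \<le> \<eta> / 2))"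
      by (rule exE)
    then have d: "d > 0" "\<And>h. norm h < d \<Longrightarrow> norm (conv' (x + h) b - conv' x b) \<le> \<eta> / 2"
      using b by auto
    show "\<exists>d>0. \<forall>z\<in>UNIV. dist z x < d \<longrightarrow> dist (LINT y|lborel. (k' (z - y) \<bullet> b) *\<^sub>R f y) (LINT y|lborel. (k' (x - y) \<bullet> b) *\<^sub>R f y) < \<eta>"
    proof (intro exI[of _ d] conjI ballI impI d(1))
      fix z assume "dist z x < d"
      then have "norm (z - x) < d" by (simp add: dist_norm)
      from d(2)[OF this] show "dist (LINT y|lborel. (k' (z - y) \<bullet> b) *\<^sub>R f y) (LINT y|lborel. (k' (x - y) \<bullet> b) *\<^sub>R f y) < \<eta>"
        using \<open>\<eta> > 0\<close> by (simp add: dist_norm)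
    qed
  qed
  then have "continuous_on UNIV (\<lambda>x. norm h *\<^sub>R (LINT y|lborel. (k' (x - y) \<bullet> b) *\<^sub>R f y))" by (intro continuous_intros)
  also have "(\<lambda>x. norm h *\<^sub>R (LINT y|lborel. (k' (x - y) \<bullet> b) *\<^sub>R f y)) = (\<lambda>x. LINT y|lborel. (k' (x - y) \<bullet> h) *\<^sub>R f y)"
    by (subst (2) h) (simp flip: integral_scaleR_right)
  finally show ?thesis .
qed

end

lemma nn_integral_lborel_reflect:
  fixes f :: "'a::euclidean_space \<Rightarrow> ennreal"
  assumes [measurable]: "f \<in> borel_measurable borel"
  shows "(\<integral>\<^sup>+y. f (c - y) \<partial>lborel) = (\<integral>\<^sup>+y. f y \<partial>lborel)"
proof -
  have eq: "lborel = density (distr lborel borel (\<lambda>x. c - x)) (\<lambda>_. 1)"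
    using lborel_affine[of "-1" c] by simp
  have "(\<integral>\<^sup>+y. f y \<partial>lborel) = (\<integral>\<^sup>+y. f y \<partial>density (distr lborel borel (\<lambda>x. c - x)) (\<lambda>_. 1))"
    using arg_cong[OF eq, of "\<lambda>M. nn_integral M f"] .
  also have "\<dots> = (\<integral>\<^sup>+y. f (c - y) \<partial>lborel)"
    by (subst nn_integral_density) (auto simp: nn_integral_distr)
  finally show ?thesis ..
qed

text \<open>Continuity of translations in L^1 for an indicator. With \<open>K\<close> compact inside
  \<open>E\<close> and \<open>U\<close> open around it, a small shift keeps \<open>K\<close> inside
  \<open>U\<close>, so a point of \<open>E\<close> whose shift leaves \<open>E\<close> lies in
  \<open>E - K\<close> or in a translate of \<open>U - E\<close>.\<close>

lemma emeasure_diff_translate_small: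
  fixes E :: "'a::euclidean_space set"
  assumes E [measurable]: "E \<in> sets borel" and fin: "emeasure lborel E < \<infinity>" and t: "\<tau> > 0"
  shows "\<exists>d>0. \<forall>z. norm z < d \<longrightarrow> emeasure lborel {x\<in>E. x - z \<notin> E} \<le> ennreal \<tau>"
proof -
  have Em: "E \<in> lmeasurable" using E fin by (simp add: fmeasurable_def)
  \<comment> \<open>\<open>E\<close> may be unbounded, so it is first truncated to a ball; this
    makes the closed inner set compact.\<close>
  have "(\<lambda>n. measure lebesgue (E \<inter> cball 0 (real n))) \<longlonglongrightarrow> measure lebesgue (\<Union>n. E \<inter> cball 0 (real n))"
  proof (rule Lim_measure_incseq)
    show "range (\<lambda>n. E \<inter> cball 0 (real n)) \<subseteq> sets lebesgue" using Em by auto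
    show "incseq (\<lambda>n. E \<inter> cball 0 (real n))" by (auto simp: incseq_def)
    have "(\<Union>n. E \<inter> cball 0 (real n)) \<subseteq> E" by auto
    then have "emeasure lebesgue (\<Union>n. E \<inter> cball 0 (real n)) \<le> emeasure lebesgue E" by (intro emeasure_mono) auto
    then show "emeasure lebesgue (\<Union>n. E \<inter> cball 0 (real n)) \<noteq> \<infinity>" using fin by (auto simp: top_unique)
  qed
  moreover have "(\<Union>n. E \<inter> cball 0 (real n)) = E" by (auto intro: real_arch_simple)
  ultimately have "eventually (\<lambda>n. measure lebesgue E - \<tau> / 4 < measure lebesgue (E \<inter> cball 0 (real n))) sequentially"
    using t by (intro order_tendstoD) auto
  then obtain n where n: "measure lebesgue E - \<tau> / 4 < measure lebesgue (E \<inter> cball 0 (real n))"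
    by (auto simp: eventually_sequentially)
  let ?E = "E \<inter> cball 0 (real n)"
  obtain K where K: "closed K" "K \<subseteq> ?E" "?E - K \<in> lmeasurable" "emeasure lebesgue (?E - K) < ennreal (\<tau> / 4)"
    using sets_lebesgue_inner_closed[of ?E "\<tau> / 4"] Em t by (auto simp: fmeasurableD)
  obtain U where U: "open U" "E \<subseteq> U" "U - E \<in> lmeasurable" "emeasure lebesgue (U - E) < ennreal (\<tau> / 2)"
    using sets_lebesgue_outer_open[of E "\<tau> / 2"] Em t by (auto simp: fmeasurableD)
  have "bounded K" by (rule bounded_subset[OF bounded_cball]) (use K in auto)
  then have cK: "compact K" using K by (simp add: compact_eq_bounded_closed)
  have KU: "K \<subseteq> U" using K U by auto
  obtain d where d: "d > 0" "(\<Union>x\<in>K. ball x d) \<subseteq> U"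
    by (rule compact_subset_open_imp_ball_epsilon_subset[OF cK U(1) KU])
  have KB: "K \<in> sets borel" "U \<in> sets borel" using K U by auto
  have EK: "emeasure lborel (E - K) \<le> ennreal (\<tau> / 2)"
  proof -
    have mE: "?E \<in> lmeasurable" "K \<in> lmeasurable" using Em cK lmeasurable_compact by (auto intro!: fmeasurable_Int_fmeasurable)
    have "measure lebesgue (?E - K) < \<tau> / 4" using K t by (simp add: emeasure_eq_measure2 ennreal_less_iff)
    moreover have "measure lebesgue (?E - K) = measure lebesgue ?E - measure lebesgue K"
      using mE K by (intro measurable_measure_Diff) auto
    moreover have "measure lebesgue (E - K) = measure lebesgue E - measure lebesgue K"
      using mE K Em by (intro measurable_measure_Diff) auto
    ultimately have "measure lebesgue (E - K) \<le> \<tau> / 2" using n by linarith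
    moreover have "E - K \<in> lmeasurable" using Em mE by auto
    ultimately have "emeasure lebesgue (E - K) \<le> ennreal (\<tau> / 2)" by (simp add: emeasure_eq_measure2 ennreal_leI)
    then show ?thesis using KB E by simp
  qed
  have "emeasure lborel {x\<in>E. x - z \<notin> E} \<le> ennreal \<tau>" if z: "norm z < d" for z
  proof -
    have sub: "{x\<in>E. x - z \<notin> E} \<subseteq> (E - K) \<union> (\<lambda>x. z + x) ` (U - E)"
    proof
      fix x assume x: "x \<in> {x\<in>E. x - z \<notin> E}"
      show "x \<in> (E - K) \<union> (\<lambda>x. z + x) ` (U - E)"
      proof (cases "x \<in> K")
        case True
        have "x - z \<in> ball x d" using z by (simp add: dist_norm)
        then have "x - z \<in> U" using True d(2) by blast
        then have "x - z \<in> U - E" using x by auto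
        then show ?thesis by (auto intro!: image_eqI[of _ _ "x - z"])
      qed (use x in auto)
    qed
    have tr: "emeasure lebesgue ((\<lambda>x. z + x) ` (U - E)) = emeasure lebesgue (U - E)"
      using emeasure_lebesgue_affine[of 1 z "U - E"] by (simp add: add.commute)
    have trm: "(\<lambda>x. z + x) ` (U - E) \<in> sets lebesgue"
      using U(3) by (intro lebesgue_sets_translation) (auto simp: add.commute)
    have "emeasure lebesgue {x\<in>E. x - z \<notin> E} \<le> emeasure lebesgue ((E - K) \<union> (\<lambda>x. z + x) ` (U - E))"
      using trm KB E by (intro emeasure_mono sub) auto
    also have "\<dots> \<le> emeasure lebesgue (E - K) + emeasure lebesgue ((\<lambda>x. z + x) ` (U - E))"
      using trm KB E by (intro emeasure_subadditive) auto
    also have "\<dots> \<le> ennreal (\<tau> / 2) + ennreal (\<tau> / 2)"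
      unfolding tr using EK KB E U(4) by (intro add_mono) auto
    also have "\<dots> = ennreal \<tau>" using t by (simp flip: ennreal_plus)
    finally show ?thesis by simp
  qed
  then show ?thesis using d(1) by (intro exI[of _ d]) auto
qed

section \<open>The isoperimetric inequality for sets of finite perimeter\<close>

text \<open>The De Giorgi perimeter of \<open>E\<close> is at most \<open>P\<close>; a predicate, as
  only upper bounds on it are ever used. Fields are bounded by 1 everywhere here, whereas
  \<open>weighted_perimeter\<close> bounds them on the set only.\<close>

definition perimeter_le :: "(real^'n::finite) set \<Rightarrow> real \<Rightarrow> bool" where
  "perimeter_le E P \<longleftrightarrow> (\<forall>v\<in>C1_compact_support. (\<forall>x. norm (v x) \<le> 1) \<longrightarrow> (LINT x|lborel. indicator E x * divergence v x) \<le> P)"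

lemma integral_vec_nth:
  fixes F :: "'a \<Rightarrow> real^'n::finite"
  assumes "integrable M F"
  shows "(LINT x|M. F x) $ i = (LINT x|M. F x $ i)"
  using integral_inner_left[of "axis i 1" M F] assms by (simp add: inner_axis)

context
  fixes k :: "real^'n::finite \<Rightarrow> real" and k' :: "real^'n \<Rightarrow> real^'n" and e :: real and E :: "(real^'n) set"
  assumes k: "C1_gradient k k'" and supp: "\<And>z. e \<le> norm z \<Longrightarrow> k z = 0 \<and> k' z = 0" and e: "e > 0"
    and k0: "\<And>z. 0 \<le> k z" and even: "\<And>z. k (- z) = k z" and odd: "\<And>z. k' (- z) = - k' z"
    and k_int: "integrable lborel k" and k1: "(LINT z|lborel. k z) = 1"
    and E: "E \<in> sets borel"
begin

definition mollified :: "real^'n \<Rightarrow> real" where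
  "mollified x = (LINT y|lborel. k (x - y) *\<^sub>R indicator E y)"

definition mollified' :: "real^'n \<Rightarrow> real^'n" where
  "mollified' x = (LINT y|lborel. indicator E y *\<^sub>R k' (x - y))"

lemma kernel_shift:
  "integrable lborel (\<lambda>y. k (x - y))" "(LINT y|lborel. k (x - y)) = 1" "(\<integral>\<^sup>+y. ennreal (k (x - y)) \<partial>lborel) = 1"
proof -
  have [measurable]: "k \<in> borel_measurable borel" by (rule C1_gradientD(4)[OF k])
  have "(\<integral>\<^sup>+y. ennreal (k (x - y)) \<partial>lborel) = (\<integral>\<^sup>+y. ennreal (k y) \<partial>lborel)"
    by (rule nn_integral_lborel_reflect) measurable
  also have "\<dots> = ennreal 1" using k_int k0 by (subst nn_integral_eq_integral) (auto simp: k1)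
  finally show 1: "(\<integral>\<^sup>+y. ennreal (k (x - y)) \<partial>lborel) = 1" by simp
  show i: "integrable lborel (\<lambda>y. k (x - y))"
    using 1 k0 by (intro integrableI_nn_integral_finite[where x=1]) auto
  show "(LINT y|lborel. k (x - y)) = 1"
    using 1 k0 i by (subst integral_eq_nn_integral) auto
qed

lemma indicator_E_facts:
  "(indicator E :: real^'n \<Rightarrow> real) \<in> borel_measurable borel" "norm (indicator E y :: real) \<le> 1"
  using E by (auto simp: indicator_def)

lemma integrable_mollified':
  "integrable lborel (\<lambda>y. indicator E y *\<^sub>R k' (x - y))"
proof (rule Bochner_Integration.integrable_bound)
  have gx: "continuous_on UNIV (\<lambda>y. k' (x - y))"
    by (rule continuous_on_compose2[OF C1_gradientD(2)[OF k]]) (auto intro!: continuous_intros)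
  show "integrable lborel (\<lambda>y. k' (x - y))"
  proof (rule integrable_continuous_bounded_support[OF gx])
    fix y :: "real^'n" assume "norm x + e \<le> norm y"
    then have "e \<le> norm (x - y)" using norm_triangle_ineq2[of y x] by (simp add: norm_minus_commute)
    then show "k' (x - y) = 0" using supp by simp
  qed
  have [measurable]: "k' \<in> borel_measurable borel" by (rule C1_gradientD(5)[OF k])
  show "(\<lambda>y. indicator E y *\<^sub>R k' (x - y)) \<in> borel_measurable lborel" using E by measurable
qed (auto simp: indicator_def)

lemma C1_gradient_mollified: "C1_gradient mollified mollified'"
proof -
  note facts = k supp indicator_E_facts
  have eq: "(LINT y|lborel. (k' (x - y) \<bullet> h) *\<^sub>R indicator E y) = mollified' x \<bullet> h" for x h
    unfolding mollified'_def by (subst integral_inner_left[symmetric]) (auto simp: integrable_mollified' mult.commute)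
  have "continuous_on UNIV (\<lambda>x. mollified' x \<bullet> h)" for h
    using continuous_on_convolution_derivative[where e=e, OF facts, where h=h] by (simp only: eq)
  moreover have "(mollified has_derivative (\<lambda>h. mollified' x \<bullet> h)) (at x)" for x
    using has_derivative_convolution[where e=e, OF facts, where x=x] by (simp only: eq mollified_def[abs_def])
  ultimately show ?thesis
    unfolding C1_gradient_def by (subst continuous_on_componentwise) auto
qed

lemma mollified_bounds: "0 \<le> mollified x" "mollified x \<le> 1"
proof -
  show "0 \<le> mollified x" unfolding mollified_def using k0 by (intro Bochner_Integration.integral_nonneg) auto
  have "mollified x \<le> (LINT y|lborel. k (x - y))"
    unfolding mollified_def
    using k0 integrable_convolution_kernel(1)[where e=e, OF k supp indicator_E_facts, where x=x] kernel_shift(1)[of x]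
    by (intro integral_mono) (auto simp: indicator_def)
  then show "mollified x \<le> 1" by (simp add: kernel_shift)
qed

lemma nn_mollified: "ennreal (mollified x) = (\<integral>\<^sup>+y. ennreal (k (x - y)) * indicator E y \<partial>lborel)"
proof -
  have "ennreal (mollified x) = (\<integral>\<^sup>+y. ennreal (k (x - y) *\<^sub>R indicator E y) \<partial>lborel)"
    unfolding mollified_def
    using k0 integrable_convolution_kernel(1)[where e=e, OF k supp indicator_E_facts, where x=x]
    by (intro nn_integral_eq_integral[symmetric]) auto
  also have "\<dots> = (\<integral>\<^sup>+y. ennreal (k (x - y)) * indicator E y \<partial>lborel)"
    by (intro nn_integral_cong) (auto simp: indicator_def)
  finally show ?thesis .
qed

text \<open>Mollifying does not increase the perimeter: by Fubini and the oddness of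
  \<open>k'\<close>, the pairing is the integral over \<open>E\<close> of the divergence of \<phi>
  convolved with \<open>k\<close>, and averaging against a probability density keeps the bound 1.
  The convolution also makes the merely continuous \<phi> a C^1 field.\<close>

lemma mollified_pairing:
  assumes P: "perimeter_le E P" and \<phi>: "continuous_on UNIV \<phi>" and \<phi>1: "\<And>x. norm (\<phi> x) \<le> 1"
    and \<phi>R: "\<And>x. R \<le> norm x \<Longrightarrow> \<phi> x = 0"
  shows "- (LINT x|lborel. \<phi> x \<bullet> mollified' x) \<le> P"
proof -
  have \<phi>m [measurable]: "\<phi> \<in> borel_measurable borel" using \<phi> by (rule borel_measurable_continuous_onI)
  have k'm [measurable]: "k' \<in> borel_measurable borel" by (rule C1_gradientD(5)[OF k])
  have km [measurable]: "k \<in> borel_measurable borel" by (rule C1_gradientD(4)[OF k])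
  note facts = k supp \<phi>m \<phi>1
  define v where "v y = (LINT x|lborel. k (y - x) *\<^sub>R \<phi> x)" for y
  define D where "D y h = (LINT x|lborel. (k' (y - x) \<bullet> h) *\<^sub>R \<phi> x)" for y h
  have dv: "(v has_derivative D y) (at y)" for y
    using has_derivative_convolution[where e=e, OF facts, where x=y] by (simp only: v_def[abs_def] D_def[abs_def])
  have vsupp: "v y = 0" if "R + e \<le> norm y" for y
  proof -
    have z: "k (y - x) *\<^sub>R \<phi> x = 0" for x
    proof (cases "R \<le> norm x")
      case False
      then have "e \<le> norm (y - x)" using that norm_triangle_ineq2[of y x] by simp
      then show ?thesis using supp by simp
    qed (use \<phi>R in simp)
    show ?thesis unfolding v_def z by simp
  qed
  have v: "v \<in> C1_compact_support"
    by (rule C1_compact_supportI[OF dv _ vsupp])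
      (simp add: D_def continuous_on_convolution_derivative[OF facts])
  have v1: "norm (v y) \<le> 1" for y
  proof -
    have "norm (v y) \<le> (LINT x|lborel. norm (k (y - x) *\<^sub>R \<phi> x))" unfolding v_def by (rule integral_norm_bound)
    also have "\<dots> \<le> (LINT x|lborel. k (y - x))"
      using integrable_norm[OF integrable_convolution_kernel(1)[where e=e, OF facts, where x=y]] kernel_shift(1)[of y] k0 \<phi>1
      by (intro integral_mono) (auto simp: mult_left_le)
    finally show ?thesis by (simp add: kernel_shift)
  qed
  have div: "divergence v y = (LINT x|lborel. k' (y - x) \<bullet> \<phi> x)" for y
  proof -
    have "divergence v y = (\<Sum>i\<in>UNIV. D y (axis i 1) $ i)" by (rule divergence_eq[OF dv])
    also have "\<dots> = (\<Sum>i\<in>UNIV. (LINT x|lborel. k' (y - x) $ i * \<phi> x $ i))"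
    proof (rule sum.cong[OF refl])
      fix i :: 'n
      have "D y (axis i 1) $ i = (LINT x|lborel. ((k' (y - x) \<bullet> axis i 1) *\<^sub>R \<phi> x) $ i)"
        unfolding D_def by (rule integral_vec_nth[OF integrable_convolution_kernel(2)[where e=e, OF facts]])
      then show "D y (axis i 1) $ i = (LINT x|lborel. k' (y - x) $ i * \<phi> x $ i)" by (simp add: inner_axis)
    qed
    also have "\<dots> = (LINT x|lborel. (\<Sum>i\<in>UNIV. k' (y - x) $ i * \<phi> x $ i))"
    proof (rule Bochner_Integration.integral_sum[symmetric])
      fix i
      show "integrable lborel (\<lambda>x. k' (y - x) $ i * \<phi> x $ i)"
        using integrable_inner_left[of "axis i 1", OF integrable_convolution_kernel(2)[where e=e, OF facts, where x=y and h="axis i 1"]]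
        by (simp add: inner_axis)
    qed
    finally show ?thesis by (simp add: inner_vec_def)
  qed
  obtain C where C: "\<And>z. norm (k' z) \<le> C"
  proof -
    have "bounded (k' ` cball 0 e)"
      by (intro compact_imp_bounded compact_continuous_image C1_gradientD[OF k] compact_cball)
    then obtain B where B: "\<And>z. z \<in> cball 0 e \<Longrightarrow> norm (k' z) \<le> B" by (metis bounded_iff imageI)
    have "norm (k' z) \<le> max B 0" for z using B[of z] supp[of z] by (cases "norm z \<le> e") (auto simp: le_max_iff_disj)
    then show ?thesis using that by blast
  qed
  define F where "F x y = indicator E y * (k' (y - x) \<bullet> \<phi> x)" for x y
  have Fint: "integrable (lborel \<Otimes>\<^sub>M lborel) (case_prod F)"
  proof (rule integrableI_bounded_set[where A="cball 0 R \<times> cball 0 (R + e)" and B=C])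
    show "cball 0 R \<times> cball 0 (R + e) \<in> sets (lborel \<Otimes>\<^sub>M lborel)" by auto
    show "case_prod F \<in> borel_measurable (lborel \<Otimes>\<^sub>M lborel)" unfolding F_def using E by measurable
    show "emeasure (lborel \<Otimes>\<^sub>M lborel) (cball (0::real^'n) R \<times> cball (0::real^'n) (R + e)) < \<infinity>"
      by (subst lborel.emeasure_pair_measure_Times) (auto simp: ennreal_mult_less_top emeasure_lborel_cball_finite[unfolded infinity_ennreal_def])
    have "norm (F x y) \<le> C" for x y
    proof -
      have "norm (F x y) \<le> \<bar>k' (y - x) \<bullet> \<phi> x\<bar>" by (auto simp: F_def indicator_def)
      also have "\<dots> \<le> norm (k' (y - x)) * norm (\<phi> x)" by (rule Cauchy_Schwarz_ineq2)
      also have "\<dots> \<le> norm (k' (y - x))" using \<phi>1[of x] by (simp add: mult_left_le)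
      finally show ?thesis using C[of "y - x"] by simp
    qed
    then show "AE p in lborel \<Otimes>\<^sub>M lborel. p \<in> cball 0 R \<times> cball 0 (R + e) \<longrightarrow> norm (case p of (x, y) \<Rightarrow> F x y) \<le> C" by auto
    have "F x y = 0" if "\<not> (norm x \<le> R \<and> norm y \<le> R + e)" for x y
    proof (cases "R \<le> norm x")
      case False
      then have "e \<le> norm (y - x)" using that norm_triangle_ineq2[of y x] by simp
      then show ?thesis using supp[of "y - x"] by (simp add: F_def)
    qed (simp add: F_def \<phi>R)
    then have "(case p of (x, y) \<Rightarrow> F x y) = 0" if "p \<notin> cball 0 R \<times> cball 0 (R + e)" for p
      using that by (cases p) auto
    then show "AE p in lborel \<Otimes>\<^sub>M lborel. p \<notin> cball 0 R \<times> cball 0 (R + e) \<longrightarrow> (case p of (x, y) \<Rightarrow> F x y) = 0"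
      by (intro AE_I2 impI)
  qed
  have "(LINT y|lborel. indicator E y * divergence v y) = (LINT y|lborel. (LINT x|lborel. F x y))"
    by (simp add: div F_def)
  also have "\<dots> = (LINT x|lborel. (LINT y|lborel. F x y))"
    by (rule lborel_pair.Fubini_integral[OF Fint])
  also have "\<dots> = (LINT x|lborel. - (\<phi> x \<bullet> mollified' x))"
  proof (rule Bochner_Integration.integral_cong[OF refl])
    fix x
    have "F x y = - (indicator E y *\<^sub>R k' (x - y) \<bullet> \<phi> x)" for y
      using odd[of "x - y"] by (simp add: F_def)
    then have "(LINT y|lborel. F x y) = - (LINT y|lborel. indicator E y *\<^sub>R k' (x - y) \<bullet> \<phi> x)" by simp
    also have "\<dots> = - (mollified' x \<bullet> \<phi> x)"
      unfolding mollified'_def by (subst integral_inner_left) (auto simp: integrable_mollified')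
    finally show "(LINT y|lborel. F x y) = - (\<phi> x \<bullet> mollified' x)" by (simp add: inner_commute)
  qed
  finally have "(LINT y|lborel. indicator E y * divergence v y) = - (LINT x|lborel. \<phi> x \<bullet> mollified' x)" by simp
  then show ?thesis using P v v1 unfolding perimeter_le_def by auto
qed

text \<open>The optimal field is -\<psi> times the normalised gradient, which may jump where the
  gradient vanishes. Adding \<eta> to the denominator restores continuity and costs at most \<eta>
  times the integral of \<psi>.\<close>

lemma mollified_variation:
  assumes P: "perimeter_le E P" and \<psi>: "continuous_on UNIV \<psi>" and \<psi>1: "\<And>x. 0 \<le> \<psi> x \<and> \<psi> x \<le> 1"
    and \<psi>R: "\<And>x. R \<le> norm x \<Longrightarrow> \<psi> x = 0"
  shows "(LINT x|lborel. \<psi> x * norm (mollified' x)) \<le> P"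
proof (rule field_le_epsilon)
  fix \<tau> :: real assume \<tau>: "\<tau> > 0"
  let ?u = mollified'
  have cu: "continuous_on UNIV ?u" by (rule C1_gradientD(2)[OF C1_gradient_mollified])
  have i\<psi>: "integrable lborel \<psi>" by (rule integrable_continuous_bounded_support[OF \<psi> \<psi>R])
  define I where "I = (LINT x|lborel. \<psi> x) + 1"
  have I: "I > 0" unfolding I_def using \<psi>1 by (intro add_nonneg_pos integral_nonneg) auto
  define \<eta> where "\<eta> = \<tau> / I"
  have \<eta>: "\<eta> > 0" using \<tau> I by (simp add: \<eta>_def)
  have nz: "\<eta> + norm (?u x) \<noteq> 0" for x using \<eta> norm_ge_zero[of "?u x"] by linarith
  define \<phi> where "\<phi> x = (- (\<psi> x / (\<eta> + norm (?u x)))) *\<^sub>R ?u x" for x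
  have c\<phi>: "continuous_on UNIV \<phi>" unfolding \<phi>_def using nz by (intro continuous_intros \<psi> cu) auto
  have c1: "continuous_on UNIV (\<lambda>x. \<psi> x * norm (?u x))" by (intro continuous_intros \<psi> cu)
  have c2: "continuous_on UNIV (\<lambda>x. \<phi> x \<bullet> ?u x)" by (intro continuous_intros c\<phi> cu)
  have i1: "integrable lborel (\<lambda>x. \<psi> x * norm (?u x))"
    by (rule integrable_continuous_bounded_support[OF c1, of R]) (simp add: \<psi>R)
  have i2: "integrable lborel (\<lambda>x. \<phi> x \<bullet> ?u x)"
    by (rule integrable_continuous_bounded_support[OF c2, of R]) (simp add: \<psi>R \<phi>_def)
  have n1: "norm (\<phi> x) \<le> 1" for x
  proof -
    have "norm (\<phi> x) = \<psi> x * (norm (?u x) / (\<eta> + norm (?u x)))" using \<psi>1[of x] \<eta> by (simp add: \<phi>_def)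
    also have "\<dots> \<le> 1 * 1" using \<psi>1[of x] \<eta> by (intro mult_mono) (auto simp: divide_le_eq add_pos_nonneg)
    finally show ?thesis by simp
  qed
  have pt: "\<psi> x * norm (?u x) \<le> - (\<phi> x \<bullet> ?u x) + \<eta> * \<psi> x" for x
  proof -
    have "- (\<phi> x \<bullet> ?u x) = \<psi> x * (norm (?u x))\<^sup>2 / (\<eta> + norm (?u x))" by (simp add: \<phi>_def power2_norm_eq_inner)
    moreover have "\<psi> x * norm (?u x) - \<eta> * \<psi> x \<le> \<psi> x * (norm (?u x))\<^sup>2 / (\<eta> + norm (?u x))"
    proof -
      have "(\<psi> x * norm (?u x) - \<eta> * \<psi> x) * (\<eta> + norm (?u x)) = \<psi> x * (norm (?u x))\<^sup>2 - \<psi> x * \<eta>\<^sup>2"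
        by (simp add: algebra_simps power2_eq_square)
      also have "\<dots> \<le> \<psi> x * (norm (?u x))\<^sup>2" using \<psi>1[of x] by simp
      finally show ?thesis using \<eta> by (simp add: pos_le_divide_eq add_pos_nonneg)
    qed
    ultimately show ?thesis by linarith
  qed
  have "(LINT x|lborel. \<psi> x * norm (?u x)) \<le> (LINT x|lborel. - (\<phi> x \<bullet> ?u x) + \<eta> * \<psi> x)"
    using i1 i2 i\<psi> pt by (intro integral_mono) auto
  also have "\<dots> = - (LINT x|lborel. \<phi> x \<bullet> ?u x) + \<eta> * (LINT x|lborel. \<psi> x)"
    using i2 i\<psi> by simp
  also have "\<dots> \<le> P + \<eta> * I"
    using \<eta> by (intro add_mono mollified_pairing[OF P c\<phi> n1, of R] mult_left_mono) (auto simp: \<phi>_def \<psi>R I_def)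
  finally show "(LINT x|lborel. \<psi> x * norm (?u x)) \<le> P + \<tau>" using I by (simp add: \<eta>_def)
qed

lemma nn_mollified_Compl:
  "(\<integral>\<^sup>+y. ennreal (k (x - y)) * indicator (- E) y \<partial>lborel) = ennreal (1 - mollified x)"
proof -
  have km [measurable]: "k \<in> borel_measurable borel" by (rule C1_gradientD(4)[OF k])
  note E [measurable]
  have "1 = (\<integral>\<^sup>+y. ennreal (k (x - y)) * indicator E y + ennreal (k (x - y)) * indicator (- E) y \<partial>lborel)"
    unfolding kernel_shift(3)[of x, symmetric] by (intro nn_integral_cong) (auto simp: indicator_def)
  also have "\<dots> = ennreal (mollified x) + (\<integral>\<^sup>+y. ennreal (k (x - y)) * indicator (- E) y \<partial>lborel)"
    by (subst nn_integral_add) (auto simp: nn_mollified)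
  finally have one: "1 = ennreal (mollified x) + (\<integral>\<^sup>+y. ennreal (k (x - y)) * indicator (- E) y \<partial>lborel)" .
  have "ennreal (1 - mollified x) = 1 - ennreal (mollified x)"
    using mollified_bounds[of x] by (simp add: ennreal_minus flip: ennreal_1)
  also have "\<dots> = (\<integral>\<^sup>+y. ennreal (k (x - y)) * indicator (- E) y \<partial>lborel)"
    by (subst one) simp
  finally show ?thesis ..
qed

text \<open>The mollified function averages translates of the indicator, so its deficit on
  \<open>E0\<close> is at most an average of the volumes that \<open>E0\<close> loses under shifts
  shorter than \<open>e\<close>. The subset \<open>E0\<close> has finite volume where
  \<open>E\<close> itself may not.\<close>

lemma mollified_defect:
  assumes E0 [measurable]: "E0 \<in> sets borel" and sub: "E0 \<subseteq> E" and tr: "\<And>z. norm z < e \<Longrightarrow> emeasure lborel {x\<in>E0. x - z \<notin> E0} \<le> ennreal \<tau>"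
  shows "(\<integral>\<^sup>+x\<in>E0. ennreal (1 - mollified x) \<partial>lborel) \<le> ennreal \<tau>"
proof -
  have km [measurable]: "k \<in> borel_measurable borel" by (rule C1_gradientD(4)[OF k])
  have um [measurable]: "mollified \<in> borel_measurable borel" by (rule C1_gradientD(4)[OF C1_gradient_mollified])
  note E [measurable]
  have "ennreal (1 - mollified x) \<le> (\<integral>\<^sup>+z. ennreal (k z) * indicator (- E0) (x - z) \<partial>lborel)" for x
  proof -
    have "ennreal (1 - mollified x) = (\<integral>\<^sup>+y. ennreal (k (x - y)) * indicator (- E) y \<partial>lborel)"
      by (rule nn_mollified_Compl[symmetric])
    also have "\<dots> \<le> (\<integral>\<^sup>+y. ennreal (k (x - y)) * indicator (- E0) (x - (x - y)) \<partial>lborel)"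
      using sub by (intro nn_integral_mono) (auto simp: indicator_def)
    also have "\<dots> = (\<integral>\<^sup>+z. ennreal (k z) * indicator (- E0) (x - z) \<partial>lborel)"
      by (rule nn_integral_lborel_reflect[of "\<lambda>z. ennreal (k z) * indicator (- E0) (x - z)" x]) measurable
    finally show ?thesis .
  qed
  then have "(\<integral>\<^sup>+x\<in>E0. ennreal (1 - mollified x) \<partial>lborel)
      \<le> (\<integral>\<^sup>+x. (\<integral>\<^sup>+z. ennreal (k z) * indicator (- E0) (x - z) \<partial>lborel) * indicator E0 x \<partial>lborel)"
    by (intro nn_integral_mono mult_right_mono) auto
  also have "\<dots> = (\<integral>\<^sup>+x. (\<integral>\<^sup>+z. ennreal (k z) * (indicator (- E0) (x - z) * indicator E0 x) \<partial>lborel) \<partial>lborel)"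
    by (intro nn_integral_cong) (auto simp: indicator_def)
  also have "\<dots> = (\<integral>\<^sup>+z. (\<integral>\<^sup>+x. ennreal (k z) * (indicator (- E0) (x - z) * indicator E0 x) \<partial>lborel) \<partial>lborel)"
    by (rule lborel_pair.Fubini') measurable
  also have "\<dots> \<le> (\<integral>\<^sup>+z. ennreal (k z) * ennreal \<tau> \<partial>lborel)"
  proof (rule nn_integral_mono)
    fix z :: "real^'n"
    have "(\<integral>\<^sup>+x. ennreal (k z) * (indicator (- E0) (x - z) * indicator E0 x) \<partial>lborel)
        = ennreal (k z) * (\<integral>\<^sup>+x. indicator {x\<in>E0. x - z \<notin> E0} x \<partial>lborel)"
      by (subst nn_integral_cmult[symmetric]) (auto intro!: nn_integral_cong simp: indicator_def)
    also have "\<dots> = ennreal (k z) * emeasure lborel {x\<in>E0. x - z \<notin> E0}" by simp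
    also have "\<dots> \<le> ennreal (k z) * ennreal \<tau>"
      using tr[of z] supp[of z] by (cases "norm z < e") (auto intro: mult_left_mono)
    finally show "(\<integral>\<^sup>+x. ennreal (k z) * (indicator (- E0) (x - z) * indicator E0 x) \<partial>lborel) \<le> ennreal (k z) * ennreal \<tau>" .
  qed
  also have "\<dots> = ennreal \<tau>"
    using kernel_shift(3)[of 0] even by (simp add: nn_integral_multc)
  finally show ?thesis .
qed

lemma nn_integral_mollified: 
  assumes w [measurable]: "w \<in> borel_measurable borel"
  shows "(\<integral>\<^sup>+x. ennreal (mollified x) * w x \<partial>lborel) = (\<integral>\<^sup>+y\<in>E. (\<integral>\<^sup>+x. ennreal (k (x - y)) * w x \<partial>lborel) \<partial>lborel)"
proof -
  have km [measurable]: "k \<in> borel_measurable borel" by (rule C1_gradientD(4)[OF k])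
  note E [measurable]
  have "(\<integral>\<^sup>+x. ennreal (mollified x) * w x \<partial>lborel)
      = (\<integral>\<^sup>+x. (\<integral>\<^sup>+y. ennreal (k (x - y)) * w x * indicator E y \<partial>lborel) \<partial>lborel)"
    unfolding nn_mollified by (intro nn_integral_cong, subst nn_integral_multc[symmetric]) (auto simp: mult_ac)
  also have "\<dots> = (\<integral>\<^sup>+y. (\<integral>\<^sup>+x. ennreal (k (x - y)) * w x * indicator E y \<partial>lborel) \<partial>lborel)"
    by (rule lborel_pair.Fubini') measurable
  also have "\<dots> = (\<integral>\<^sup>+y\<in>E. (\<integral>\<^sup>+x. ennreal (k (x - y)) * w x \<partial>lborel) \<partial>lborel)"
    by (intro nn_integral_cong nn_integral_multc) auto
  finally show ?thesis .
qed

end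

lemma finite_measure_tail:
  fixes M :: "'a::real_normed_vector measure"
  assumes M: "sets M = sets borel" and fin: "emeasure M (space M) < \<infinity>" and t: "\<tau> > 0"
  shows "\<exists>r0. \<forall>r\<ge>r0. emeasure M {x. r \<le> norm x} \<le> ennreal \<tau>"
proof -
  have cl: "{x::'a. r \<le> norm x} \<in> sets M" for r
    unfolding M by (intro borel_closed closed_Collect_le continuous_intros)
  have "(\<lambda>n. emeasure M {x. real n \<le> norm x}) \<longlonglongrightarrow> emeasure M (\<Inter>n. {x. real n \<le> norm x})"
  proof (rule Lim_emeasure_decseq)
    show "decseq (\<lambda>n. {x::'a. real n \<le> norm x})" by (auto simp: decseq_def)
    fix n
    have "emeasure M {x. real n \<le> norm x} \<le> emeasure M (space M)" by (rule emeasure_space)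
    then show "emeasure M {x. real n \<le> norm x} \<noteq> \<infinity>" using fin by (auto simp: top_unique)
  qed (use cl in auto)
  moreover have "(\<Inter>n. {x::'a. real n \<le> norm x}) = {}"
  proof -
    have "\<exists>n. \<not> real n \<le> norm x" for x :: 'a using reals_Archimedean2[of "norm x"] by (auto simp: not_le)
    then show ?thesis by auto
  qed
  ultimately have "(\<lambda>n. emeasure M {x. real n \<le> norm x}) \<longlonglongrightarrow> 0" by simp
  then have "eventually (\<lambda>n. emeasure M {x. real n \<le> norm x} < ennreal \<tau>) sequentially"
    using t by (intro order_tendstoD) auto
  then obtain n where n: "emeasure M {x. real n \<le> norm x} < ennreal \<tau>" by (auto simp: eventually_sequentially)
  have "emeasure M {x. r \<le> norm x} \<le> ennreal \<tau>" if "r \<ge> real n" for r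
  proof -
    have "emeasure M {x. r \<le> norm x} \<le> emeasure M {x. real n \<le> norm x}"
      using that cl by (intro emeasure_mono) auto
    then show ?thesis using n by simp
  qed
  then show ?thesis by blast
qed

text \<open>Cutting off at radius \<open>r\<close> costs \<open>C / r\<close> times the volume of
  \<open>E\<close> in an annulus. There 1/r is at most 4/(1 + |y|), so the cost is governed by the
  tail of a convergent integral. The annulus is widened by 1 on both sides to allow for
  mollification at scale at most 1.\<close>

lemma cutoff_error_small:
  fixes E :: "(real^'n::finite) set" and C :: real
  assumes E [measurable]: "E \<in> sets borel" and H: "(\<integral>\<^sup>+x\<in>E. ennreal (1 / (1 + norm x)) \<partial>lborel) < \<infinity>"
    and t: "\<tau> > 0" and C: "C > 0"
  shows "\<exists>r0. \<forall>r\<ge>r0. (\<integral>\<^sup>+y\<in>E. ennreal (C / r) * indicator {y. r - 1 \<le> norm y \<and> norm y \<le> 2 * r + 1} y \<partial>lborel) \<le> ennreal \<tau>"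
proof -
  define f where "f x = ennreal (1 / (1 + norm x)) * indicator E x" for x :: "real^'n"
  have fm [measurable]: "f \<in> borel_measurable borel" unfolding f_def by measurable
  have "\<exists>r0. \<forall>r\<ge>r0. emeasure (density lborel f) {x. r \<le> norm x} \<le> ennreal (\<tau> / (4 * C))"
  proof (rule finite_measure_tail)
    show "emeasure (density lborel f) (space (density lborel f)) < \<infinity>"
      using H by (simp add: emeasure_density f_def)
  qed (use t C in auto)
  then obtain r0 where r0: "\<And>r. r \<ge> r0 \<Longrightarrow> emeasure (density lborel f) {x. r \<le> norm x} \<le> ennreal (\<tau> / (4 * C))" by blast
  have "(\<integral>\<^sup>+y\<in>E. ennreal (C / r) * indicator {y. r - 1 \<le> norm y \<and> norm y \<le> 2 * r + 1} y \<partial>lborel) \<le> ennreal \<tau>"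
    if r: "r \<ge> max 1 (r0 + 1)" for r
  proof -
    have cl: "{x::real^'n. r - 1 \<le> norm x} \<in> sets borel" by (intro borel_closed closed_Collect_le continuous_intros)
    have "(\<integral>\<^sup>+y\<in>E. ennreal (C / r) * indicator {y. r - 1 \<le> norm y \<and> norm y \<le> 2 * r + 1} y \<partial>lborel)
        \<le> (\<integral>\<^sup>+y. ennreal (4 * C) * (f y * indicator {x. r - 1 \<le> norm x} y) \<partial>lborel)"
    proof (rule nn_integral_mono)
      fix y :: "real^'n"
      show "ennreal (C / r) * indicator {y. r - 1 \<le> norm y \<and> norm y \<le> 2 * r + 1} y * indicator E y
          \<le> ennreal (4 * C) * (f y * indicator {x. r - 1 \<le> norm x} y)"
      proof (cases "y \<in> E \<and> r - 1 \<le> norm y \<and> norm y \<le> 2 * r + 1")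
        case True
        have "C / r \<le> 4 * C * (1 / (1 + norm y))"
        proof -
          have "1 + norm y \<le> 4 * r" using True r by simp
          moreover have "1 + norm y > 0" by (simp add: add_pos_nonneg)
          ultimately have "C * (1 + norm y) \<le> C * (4 * r)" using C by (intro mult_left_mono) auto
          then show ?thesis using r \<open>1 + norm y > 0\<close> by (simp add: field_simps)
        qed
        then have "ennreal (C / r) \<le> ennreal (4 * C * (1 / (1 + norm y)))" by (rule ennreal_leI)
        also have "\<dots> = ennreal (4 * C) * ennreal (1 / (1 + norm y))" using C by (intro ennreal_mult) auto
        finally show ?thesis using True by (simp add: f_def)
      qed (auto simp: indicator_def)
    qed
    also have "\<dots> = ennreal (4 * C) * emeasure (density lborel f) {x. r - 1 \<le> norm x}"
      using cl by (simp add: nn_integral_cmult emeasure_density)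
    also have "\<dots> \<le> ennreal (4 * C) * ennreal (\<tau> / (4 * C))" using r0[of "r - 1"] r by (intro mult_left_mono) auto
    also have "\<dots> = ennreal \<tau>" using C t by (simp flip: ennreal_mult')
    finally show ?thesis .
  qed
  then show ?thesis by blast
qed

text \<open>What is needed of a C^1 stand-in for the indicator of \<open>E\<close>: nearly the right
  total variation, superlevel sets at 1 - \<delta> that fill \<open>E0\<close> up to \<delta> inside
  every Borel set, so that one \<open>w\<close> serves all slabs, and little mass outside
  \<open>E\<close>. The part \<open>E0\<close> has finite volume, since that of \<open>E\<close> is
  at first unknown.\<close>

definition perimeter_approximant ::
  "(real^'n::finite) set \<Rightarrow> (real^'n) set \<Rightarrow> real \<Rightarrow> real \<Rightarrow> (real^'n \<Rightarrow> real) \<Rightarrow> (real^'n \<Rightarrow> real^'n) \<Rightarrow> real \<Rightarrow> bool" where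
  "perimeter_approximant E E0 P \<delta> w w' R \<longleftrightarrow> C1_gradient w w' \<and> (\<forall>x. 0 \<le> w x \<and> w x \<le> 1) \<and> (\<forall>x. R \<le> norm x \<longrightarrow> w x = 0) \<and>
    integrable lborel (\<lambda>x. norm (w' x)) \<and> (LINT x|lborel. norm (w' x)) \<le> P + \<delta> \<and>
    (\<forall>S\<in>sets borel. measure lebesgue (E0 \<inter> S) - \<delta> \<le> measure lebesgue ({x. 1 - \<delta> < w x} \<inter> S)) \<and>
    (emeasure lborel E < \<infinity> \<longrightarrow> (\<integral>\<^sup>+x\<in>- E. ennreal (w x) \<partial>lborel) \<le> ennreal \<delta>)"

lemma perimeter_approximantD:
  assumes "perimeter_approximant E E0 P \<delta> w w' R"
  shows "C1_gradient w w'" "0 \<le> w x" "w x \<le> 1" "R \<le> norm x \<Longrightarrow> w x = 0"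
    "integrable lborel (\<lambda>x. norm (w' x))" "(LINT x|lborel. norm (w' x)) \<le> P + \<delta>"
    "S \<in> sets borel \<Longrightarrow> measure lebesgue (E0 \<inter> S) - \<delta> \<le> measure lebesgue ({x. 1 - \<delta> < w x} \<inter> S)"
    "emeasure lborel E < \<infinity> \<Longrightarrow> (\<integral>\<^sup>+x\<in>- E. ennreal (w x) \<partial>lborel) \<le> ennreal \<delta>"
  using assms unfolding perimeter_approximant_def by auto

text \<open>The integrability hypothesis makes the truncation error vanish even when \<^term>\<open>E\<close> has infinite measure.\<close>

lemma perimeter_approx:
  fixes E E0 :: "(real^'n::finite) set"
  assumes E: "E \<in> sets borel" and P: "perimeter_le E P"
    and H: "(\<integral>\<^sup>+x\<in>E. ennreal (1 / (1 + norm x)) \<partial>lborel) < \<infinity>"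
    and E0: "E0 \<in> sets borel" "E0 \<subseteq> E" "emeasure lborel E0 < \<infinity>" and d: "0 < \<delta>" "\<delta> < 1"
  shows "\<exists>w w' R. perimeter_approximant E E0 P \<delta> w w' R"
proof -
  \<comment> \<open>Two errors of size \<tau>, from mollification and from truncation, add up to
    \<delta>^2; Chebyshev at level 1 - \<delta> then leaves volume at most \<delta>.\<close>
  define \<tau> where "\<tau> = \<delta>\<^sup>2 / 2"
  have \<tau>: "\<tau> > 0" "\<tau> \<le> \<delta>" using d by (auto simp: \<tau>_def power2_eq_square mult_left_le)
  note E [measurable] E0(1) [measurable]
  obtain e0 where e0: "e0 > 0" "\<And>z. norm z < e0 \<Longrightarrow> emeasure lborel {x\<in>E0. x - z \<notin> E0} \<le> ennreal \<tau>"
    using emeasure_diff_translate_small[OF E0(1,3) \<tau>(1)] by auto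
  obtain e1 where e1: "e1 > 0" "\<And>z. emeasure lborel E < \<infinity> \<Longrightarrow> norm z < e1 \<Longrightarrow> emeasure lborel {x\<in>E. x - z \<notin> E} \<le> ennreal \<tau>"
  proof (cases "emeasure lborel E < \<infinity>")
    case True
    from emeasure_diff_translate_small[OF E True \<tau>(1)] show ?thesis using that by auto
  qed (use that[of 1] in auto)
  define e where "e = min 1 (min e0 e1)"
  have e: "e > 0" "e \<le> 1" "e \<le> e0" "e \<le> e1" using e0 e1 by (auto simp: e_def)
  obtain k k' :: "real^'n \<Rightarrow> _" where "C1_gradient k k' \<and> (\<forall>x. 0 \<le> k x) \<and> (\<forall>x. k (- x) = k x) \<and> (\<forall>x. k' (- x) = - k' x) \<and>
    (\<forall>x. e \<le> norm x \<longrightarrow> k x = 0 \<and> k' x = 0) \<and> integrable lborel k \<and> (LINT x|lborel. k x) = 1"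
    using mollifier_exists[OF e(1), where 'a="real^'n"] by auto
  then have k: "C1_gradient k k'" "\<And>z. e \<le> norm z \<Longrightarrow> k z = 0 \<and> k' z = 0" "e > 0" "\<And>z. 0 \<le> k z" "\<And>z. k (- z) = k z"
    "\<And>z. k' (- z) = - k' z" "integrable lborel k" "(LINT z|lborel. k z) = 1" "E \<in> sets borel"
    using e E by auto
  define u where "u = mollified k E"
  define u' where "u' = mollified' k' E"
  have u: "C1_gradient u u'" unfolding u_def u'_def by (rule C1_gradient_mollified[OF k])
  have um [measurable]: "u \<in> borel_measurable borel" by (rule C1_gradientD(4)[OF u])
  have km [measurable]: "k \<in> borel_measurable borel" by (rule C1_gradientD(4)[OF k(1)])
  have u01: "0 \<le> u x" "u x \<le> 1" for x using mollified_bounds[OF k, of x] by (auto simp: u_def)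
  obtain C where C: "C > 0" "\<And>r x. r > 0 \<Longrightarrow> norm (cutoff' r (x::real^'n)) \<le> C / r"
    using cutoff'_bound[where 'a="real^'n"] by auto
  obtain r1 where r1: "\<And>r. r \<ge> r1 \<Longrightarrow> (\<integral>\<^sup>+y\<in>E. ennreal (C / r) * indicator {y. r - 1 \<le> norm y \<and> norm y \<le> 2 * r + 1} y \<partial>lborel) \<le> ennreal \<delta>"
    using cutoff_error_small[OF E H d(1) C(1)] by auto
  obtain r2 where r2: "\<And>r. r \<ge> r2 \<Longrightarrow> emeasure (density lborel (indicator E0)) {x. r \<le> norm x} \<le> ennreal \<tau>"
    using finite_measure_tail[of "density lborel (indicator E0)" \<tau>] \<tau> E0 by (auto simp: emeasure_density)
  define r where "r = max 1 (max r1 r2)"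
  have r: "r \<ge> 1" "r > 0" "r \<ge> r1" "r \<ge> r2" by (auto simp: r_def)
  define w where "w x = u x * cutoff r x" for x
  define w' where "w' x = u x *\<^sub>R cutoff' r x + cutoff r x *\<^sub>R u' x" for x
  have w: "C1_gradient w w'" unfolding w_def w'_def by (rule C1_gradient_intros(3)[OF u C1_gradient_cutoff])
  have wm [measurable]: "w \<in> borel_measurable borel" by (rule C1_gradientD(4)[OF w])
  have w01: "0 \<le> w x" "w x \<le> 1" "w x \<le> u x" for x
    using u01[of x] cutoff_simps(1,2)[OF r(2), of x] by (auto simp: w_def mult_le_one mult_left_le)
  have wR: "w x = 0" "w' x = 0" if "2 * r \<le> norm x" for x
    using cutoff_simps(4,6)[OF r(2) that] by (auto simp: w_def w'_def)
  have c_cut: "continuous_on UNIV (cutoff r :: real^'n \<Rightarrow> real)" "continuous_on UNIV (cutoff' r :: real^'n \<Rightarrow> _)"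
    using C1_gradientD[OF C1_gradient_cutoff] by auto
  have cu: "continuous_on UNIV u" "continuous_on UNIV u'" using C1_gradientD[OF u] by auto
  have i1: "integrable lborel (\<lambda>x. norm (w' x))"
    by (rule integrable_continuous_bounded_support[of _ "2 * r"]) (use C1_gradientD(2)[OF w] wR in \<open>auto intro!: continuous_intros\<close>)
  have i2: "integrable lborel (\<lambda>x. cutoff r x * norm (u' x))"
    by (rule integrable_continuous_bounded_support[of _ "2 * r"]) (use cu c_cut cutoff_simps(4)[OF r(2)] in \<open>auto intro!: continuous_intros\<close>)
  have i3: "integrable lborel (\<lambda>x. u x * norm (cutoff' r x))"
    by (rule integrable_continuous_bounded_support[of _ "2 * r"]) (use cu c_cut cutoff_simps(6)[OF r(2)] in \<open>auto intro!: continuous_intros\<close>)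
  have "(LINT x|lborel. norm (w' x)) \<le> (LINT x|lborel. u x * norm (cutoff' r x) + cutoff r x * norm (u' x))"
  proof (rule integral_mono[OF i1 Bochner_Integration.integrable_add[OF i3 i2]])
    fix x
    have "norm (w' x) \<le> norm (u x *\<^sub>R cutoff' r x) + norm (cutoff r x *\<^sub>R u' x)" unfolding w'_def by (rule norm_triangle_ineq)
    then show "norm (w' x) \<le> u x * norm (cutoff' r x) + cutoff r x * norm (u' x)"
      using u01[of x] cutoff_simps(1)[OF r(2), of x] by simp
  qed
  also have "\<dots> = (LINT x|lborel. u x * norm (cutoff' r x)) + (LINT x|lborel. cutoff r x * norm (u' x))"
    by (rule Bochner_Integration.integral_add[OF i3 i2])
  also have "(LINT x|lborel. cutoff r x * norm (u' x)) \<le> P"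
    unfolding u'_def
    by (rule mollified_variation[OF k P c_cut(1), of "2 * r"]) (use cutoff_simps[OF r(2)] in auto)
  \<comment> \<open>Moving the mollification from \<open>u\<close> to the annulus leaves an integral
    over \<open>E\<close>, to which \<open>cutoff_error_small\<close> applies.\<close>
  also have "(LINT x|lborel. u x * norm (cutoff' r x)) \<le> \<delta>"
  proof -
    define W where "W x = ennreal (C / r) * indicator {x. r \<le> norm x \<and> norm x \<le> 2 * r} x" for x :: "real^'n"
    have "closed {x::real^'n. r \<le> norm x \<and> norm x \<le> 2 * r}"
      by (intro closed_Collect_conj closed_Collect_le continuous_intros)
    then have Wm [measurable]: "W \<in> borel_measurable borel" unfolding W_def by (intro borel_measurable_times_ennreal) auto
    have "ennreal (LINT x|lborel. u x * norm (cutoff' r x)) = (\<integral>\<^sup>+x. ennreal (u x * norm (cutoff' r x)) \<partial>lborel)"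
      using i3 u01 by (intro nn_integral_eq_integral[symmetric]) auto
    also have "\<dots> \<le> (\<integral>\<^sup>+x. ennreal (u x) * W x \<partial>lborel)"
    proof (rule nn_integral_mono)
      fix x :: "real^'n"
      show "ennreal (u x * norm (cutoff' r x)) \<le> ennreal (u x) * W x"
      proof (cases "r \<le> norm x \<and> norm x \<le> 2 * r")
        case True
        have "ennreal (norm (cutoff' r x)) \<le> ennreal (C / r)" using C(2)[OF r(2)] by (intro ennreal_leI)
        then show ?thesis using True u01[of x] by (simp add: W_def ennreal_mult mult_left_mono)
      next
        case False
        then have "cutoff' r x = 0" using cutoff_simps(5,6)[OF r(2), of x] by (cases "norm x \<le> r") auto
        then show ?thesis by simp
      qed
    qed
    also have "\<dots> = (\<integral>\<^sup>+y\<in>E. (\<integral>\<^sup>+x. ennreal (k (x - y)) * W x \<partial>lborel) \<partial>lborel)"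
      unfolding u_def by (rule nn_integral_mollified[OF k Wm])
    also have "\<dots> \<le> (\<integral>\<^sup>+y\<in>E. ennreal (C / r) * indicator {y. r - 1 \<le> norm y \<and> norm y \<le> 2 * r + 1} y \<partial>lborel)"
    proof (intro nn_integral_mono mult_right_mono)
      fix y :: "real^'n"
      have "ennreal (k (x - y)) * W x \<le> ennreal (k (y - x)) * (ennreal (C / r) * indicator {y. r - 1 \<le> norm y \<and> norm y \<le> 2 * r + 1} y)" for x
      proof (cases "norm (x - y) < e \<and> r \<le> norm x \<and> norm x \<le> 2 * r")
        case True
        then have "r - 1 \<le> norm y" "norm y \<le> 2 * r + 1"
          using e(2) norm_triangle_ineq2[of x y] norm_triangle_ineq2[of y x] by (auto simp: norm_minus_commute)
        then show ?thesis using True k(5)[of "x - y"] by (simp add: W_def)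
      next
        case False
        then show ?thesis using k(2)[of "x - y"] by (cases "e \<le> norm (x - y)") (auto simp: W_def)
      qed
      then have "(\<integral>\<^sup>+x. ennreal (k (x - y)) * W x \<partial>lborel)
          \<le> (\<integral>\<^sup>+x. ennreal (k (y - x)) * (ennreal (C / r) * indicator {y. r - 1 \<le> norm y \<and> norm y \<le> 2 * r + 1} y) \<partial>lborel)"
        by (rule nn_integral_mono)
      also have "\<dots> = (ennreal (C / r) * indicator {y. r - 1 \<le> norm y \<and> norm y \<le> 2 * r + 1} y)"
        using kernel_shift(3)[OF k, of y] by (subst nn_integral_multc) auto
      finally show "(\<integral>\<^sup>+x. ennreal (k (x - y)) * W x \<partial>lborel) \<le> ennreal (C / r) * indicator {y. r - 1 \<le> norm y \<and> norm y \<le> 2 * r + 1} y" .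
    qed auto
    also have "\<dots> \<le> ennreal \<delta>" by (rule r1[OF r(3)])
    finally show ?thesis using d by (simp add: ennreal_le_iff)
  qed
  finally have var: "(LINT x|lborel. norm (w' x)) \<le> P + \<delta>" by simp
  have defect: "(\<integral>\<^sup>+x\<in>E0. ennreal (1 - w x) \<partial>lborel) \<le> ennreal (\<delta>\<^sup>2)"
  proof -
    have cl: "{x::real^'n. r \<le> norm x} \<in> sets borel" by (intro borel_closed closed_Collect_le continuous_intros)
    have "(\<integral>\<^sup>+x\<in>E0. ennreal (1 - w x) \<partial>lborel) \<le> (\<integral>\<^sup>+x. ennreal (1 - u x) * indicator E0 x + indicator E0 x * indicator {x. r \<le> norm x} x \<partial>lborel)"
    proof (rule nn_integral_mono)
      fix x :: "real^'n"
      have "ennreal (1 - w x) \<le> ennreal (1 - u x) + indicator {x. r \<le> norm x} x"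
      proof (cases "r \<le> norm x")
        case True
        have "ennreal (1 - w x) \<le> ennreal 1" using w01[of x] by (intro ennreal_leI) auto
        then show ?thesis using True by (simp add: add_increasing)
      next
        case False
        then show ?thesis using cutoff_simps(3)[OF r(2), of x] by (simp add: w_def)
      qed
      then show "ennreal (1 - w x) * indicator E0 x \<le> ennreal (1 - u x) * indicator E0 x + indicator E0 x * indicator {x. r \<le> norm x} x"
        by (auto simp: indicator_def)
    qed
    also have "\<dots> = (\<integral>\<^sup>+x\<in>E0. ennreal (1 - u x) \<partial>lborel) + emeasure (density lborel (indicator E0)) {x. r \<le> norm x}"
      using cl by (subst nn_integral_add) (auto simp: emeasure_density)
    also have "\<dots> \<le> ennreal \<tau> + ennreal \<tau>"
    proof (intro add_mono)
      show "(\<integral>\<^sup>+x\<in>E0. ennreal (1 - u x) \<partial>lborel) \<le> ennreal \<tau>"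
        unfolding u_def by (rule mollified_defect[OF k E0(1,2)]) (use e0 e in auto)
    qed (rule r2[OF r(4)])
    also have "\<dots> = ennreal (\<delta>\<^sup>2)" using \<tau> by (simp flip: ennreal_plus) (simp add: \<tau>_def)
    finally show ?thesis .
  qed
  have level: "measure lebesgue (E0 \<inter> S) - \<delta> \<le> measure lebesgue ({x. 1 - \<delta> < w x} \<inter> S)" if S [measurable]: "S \<in> sets borel" for S
  proof -
    let ?B = "{x\<in>E0. w x \<le> 1 - \<delta>}" and ?L = "{x. 1 - \<delta> < w x}"
    have Bm: "?B \<in> sets borel" and Lm: "?L \<in> sets borel" by measurable
    have Lb: "?L \<subseteq> ball 0 (2 * r)"
    proof
      fix x assume "x \<in> ?L"
      then have "w x \<noteq> 0" using d by auto
      then show "x \<in> ball 0 (2 * r)" using wR[of x] by (auto simp: not_le[symmetric])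
    qed
    have Lf: "?L \<inter> S \<in> lmeasurable"
      by (rule fmeasurableI2[OF lmeasurable_ball[of 0 "2 * r"]]) (use Lb Lm S in auto)
    have E0f: "E0 \<in> lmeasurable" using E0 by (simp add: fmeasurable_def)
    have Bf: "?B \<in> lmeasurable" by (rule fmeasurableI2[OF E0f]) (use Bm in auto)
    have "ennreal \<delta> * emeasure lborel ?B = (\<integral>\<^sup>+x. ennreal \<delta> * indicator ?B x \<partial>lborel)"
      using Bm by (simp add: nn_integral_cmult)
    also have "\<dots> \<le> (\<integral>\<^sup>+x\<in>E0. ennreal (1 - w x) \<partial>lborel)"
      by (intro nn_integral_mono) (auto simp: indicator_def intro: ennreal_leI)
    also note defect
    finally have "ennreal \<delta> * ennreal (measure lebesgue ?B) \<le> ennreal (\<delta>\<^sup>2)"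
      using emeasure_eq_measure2[OF Bf] Bm by simp
    then have "\<delta> * measure lebesgue ?B \<le> \<delta> * \<delta>" using d by (simp add: power2_eq_square flip: ennreal_mult')
    then have B: "measure lebesgue ?B \<le> \<delta>" using d by simp
    have "measure lebesgue (E0 \<inter> S) \<le> measure lebesgue ((?L \<inter> S) \<union> ?B)"
      using Lf Bf S by (intro measure_mono_fmeasurable) auto
    also have "\<dots> \<le> measure lebesgue (?L \<inter> S) + measure lebesgue ?B"
      using Lf Bf by (intro measure_Un_le) auto
    finally show ?thesis using B by simp
  qed
  have outer: "(\<integral>\<^sup>+x\<in>- E. ennreal (w x) \<partial>lborel) \<le> ennreal \<delta>" if fin: "emeasure lborel E < \<infinity>"
  proof -
    have "(\<integral>\<^sup>+x\<in>- E. ennreal (w x) \<partial>lborel) \<le> (\<integral>\<^sup>+x. ennreal (u x) * indicator (- E) x \<partial>lborel)"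
      using w01 by (intro nn_integral_mono mult_right_mono ennreal_leI) auto
    also have "\<dots> = (\<integral>\<^sup>+y\<in>E. (\<integral>\<^sup>+x. ennreal (k (x - y)) * indicator (- E) x \<partial>lborel) \<partial>lborel)"
      unfolding u_def by (rule nn_integral_mollified[OF k]) measurable
    \<comment> \<open>The kernel is even, so the mass pushed out of \<open>E\<close> equals the mass
      missing inside, and \<open>mollified_defect\<close> applies with \<open>E\<close> itself as
      the subset.\<close>
    also have "\<dots> = (\<integral>\<^sup>+y\<in>E. ennreal (1 - u y) \<partial>lborel)"
    proof (intro nn_integral_cong arg_cong2[where f="(*)"] refl)
      fix y :: "real^'n"
      have "(\<integral>\<^sup>+x. ennreal (k (x - y)) * indicator (- E) x \<partial>lborel) = (\<integral>\<^sup>+x. ennreal (k (y - x)) * indicator (- E) x \<partial>lborel)"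
        using k(5)[of "_ - y"] by simp
      then show "(\<integral>\<^sup>+x. ennreal (k (x - y)) * indicator (- E) x \<partial>lborel) = ennreal (1 - u y)"
        using nn_mollified_Compl[OF k, of y] by (simp add: u_def)
    qed
    also have "\<dots> \<le> ennreal \<tau>"
      unfolding u_def by (rule mollified_defect[OF k E]) (use e1 e fin in auto)
    also have "\<dots> \<le> ennreal \<delta>" using \<tau> by (intro ennreal_leI)
    finally show ?thesis .
  qed
  show ?thesis
    unfolding perimeter_approximant_def using w w01(1,2) wR(1) i1 var level outer by blast
qed

text \<open>Take the unit ball as \<open>K\<close> in \<open>wulff_inequality\<close>, so that
  \<open>g\<close> is the length of the gradient, and let \<delta> tend to 0. The volume on the left
  is that of a finite part \<open>E0\<close>, so that the inequality can be used to prove that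
  \<open>E\<close> is finite.\<close>

theorem isoperimetric_perimeter_le:
  fixes E E0 :: "(real^'n::finite) set"
  assumes N: "CARD('n) \<ge> 2" and E: "E \<in> sets borel" and P: "perimeter_le E P"
    and H: "(\<integral>\<^sup>+x\<in>E. ennreal (1 / (1 + norm x)) \<partial>lborel) < \<infinity>"
    and E0: "E0 \<in> sets borel" "E0 \<subseteq> E" "emeasure lborel E0 < \<infinity>"
  shows "CARD('n) * root CARD('n) (measure lebesgue (ball (0::real^'n) 1)) * root CARD('n) (measure lebesgue E0) ^ (CARD('n) - 1) \<le> P"
proof -
  let ?n = "CARD('n)" and ?\<omega> = "measure lebesgue (ball (0::real^'n) 1)"
  let ?f = "\<lambda>\<delta>::real. (1 - \<delta>) * ?n * root ?n ?\<omega> * root ?n (measure lebesgue E0 - \<delta>) ^ (?n - 1)"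
  have ineq: "?f \<delta> \<le> P + \<delta>" if d: "0 < \<delta>" "\<delta> < 1" "\<delta> < measure lebesgue E0" for \<delta>
  proof -
    obtain w w' R where "perimeter_approximant E E0 P \<delta> w w' R"
      using perimeter_approx[OF E P H E0 d(1,2)] by blast
    note w = perimeter_approximantD[OF this]
    have "(1 - \<delta>) * DIM(real^'n) * root DIM(real^'n) ?\<omega> * root DIM(real^'n) (measure lebesgue {x. 1 - \<delta> < w x}) ^ (DIM(real^'n) - 1)
        \<le> (LINT x|lborel. norm (w' x))"
    proof (rule wulff_inequality[OF _ w(1,2,4) _ _ _ w(5)])
      show "- (w' x \<bullet> y) \<le> norm (w' x)" if "y \<in> ball 0 1" for x y
      proof -
        have "\<bar>w' x \<bullet> y\<bar> \<le> norm (w' x) * norm y" by (rule Cauchy_Schwarz_ineq2)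
        also have "\<dots> \<le> norm (w' x)" using that by (simp add: mult_left_le)
        finally show ?thesis by simp
      qed
    qed (use N d in auto)
    moreover have "?f \<delta> \<le> (1 - \<delta>) * ?n * root ?n ?\<omega> * root ?n (measure lebesgue {x. 1 - \<delta> < w x}) ^ (?n - 1)"
      using d w(7)[of UNIV] N by (intro mult_left_mono power_mono real_root_le_mono) auto
    ultimately show ?thesis using w(6) by simp
  qed
  have P0: "0 \<le> P"
    using P unfolding perimeter_le_def
  proof (drule_tac bspec)
    show "(\<lambda>x. 0 :: real^'n) \<in> C1_compact_support"
      by (rule C1_compact_supportI[where D="\<lambda>_ _. 0" and R=0]) auto
    show "(\<forall>x. norm (0::real^'n) \<le> 1) \<longrightarrow> (LINT x|lborel. indicator E x * divergence (\<lambda>x. 0) x) \<le> P \<Longrightarrow> 0 \<le> P"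
      by (subst (asm) divergence_eq[where D="\<lambda>_. 0"]) auto
  qed
  show ?thesis
  proof (cases "measure lebesgue E0 > 0")
    case True
    have "(?f \<longlongrightarrow> (1 - 0 :: real) * ?n * root ?n ?\<omega> * root ?n (measure lebesgue E0 - 0) ^ (?n - 1)) (at_right 0)"
      by (intro tendsto_intros)
    moreover have "((\<lambda>\<delta>. P + \<delta>) \<longlongrightarrow> P + 0) (at_right 0)" by (intro tendsto_intros)
    moreover have "eventually (\<lambda>\<delta>. ?f \<delta> \<le> P + \<delta>) (at_right 0)"
    proof (rule eventually_mono)
      show "eventually (\<lambda>\<delta>. \<delta> \<in> {0<..<min 1 (measure lebesgue E0)}) (at_right 0)"
        using True by (intro eventually_at_right_real) auto
      show "?f \<delta> \<le> P + \<delta>" if "\<delta> \<in> {0<..<min 1 (measure lebesgue E0)}" for \<delta>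
        by (rule ineq) (use that in auto)
    qed
    ultimately have "(1 - 0 :: real) * ?n * root ?n ?\<omega> * root ?n (measure lebesgue E0 - 0) ^ (?n - 1) \<le> P + 0"
      by (intro tendsto_le[of "at_right (0::real)"]) auto
    then show ?thesis by simp
  next
    case False
    then have "measure lebesgue E0 = 0" by (simp add: antisym not_less)
    moreover have "(0::real) ^ (?n - 1) = 0" using N by (intro zero_power) simp
    ultimately show ?thesis using P0 by (simp only: real_root_zero mult_zero_right)
  qed
qed

section \<open>Equality in the isoperimetric inequality\<close>

definition cyl :: "'a::euclidean_space \<Rightarrow> real \<Rightarrow> real \<Rightarrow> real \<Rightarrow> 'a set" where
  "cyl e a h r = {z. a < z \<bullet> e \<and> z \<bullet> e < a + h \<and> norm (z - (z \<bullet> e) *\<^sub>R e) < r}"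

text \<open>Equals the volume of the unit ball in dimension N - 1; a cylinder of height 1 expresses
  it by N-dimensional Lebesgue measure.\<close>

definition unit_cyl_vol :: "'a::euclidean_space \<Rightarrow> real" where
  "unit_cyl_vol e = measure lebesgue (cyl e 0 1 1)"

lemma norm_orthogonal_part:
  assumes "e \<in> Basis"
  shows "(norm (z - (z \<bullet> e) *\<^sub>R e))\<^sup>2 = (norm z)\<^sup>2 - (z \<bullet> e)\<^sup>2"
  unfolding power2_norm_eq_inner
  using assms by (simp add: inner_diff_left inner_diff_right inner_commute power2_eq_square)

lemma open_cyl: "open (cyl e a h r)"
  unfolding cyl_def by (intro open_Collect_conj open_Collect_less continuous_intros)

lemma bounded_cyl:
  assumes e: "e \<in> Basis" shows "bounded (cyl e a h r)"
proof -
  have "norm z \<le> r + (\<bar>a\<bar> + \<bar>a + h\<bar>)" if "z \<in> cyl e a h r" for z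
  proof -
    have "norm z \<le> norm (z - (z \<bullet> e) *\<^sub>R e) + norm ((z \<bullet> e) *\<^sub>R e)"
      using norm_triangle_ineq[of "z - (z \<bullet> e) *\<^sub>R e" "(z \<bullet> e) *\<^sub>R e"] by simp
    moreover have "\<bar>z \<bullet> e\<bar> \<le> \<bar>a\<bar> + \<bar>a + h\<bar>" using that unfolding cyl_def by auto
    ultimately show ?thesis using that e by (auto simp: cyl_def)
  qed
  then show ?thesis unfolding bounded_iff by blast
qed

text \<open>The affine map that scales by \<open>h\<close> along \<open>e\<close> and by
  \<open>r\<close> across it carries the unit cylinder to this one.\<close>

lemma measure_cyl:
  fixes e :: "'a::euclidean_space"
  assumes e: "e \<in> Basis" and h: "h > 0" and r: "r > 0"
  shows "measure lebesgue (cyl e a h r) = h * r ^ (DIM('a) - 1) * unit_cyl_vol e"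
proof -
  define c where "c j = (if j = e then h else r)" for j
  define T where "T x = a *\<^sub>R e + (\<Sum>j\<in>Basis. (c j * (x \<bullet> j)) *\<^sub>R j)" for x
  have aff: "lborel = density (distr lborel borel T) (\<lambda>_. ennreal (\<Prod>j\<in>Basis. \<bar>c j\<bar>))"
    unfolding T_def[abs_def]
    by (subst lborel_affine_euclidean[of c "a *\<^sub>R e"]) (use h r in \<open>auto simp: c_def prod_ennreal\<close>)
  have T: "T x = a *\<^sub>R e + r *\<^sub>R x + ((h - r) * (x \<bullet> e)) *\<^sub>R e" for x
  proof (rule euclidean_eqI)
    fix j :: 'a assume j: "j \<in> Basis"
    then show "T x \<bullet> j = (a *\<^sub>R e + r *\<^sub>R x + ((h - r) * (x \<bullet> e)) *\<^sub>R e) \<bullet> j"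
      using e by (auto simp: T_def c_def inner_add_left inner_Basis algebra_simps)
  qed
  have Te: "T x \<bullet> e = a + h * (x \<bullet> e)" for x using e by (simp add: T inner_add_left algebra_simps)
  have Tn: "norm (T x - (a + h * (x \<bullet> e)) *\<^sub>R e) = r * norm (x - (x \<bullet> e) *\<^sub>R e)" for x
  proof -
    have "T x - (a + h * (x \<bullet> e)) *\<^sub>R e = r *\<^sub>R (x - (x \<bullet> e) *\<^sub>R e)"
      by (simp add: T algebra_simps)
    then show ?thesis using r by simp
  qed
  have pre: "T -` cyl e a h r = cyl e 0 1 1"
    using h r by (auto simp: cyl_def Te Tn zero_less_mult_iff)
  have Tm: "T \<in> borel_measurable borel"
    unfolding T_def[abs_def] by (intro borel_measurable_continuous_onI continuous_intros)
  have pr: "(\<Prod>j\<in>Basis. \<bar>c j\<bar>) = h * r ^ (DIM('a) - 1)"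
  proof -
    have "(\<Prod>j\<in>Basis. \<bar>c j\<bar>) = \<bar>c e\<bar> * (\<Prod>j\<in>Basis - {e}. \<bar>c j\<bar>)" using e by (intro prod.remove) auto
    also have "(\<Prod>j\<in>Basis - {e}. \<bar>c j\<bar>) = (\<Prod>j\<in>Basis - {e}. r)" using r by (intro prod.cong) (auto simp: c_def)
    finally show ?thesis using h e by (simp add: c_def)
  qed
  have "emeasure lborel (cyl e a h r) = emeasure (density (distr lborel borel T) (\<lambda>_. ennreal (\<Prod>j\<in>Basis. \<bar>c j\<bar>))) (cyl e a h r)"
    using arg_cong[OF aff, of "\<lambda>M. emeasure M (cyl e a h r)"] .
  also have "\<dots> = ennreal (h * r ^ (DIM('a) - 1)) * emeasure lborel (cyl e 0 1 1)"
    using Tm open_cyl[of e a h r] by (simp add: pr emeasure_density nn_integral_cmult_indicator emeasure_distr pre)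
  finally have "ennreal (measure lebesgue (cyl e a h r)) = ennreal (h * r ^ (DIM('a) - 1) * unit_cyl_vol e)"
    using emeasure_lborel_eq_measure_lebesgue[OF borel_open[OF open_cyl] bounded_cyl[OF e], of a h r]
      emeasure_lborel_eq_measure_lebesgue[OF borel_open[OF open_cyl] bounded_cyl[OF e], of 0 1 1] h r
    by (simp add: unit_cyl_vol_def ennreal_mult)
  then show ?thesis using h r by (subst (asm) ennreal_inj) (auto simp: unit_cyl_vol_def)
qed

lemma measure_pos_open:
  assumes "open S" "bounded S" "x \<in> S" shows "measure lebesgue (S :: 'a::euclidean_space set) > 0"
  using assms lmeasurable_open[OF assms(2,1)]
  by (metis negligible_iff_measure open_not_negligible order_less_le measure_nonneg empty_iff)

lemma unit_cyl_vol_pos: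
  fixes e :: "'a::euclidean_space"
  assumes e: "e \<in> Basis" shows "unit_cyl_vol e > 0"
  unfolding unit_cyl_vol_def
  by (rule measure_pos_open[OF open_cyl bounded_cyl[OF e], of "(1/2) *\<^sub>R e"]) (use e in \<open>auto simp: cyl_def\<close>)

text \<open>The (N - 1)-dimensional volume of the section of the ball of radius \<rho> at height
  \<open>s\<close>.\<close>

definition section_area :: "'a::euclidean_space \<Rightarrow> real \<Rightarrow> real \<Rightarrow> real" where
  "section_area e \<rho> s = unit_cyl_vol e * sqrt (\<rho>\<^sup>2 - s\<^sup>2) ^ (DIM('a) - 1)"

definition slab :: "'a::euclidean_space \<Rightarrow> real \<Rightarrow> real \<Rightarrow> 'a set" where
  "slab e s t = {y. s < y \<bullet> e \<and> y \<bullet> e < t}"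

lemma open_slab: "open (slab e s t)"
  unfolding slab_def by (intro open_Collect_conj open_Collect_less continuous_intros)

lemma measure_ball_slab_le:
  fixes e :: "'a::euclidean_space"
  assumes e: "e \<in> Basis" and s: "s < t" and R: "R > 0" "\<And>u. s < u \<Longrightarrow> u < t \<Longrightarrow> \<rho>\<^sup>2 - u\<^sup>2 \<le> R\<^sup>2"
  shows "measure lebesgue (ball 0 \<rho> \<inter> slab e s t) \<le> (t - s) * (unit_cyl_vol e * R ^ (DIM('a) - 1))"
proof -
  have "ball 0 \<rho> \<inter> slab e s t \<subseteq> cyl e s (t - s) R"
  proof
    fix y assume y: "y \<in> ball 0 \<rho> \<inter> slab e s t"
    have "(norm y)\<^sup>2 < \<rho>\<^sup>2" using y by (intro power_strict_mono) auto
    then have "(norm (y - (y \<bullet> e) *\<^sub>R e))\<^sup>2 < R\<^sup>2"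
      unfolding norm_orthogonal_part[OF e] using R(2)[of "y \<bullet> e"] y by (auto simp: slab_def)
    then have "norm (y - (y \<bullet> e) *\<^sub>R e) < R" using R(1) by (simp add: power2_less_imp_less)
    then show "y \<in> cyl e s (t - s) R" using y by (simp add: cyl_def slab_def)
  qed
  then have "measure lebesgue (ball 0 \<rho> \<inter> slab e s t) \<le> measure lebesgue (cyl e s (t - s) R)"
    by (intro measure_mono_fmeasurable lmeasurable_open bounded_cyl e open_cyl) (auto intro!: borel_open simp: open_slab)
  then show ?thesis using measure_cyl[OF e, of "t - s" R s] s R by (simp add: mult_ac)
qed

text \<open>Cut the slab of the ball at height \<open>s\<close> and move its halves apart by
  \<open>h\<close> along \<open>e\<close>. The halves stay in \<open>K\<close>, and the gap takes a
  cylinder of height \<open>h\<close> over the section at \<open>s\<close>; the three pieces are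
  disjoint.\<close>

lemma measure_thickened_slab:
  fixes e :: "'a::euclidean_space"
  assumes e: "e \<in> Basis" and \<rho>: "\<rho> > 0" and s: "s0 < s" "s < s1" "- \<rho> \<le> s0" "s1 \<le> \<rho>" and h: "h > 0"
  defines "B2 \<equiv> ball 0 \<rho> \<inter> slab e s0 s1" and "K \<equiv> minkowski_sum (ball 0 \<rho> \<inter> slab e s0 s1) ((\<lambda>u. u *\<^sub>R e) ` {- h / 2..h / 2})"
  shows "open K" "bounded K" "K \<noteq> {}" "measure lebesgue B2 + h * section_area e \<rho> s \<le> measure lebesgue K"
proof -
  have oB: "open B2" and bB: "bounded B2" unfolding B2_def by (auto simp: open_slab intro: bounded_Int)
  show oK: "open K" unfolding K_def using oB by (intro open_minkowski_sum) (simp add: B2_def)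
  have "compact ((\<lambda>u. u *\<^sub>R e) ` {- h / 2..h / 2})" by (intro compact_continuous_image continuous_intros) auto
  then have bS: "bounded ((\<lambda>u. u *\<^sub>R e) ` {- h / 2..h / 2})" by (rule compact_imp_bounded)
  show bK: "bounded K" using bounded_minkowski_sum[OF bB bS] by (simp add: K_def B2_def)
  have sr: "\<bar>s\<bar> < \<rho>" using s by auto
  have sq: "s\<^sup>2 < \<rho>\<^sup>2" using sr \<rho> abs_le_square_iff[of \<rho> s] by (simp add: not_le[symmetric])
  have "s *\<^sub>R e \<in> B2" using s e sr by (simp add: B2_def slab_def)
  then have "s *\<^sub>R e + 0 *\<^sub>R e \<in> K" unfolding K_def mem_minkowski_sum using h
    by (intro bexI[of _ "s *\<^sub>R e"] bexI[of _ "0 *\<^sub>R e"] imageI) (auto simp: B2_def)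
  then show "K \<noteq> {}" by blast
  have memK: "y + u *\<^sub>R e \<in> K" if "y \<in> B2" "\<bar>u\<bar> \<le> h / 2" for y u
    unfolding K_def mem_minkowski_sum using that
    by (intro bexI[of _ y] bexI[of _ "u *\<^sub>R e"] imageI) (auto simp: B2_def)
  let ?m = "measure lebesgue :: 'a set \<Rightarrow> real"
  define r where "r = sqrt (\<rho>\<^sup>2 - s\<^sup>2)"
  have r: "r > 0" "r\<^sup>2 = \<rho>\<^sup>2 - s\<^sup>2" using sq by (auto simp: r_def)
  have ee: "e \<bullet> e = 1" using e by simp
  define p where "p = (- h / 2) *\<^sub>R e"
  define q where "q = (h / 2) *\<^sub>R e"
  have pq: "p \<bullet> e = - h / 2" "q \<bullet> e = h / 2" by (simp_all add: p_def q_def ee)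
  let ?X = "(\<lambda>y. p + y) ` (B2 \<inter> {y. y \<bullet> e < s})" and ?Y = "(\<lambda>y. q + y) ` (B2 \<inter> {y. s < y \<bullet> e})"
  let ?Z = "cyl e (s - h / 2) h r"
  have B2m: "B2 \<in> lmeasurable" by (rule lmeasurable_open[OF bB oB])
  have lo: "B2 \<inter> {y. y \<bullet> e < s} \<in> lmeasurable" and up: "B2 \<inter> {y. s < y \<bullet> e} \<in> lmeasurable"
    by (auto intro!: fmeasurable_Int_fmeasurable B2m)
  have X: "?X \<in> lmeasurable" "?m ?X = ?m (B2 \<inter> {y. y \<bullet> e < s})"
    using measurable_translation[OF lo] measure_translation[of p "B2 \<inter> {y. y \<bullet> e < s}"] by auto
  have Y: "?Y \<in> lmeasurable" "?m ?Y = ?m (B2 \<inter> {y. s < y \<bullet> e})"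
    using measurable_translation[OF up] measure_translation[of q "B2 \<inter> {y. s < y \<bullet> e}"] by auto
  have Z: "?Z \<in> lmeasurable" "?m ?Z = h * section_area e \<rho> s"
    using lmeasurable_open[OF bounded_cyl[OF e] open_cyl, of "s - h/2" h r] measure_cyl[OF e h r(1), of "s - h / 2"]
    by (auto simp: section_area_def r_def)
  have "p + y \<in> K" "q + y \<in> K" if "y \<in> B2" for y
    using memK[OF that, of "- h / 2"] memK[OF that, of "h / 2"] h by (auto simp: p_def q_def add.commute)
  then have "?X \<subseteq> K" "?Y \<subseteq> K" by auto
  moreover have "?Z \<subseteq> K"
  proof
    fix z assume z: "z \<in> ?Z"
    define y where "y = z - (z \<bullet> e - s) *\<^sub>R e"
    have ye: "y \<bullet> e = s" by (simp add: y_def inner_diff_left ee)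
    have "y - (y \<bullet> e) *\<^sub>R e = z - (z \<bullet> e) *\<^sub>R e" unfolding ye by (simp add: y_def algebra_simps)
    then have "(norm y)\<^sup>2 = (norm (z - (z \<bullet> e) *\<^sub>R e))\<^sup>2 + s\<^sup>2" using norm_orthogonal_part[OF e, of y] by (simp add: ye)
    moreover have "(norm (z - (z \<bullet> e) *\<^sub>R e))\<^sup>2 < r\<^sup>2" using z by (intro power_strict_mono) (auto simp: cyl_def)
    ultimately have "(norm y)\<^sup>2 < \<rho>\<^sup>2" using r(2) by simp
    then have "norm y < \<rho>" using \<rho> by (simp add: power2_less_imp_less)
    then have "y \<in> B2" using ye s by (simp add: B2_def slab_def)
    moreover have "\<bar>z \<bullet> e - s\<bar> \<le> h / 2" 
    proof -
      have "s - h / 2 < z \<bullet> e" "z \<bullet> e < s - h / 2 + h" using z by (auto simp: cyl_def)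
      then show ?thesis by linarith
    qed
    ultimately have "y + (z \<bullet> e - s) *\<^sub>R e \<in> K" by (rule memK)
    then show "z \<in> K" by (simp add: y_def)
  qed
  ultimately have "?m (?X \<union> ?Y \<union> ?Z) \<le> ?m K"
    using X Y Z lmeasurable_open[OF bK oK] by (intro measure_mono_fmeasurable) auto
  moreover have "?m (?X \<union> ?Y \<union> ?Z) = ?m ?X + ?m ?Y + ?m ?Z"
  proof -
    have "x \<bullet> e < s - h / 2" if "x \<in> ?X" for x using that by (auto simp: inner_add_left pq)
    moreover have "s + h / 2 < x \<bullet> e" if "x \<in> ?Y" for x using that by (auto simp: inner_add_left pq)
    moreover have "s - h / 2 < x \<bullet> e \<and> x \<bullet> e < s + h / 2" if "x \<in> ?Z" for x using that by (auto simp: cyl_def)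
    ultimately have "?X \<inter> ?Y = {}" "(?X \<union> ?Y) \<inter> ?Z = {}"
      using h by fastforce+
    then show ?thesis using measure_Un3[OF fmeasurable.Un[OF X(1) Y(1)] Z(1)] measure_Un3[OF X(1) Y(1)] by simp
  qed
  moreover have "?m B2 = ?m (B2 \<inter> {y. y \<bullet> e < s}) + ?m (B2 \<inter> {y. s < y \<bullet> e})"
    by (rule measure_halfspace_split[OF B2m e])
  ultimately show "?m B2 + h * section_area e \<rho> s \<le> ?m K" using X Y Z by simp
qed

lemma measure_halfspace_diff:
  fixes A :: "'a::euclidean_space set"
  assumes A: "A \<in> lmeasurable" and e: "e \<in> Basis" and s: "s \<le> t"
  shows "measure lebesgue (A \<inter> {x. x \<bullet> e < t}) - measure lebesgue (A \<inter> {x. x \<bullet> e < s}) = measure lebesgue (A \<inter> slab e s t)"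
proof -
  have "A \<inter> {x. x \<bullet> e < t} \<in> lmeasurable" by (auto intro!: fmeasurable_Int_fmeasurable A)
  from measure_halfspace_split[OF this e, of s]
  have "measure lebesgue (A \<inter> {x. x \<bullet> e < t}) = measure lebesgue (A \<inter> {x. x \<bullet> e < t} \<inter> {x. x \<bullet> e < s})
    + measure lebesgue (A \<inter> {x. x \<bullet> e < t} \<inter> {x. s < x \<bullet> e})" .
  moreover have "A \<inter> {x. x \<bullet> e < t} \<inter> {x. x \<bullet> e < s} = A \<inter> {x. x \<bullet> e < s}"
    "A \<inter> {x. x \<bullet> e < t} \<inter> {x. s < x \<bullet> e} = A \<inter> slab e s t" using s by (auto simp: slab_def)
  ultimately show ?thesis by simp
qed

section \<open>Elementary inequalities for roots, and slab cutoffs\<close>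

text \<open>A global form of the expansion 1 + x/n: with y = x/(1 + x), Bernoulli bounds the root of
  1 - y = 1/(1 + x) by 1 - y/n, and the reciprocal of 1 - y/n is at least 1 + y/n.\<close>

lemma root_one_plus_ge:
  assumes n: "n > 0" and x: "x \<ge> 0"
  shows "1 + x / (n * (1 + x)) \<le> root n (1 + x)"
proof -
  define y where "y = x / (1 + x)"
  have y: "0 \<le> y" "y < 1" "1 - y = 1 / (1 + x)" using x by (auto simp: y_def field_simps)
  have n1: "real n \<ge> 1" using n by simp
  have yn: "y / n < 1" "0 \<le> y / n" using y n1 by (auto simp: divide_less_eq)
  have "1 - y \<le> (1 - y / n) ^ n"
    using Bernoulli_inequality[of "- (y / n)" n] yn n by simp
  then have "root n (1 - y) \<le> 1 - y / n"
    using n yn y by (metis real_root_le_mono real_root_power_cancel less_eq_real_def diff_gt_0_iff_gt)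
  moreover have "root n (1 - y) = 1 / root n (1 + x)" using y(3) n by (simp add: real_root_divide)
  moreover have rp: "root n (1 + x) > 0" using n x by (simp add: real_root_gt_zero)
  ultimately have "1 \<le> (1 - y / n) * root n (1 + x)" by (simp add: divide_le_eq)
  moreover have "(1 + y / n) * ((1 - y / n) * root n (1 + x)) \<le> root n (1 + x)"
  proof -
    have "(1 + y / n) * (1 - y / n) \<le> 1" by (simp add: algebra_simps)
    then have "((1 + y / n) * (1 - y / n)) * root n (1 + x) \<le> 1 * root n (1 + x)" using rp by (intro mult_right_mono) auto
    then show ?thesis by (simp add: mult.assoc)
  qed
  moreover have "1 + y / n \<le> (1 + y / n) * ((1 - y / n) * root n (1 + x))"
    using \<open>1 \<le> (1 - y / n) * root n (1 + x)\<close> yn by (simp add: mult_le_cancel_left1)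
  ultimately have "1 + y / n \<le> root n (1 + x)" by linarith
  moreover have "y / n = x / (n * (1 + x))" by (simp add: y_def)
  ultimately show ?thesis by simp
qed

text \<open>The right-hand side is a weighted geometric mean of \<open>m\<close> and
  \<open>t\<close>, hence at least the smaller of the two.\<close>

lemma root_mult_root_diff_ge:
  assumes n: "n \<ge> 2" and m: "m > 0" and e: "e \<ge> 0" and t: "t \<ge> 0" "m - e \<le> t"
  shows "m - e \<le> root n m * root n t ^ (n - 1)"
proof (cases "t \<ge> m")
  case True
  have "m = root n m * root n m ^ (n - 1)"
    using n m by (simp add: power_eq_if[of _ n, symmetric] flip: power_Suc)
  also have "\<dots> \<le> root n m * root n t ^ (n - 1)" using True n m by (intro mult_left_mono power_mono) auto
  finally show ?thesis using e by linarith
next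
  case False
  have "t = root n t * root n t ^ (n - 1)"
    using n t by (simp add: power_eq_if[of _ n, symmetric] flip: power_Suc)
  also have "\<dots> \<le> root n m * root n t ^ (n - 1)" using False n t by (intro mult_right_mono) auto
  finally show ?thesis using t by linarith
qed

text \<open>Strict concavity of the power (n - 1)/n: splitting a volume into two separate pieces
  strictly raises the least perimeter. This is what excludes gaps in an equality case.\<close>

lemma root_power_strict_subadditive:
  assumes n: "n \<ge> 2" and ab: "a > 0" "b > 0"
  shows "root n (a + b) ^ (n - 1) < root n a ^ (n - 1) + root n b ^ (n - 1)"
proof -
  let ?g = "root n (a + b)"
  have g: "?g > 0" using n ab by (simp add: real_root_gt_zero)
  have pow: "root n z * root n z ^ (n - 1) = z" if "z > 0" for z
    using n that by (simp add: power_eq_if[of _ n, symmetric] flip: power_Suc)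
  have "?g * ?g ^ (n - 1) = root n a * root n a ^ (n - 1) + root n b * root n b ^ (n - 1)"
    using pow ab by (simp add: add_pos_pos)
  also have "\<dots> < ?g * root n a ^ (n - 1) + ?g * root n b ^ (n - 1)"
    using n ab by (intro add_strict_mono mult_strict_right_mono) (auto simp: real_root_gt_zero)
  finally have "?g * ?g ^ (n - 1) < ?g * (root n a ^ (n - 1) + root n b ^ (n - 1))" by (simp add: algebra_simps)
  then show ?thesis using g by simp
qed

lemma C1_gradient_step:
  assumes d: "d > 0"
  shows "C1_gradient (\<lambda>x. smooth_step ((x \<bullet> e - c) / d)) (\<lambda>x. (smooth_step' ((x \<bullet> e - c) / d) / d) *\<^sub>R e)"
proof -
  have "C1_gradient (\<lambda>x. smooth_step ((x \<bullet> e - c) / d)) (\<lambda>x. smooth_step' ((x \<bullet> e - c) / d) *\<^sub>R (1 / d) *\<^sub>R e)"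
    by (rule C1_gradient_compose[OF DERIV_smooth_step continuous_on_smooth_step' C1_gradient_inner])
  then show ?thesis by simp
qed

lemma continuous_on_smooth_step: "continuous_on S smooth_step"
  by (intro continuous_at_imp_continuous_on ballI DERIV_isCont[OF DERIV_smooth_step])

lemma borel_measurable_smooth_step [measurable]:
  "smooth_step \<in> borel_measurable borel" "smooth_step' \<in> borel_measurable borel"
  by (intro borel_measurable_continuous_onI continuous_on_smooth_step continuous_on_smooth_step')+

text \<open>The integral runs over the position \<open>c\<close> of the step: averaged over its
  position, a transition layer has total weight 1 at every height \<open>t\<close>.\<close>

lemma nn_integral_smooth_step':
  assumes d: "d > 0"
  shows "(\<integral>\<^sup>+c. ennreal (smooth_step' ((t - c) / d) / d) \<partial>lborel) = 1"
proof -
  have "(\<integral>\<^sup>+c. ennreal (smooth_step' ((t - c) / d) / d) \<partial>lborel) = (\<integral>\<^sup>+c. ennreal (smooth_step' (c / d) / d) \<partial>lborel)"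
    by (rule nn_integral_lborel_reflect[of "\<lambda>c. ennreal (smooth_step' (c / d) / d)"]) measurable
  also have "\<dots> = (\<integral>\<^sup>+c. ennreal (smooth_step' (c / d) / d) * indicator {0..d} c \<partial>lborel)"
  proof (rule nn_integral_cong)
    fix c :: real
    show "ennreal (smooth_step' (c / d) / d) = ennreal (smooth_step' (c / d) / d) * indicator {0..d} c"
    proof (cases "c \<in> {0..d}")
      case False
      then have "c / d \<le> 0 \<or> 1 \<le> c / d" using d by (auto simp: field_simps)
      then show ?thesis by auto
    qed simp
  qed
  also have "\<dots> = ennreal (smooth_step (d / d) - smooth_step (0 / d))"
  proof (rule nn_integral_FTC_Icc)
    show "((\<lambda>c. smooth_step (c / d)) has_real_derivative smooth_step' (c / d) / d) (at c)" for c
    proof -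
      have "((\<lambda>c. c / d) has_real_derivative 1 / d) (at c)" using d by (auto intro!: derivative_eq_intros)
      from DERIV_chain2[where f=smooth_step and g="\<lambda>c. c / d", OF DERIV_smooth_step this] show ?thesis by simp
    qed
  qed (use d in auto)
  finally show ?thesis using d by simp
qed

text \<open>As \<open>w\<close> is at most 1 on \<open>E\<close>, passing from the indicator to
  \<open>w\<close> costs only the mass of \<open>w\<close> outside \<open>E\<close>.\<close>

lemma approximant_integral_le:
  fixes f :: "real^'n::finite \<Rightarrow> real"
  assumes A: "perimeter_approximant E E0 P \<delta> w w' R" and E: "E \<in> sets borel" and fin: "emeasure lborel E < \<infinity>"
    and f [measurable]: "f \<in> borel_measurable borel" and f0: "\<And>x. 0 \<le> f x" and fc: "\<And>x. f x \<le> c" and d: "\<delta> > 0"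
  shows "integrable lborel (\<lambda>x. w x * f x)" "(LINT x|lborel. w x * f x) \<le> (LINT x|lborel. indicator E x * f x) + c * \<delta>"
proof -
  note w = perimeter_approximantD[OF A]
  note E [measurable]
  have wm [measurable]: "w \<in> borel_measurable borel" by (rule C1_gradientD(4)[OF w(1)])
  have c0: "0 \<le> c" using f0[of 0] fc[of 0] by linarith
  have wi: "integrable lborel w"
    by (rule integrable_continuous_bounded_support[OF C1_gradientD(3)[OF w(1)] w(4)])
  show i1: "integrable lborel (\<lambda>x. w x * f x)"
  proof (rule Bochner_Integration.integrable_bound[OF integrable_mult_right[OF wi, of c]])
    show "AE x in lborel. norm (w x * f x) \<le> norm (c * w x)"
    proof (rule AE_I2)
      fix x show "norm (w x * f x) \<le> norm (c * w x)"
        using mult_right_mono[OF fc[of x] w(2)[of x]] f0[of x] w(2)[of x] c0 by (simp add: abs_mult mult.commute)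
    qed
  qed measurable
  have iE: "integrable lborel (\<lambda>x. indicator E x * f x)"
  proof (rule Bochner_Integration.integrable_bound[of _ "\<lambda>x. c * indicator E x"])
    show "integrable lborel (\<lambda>x. c * indicat_real E x)" using E fin by (intro integrable_mult_right integrable_real_indicator) auto
    show "AE x in lborel. norm (indicat_real E x * f x) \<le> norm (c * indicat_real E x)"
      using f0 fc c0 by (auto simp: indicator_def abs_le_iff intro: order_trans[of _ 0])
  qed measurable
  have iw: "integrable lborel (\<lambda>x. w x * indicator (- E) x)"
    by (rule integrable_real_mult_indicator) (use wi E in auto)
  have "(LINT x|lborel. w x * f x) \<le> (LINT x|lborel. indicator E x * f x + c * (w x * indicator (- E) x))"
  proof (rule integral_mono[OF i1])
    show "integrable lborel (\<lambda>x. indicator E x * f x + c * (w x * indicator (- E) x))"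
      using iE iw by (intro Bochner_Integration.integrable_add integrable_mult_right)
    fix x
    show "w x * f x \<le> indicator E x * f x + c * (w x * indicator (- E) x)"
    proof (cases "x \<in> E")
      case True
      then show ?thesis using mult_right_mono[OF w(3)[of x] f0[of x]] by simp
    next
      case False
      then show ?thesis using mult_left_mono[OF fc[of x] w(2)[of x]] by (simp add: mult.commute)
    qed
  qed
  also have "\<dots> = (LINT x|lborel. indicator E x * f x) + c * (LINT x|lborel. w x * indicator (- E) x)"
    using iE iw by simp
  also have "(LINT x|lborel. w x * indicator (- E) x) \<le> \<delta>"
  proof -
    have "ennreal (LINT x|lborel. w x * indicator (- E) x) = (\<integral>\<^sup>+x. ennreal (w x * indicator (- E) x) \<partial>lborel)"
      using iw w(2) by (intro nn_integral_eq_integral[symmetric]) auto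
    also have "\<dots> = (\<integral>\<^sup>+x\<in>- E. ennreal (w x) \<partial>lborel)"
      by (intro nn_integral_cong) (auto simp: indicator_def)
    also have "\<dots> \<le> ennreal \<delta>" by (rule w(8)[OF fin])
    finally show ?thesis using d by simp
  qed
  finally show "(LINT x|lborel. w x * f x) \<le> (LINT x|lborel. indicator E x * f x) + c * \<delta>"
    using c0 by (simp add: mult_left_mono)
qed

text \<open>\<open>wulff_inequality\<close> for the product of \<open>w\<close> with a cutoff \<eta>
  to a slab. The gradient of \<eta> contributes a term that stands for the trace of \<open>E\<close>
  on the faces of the slab, and each slab may have its own \<open>K\<close>.\<close>

lemma wulff_localized:
  fixes w :: "real^'n::finite \<Rightarrow> real"
  assumes N: "CARD('n) \<ge> 2" and A: "perimeter_approximant E E P \<delta> w w' R" and d: "0 < \<delta>" "\<delta> < 1"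
    and \<eta>: "C1_gradient \<eta> \<eta>'" "\<And>x. 0 \<le> \<eta> x" "\<And>x. \<eta> x \<le> 1"
    and K: "open K" "bounded K" "K \<noteq> {}"
    and g: "integrable lborel g" "\<And>x y. y \<in> K \<Longrightarrow> - (\<eta> x * (w' x \<bullet> y)) - w x * (\<eta>' x \<bullet> y) \<le> g x"
    and S: "S \<in> sets borel" "\<And>x. x \<in> S \<Longrightarrow> \<eta> x = 1"
  shows "\<exists>t\<ge>0. measure lebesgue (E \<inter> S) - \<delta> \<le> t \<and>
    (1 - \<delta>) * CARD('n) * root CARD('n) (measure lebesgue K) * root CARD('n) t ^ (CARD('n) - 1) \<le> (LINT x|lborel. g x)"
proof -
  note w = perimeter_approximantD[OF A]
  let ?L = "{x. 1 - \<delta> < w x * \<eta> x}"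
  have C: "C1_gradient (\<lambda>x. w x * \<eta> x) (\<lambda>x. w x *\<^sub>R \<eta>' x + \<eta> x *\<^sub>R w' x)"
    by (rule C1_gradient_intros(3)[OF w(1) \<eta>(1)])
  have "(1 - \<delta>) * DIM(real^'n) * root DIM(real^'n) (measure lebesgue K) * root DIM(real^'n) (measure lebesgue ?L) ^ (DIM(real^'n) - 1) \<le> (LINT x|lborel. g x)"
  proof (rule wulff_inequality[OF _ C _ _ K g(1)])
    show "0 \<le> w x * \<eta> x" for x using w(2) \<eta>(2) by simp
    show "w x * \<eta> x = 0" if "R \<le> norm x" for x using w(4)[OF that] by simp
    show "- ((w x *\<^sub>R \<eta>' x + \<eta> x *\<^sub>R w' x) \<bullet> y) \<le> g x" if "y \<in> K" for x y
      using g(2)[OF that, of x] by (simp add: inner_add_left)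
  qed (use N d in auto)
  moreover have "measure lebesgue (E \<inter> S) - \<delta> \<le> measure lebesgue ?L"
  proof -
    have "continuous_on UNIV (\<lambda>x. w x * \<eta> x)" by (rule C1_gradientD(3)[OF C])
    then have o: "open ?L" by (rule open_Collect_less[OF continuous_on_const])
    have "?L \<subseteq> ball 0 R"
    proof
      fix x assume "x \<in> ?L"
      then have "w x \<noteq> 0" using d by auto
      then show "x \<in> ball 0 R" using w(4)[of x] by (auto simp: not_le[symmetric])
    qed
    then have "bounded ?L" using bounded_ball bounded_subset by metis
    then have Lm: "?L \<in> lmeasurable" using o by (rule lmeasurable_open)
    have "measure lebesgue (E \<inter> S) - \<delta> \<le> measure lebesgue ({x. 1 - \<delta> < w x} \<inter> S)" by (rule w(7)[OF S(1)])
    also have "\<dots> \<le> measure lebesgue ?L"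
    proof (rule measure_mono_fmeasurable[OF _ _ Lm])
      show "{x. 1 - \<delta> < w x} \<inter> S \<subseteq> ?L" using S(2) by auto
      have "open {x. 1 - \<delta> < w x}" using C1_gradientD(3)[OF w(1)] by (intro open_Collect_less continuous_intros)
      then show "{x. 1 - \<delta> < w x} \<inter> S \<in> sets lebesgue" using S(1) by auto
    qed
    finally show ?thesis .
  qed
  ultimately show ?thesis by (intro exI[of _ "measure lebesgue ?L"]) simp
qed

section \<open>Volumes of slabs in an equality case\<close>

text \<open>The perimeter of the ball of radius \<rho> is N times its volume over \<rho>, so the
  last assumption says that \<open>E\<close> does no worse than the ball of its volume.\<close>

locale equality_case =
  fixes E :: "(real^'n::finite) set" and \<rho> :: real
  assumes N: "CARD('n) \<ge> 2" and E: "E \<in> sets borel" and fin: "emeasure lborel E < \<infinity>" and \<rho>: "\<rho> > 0"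
    and vol: "measure lebesgue E = measure lebesgue (ball (0::real^'n) \<rho>)"
    and per: "perimeter_le E (CARD('n) * measure lebesgue E / \<rho>)"
begin

abbreviation "B \<equiv> ball (0::real^'n) \<rho>"
definition "V = measure lebesgue E"
definition "P = CARD('n) * V / \<rho>"
definition "F e c = measure lebesgue (E \<inter> {x. x \<bullet> e < c})"
definition "FB e s = measure lebesgue (B \<inter> {x. x \<bullet> e < s})"

lemma \<rho>P: "\<rho> * P = CARD('n) * V" using \<rho> by (simp add: P_def)

lemma E_lmeasurable: "E \<in> lmeasurable" using E fin by (simp add: fmeasurable_def)

lemma B_lmeasurable: "B \<in> lmeasurable" by simp

lemma V_pos: "V > 0" using \<rho> by (simp add: V_def vol)

lemma P_pos: "P > 0" using V_pos \<rho> N by (simp add: P_def)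

lemma approximant_exists:
  assumes "0 < \<delta>" "\<delta> < 1"
  shows "\<exists>w w' R. perimeter_approximant E E P \<delta> w w' R"
proof (rule perimeter_approx[OF E _ _ E order_refl fin assms])
  show "perimeter_le E P" using per by (simp add: P_def V_def)
  have "(\<integral>\<^sup>+x\<in>E. ennreal (1 / (1 + norm x)) \<partial>lborel) \<le> (\<integral>\<^sup>+x. indicator E x \<partial>lborel)"
    by (intro nn_integral_mono) (auto simp: indicator_def divide_le_eq add_pos_nonneg)
  then show "(\<integral>\<^sup>+x\<in>E. ennreal (1 / (1 + norm x)) \<partial>lborel) < \<infinity>" using fin E by (simp add: le_less_trans)
qed

lemma F_mono:
  assumes "c \<le> c'" shows "F e c \<le> F e c'"
  unfolding F_def using assms
  by (intro measure_mono_fmeasurable fmeasurable_Int_fmeasurable E_lmeasurable) (auto intro!: sets.Int simp: E)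

lemma FB_mono:
  assumes "c \<le> c'" shows "FB e c \<le> FB e c'"
  unfolding FB_def using assms
  by (intro measure_mono_fmeasurable fmeasurable_Int_fmeasurable B_lmeasurable) (auto intro!: sets.Int)

lemma F_bounds: "0 \<le> F e c" "F e c \<le> V"
  unfolding F_def V_def
  by (simp, intro measure_mono_fmeasurable E_lmeasurable) (auto intro!: sets.Int simp: E)

lemma measure_upper:
  assumes "e \<in> Basis"
  shows "measure lebesgue (E \<inter> {x. c < x \<bullet> e}) = V - F e c" "measure lebesgue (B \<inter> {x. c < x \<bullet> e}) = V - FB e c"
  using measure_halfspace_split[OF E_lmeasurable assms, of c] measure_halfspace_split[OF B_lmeasurable assms, of c]
  unfolding V_def F_def FB_def vol by linarith+

lemma continuous_on_F:
  assumes "e \<in> Basis" shows "continuous_on S (F e)" "continuous_on S (FB e)"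
proof -
  show "continuous_on S (F e)" unfolding F_def[abs_def]
    by (rule continuous_on_subset[OF continuous_on_measure_halfspace[OF E_lmeasurable assms]]) simp
  show "continuous_on S (FB e)" unfolding FB_def[abs_def]
    by (rule continuous_on_subset[OF continuous_on_measure_halfspace[OF B_lmeasurable assms]]) simp
qed

text \<open>If a slab met \<open>E\<close> in a null set between two parts of positive volume, a
  step rising inside the slab would separate the parts at no cost, and each would obey the
  isoperimetric inequality with its own share of the perimeter. This contradicts
  \<open>root_power_strict_subadditive\<close>.\<close>

lemma F_no_gap:
  assumes e: "e \<in> Basis" and cc: "c < c'" and F: "0 < F e c" "F e c < V"
  shows "F e c < F e c'"
proof (rule ccontr)
  assume "\<not> F e c < F e c'"
  with F_mono[of c c' e] cc have eq: "F e c' = F e c" by simp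
  have slab0: "measure lebesgue (E \<inter> slab e c c') = 0"
    using measure_halfspace_diff[OF E_lmeasurable e, of c c'] cc eq by (simp add: F_def)
  define d where "d = c' - c"
  have d: "d > 0" using cc by (simp add: d_def)
  define \<eta> where "\<eta> x = smooth_step ((x \<bullet> e - c) / d)" for x
  define s where "s x = smooth_step' ((x \<bullet> e - c) / d) / d" for x
  have C: "C1_gradient \<eta> (\<lambda>x. s x *\<^sub>R e)" unfolding \<eta>_def s_def by (rule C1_gradient_step[OF d])
  have C': "C1_gradient (\<lambda>x. 1 - \<eta> x) (\<lambda>x. - (s x *\<^sub>R e))" by (rule C1_gradient_intros(5)[OF C C])
  have \<eta>01: "0 \<le> \<eta> x" "\<eta> x \<le> 1" "0 \<le> 1 - \<eta> x" "1 - \<eta> x \<le> 1" for x by (auto simp: \<eta>_def)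
  obtain Cs where Cs: "Cs > 0" "\<And>t. smooth_step' t \<le> Cs" using smooth_step'_bounded by blast
  have s: "0 \<le> s x" "s x \<le> Cs / d" for x using Cs d by (auto simp: s_def divide_right_mono)
  have sm: "s \<in> borel_measurable borel" unfolding s_def by measurable
  have s_supp: "s x = 0" if "x \<notin> slab e c c'" for x
  proof -
    have "(x \<bullet> e - c) / d \<le> 0 \<or> 1 \<le> (x \<bullet> e - c) / d"
      using that d by (auto simp: slab_def d_def not_less divide_le_0_iff)
    then show ?thesis by (auto simp: s_def)
  qed
  let ?r = "root CARD('n)"
  define a where "a = F e c"
  define b where "b = V - F e c"
  have ab: "a > 0" "b > 0" "a + b = V" using F by (auto simp: a_def b_def)
  have V2: "V = ?r V * ?r V ^ (CARD('n) - 1)" using N V_pos by (simp add: power_eq_if[of _ "CARD('n)", symmetric] flip: power_Suc)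
  \<comment> \<open>The trace terms contain \<open>w * s\<close>, and \<open>s\<close> lives in the
    slab where \<open>E\<close> is null, so they are of order \<delta>.\<close>
  have ineq: "(1 - \<delta>) * CARD('n) * ?r V * (?r (a - \<delta>) ^ (CARD('n) - 1) + ?r (b - \<delta>) ^ (CARD('n) - 1)) \<le> \<rho> * (P + \<delta>) + 2 * \<rho> * (Cs / d * \<delta>)"
    if \<delta>: "0 < \<delta>" "\<delta> < 1" "\<delta> < a" "\<delta> < b" for \<delta>
  proof -
    obtain w w' R where A: "perimeter_approximant E E P \<delta> w w' R" using approximant_exists[OF \<delta>(1,2)] by blast
    note w = perimeter_approximantD[OF A]
    note ws = approximant_integral_le[OF A E fin sm s \<delta>(1)]
    have zero: "(LINT x|lborel. indicator E x * s x) = 0"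
    proof (rule integral_eq_zero_AE)
      have "E \<inter> slab e c c' \<in> lmeasurable" by (auto intro!: fmeasurable_Int_fmeasurable E_lmeasurable borel_open simp: open_slab)
      then have "E \<inter> slab e c c' \<in> null_sets lborel"
        using emeasure_eq_measure2[of "E \<inter> slab e c c'" lebesgue] slab0 E by (intro null_setsI) (auto simp: open_slab borel_open)
      then have "AE x in lborel. x \<notin> E \<inter> slab e c c'" by (rule AE_not_in)
      then show "AE x in lborel. indicator E x * s x = 0"
        by eventually_elim (use s_supp in \<open>auto simp: indicator_def\<close>)
    qed
    have ws': "(LINT x|lborel. w x * s x) \<le> Cs / d * \<delta>" using ws(2) zero by simp
    have i1: "integrable lborel (\<lambda>x. \<zeta> x * norm (w' x))" if "continuous_on UNIV \<zeta>" "\<And>x. 0 \<le> \<zeta> x \<and> \<zeta> x \<le> 1" for \<zeta> :: "real^'n \<Rightarrow> real"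
    proof (rule Bochner_Integration.integrable_bound[OF w(5)])
      have "\<zeta> \<in> borel_measurable borel" "w' \<in> borel_measurable borel"
        using borel_measurable_continuous_onI[OF that(1)] C1_gradientD(5)[OF w(1)] by auto
      then show "(\<lambda>x. \<zeta> x * norm (w' x)) \<in> borel_measurable lborel" by measurable
      show "AE x in lborel. norm (\<zeta> x * norm (w' x)) \<le> norm (norm (w' x))"
        using that(2) by (auto simp: abs_mult mult_le_cancel_right1 mult_left_le_one_le)
    qed
    have c1: "continuous_on UNIV \<eta>" "continuous_on UNIV (\<lambda>x. 1 - \<eta> x)" using C1_gradientD(3)[OF C] C1_gradientD(3)[OF C'] by auto
    have i\<eta>: "integrable lborel (\<lambda>x. \<eta> x * norm (w' x))" "integrable lborel (\<lambda>x. (1 - \<eta> x) * norm (w' x))"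
      using c1 \<eta>01 by (auto intro!: i1)
    have bnd: "- (\<zeta> * (w' x \<bullet> y)) - w x * (z \<bullet> y) \<le> \<rho> * (\<zeta> * norm (w' x) + w x * s x)"
      if "y \<in> B" "0 \<le> \<zeta>" "norm z \<le> s x" for \<zeta> x y and z :: "real^'n"
    proof -
      have y: "norm y \<le> \<rho>" using that by simp
      have "\<bar>w' x \<bullet> y\<bar> \<le> norm (w' x) * \<rho>" using Cauchy_Schwarz_ineq2[of "w' x" y] mult_left_mono[OF y, of "norm (w' x)"] by simp
      then have "\<zeta> * - (w' x \<bullet> y) \<le> \<zeta> * (norm (w' x) * \<rho>)" using that(2) by (intro mult_left_mono) auto
      moreover have "\<bar>z \<bullet> y\<bar> \<le> s x * \<rho>"
        using Cauchy_Schwarz_ineq2[of z y] mult_mono[OF that(3) y] s(1)[of x] by simp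
      then have "w x * - (z \<bullet> y) \<le> w x * (s x * \<rho>)" using w(2)[of x] by (intro mult_left_mono) auto
      ultimately show ?thesis by (simp add: algebra_simps)
    qed
    have "\<exists>t\<ge>0. measure lebesgue (E \<inter> {x. c' < x \<bullet> e}) - \<delta> \<le> t \<and>
        (1 - \<delta>) * CARD('n) * ?r (measure lebesgue B) * ?r t ^ (CARD('n) - 1) \<le> (LINT x|lborel. \<rho> * (\<eta> x * norm (w' x) + w x * s x))"
    proof (rule wulff_localized[OF N A \<delta>(1,2) C \<eta>01(1,2)])
      show "integrable lborel (\<lambda>x. \<rho> * (\<eta> x * norm (w' x) + w x * s x))" using i\<eta> ws(1) by simp
      show "- (\<eta> x * (w' x \<bullet> y)) - w x * (s x *\<^sub>R e \<bullet> y) \<le> \<rho> * (\<eta> x * norm (w' x) + w x * s x)" if "y \<in> B" for x y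
        by (rule bnd[OF that \<eta>01(1)]) (use s e in simp)
      show "{x. c' < x \<bullet> e} \<in> sets borel" by (intro borel_open open_Collect_less continuous_intros)
      show "\<eta> x = 1" if "x \<in> {x. c' < x \<bullet> e}" for x using that d by (simp add: \<eta>_def d_def)
    qed (use \<rho> in auto)
    then obtain t2 where t2: "t2 \<ge> 0" "b - \<delta> \<le> t2"
      "(1 - \<delta>) * CARD('n) * ?r V * ?r t2 ^ (CARD('n) - 1) \<le> (LINT x|lborel. \<rho> * (\<eta> x * norm (w' x) + w x * s x))"
      unfolding measure_upper[OF e] eq b_def V_def vol by blast
    have "\<exists>t\<ge>0. measure lebesgue (E \<inter> {x. x \<bullet> e < c}) - \<delta> \<le> t \<and>
        (1 - \<delta>) * CARD('n) * ?r (measure lebesgue B) * ?r t ^ (CARD('n) - 1) \<le> (LINT x|lborel. \<rho> * ((1 - \<eta> x) * norm (w' x) + w x * s x))"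
    proof (rule wulff_localized[OF N A \<delta>(1,2) C' \<eta>01(3,4)])
      show "integrable lborel (\<lambda>x. \<rho> * ((1 - \<eta> x) * norm (w' x) + w x * s x))" using i\<eta> ws(1) by simp
      show "- ((1 - \<eta> x) * (w' x \<bullet> y)) - w x * (- (s x *\<^sub>R e) \<bullet> y) \<le> \<rho> * ((1 - \<eta> x) * norm (w' x) + w x * s x)" if "y \<in> B" for x y
        by (rule bnd[OF that \<eta>01(3)]) (use s e in simp)
      show "{x. x \<bullet> e < c} \<in> sets borel" by (intro borel_open open_Collect_less continuous_intros)
      show "1 - \<eta> x = 1" if "x \<in> {x. x \<bullet> e < c}" for x using that d by (simp add: \<eta>_def divide_le_0_iff)
    qed (use \<rho> in auto)
    then obtain t1 where t1: "t1 \<ge> 0" "a - \<delta> \<le> t1"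
      "(1 - \<delta>) * CARD('n) * ?r V * ?r t1 ^ (CARD('n) - 1) \<le> (LINT x|lborel. \<rho> * ((1 - \<eta> x) * norm (w' x) + w x * s x))"
      unfolding F_def[symmetric] a_def V_def vol by blast
    have "(1 - \<delta>) * CARD('n) * ?r V * (?r (a - \<delta>) ^ (CARD('n) - 1) + ?r (b - \<delta>) ^ (CARD('n) - 1)) \<le> (1 - \<delta>) * CARD('n) * ?r V * (?r t1 ^ (CARD('n) - 1) + ?r t2 ^ (CARD('n) - 1))"
      using \<delta> t1 t2 N V_pos by (intro mult_left_mono add_mono power_mono real_root_le_mono) auto
    also have "\<dots> \<le> (LINT x|lborel. \<rho> * (\<eta> x * norm (w' x) + w x * s x)) + (LINT x|lborel. \<rho> * ((1 - \<eta> x) * norm (w' x) + w x * s x))"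
      using t1(3) t2(3) by (simp add: algebra_simps)
    also have "\<dots> = (LINT x|lborel. \<rho> * (\<eta> x * norm (w' x) + w x * s x) + \<rho> * ((1 - \<eta> x) * norm (w' x) + w x * s x))"
      using i\<eta> ws(1) by (intro Bochner_Integration.integral_add[symmetric]) auto
    also have "\<dots> = (LINT x|lborel. \<rho> * norm (w' x) + 2 * \<rho> * (w x * s x))"
      by (intro Bochner_Integration.integral_cong) (auto simp: algebra_simps)
    also have "\<dots> = \<rho> * (LINT x|lborel. norm (w' x)) + 2 * \<rho> * (LINT x|lborel. w x * s x)"
      using w(5) ws(1) by simp
    also have "\<dots> \<le> \<rho> * (P + \<delta>) + 2 * \<rho> * (Cs / d * \<delta>)"
      using w(6) ws' \<rho> by (intro add_mono mult_left_mono) auto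
    finally show ?thesis .
  qed
  have "(1 - 0 :: real) * CARD('n) * ?r V * (?r (a - 0) ^ (CARD('n) - 1) + ?r (b - 0) ^ (CARD('n) - 1)) \<le> \<rho> * (P + 0) + 2 * \<rho> * (Cs / d * 0)"
  proof (rule tendsto_le[of "at_right (0::real)"])
    show "((\<lambda>\<delta>::real. (1 - \<delta>) * CARD('n) * ?r V * (?r (a - \<delta>) ^ (CARD('n) - 1) + ?r (b - \<delta>) ^ (CARD('n) - 1))) \<longlongrightarrow> (1 - 0 :: real) * CARD('n) * ?r V * (?r (a - 0) ^ (CARD('n) - 1) + ?r (b - 0) ^ (CARD('n) - 1))) (at_right 0)"
      by (intro tendsto_intros)
    show "((\<lambda>\<delta>. \<rho> * (P + \<delta>) + 2 * \<rho> * (Cs / d * \<delta>)) \<longlongrightarrow> \<rho> * (P + 0) + 2 * \<rho> * (Cs / d * 0)) (at_right 0)"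
      by (intro tendsto_intros)
    show "\<forall>\<^sub>F \<delta> in at_right (0::real). (1 - \<delta>) * CARD('n) * ?r V * (?r (a - \<delta>) ^ (CARD('n) - 1) + ?r (b - \<delta>) ^ (CARD('n) - 1)) \<le> \<rho> * (P + \<delta>) + 2 * \<rho> * (Cs / d * \<delta>)"
    proof (rule eventually_mono)
      show "eventually (\<lambda>\<delta>. \<delta> \<in> {0<..<min 1 (min a b)}) (at_right (0::real))"
        using ab by (intro eventually_at_right_real) auto
    qed (rule ineq, auto)
  qed simp
  then have "CARD('n) * (?r V * (?r a ^ (CARD('n) - 1) + ?r b ^ (CARD('n) - 1))) \<le> CARD('n) * V" by (simp add: \<rho>P mult.assoc)
  then have "?r V * (?r a ^ (CARD('n) - 1) + ?r b ^ (CARD('n) - 1)) \<le> V" using N by simp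
  moreover have "?r V * ?r V ^ (CARD('n) - 1) < ?r V * (?r a ^ (CARD('n) - 1) + ?r b ^ (CARD('n) - 1))"
    using root_power_strict_subadditive[OF N ab(1,2)] ab(3) V_pos N by (intro mult_strict_left_mono) auto
  ultimately show False using V2 by linarith
qed

end

context equality_case
begin

text \<open>The length of the gradient of a step at height \<open>c\<close>, for a unit vector
  \<open>e\<close>. Integrated over \<open>E\<close> it stands for the area of the section of
  \<open>E\<close> there.\<close>

definition trans_density :: "real^'n \<Rightarrow> real \<Rightarrow> real \<Rightarrow> real^'n \<Rightarrow> real" where
  "trans_density e d c x = smooth_step' ((x \<bullet> e - c) / d) / d"

definition slab_bump :: "real^'n \<Rightarrow> real \<Rightarrow> real \<Rightarrow> real \<Rightarrow> real^'n \<Rightarrow> real" where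
  "slab_bump e d c c' x = smooth_step ((x \<bullet> e - c) / d) - smooth_step ((x \<bullet> e - c') / d)"

lemma slab_bump_bounds:
  assumes d: "d > 0" and cc: "c + d \<le> c'"
  shows "0 \<le> slab_bump e d c c' x" "slab_bump e d c c' x \<le> 1"
    "x \<bullet> e \<le> c \<or> c' + d \<le> x \<bullet> e \<Longrightarrow> slab_bump e d c c' x = 0"
    "c + d \<le> x \<bullet> e \<Longrightarrow> x \<bullet> e \<le> c' \<Longrightarrow> slab_bump e d c c' x = 1"
proof -
  have "slab_bump e d c c' x \<ge> 0"
  proof (cases "x \<bullet> e \<le> c'")
    case True
    then have "(x \<bullet> e - c') / d \<le> 0" using d by (simp add: divide_le_0_iff)
    then show ?thesis by (simp add: slab_bump_def)
  next
    case False
    then have "1 \<le> (x \<bullet> e - c) / d" using d cc by (simp add: field_simps)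
    then show ?thesis by (simp add: slab_bump_def)
  qed
  then show "0 \<le> slab_bump e d c c' x" .
  show "slab_bump e d c c' x \<le> 1" using smooth_step_simps(3,4) by (smt (verit) slab_bump_def)
  show "slab_bump e d c c' x = 0" if "x \<bullet> e \<le> c \<or> c' + d \<le> x \<bullet> e"
    using that
  proof
    assume "x \<bullet> e \<le> c"
    then have "(x \<bullet> e - c) / d \<le> 0" "(x \<bullet> e - c') / d \<le> 0" using d cc by (auto simp: divide_le_0_iff)
    then show ?thesis by (simp add: slab_bump_def)
  next
    assume "c' + d \<le> x \<bullet> e"
    then have "1 \<le> (x \<bullet> e - c) / d" "1 \<le> (x \<bullet> e - c') / d" using d cc by (auto simp: field_simps)
    then show ?thesis by (simp add: slab_bump_def)
  qed
  show "slab_bump e d c c' x = 1" if "c + d \<le> x \<bullet> e" "x \<bullet> e \<le> c'"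
  proof -
    have "1 \<le> (x \<bullet> e - c) / d" "(x \<bullet> e - c') / d \<le> 0" using d that by (auto simp: field_simps divide_le_0_iff)
    then show ?thesis by (simp add: slab_bump_def)
  qed
qed

lemma trans_density_facts:
  assumes d: "d > 0"
  shows "0 \<le> trans_density e d c x" "trans_density e d c \<in> borel_measurable borel"
    "\<exists>C. \<forall>x. trans_density e d c x \<le> C" "trans_density e d c x \<noteq> 0 \<Longrightarrow> c < x \<bullet> e \<and> x \<bullet> e < c + d"
proof -
  show "0 \<le> trans_density e d c x" using d by (simp add: trans_density_def)
  show "trans_density e d c \<in> borel_measurable borel" unfolding trans_density_def[abs_def] by measurable
  obtain C where "\<And>t. smooth_step' t \<le> C" using smooth_step'_bounded by blast
  then have "trans_density e d c x \<le> C / d" for x using d by (simp add: trans_density_def divide_right_mono)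
  then show "\<exists>C. \<forall>x. trans_density e d c x \<le> C" by blast
  assume "trans_density e d c x \<noteq> 0"
  then have "smooth_step' ((x \<bullet> e - c) / d) \<noteq> 0" by (simp add: trans_density_def)
  then have "\<not> (x \<bullet> e - c) / d \<le> 0" "\<not> 1 \<le> (x \<bullet> e - c) / d" by auto
  then show "c < x \<bullet> e \<and> x \<bullet> e < c + d" using d by (auto simp: field_simps)
qed

lemma integrable_times_gradient:
  assumes A: "perimeter_approximant E E P \<delta> w w' R" and \<zeta>: "\<zeta> \<in> borel_measurable borel" "\<And>x. 0 \<le> \<zeta> x" "\<And>x. \<zeta> x \<le> 1"
  shows "integrable lborel (\<lambda>x. \<zeta> x * norm (w' x))"
proof (rule Bochner_Integration.integrable_bound[OF perimeter_approximantD(5)[OF A]])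
  have "w' \<in> borel_measurable borel" using C1_gradientD(5)[OF perimeter_approximantD(1)[OF A]] by auto
  then show "(\<lambda>x. \<zeta> x * norm (w' x)) \<in> borel_measurable lborel" using \<zeta>(1) by measurable
  show "AE x in lborel. norm (\<zeta> x * norm (w' x)) \<le> norm (norm (w' x))"
    using \<zeta> by (auto simp: abs_mult mult_left_le_one_le)
qed

text \<open>The Wulff inequality in three slabs of \<open>E\<close>, each with the slab of the ball
  of equal volume as \<open>K\<close>, except that the middle one is thickened by \<open>h\<close>.
  Unthickened, the sum would only return the isoperimetric inequality; thickening gains
  \<open>h * \<beta>\<close> to first order on the left and costs, on the right, h/2 times the
  perimeter in the middle slab plus the areas of its two faces.\<close>

lemma three_slab_inequality:
  fixes \<epsilon> \<kappa> h \<beta> :: real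
  assumes e: "e \<in> Basis" and A: "perimeter_approximant E E P \<delta> w w' R" and \<delta>: "0 < \<delta>" "\<delta> < 1"
    and d: "d > 0" and cc: "c + d \<le> c'" and s: "- \<rho> < s0" "s1 < \<rho>" and Fs: "F e c = FB e s0" "F e c' = FB e s1"
    and h: "h > 0" and \<beta>: "0 \<le> \<beta>" "\<And>s. s0 < s \<Longrightarrow> s < s1 \<Longrightarrow> \<beta> \<le> section_area e \<rho> s"
    and \<kappa>: "0 < \<kappa>" "\<kappa> \<le> F e c' - F e c"
    and \<epsilon>: "\<delta> + (F e (c + d) - F e c) \<le> \<epsilon>" "\<delta> + (F e (c' + d) - F e c') \<le> \<epsilon>" "\<epsilon> \<le> \<kappa>"
  shows "(1 - \<delta>) * (CARD('n) * V - 3 * CARD('n) * \<epsilon> + (1 - \<epsilon> / \<kappa>) * (h * \<beta>) / (1 + h * \<beta> / \<kappa>))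
    \<le> \<rho> * (P + \<delta>) + h / 2 * (LINT x|lborel. slab_bump e d c c' x * norm (w' x) + w x * (trans_density e d c x + trans_density e d c' x))"
proof -
  note w = perimeter_approximantD[OF A]
  let ?r = "root CARD('n)" and ?m = "measure lebesgue :: (real^'n) set \<Rightarrow> real"
  define m1 where "m1 = F e c"
  define m2 where "m2 = F e c' - F e c"
  define m3 where "m3 = V - F e c'"
  have m2: "m2 > 0" "\<kappa> \<le> m2" using \<kappa> by (auto simp: m2_def)
  have s01: "s0 < s1"
  proof (rule ccontr)
    assume "\<not> s0 < s1"
    then have "FB e s1 \<le> FB e s0" by (intro FB_mono) simp
    then show False using m2 Fs by (simp add: m2_def)
  qed
  have ee: "e \<bullet> e = 1" "norm e = 1" using e by auto
  have nn: "0 \<le> F e (c + d) - F e c" "0 \<le> F e (c' + d) - F e c'" using F_mono[of c "c + d" e] F_mono[of c' "c' + d" e] d by auto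
  have \<epsilon>0: "\<epsilon> > 0" using \<epsilon>(1) nn \<delta> by linarith
  define \<sigma> where "\<sigma> c x = smooth_step ((x \<bullet> e - c) / d)" for c x
  define S where "S = trans_density e d"
  have C: "C1_gradient (\<sigma> c) (\<lambda>x. S c x *\<^sub>R e)" for c
    unfolding \<sigma>_def[abs_def] S_def trans_density_def by (rule C1_gradient_step[OF d])
  have C1: "C1_gradient (\<lambda>x. 1 - \<sigma> c x) (\<lambda>x. - (S c x *\<^sub>R e))" by (rule C1_gradient_intros(5)[OF C C])
  have C2: "C1_gradient (\<lambda>x. \<sigma> c x - \<sigma> c' x) (\<lambda>x. S c x *\<^sub>R e - S c' x *\<^sub>R e)" by (rule C1_gradient_intros(2)[OF C C])
  have bump: "slab_bump e d c c' = (\<lambda>x. \<sigma> c x - \<sigma> c' x)" by (auto simp: slab_bump_def \<sigma>_def)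
  note b = slab_bump_bounds[OF d cc, where e=e, unfolded bump]
  have \<sigma>01: "0 \<le> \<sigma> c x" "\<sigma> c x \<le> 1" "0 \<le> 1 - \<sigma> c x" "1 - \<sigma> c x \<le> 1" for c x by (auto simp: \<sigma>_def)
  have \<sigma>m: "\<sigma> c \<in> borel_measurable borel" for c by (rule C1_gradientD(4)[OF C])
  have S0: "0 \<le> S c x" for c x unfolding S_def by (rule trans_density_facts(1)[OF d])
  have iS: "integrable lborel (\<lambda>x. w x * S c x)" for c
  proof -
    obtain Cb where "\<And>x. trans_density e d c x \<le> Cb" using trans_density_facts(3)[OF d] by blast
    then show ?thesis unfolding S_def
      by (intro approximant_integral_le(1)[OF A E fin trans_density_facts(2)[OF d] trans_density_facts(1)[OF d] _ \<delta>(1)])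
  qed
  have i1: "integrable lborel (\<lambda>x. (1 - \<sigma> c x) * norm (w' x))"
    by (rule integrable_times_gradient[OF A]) (use \<sigma>m \<sigma>01 in auto)
  have i2: "integrable lborel (\<lambda>x. (\<sigma> c x - \<sigma> c' x) * norm (w' x))"
    by (rule integrable_times_gradient[OF A]) (use \<sigma>m b in auto)
  have i3: "integrable lborel (\<lambda>x. \<sigma> c' x * norm (w' x))"
    by (rule integrable_times_gradient[OF A]) (use \<sigma>m \<sigma>01 in auto)
  have wy: "\<zeta> * - (w' x \<bullet> y) \<le> \<zeta> * (norm (w' x) * q)" if "norm y \<le> q" "0 \<le> \<zeta>" for \<zeta> q x y
    using Cauchy_Schwarz_ineq2[of "w' x" y] mult_left_mono[OF that(1), of "norm (w' x)"] that(2)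
    by (intro mult_left_mono) auto
  let ?K1 = "B \<inter> {y. y \<bullet> e < s0}" and ?K3 = "B \<inter> {y. s1 < y \<bullet> e}"
  let ?K2 = "minkowski_sum (B \<inter> slab e s0 s1) ((\<lambda>u. u *\<^sub>R e) ` {- h / 2..h / 2})"
  \<comment> \<open>Upper bounds from the shape of each \<open>K\<close>: length at most \<rho>, or
    \<rho> + h/2 after thickening, and heights limited by \<open>s0\<close> and \<open>s1\<close>. A
    height enters with opposite signs on the two sides of a face, so \<open>s0\<close> and
    \<open>s1\<close> cancel in the sum.\<close>
  let ?g1 = "\<lambda>x. \<rho> * ((1 - \<sigma> c x) * norm (w' x)) + s0 * (w x * S c x)"
  let ?g2 = "\<lambda>x. (\<rho> + h / 2) * ((\<sigma> c x - \<sigma> c' x) * norm (w' x)) + (h / 2 - s0) * (w x * S c x) + (h / 2 + s1) * (w x * S c' x)"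
  let ?g3 = "\<lambda>x. \<rho> * (\<sigma> c' x * norm (w' x)) - s1 * (w x * S c' x)"
  have "\<exists>t\<ge>0. ?m (E \<inter> {x. x \<bullet> e < c}) - \<delta> \<le> t \<and>
      (1 - \<delta>) * CARD('n) * ?r (?m ?K1) * ?r t ^ (CARD('n) - 1) \<le> (LINT x|lborel. ?g1 x)"
  proof (rule wulff_localized[OF N A \<delta> C1 \<sigma>01(3,4)])
    have "(s0 - \<rho>) / 2 < s0" "\<bar>(s0 - \<rho>) / 2\<bar> < \<rho>" using s s01 by (auto simp: abs_less_iff)
    then have "((s0 - \<rho>) / 2) *\<^sub>R e \<in> ?K1" using ee by simp
    then show "?K1 \<noteq> {}" by blast
    show "open ?K1" by (intro open_Int open_ball open_Collect_less continuous_intros)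
    show "integrable lborel ?g1" using i1 iS by auto
    show "- ((1 - \<sigma> c x) * (w' x \<bullet> y)) - w x * (- (S c x *\<^sub>R e) \<bullet> y) \<le> ?g1 x" if y: "y \<in> ?K1" for x y
    proof -
      have "(1 - \<sigma> c x) * - (w' x \<bullet> y) \<le> (1 - \<sigma> c x) * (norm (w' x) * \<rho>)" using y \<sigma>01 by (intro wy) auto
      moreover have "w x * (S c x * (y \<bullet> e)) \<le> w x * (S c x * s0)"
        using y w(2)[of x] S0[of c x] by (intro mult_left_mono) auto
      ultimately show ?thesis by (simp add: inner_commute algebra_simps)
    qed
    show "{x. x \<bullet> e < c} \<in> sets borel" by (intro borel_open open_Collect_less continuous_intros)
    show "1 - \<sigma> c x = 1" if "x \<in> {x. x \<bullet> e < c}" for x using that d by (simp add: \<sigma>_def divide_le_0_iff)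
  qed (auto intro: bounded_Int)
  then obtain t1 where t1: "t1 \<ge> 0" "m1 - \<delta> \<le> t1" "(1 - \<delta>) * CARD('n) * ?r m1 * ?r t1 ^ (CARD('n) - 1) \<le> (LINT x|lborel. ?g1 x)"
    unfolding F_def[symmetric] FB_def[symmetric] m1_def Fs by blast
  \<comment> \<open>The step at \<open>c'\<close> reaches 1 only at \<open>c' + d\<close>; the
    volume lost in between is absorbed by \<epsilon>.\<close>
  have "\<exists>t\<ge>0. ?m (E \<inter> {x. c' + d < x \<bullet> e}) - \<delta> \<le> t \<and>
      (1 - \<delta>) * CARD('n) * ?r (?m ?K3) * ?r t ^ (CARD('n) - 1) \<le> (LINT x|lborel. ?g3 x)"
  proof (rule wulff_localized[OF N A \<delta> C \<sigma>01(1,2)])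
    have "s1 < (s1 + \<rho>) / 2" "\<bar>(s1 + \<rho>) / 2\<bar> < \<rho>" using s s01 by (auto simp: abs_less_iff)
    then have "((s1 + \<rho>) / 2) *\<^sub>R e \<in> ?K3" using ee by simp
    then show "?K3 \<noteq> {}" by blast
    show "open ?K3" by (intro open_Int open_ball open_Collect_less continuous_intros)
    show "integrable lborel ?g3" using i3 iS by auto
    show "- (\<sigma> c' x * (w' x \<bullet> y)) - w x * (S c' x *\<^sub>R e \<bullet> y) \<le> ?g3 x" if y: "y \<in> ?K3" for x y
    proof -
      have "\<sigma> c' x * - (w' x \<bullet> y) \<le> \<sigma> c' x * (norm (w' x) * \<rho>)" using y \<sigma>01 by (intro wy) auto
      moreover have "w x * (S c' x * s1) \<le> w x * (S c' x * (y \<bullet> e))"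
        using y w(2)[of x] S0[of c' x] by (intro mult_left_mono) auto
      ultimately show ?thesis by (simp add: inner_commute algebra_simps)
    qed
    show "{x. c' + d < x \<bullet> e} \<in> sets borel" by (intro borel_open open_Collect_less continuous_intros)
    show "\<sigma> c' x = 1" if "x \<in> {x. c' + d < x \<bullet> e}" for x using that d by (simp add: \<sigma>_def field_simps)
  qed (auto intro: bounded_Int)
  moreover have "?m (E \<inter> {x. c' + d < x \<bullet> e}) = V - F e (c' + d)" "?m ?K3 = m3"
    using measure_upper[OF e] by (auto simp: m3_def Fs)
  ultimately obtain t3 where t3: "t3 \<ge> 0" "m3 - \<epsilon> \<le> t3" "(1 - \<delta>) * CARD('n) * ?r m3 * ?r t3 ^ (CARD('n) - 1) \<le> (LINT x|lborel. ?g3 x)"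
    using \<epsilon>(2) unfolding m3_def by (smt (verit))
  have smid: "- \<rho> \<le> s0" "s1 \<le> \<rho>" using s by auto
  define s where "s = (s0 + s1) / 2"
  have ss: "s0 < s" "s < s1" using s01 by (auto simp: s_def)
  note K2 = measure_thickened_slab[OF e \<rho> ss smid h]
  have "\<exists>t\<ge>0. ?m (E \<inter> slab e (c + d) c') - \<delta> \<le> t \<and>
      (1 - \<delta>) * CARD('n) * ?r (?m ?K2) * ?r t ^ (CARD('n) - 1) \<le> (LINT x|lborel. ?g2 x)"
  proof (rule wulff_localized[OF N A \<delta> C2 b(1,2) K2(1,2,3)])
    show "integrable lborel ?g2" using i2 iS by auto
    show "- ((\<sigma> c x - \<sigma> c' x) * (w' x \<bullet> y)) - w x * ((S c x *\<^sub>R e - S c' x *\<^sub>R e) \<bullet> y) \<le> ?g2 x" if y: "y \<in> ?K2" for x y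
    proof -
      obtain z v where zv: "z \<in> B \<inter> slab e s0 s1" "v \<in> (\<lambda>u. u *\<^sub>R e) ` {- h / 2..h / 2}" "y = z + v"
        using y unfolding mem_minkowski_sum by blast
      then obtain u where u': "u \<in> {- h / 2..h / 2}" "v = u *\<^sub>R e" by blast
      have z: "z \<in> B" "s0 < z \<bullet> e" "z \<bullet> e < s1" "y = z + u *\<^sub>R e" and u: "- h / 2 \<le> u" "u \<le> h / 2"
        using zv u' by (auto simp: slab_def)
      have "norm y \<le> norm z + norm (u *\<^sub>R e)" unfolding z(4) by (rule norm_triangle_ineq)
      then have ny: "norm y \<le> \<rho> + h / 2" using z(1) u ee by auto
      have ye: "y \<bullet> e = z \<bullet> e + u" by (simp add: z(4) inner_add_left ee)
      have "(\<sigma> c x - \<sigma> c' x) * - (w' x \<bullet> y) \<le> (\<sigma> c x - \<sigma> c' x) * (norm (w' x) * (\<rho> + h / 2))" by (intro wy ny b)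
      moreover have "w x * (S c x * - (y \<bullet> e)) \<le> w x * (S c x * (h / 2 - s0))"
      proof (intro mult_left_mono w(2) S0)
        show "- (y \<bullet> e) \<le> h / 2 - s0" using u z(2) ye by linarith
      qed
      moreover have "w x * (S c' x * (y \<bullet> e)) \<le> w x * (S c' x * (h / 2 + s1))"
      proof (intro mult_left_mono w(2) S0)
        show "y \<bullet> e \<le> h / 2 + s1" using u z(3) ye by linarith
      qed
      moreover have "- ((\<sigma> c x - \<sigma> c' x) * (w' x \<bullet> y)) - w x * ((S c x *\<^sub>R e - S c' x *\<^sub>R e) \<bullet> y)
          = (\<sigma> c x - \<sigma> c' x) * - (w' x \<bullet> y) + w x * (S c x * - (y \<bullet> e)) + w x * (S c' x * (y \<bullet> e))"
        by (simp add: inner_diff_left inner_commute algebra_simps)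
      moreover have "(\<sigma> c x - \<sigma> c' x) * (norm (w' x) * (\<rho> + h / 2)) + w x * (S c x * (h / 2 - s0)) + w x * (S c' x * (h / 2 + s1)) = ?g2 x"
        by (simp add: field_simps)
      ultimately show ?thesis by linarith
    qed
    show "slab e (c + d) c' \<in> sets borel" by (intro borel_open open_slab)
    show "\<sigma> c x - \<sigma> c' x = 1" if "x \<in> slab e (c + d) c'" for x using b(4)[of x] that by (auto simp: slab_def)
  qed
  then obtain t2 where t2: "t2 \<ge> 0" "?m (E \<inter> slab e (c + d) c') - \<delta> \<le> t2"
    "(1 - \<delta>) * CARD('n) * ?r (?m ?K2) * ?r t2 ^ (CARD('n) - 1) \<le> (LINT x|lborel. ?g2 x)" by blast
  have t2': "m2 - \<epsilon> \<le> t2"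
    using t2(2) \<epsilon>(1) measure_halfspace_diff[OF E_lmeasurable e cc] unfolding m2_def F_def by linarith
  \<comment> \<open>A lower bound for the relative volume gained by thickening the middle
    slab.\<close>
  define x where "x = h * \<beta> / m2"
  have x0: "x \<ge> 0" using h \<beta> m2 by (simp add: x_def)
  have mK2: "m2 * (1 + x) \<le> ?m ?K2"
  proof -
    have "?m (B \<inter> slab e s0 s1) = m2"
      using measure_halfspace_diff[OF B_lmeasurable e, of s0 s1] s01 by (simp add: m2_def Fs FB_def)
    moreover have "h * \<beta> \<le> h * section_area e \<rho> s" using \<beta>(2)[OF ss] h by simp
    ultimately have "m2 + h * \<beta> \<le> ?m ?K2" using K2(4) by linarith
    then show ?thesis using m2 by (simp add: x_def distrib_left)
  qed
  have term1: "m1 - \<epsilon> \<le> ?r m1 * ?r t1 ^ (CARD('n) - 1)"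
  proof (cases "m1 > 0")
    case True
    then show ?thesis using t1 \<epsilon>(1) nn \<epsilon>0 N by (intro root_mult_root_diff_ge) auto
  next
    case False
    have "0 \<le> m1" by (simp add: m1_def F_bounds)
    then have "0 \<le> ?r m1 * ?r t1 ^ (CARD('n) - 1)" using t1(1) by simp
    then show ?thesis using False \<epsilon>0 by linarith
  qed
  have term3: "m3 - \<epsilon> \<le> ?r m3 * ?r t3 ^ (CARD('n) - 1)"
  proof (cases "m3 > 0")
    case True
    then show ?thesis using t3 \<epsilon>0 N by (intro root_mult_root_diff_ge) auto
  next
    case False
    have "0 \<le> m3" using F_bounds(2)[of e c'] by (simp add: m3_def)
    then have "0 \<le> ?r m3 * ?r t3 ^ (CARD('n) - 1)" using t3(1) by simp
    then show ?thesis using False \<epsilon>0 by linarith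
  qed
  \<comment> \<open>\<open>root_one_plus_ge\<close> gives the gain x/(n(1 + x)), and its
    \<open>n\<close> cancels against the factor N. Replacing \<open>m2\<close> by its lower bound
    \<kappa> makes the estimate uniform in the slab.\<close>
  have term2: "CARD('n) * (m2 - \<epsilon>) + (1 - \<epsilon> / \<kappa>) * (h * \<beta>) / (1 + h * \<beta> / \<kappa>) \<le> CARD('n) * (?r (?m ?K2) * ?r t2 ^ (CARD('n) - 1))"
  proof -
    have N0: "real CARD('n) > 0" "CARD('n) > 0" using N by auto
    have "(1 + x / (CARD('n) * (1 + x))) * (m2 - \<epsilon>) \<le> ?r (1 + x) * (?r m2 * ?r t2 ^ (CARD('n) - 1))"
    proof (rule mult_mono)
      show "1 + x / (CARD('n) * (1 + x)) \<le> ?r (1 + x)" using root_one_plus_ge[OF N0(2) x0] .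
      show "m2 - \<epsilon> \<le> ?r m2 * ?r t2 ^ (CARD('n) - 1)" using m2 \<epsilon>0 t2(1) t2' N by (intro root_mult_root_diff_ge) auto
      show "0 \<le> ?r (1 + x)" using x0 by simp
      show "0 \<le> m2 - \<epsilon>" using m2 \<epsilon> by linarith
    qed
    also have "\<dots> = ?r (m2 * (1 + x)) * ?r t2 ^ (CARD('n) - 1)" by (simp add: real_root_mult mult_ac)
    also have "\<dots> \<le> ?r (?m ?K2) * ?r t2 ^ (CARD('n) - 1)"
      using mK2 N t2(1) by (intro mult_right_mono real_root_le_mono) auto
    finally have "CARD('n) * ((1 + x / (CARD('n) * (1 + x))) * (m2 - \<epsilon>)) \<le> CARD('n) * (?r (?m ?K2) * ?r t2 ^ (CARD('n) - 1))"
      using N0 by (intro mult_left_mono) auto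
    moreover have "CARD('n) * ((1 + x / (CARD('n) * (1 + x))) * (m2 - \<epsilon>)) = CARD('n) * (m2 - \<epsilon>) + (m2 - \<epsilon>) * x / (1 + x)"
    proof -
      have "CARD('n) * ((1 + q) * k) = CARD('n) * k + (CARD('n) * q) * k" for q k :: real by (simp add: algebra_simps)
      moreover have "CARD('n) * (x / (CARD('n) * (1 + x))) = x / (1 + x)" using N0 by simp
      ultimately show ?thesis by (simp only: times_divide_eq_left times_divide_eq_right mult.commute)
    qed
    moreover have "(1 - \<epsilon> / \<kappa>) * (h * \<beta>) / (1 + h * \<beta> / \<kappa>) \<le> (m2 - \<epsilon>) * x / (1 + x)"
    proof (rule frac_le)
      have "\<epsilon> / m2 \<le> \<epsilon> / \<kappa>" using m2 \<kappa> \<epsilon>0 by (intro divide_left_mono) auto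
      then have "(1 - \<epsilon> / \<kappa>) * (h * \<beta>) \<le> (1 - \<epsilon> / m2) * (h * \<beta>)" using h \<beta> by (intro mult_right_mono) auto
      also have "\<dots> = (m2 - \<epsilon>) * x" using m2 by (simp add: x_def field_simps)
      finally show "(1 - \<epsilon> / \<kappa>) * (h * \<beta>) \<le> (m2 - \<epsilon>) * x" .
      have "x \<le> h * \<beta> / \<kappa>" unfolding x_def using m2 \<kappa> h \<beta> by (intro divide_left_mono) auto
      then show "1 + x \<le> 1 + h * \<beta> / \<kappa>" by simp
      show "0 \<le> (m2 - \<epsilon>) * x" using m2 \<epsilon> x0 by simp
      show "0 < 1 + x" using x0 by simp
    qed
    ultimately show ?thesis by linarith
  qed
  have "(1 - \<delta>) * (CARD('n) * V - 3 * CARD('n) * \<epsilon> + (1 - \<epsilon> / \<kappa>) * (h * \<beta>) / (1 + h * \<beta> / \<kappa>))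
      \<le> (1 - \<delta>) * (CARD('n) * (?r m1 * ?r t1 ^ (CARD('n) - 1)) + CARD('n) * (?r (?m ?K2) * ?r t2 ^ (CARD('n) - 1)) + CARD('n) * (?r m3 * ?r t3 ^ (CARD('n) - 1)))"
  proof (rule mult_left_mono)
    have "CARD('n) * (m1 - \<epsilon>) \<le> CARD('n) * (?r m1 * ?r t1 ^ (CARD('n) - 1))" using term1 by (intro mult_left_mono) auto
    moreover have "CARD('n) * (m3 - \<epsilon>) \<le> CARD('n) * (?r m3 * ?r t3 ^ (CARD('n) - 1))" using term3 by (intro mult_left_mono) auto
    moreover have "CARD('n) * V = CARD('n) * m1 + CARD('n) * m2 + CARD('n) * m3" by (simp add: m1_def m2_def m3_def algebra_simps)
    ultimately show "CARD('n) * V - 3 * CARD('n) * \<epsilon> + (1 - \<epsilon> / \<kappa>) * (h * \<beta>) / (1 + h * \<beta> / \<kappa>)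
      \<le> CARD('n) * (?r m1 * ?r t1 ^ (CARD('n) - 1)) + CARD('n) * (?r (?m ?K2) * ?r t2 ^ (CARD('n) - 1)) + CARD('n) * (?r m3 * ?r t3 ^ (CARD('n) - 1))"
      using term2 by (simp add: right_diff_distrib)
  qed (use \<delta> in auto)
  also have "\<dots> \<le> (LINT x|lborel. ?g1 x) + (LINT x|lborel. ?g2 x) + (LINT x|lborel. ?g3 x)"
    using t1(3) t2(3) t3(3) by (simp only: distrib_left mult.assoc)
  also have "\<dots> = (LINT x|lborel. ?g1 x + ?g2 x + ?g3 x)"
  proof -
    have a: "integrable lborel ?g1" "integrable lborel ?g2" "integrable lborel ?g3" using i1 i2 i3 iS by auto
    show ?thesis using Bochner_Integration.integral_add[OF a(1,2)] Bochner_Integration.integral_add[OF Bochner_Integration.integrable_add[OF a(1,2)] a(3)] by simp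
  qed
  also have "\<dots> = (LINT x|lborel. \<rho> * norm (w' x) + h / 2 * ((\<sigma> c x - \<sigma> c' x) * norm (w' x) + w x * (S c x + S c' x)))"
    by (intro Bochner_Integration.integral_cong refl) (simp add: algebra_simps)
  also have "\<dots> = \<rho> * (LINT x|lborel. norm (w' x)) + h / 2 * (LINT x|lborel. (\<sigma> c x - \<sigma> c' x) * norm (w' x) + w x * (S c x + S c' x))"
  proof -
    have "integrable lborel (\<lambda>x. (\<sigma> c x - \<sigma> c' x) * norm (w' x) + w x * (S c x + S c' x))"
      using i2 iS by (simp add: distrib_left)
    then show ?thesis using w(5) by simp
  qed
  also have "\<dots> \<le> \<rho> * (P + \<delta>) + h / 2 * (LINT x|lborel. (\<sigma> c x - \<sigma> c' x) * norm (w' x) + w x * (S c x + S c' x))"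
    using w(6) \<rho> by (intro add_right_mono mult_left_mono) auto
  finally show ?thesis by (simp add: bump S_def)
qed

end

context equality_case
begin

text \<open>Averaging over the position of a slab of width \<alpha>. A point lies in the slab only
  for positions in an interval of length \<alpha> + d, so the perimeter contributes at most
  (\<alpha> + d)(P + \<delta>); each face sweeps out at most the volume between \<open>c0\<close>
  and \<open>c1 + d\<close>, up to \<delta>.\<close>

lemma bump_average:
  assumes e: "e \<in> Basis" and A: "perimeter_approximant E E P \<delta> w w' R" and \<delta>: "0 < \<delta>"
    and d: "d > 0" and \<alpha>: "d \<le> \<alpha>" "c0 \<le> c1 - \<alpha>"
    and Q: "\<And>c. c0 \<le> c \<Longrightarrow> c \<le> c1 - \<alpha> \<Longrightarrow>
      Q \<le> (LINT x|lborel. slab_bump e d c (c + \<alpha>) x * norm (w' x) + w x * (trans_density e d c x + trans_density e d (c + \<alpha>) x))"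
  shows "(c1 - \<alpha> - c0) * Q \<le> (\<alpha> + d) * (P + \<delta>) + 2 * (F e (c1 + d) - F e c0 + \<delta>)"
proof -
  note w = perimeter_approximantD[OF A]
  let ?I = "{c0..c1 - \<alpha>}" and ?S = "slab e c0 (c1 + d)"
  have \<alpha>0: "\<alpha> > 0" using d \<alpha> by simp
  have wm [measurable]: "w \<in> borel_measurable borel" and w'm [measurable]: "w' \<in> borel_measurable borel"
    using C1_gradientD(4,5)[OF w(1)] by auto
  have b01: "0 \<le> slab_bump e d c (c + \<alpha>) x" "slab_bump e d c (c + \<alpha>) x \<le> 1" for c x
    using slab_bump_bounds(1,2)[OF d, of c "c + \<alpha>"] \<alpha> by auto
  have t0: "0 \<le> trans_density e d c x" for c x by (rule trans_density_facts(1)[OF d])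
  define J where "J c x = ennreal (slab_bump e d c (c + \<alpha>) x) * ennreal (norm (w' x)) +
    ennreal (w x) * (ennreal (trans_density e d c x) + ennreal (trans_density e d (c + \<alpha>) x))" for c x
  have Jm: "(\<lambda>(c, x). J c x * indicator ?I c) \<in> borel_measurable (lborel \<Otimes>\<^sub>M lborel)"
    unfolding J_def slab_bump_def trans_density_def by measurable
  have Sm: "?S \<in> sets borel" by (intro borel_open open_slab)
  have J: "ennreal Q \<le> (\<integral>\<^sup>+x. J c x \<partial>lborel)" if "c \<in> ?I" for c
  proof -
    let ?f = "\<lambda>x. slab_bump e d c (c + \<alpha>) x * norm (w' x) + w x * (trans_density e d c x + trans_density e d (c + \<alpha>) x)"
    have "ennreal Q \<le> ennreal (LINT x|lborel. ?f x)" using Q that by (intro ennreal_leI) auto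
    also have "\<dots> \<le> (\<integral>\<^sup>+x. ennreal (?f x) \<partial>lborel)"
    \<comment> \<open>A nonintegrable integrand would have Bochner integral 0, and then the bound is
      trivial.\<close>
    proof (cases "integrable lborel ?f")
      case True
      then show ?thesis using b01 t0 w(2) by (subst nn_integral_eq_integral) auto
    qed (simp add: not_integrable_integral_eq)
    also have "\<dots> = (\<integral>\<^sup>+x. J c x \<partial>lborel)"
      unfolding J_def using b01 t0 w(2) by (intro nn_integral_cong) (simp add: ennreal_mult)
    finally show ?thesis .
  qed
  have "ennreal Q * ennreal (c1 - \<alpha> - c0) = (\<integral>\<^sup>+c\<in>?I. ennreal Q \<partial>lborel)"
    using \<alpha> by (simp add: nn_integral_cmult)
  also have "\<dots> \<le> (\<integral>\<^sup>+c. (\<integral>\<^sup>+x. J c x * indicator ?I c \<partial>lborel) \<partial>lborel)"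
  proof (rule nn_integral_mono)
    fix c show "ennreal Q * indicator ?I c \<le> (\<integral>\<^sup>+x. J c x * indicator ?I c \<partial>lborel)"
      using J[of c] by (cases "c \<in> ?I") auto
  qed
  also have "\<dots> = (\<integral>\<^sup>+x. (\<integral>\<^sup>+c. J c x * indicator ?I c \<partial>lborel) \<partial>lborel)"
    by (rule lborel_pair.Fubini'[symmetric]) (use Jm in measurable)
  also have "\<dots> \<le> (\<integral>\<^sup>+x. ennreal (\<alpha> + d) * ennreal (norm (w' x)) + 2 * (ennreal (w x) * indicator ?S x) \<partial>lborel)"
  proof (rule nn_integral_mono)
    fix x :: "real^'n"
    have meas1: "(\<lambda>c. ennreal (slab_bump e d c (c + \<alpha>) x) * indicator ?I c) \<in> borel_measurable lborel"
      "(\<lambda>c. ennreal (trans_density e d c x) * indicator ?I c) \<in> borel_measurable lborel"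
      "(\<lambda>c. ennreal (trans_density e d (c + \<alpha>) x) * indicator ?I c) \<in> borel_measurable lborel"
      unfolding slab_bump_def trans_density_def by measurable
    have "(\<integral>\<^sup>+c. J c x * indicator ?I c \<partial>lborel)
      = (\<integral>\<^sup>+c. ennreal (norm (w' x)) * (ennreal (slab_bump e d c (c + \<alpha>) x) * indicator ?I c) +
        (ennreal (w x) * (ennreal (trans_density e d c x) * indicator ?I c) +
         ennreal (w x) * (ennreal (trans_density e d (c + \<alpha>) x) * indicator ?I c)) \<partial>lborel)"
      by (intro nn_integral_cong) (simp add: J_def distrib_left distrib_right mult_ac)
    also have "\<dots> = ennreal (norm (w' x)) * (\<integral>\<^sup>+c. ennreal (slab_bump e d c (c + \<alpha>) x) * indicator ?I c \<partial>lborel) +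
        (ennreal (w x) * (\<integral>\<^sup>+c. ennreal (trans_density e d c x) * indicator ?I c \<partial>lborel) +
         ennreal (w x) * (\<integral>\<^sup>+c. ennreal (trans_density e d (c + \<alpha>) x) * indicator ?I c \<partial>lborel))"
      using meas1 by (simp add: nn_integral_add nn_integral_cmult)
    also have "\<dots> \<le> ennreal (norm (w' x)) * ennreal (\<alpha> + d) + (ennreal (w x) * indicator ?S x + ennreal (w x) * indicator ?S x)"
    proof (intro add_mono mult_left_mono)
      have "(\<integral>\<^sup>+c. ennreal (slab_bump e d c (c + \<alpha>) x) * indicator ?I c \<partial>lborel) \<le> (\<integral>\<^sup>+c. indicator {x \<bullet> e - \<alpha> - d..x \<bullet> e} c \<partial>lborel)"
      proof (rule nn_integral_mono)
        fix c
        show "ennreal (slab_bump e d c (c + \<alpha>) x) * indicator ?I c \<le> indicator {x \<bullet> e - \<alpha> - d..x \<bullet> e} c"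
          using slab_bump_bounds(3)[OF d, of c "c + \<alpha>" x e] b01[of c x] \<alpha>
          by (cases "c \<in> {x \<bullet> e - \<alpha> - d..x \<bullet> e}") (auto simp: indicator_def)
      qed
      then show "(\<integral>\<^sup>+c. ennreal (slab_bump e d c (c + \<alpha>) x) * indicator ?I c \<partial>lborel) \<le> ennreal (\<alpha> + d)"
        using \<alpha>0 d by simp
      have one: "(\<integral>\<^sup>+c. ennreal (trans_density e d (c + a) x) \<partial>lborel) = 1" for a
      proof -
        have "(\<integral>\<^sup>+c. ennreal (trans_density e d (c + a) x) \<partial>lborel) = (\<integral>\<^sup>+c. ennreal (smooth_step' (((x \<bullet> e - a) - c) / d) / d) \<partial>lborel)"
          by (intro nn_integral_cong) (simp add: trans_density_def algebra_simps)
        then show ?thesis using nn_integral_smooth_step'[OF d, of "x \<bullet> e - a"] by simp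
      qed
      have bnd: "(\<integral>\<^sup>+c. ennreal (trans_density e d (c + a) x) * indicator ?I c \<partial>lborel) \<le> indicator ?S x" if a: "0 \<le> a" "a \<le> \<alpha>" for a
      proof (cases "x \<in> ?S")
        case True
        have "(\<integral>\<^sup>+c. ennreal (trans_density e d (c + a) x) * indicator ?I c \<partial>lborel) \<le> (\<integral>\<^sup>+c. ennreal (trans_density e d (c + a) x) \<partial>lborel)"
          by (intro nn_integral_mono) (auto simp: indicator_def)
        then show ?thesis using True one[of a] by simp
      next
        case False
        have z: "ennreal (trans_density e d (c + a) x) * indicator ?I c = 0" for c
          using trans_density_facts(4)[OF d, of e "c + a" x] False a by (cases "trans_density e d (c + a) x = 0") (auto simp: slab_def indicator_def)
        show ?thesis unfolding z by simp
      qed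
      show "(\<integral>\<^sup>+c. ennreal (trans_density e d c x) * indicator ?I c \<partial>lborel) \<le> indicator ?S x" using bnd[of 0] \<alpha>0 by simp
      show "(\<integral>\<^sup>+c. ennreal (trans_density e d (c + \<alpha>) x) * indicator ?I c \<partial>lborel) \<le> indicator ?S x" using bnd[of \<alpha>] \<alpha>0 by simp
    qed auto
    also have "\<dots> = ennreal (\<alpha> + d) * ennreal (norm (w' x)) + 2 * (ennreal (w x) * indicator ?S x)"
      by (simp add: mult.commute mult_2)
    finally show "(\<integral>\<^sup>+c. J c x * indicator ?I c \<partial>lborel) \<le> ennreal (\<alpha> + d) * ennreal (norm (w' x)) + 2 * (ennreal (w x) * indicator ?S x)" .
  qed
  also have "\<dots> = ennreal (\<alpha> + d) * (\<integral>\<^sup>+x. ennreal (norm (w' x)) \<partial>lborel) + 2 * (\<integral>\<^sup>+x. ennreal (w x) * indicator ?S x \<partial>lborel)"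
    using Sm by (simp add: nn_integral_add nn_integral_cmult)
  also have "(\<integral>\<^sup>+x. ennreal (norm (w' x)) \<partial>lborel) = ennreal (LINT x|lborel. norm (w' x))"
    using w(5) by (intro nn_integral_eq_integral) auto
  also have "\<dots> \<le> ennreal (P + \<delta>)" using w(6) by (rule ennreal_leI)
  also have "(\<integral>\<^sup>+x. ennreal (w x) * indicator ?S x \<partial>lborel) \<le> ennreal (F e (c1 + d) - F e c0 + \<delta>)"
  proof -
    have i: "(indicat_real ?S) \<in> borel_measurable borel" using Sm by simp
    note wS = approximant_integral_le[OF A E fin i indicator_pos_le indicator_le_1 \<delta>]
    have "(\<integral>\<^sup>+x. ennreal (w x) * indicator ?S x \<partial>lborel) = (\<integral>\<^sup>+x. ennreal (w x * indicator ?S x) \<partial>lborel)"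
      by (intro nn_integral_cong) (auto simp: indicator_def)
    also have "\<dots> = ennreal (LINT x|lborel. w x * indicator ?S x)"
      using wS(1) w(2) by (intro nn_integral_eq_integral) auto
    also have "\<dots> \<le> ennreal ((LINT x|lborel. indicator E x * indicat_real ?S x) + 1 * \<delta>)" by (rule ennreal_leI[OF wS(2)])
    also have "(LINT x|lborel. indicator E x * indicat_real ?S x) = measure lborel (E \<inter> ?S)"
      by (simp flip: indicator_inter_arith)
    also have "measure lborel (E \<inter> ?S) = F e (c1 + d) - F e c0"
      using measure_halfspace_diff[OF E_lmeasurable e, of c0 "c1 + d"] \<alpha> d \<alpha>0 Sm E by (simp add: F_def)
    finally show ?thesis by simp
  qed
  finally have main: "ennreal Q * ennreal (c1 - \<alpha> - c0) \<le> ennreal (\<alpha> + d) * ennreal (P + \<delta>) + 2 * ennreal (F e (c1 + d) - F e c0 + \<delta>)"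
    by (simp add: add_mono mult_left_mono)
  have Fd: "0 \<le> F e (c1 + d) - F e c0" using F_mono[of c0 "c1 + d" e] \<alpha> d \<alpha>0 by simp
  have P0: "P > 0" by (rule P_pos)
  show ?thesis
  \<comment> \<open>\<open>ennreal\<close> sends negative numbers to 0, so a nonpositive
    \<open>Q\<close> is treated separately.\<close>
  proof (cases "Q \<le> 0")
    case True
    then have "(c1 - \<alpha> - c0) * Q \<le> 0" using \<alpha> by (intro mult_nonneg_nonpos) auto
    also have "0 \<le> (\<alpha> + d) * (P + \<delta>) + 2 * (F e (c1 + d) - F e c0 + \<delta>)" using Fd P0 \<delta> \<alpha>0 d by simp
    finally show ?thesis .
  next
    case False
    have two: "(2::ennreal) = ennreal 2" by simp
    have "ennreal (Q * (c1 - \<alpha> - c0)) \<le> ennreal ((\<alpha> + d) * (P + \<delta>) + 2 * (F e (c1 + d) - F e c0 + \<delta>))"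
    proof -
      have sum: "ennreal (a * p + 2 * y) = ennreal a * ennreal p + ennreal 2 * ennreal y" if "0 \<le> a" "0 \<le> p" "0 \<le> y" for a p y :: real
        using that by (simp add: ennreal_mult ennreal_plus del: ennreal_numeral)
      have "ennreal (Q * (c1 - \<alpha> - c0)) = ennreal Q * ennreal (c1 - \<alpha> - c0)" using False \<alpha> by (intro ennreal_mult) auto
      then show ?thesis using main Fd P0 \<delta> \<alpha>0 d unfolding two by (subst sum) auto
    qed
    then have "Q * (c1 - \<alpha> - c0) \<le> (\<alpha> + d) * (P + \<delta>) + 2 * (F e (c1 + d) - F e c0 + \<delta>)"
      using Fd P0 \<delta> \<alpha>0 d by (subst (asm) ennreal_le_iff) auto
    then show ?thesis by (simp add: mult.commute)
  qed
qed

lemma FB_strict: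
  assumes e: "e \<in> Basis" and s: "- \<rho> \<le> s" "s < s'" "s' \<le> \<rho>"
  shows "FB e s < FB e s'"
proof -
  have "open (B \<inter> slab e s s')" "bounded (B \<inter> slab e s s')" by (auto simp: open_slab intro: bounded_Int)
  moreover have "((s + s') / 2) *\<^sub>R e \<in> B \<inter> slab e s s'" using e s by (auto simp: slab_def abs_less_iff)
  ultimately have "measure lebesgue (B \<inter> slab e s s') > 0" by (rule measure_pos_open)
  then show ?thesis using measure_halfspace_diff[OF B_lmeasurable e, of s s'] s by (simp add: FB_def)
qed

lemma FB_ends:
  assumes e: "e \<in> Basis" shows "FB e (- \<rho>) = 0" "FB e \<rho> = V"
proof -
  have b: "\<bar>x \<bullet> e\<bar> < \<rho>" if "x \<in> B" for x using that Basis_le_norm[OF e, of x] by simp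
  have "B \<inter> {x. x \<bullet> e < - \<rho>} = {}" "B \<inter> {x. x \<bullet> e < \<rho>} = B" using b by fastforce+
  then show "FB e (- \<rho>) = 0" "FB e \<rho> = V" by (simp_all add: FB_def V_def vol)
qed

text \<open>Per unit of height, \<open>E\<close> has at least the volume \<beta>, a lower bound for
  the sections of the matching part of the ball. Three limits are taken in this order: the
  approximation error \<epsilon>, then the thickening \<open>h\<close>, which removes the
  second-order terms, then the width \<alpha>, which removes \<alpha> P.\<close>

lemma F_increment:
  assumes e: "e \<in> Basis" and c: "c0 < c1" and s: "- \<rho> < s0" "s1 < \<rho>" and s01: "s0 \<le> s1" and Fs: "F e c0 = FB e s0" "F e c1 = FB e s1"
    and \<beta>: "0 < \<beta>" "\<And>s. s0 \<le> s \<Longrightarrow> s \<le> s1 \<Longrightarrow> \<beta> \<le> section_area e \<rho> s"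
  shows "(c1 - c0) * \<beta> \<le> F e c1 - F e c0"
proof -
  have F0: "0 < F e c0" using FB_strict[OF e, of "- \<rho>" s0] s s01 FB_ends[OF e] Fs by simp
  have FV: "F e c1 < V" using FB_strict[OF e, of s1 \<rho>] s s01 FB_ends[OF e] Fs by simp
  have sel: "\<exists>t. s0 \<le> t \<and> t \<le> s1 \<and> F e c = FB e t" if "c0 \<le> c" "c \<le> c1" for c
  proof -
    have "FB e s0 \<le> F e c" "F e c \<le> FB e s1" using that Fs F_mono[of c0 c e] F_mono[of c c1 e] by auto
    then show ?thesis using IVT'[of "FB e" s0 "F e c" s1] s01 continuous_on_F(2)[OF e] by metis
  qed
  have step_a: "2 * (c1 - \<alpha> - c0) * \<beta> \<le> \<alpha> * P + 2 * (F e c1 - F e c0)" if \<alpha>: "0 < \<alpha>" "\<alpha> < c1 - c0" for \<alpha>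
  proof -
    define G where "G c = F e (c + \<alpha>) - F e c" for c
    have "continuous_on {c0..c1 - \<alpha>} G"
      unfolding G_def by (intro continuous_on_diff continuous_on_F(1)[OF e] continuous_on_compose2[OF continuous_on_F(1)[OF e, of UNIV]] continuous_intros) auto
    then obtain cm where cm: "cm \<in> {c0..c1 - \<alpha>}" "\<And>c. c \<in> {c0..c1 - \<alpha>} \<Longrightarrow> G cm \<le> G c"
      using continuous_attains_inf[of "{c0..c1 - \<alpha>}" G] \<alpha> by auto
    \<comment> \<open>The least volume of a slab of width \<alpha> in the range, positive by
      \<open>F_no_gap\<close> and compactness; it bounds the relative thickening of all middle slabs
      at once.\<close>
    define \<kappa> where "\<kappa> = G cm"
    have "0 < F e cm" "F e cm < V" using cm(1) F0 FV F_mono[of c0 cm e] F_mono[of cm c1 e] \<alpha> by auto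
    then have \<kappa>: "\<kappa> > 0" using F_no_gap[OF e, of cm "cm + \<alpha>"] \<alpha> by (simp add: \<kappa>_def G_def)
    have \<kappa>c: "\<kappa> \<le> F e (c + \<alpha>) - F e c" if "c0 \<le> c" "c \<le> c1 - \<alpha>" for c using cm(2)[of c] that by (simp add: \<kappa>_def G_def)
    have step_h: "(c1 - \<alpha> - c0) * (2 * (\<beta> / (1 + h * \<beta> / \<kappa>))) \<le> \<alpha> * P + 2 * (F e c1 - F e c0)" if h: "h > 0" for h
    proof -
      define X where "X = h * \<beta> / (1 + h * \<beta> / \<kappa>)"
      let ?N = "real CARD('n)"
      \<comment> \<open>The lower bound on perimeter plus faces that results from solving
        \<open>three_slab_inequality\<close> for the integral, with \<rho> P = N V. At \<epsilon> =
        0 it is 2 X / h.\<close>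
      let ?Q = "\<lambda>\<epsilon>. (2 / h) * ((1 - \<epsilon>) * (?N * V - 3 * ?N * \<epsilon> + (1 - \<epsilon> / \<kappa>) * X) - ?N * V - \<rho> * \<epsilon>)"
      have step_e: "(c1 - \<alpha> - c0) * ?Q \<epsilon> \<le> (\<alpha> + \<epsilon>) * (P + \<epsilon>) + 2 * (F e c1 - F e c0 + 2 * \<epsilon>)"
        if \<epsilon>: "0 < \<epsilon>" "\<epsilon> < 1" "\<epsilon> \<le> \<kappa>" "3 * \<epsilon> \<le> V" for \<epsilon>
      proof -
        have "uniformly_continuous_on {c0..c1 + 1} (F e)"
          by (intro compact_uniformly_continuous continuous_on_F e) auto
        then obtain d1 where d1: "d1 > 0" "\<And>x y. x \<in> {c0..c1+1} \<Longrightarrow> y \<in> {c0..c1+1} \<Longrightarrow> dist y x < d1 \<Longrightarrow> dist (F e y) (F e x) < \<epsilon> / 2"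
          using \<epsilon>(1) unfolding uniformly_continuous_on_def by (metis half_gt_zero)
        define d where "d = min (min 1 (d1 / 2)) (min \<alpha> \<epsilon>)"
        have d: "d > 0" "d \<le> 1" "d < d1" "d \<le> \<alpha>" "d \<le> \<epsilon>" using d1(1) \<alpha> \<epsilon> by (auto simp: d_def)
        define \<delta> where "\<delta> = \<epsilon> / 2"
        have \<delta>: "0 < \<delta>" "\<delta> < 1" "\<delta> \<le> \<epsilon>" using \<epsilon> by (auto simp: \<delta>_def)
        have Fd: "\<delta> + (F e (c + d) - F e c) \<le> \<epsilon>" if "c0 \<le> c" "c \<le> c1" for c
        proof -
          have "\<bar>F e (c + d) - F e c\<bar> < \<epsilon> / 2" using d1(2)[of c "c + d"] that d by (auto simp: dist_real_def)
          then show ?thesis unfolding \<delta>_def by linarith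
        qed
        obtain w w' R where A: "perimeter_approximant E E P \<delta> w w' R" using approximant_exists[OF \<delta>(1,2)] by blast
        have "(c1 - \<alpha> - c0) * ?Q \<epsilon> \<le> (\<alpha> + d) * (P + \<delta>) + 2 * (F e (c1 + d) - F e c0 + \<delta>)"
        proof (rule bump_average[OF e A \<delta>(1) d(1) d(4)])
          show "c0 \<le> c1 - \<alpha>" using \<alpha> by simp
          fix c assume cc: "c0 \<le> c" "c \<le> c1 - \<alpha>"
          obtain t where t: "s0 \<le> t" "t \<le> s1" "F e c = FB e t" using sel[of c] cc \<alpha> by auto
          obtain t' where t': "s0 \<le> t'" "t' \<le> s1" "F e (c + \<alpha>) = FB e t'" using sel[of "c + \<alpha>"] cc \<alpha> by auto
          let ?\<Phi> = "LINT x|lborel. slab_bump e d c (c + \<alpha>) x * norm (w' x) + w x * (trans_density e d c x + trans_density e d (c + \<alpha>) x)"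
          have "(1 - \<delta>) * (CARD('n) * V - 3 * CARD('n) * \<epsilon> + (1 - \<epsilon> / \<kappa>) * (h * \<beta>) / (1 + h * \<beta> / \<kappa>)) \<le> \<rho> * (P + \<delta>) + h / 2 * ?\<Phi>"
          proof (rule three_slab_inequality[OF e A \<delta>(1,2) d(1)])
            show "- \<rho> < t" "t' < \<rho>" using s t t' by auto
            show "\<beta> \<le> section_area e \<rho> u" if "t < u" "u < t'" for u using \<beta>(2)[of u] t t' that by auto
            show "\<delta> + (F e (c + d) - F e c) \<le> \<epsilon>" "\<delta> + (F e (c + \<alpha> + d) - F e (c + \<alpha>)) \<le> \<epsilon>"
              using Fd[of c] Fd[of "c + \<alpha>"] cc \<alpha> by auto
            show "\<kappa> \<le> F e (c + \<alpha>) - F e c" using \<kappa>c[OF cc] .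
          qed (use d h \<beta> \<kappa> \<epsilon> t t' in auto)
          then have "(1 - \<delta>) * (?N * V - 3 * ?N * \<epsilon> + (1 - \<epsilon> / \<kappa>) * X) \<le> \<rho> * (P + \<delta>) + h / 2 * ?\<Phi>"
            by (simp add: X_def)
          moreover have "(1 - \<epsilon>) * (?N * V - 3 * ?N * \<epsilon> + (1 - \<epsilon> / \<kappa>) * X) \<le> (1 - \<delta>) * (?N * V - 3 * ?N * \<epsilon> + (1 - \<epsilon> / \<kappa>) * X)"
          proof (rule mult_right_mono)
            have "?N * (3 * \<epsilon>) \<le> ?N * V" using \<epsilon> by (intro mult_left_mono) auto
            moreover have "0 \<le> (1 - \<epsilon> / \<kappa>) * X" using \<epsilon> \<kappa> h \<beta> by (simp add: X_def)
            ultimately show "0 \<le> ?N * V - 3 * ?N * \<epsilon> + (1 - \<epsilon> / \<kappa>) * X" by (simp add: mult_ac)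
          qed (use \<delta> in simp)
          moreover have "\<rho> * \<delta> \<le> \<rho> * \<epsilon>" using \<delta> \<rho> by simp
          moreover have "\<rho> * (P + \<delta>) = ?N * V + \<rho> * \<delta>" using \<rho>P by (simp add: distrib_left)
          ultimately have "(1 - \<epsilon>) * (?N * V - 3 * ?N * \<epsilon> + (1 - \<epsilon> / \<kappa>) * X) - ?N * V - \<rho> * \<epsilon> \<le> h / 2 * ?\<Phi>"
            by linarith
          then have "(2 / h) * ((1 - \<epsilon>) * (?N * V - 3 * ?N * \<epsilon> + (1 - \<epsilon> / \<kappa>) * X) - ?N * V - \<rho> * \<epsilon>) \<le> (2 / h) * (h / 2 * ?\<Phi>)"
            using h by (intro mult_left_mono) auto
          then show "?Q \<epsilon> \<le> ?\<Phi>" using h by simp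
        qed
        also have "\<dots> \<le> (\<alpha> + \<epsilon>) * (P + \<epsilon>) + 2 * (F e c1 - F e c0 + 2 * \<epsilon>)"
        proof -
          have "(\<alpha> + d) * (P + \<delta>) \<le> (\<alpha> + \<epsilon>) * (P + \<epsilon>)" using d \<delta> \<alpha> \<epsilon> P_pos by (intro mult_mono) auto
          moreover have "F e (c1 + d) - F e c1 \<le> \<epsilon>" using Fd[of c1] c \<delta> by simp
          then have "F e (c1 + d) - F e c0 + \<delta> \<le> F e c1 - F e c0 + 2 * \<epsilon>" using \<delta>(3) by simp
          then have "2 * (F e (c1 + d) - F e c0 + \<delta>) \<le> 2 * (F e c1 - F e c0 + 2 * \<epsilon>)" by simp
          ultimately show ?thesis by (rule add_mono)
        qed
        finally show ?thesis .
      qed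
      have "(c1 - \<alpha> - c0) * ((2 / h) * ((1 - 0) * (?N * V - 3 * ?N * 0 + (1 - 0 / \<kappa>) * X) - ?N * V - \<rho> * 0)) \<le> (\<alpha> + 0) * (P + 0) + 2 * (F e c1 - F e c0 + 2 * 0)"
      proof (rule tendsto_le[of "at_right (0::real)"])
        show "((\<lambda>\<epsilon>. (c1 - \<alpha> - c0) * ?Q \<epsilon>) \<longlongrightarrow> (c1 - \<alpha> - c0) * ((2 / h) * ((1 - 0) * (?N * V - 3 * ?N * 0 + (1 - 0 / \<kappa>) * X) - ?N * V - \<rho> * 0))) (at_right 0)"
          using \<kappa> h by (intro tendsto_intros) auto
        show "((\<lambda>\<epsilon>. (\<alpha> + \<epsilon>) * (P + \<epsilon>) + 2 * (F e c1 - F e c0 + 2 * \<epsilon>)) \<longlongrightarrow> (\<alpha> + 0) * (P + 0) + 2 * (F e c1 - F e c0 + 2 * 0)) (at_right 0)"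
          by (intro tendsto_intros)
        show "\<forall>\<^sub>F \<epsilon> in at_right 0. (c1 - \<alpha> - c0) * ?Q \<epsilon> \<le> (\<alpha> + \<epsilon>) * (P + \<epsilon>) + 2 * (F e c1 - F e c0 + 2 * \<epsilon>)"
        proof (rule eventually_mono)
          show "eventually (\<lambda>\<epsilon>. \<epsilon> \<in> {0<..<min (min 1 \<kappa>) (V / 3)}) (at_right (0::real))"
            using \<kappa> V_pos by (intro eventually_at_right_real) auto
        qed (rule step_e, auto)
      qed simp
      then show ?thesis using h by (simp add: X_def)
    qed
    have "(c1 - \<alpha> - c0) * (2 * (\<beta> / (1 + 0 * \<beta> / \<kappa>))) \<le> \<alpha> * P + 2 * (F e c1 - F e c0)"
    proof (rule tendsto_upperbound[of _ _ "at_right (0::real)"])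
      show "((\<lambda>h. (c1 - \<alpha> - c0) * (2 * (\<beta> / (1 + h * \<beta> / \<kappa>)))) \<longlongrightarrow> (c1 - \<alpha> - c0) * (2 * (\<beta> / (1 + 0 * \<beta> / \<kappa>)))) (at_right 0)"
        using \<kappa> by (intro tendsto_intros) auto
      show "\<forall>\<^sub>F h in at_right 0. (c1 - \<alpha> - c0) * (2 * (\<beta> / (1 + h * \<beta> / \<kappa>))) \<le> \<alpha> * P + 2 * (F e c1 - F e c0)"
        by (rule eventually_mono[OF eventually_at_right_less step_h])
    qed simp
    then show ?thesis by (simp add: mult_ac)
  qed
  have "2 * (c1 - 0 - c0) * \<beta> \<le> 0 * P + 2 * (F e c1 - F e c0)"
  proof (rule tendsto_le[of "at_right (0::real)"])
    show "((\<lambda>\<alpha>. 2 * (c1 - \<alpha> - c0) * \<beta>) \<longlongrightarrow> 2 * (c1 - 0 - c0) * \<beta>) (at_right 0)" by (intro tendsto_intros)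
    show "((\<lambda>\<alpha>. \<alpha> * P + 2 * (F e c1 - F e c0)) \<longlongrightarrow> 0 * P + 2 * (F e c1 - F e c0)) (at_right 0)" by (intro tendsto_intros)
    show "\<forall>\<^sub>F \<alpha> in at_right 0. 2 * (c1 - \<alpha> - c0) * \<beta> \<le> \<alpha> * P + 2 * (F e c1 - F e c0)"
    proof (rule eventually_mono)
      show "eventually (\<lambda>\<alpha>. \<alpha> \<in> {0<..<c1 - c0}) (at_right (0::real))" using c by (intro eventually_at_right_real) auto
    qed (rule step_a, auto)
  qed simp
  then show ?thesis by (simp add: algebra_simps)
qed

end

section \<open>From volumes of slabs to a ball\<close>

text \<open>\<open>D\<close> is exactly the set where \<open>h\<close> is negative, so passing from
  \<open>A\<close> to \<open>D\<close> only removes nonnegative and adds negative contributions;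
  equality forces \<open>A\<close> to contain almost all of \<open>D\<close>. Subtracting a suitable
  constant in \<open>h\<close> turns this into a comparison of sets of equal measure.\<close>

lemma bathtub:
  fixes h :: "'a \<Rightarrow> real"
  assumes A [measurable]: "A \<in> sets M" and D [measurable]: "D \<in> sets M"
    and iA: "integrable M (\<lambda>x. indicator A x * h x)" and iD: "integrable M (\<lambda>x. indicator D x * h x)"
    and neg: "\<And>x. x \<in> D \<Longrightarrow> h x < 0" and pos: "\<And>x. x \<notin> D \<Longrightarrow> 0 \<le> h x"
  shows "(LINT x|M. indicator D x * h x) \<le> (LINT x|M. indicator A x * h x)"
    and "(LINT x|M. indicator A x * h x) \<le> (LINT x|M. indicator D x * h x) \<Longrightarrow> D - A \<in> null_sets M"
proof -
  let ?g = "\<lambda>x. indicator A x * h x - indicator D x * h x"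
  have ig: "integrable M ?g" using iA iD by simp
  have g0: "0 \<le> ?g x" for x
    using neg[of x] pos[of x] by (auto simp: indicator_def)
  have int: "(LINT x|M. ?g x) = (LINT x|M. indicator A x * h x) - (LINT x|M. indicator D x * h x)"
    using iA iD by simp
  moreover have "0 \<le> (LINT x|M. ?g x)" using g0 by (intro Bochner_Integration.integral_nonneg) auto
  ultimately show "(LINT x|M. indicator D x * h x) \<le> (LINT x|M. indicator A x * h x)" by simp
  assume "(LINT x|M. indicator A x * h x) \<le> (LINT x|M. indicator D x * h x)"
  with int \<open>0 \<le> (LINT x|M. ?g x)\<close> have "(LINT x|M. ?g x) = 0" by linarith
  then have "AE x in M. ?g x = 0"
    using ig g0 by (subst (asm) integral_nonneg_eq_0_iff_AE) auto
  then have "AE x in M. x \<notin> D - A"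
    by eventually_elim (use neg in \<open>force simp: indicator_def\<close>)
  then show "D - A \<in> null_sets M" by (subst AE_iff_null_sets) auto
qed

text \<open>Two sets of equal finite measure exceed their intersection by the same amount.\<close>

lemma null_sets_Diff_swap:
  assumes A: "A \<in> fmeasurable M" and D: "D \<in> fmeasurable M" and eq: "measure M A = measure M D" and null: "D - A \<in> null_sets M"
  shows "A - D \<in> null_sets M"
proof -
  have m0: "measure M (D - A) = 0" using null by (simp add: measure_eq_0_null_sets)
  have "measure M X = measure M (X \<inter> Y) + measure M (X - Y)" if "X \<in> fmeasurable M" "Y \<in> fmeasurable M" for X Y
  proof -
    have "measure M ((X \<inter> Y) \<union> (X - Y)) = measure M (X \<inter> Y) + measure M (X - Y)"
    proof -
      have "X \<inter> Y \<inter> (X - Y) = {}" by auto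
      then show ?thesis using measure_Un3[of "X \<inter> Y" M "X - Y"] that by (simp add: fmeasurable.Int fmeasurable.Diff)
    qed
    then show ?thesis by (simp add: Un_Diff_Int Un_commute)
  qed
  from this[OF A D] this[OF D A] have "measure M A = measure M (D \<inter> A) + measure M (A - D)"
    "measure M D = measure M (D \<inter> A) + measure M (D - A)" by (simp_all add: Int_commute)
  then have "measure M (A - D) = 0" using m0 eq by simp
  moreover have AD: "A - D \<in> fmeasurable M" using A D by auto
  ultimately have "emeasure M (A - D) = 0" using emeasure_eq_measure2[OF AD] by simp
  then show ?thesis using AD by (intro null_setsI) (auto simp: fmeasurableD)
qed

lemma set_nn_integral_layer_cake:
  fixes f :: "'a::euclidean_space \<Rightarrow> real"
  assumes [measurable]: "f \<in> borel_measurable borel" "E \<in> sets borel"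
  shows "(\<integral>\<^sup>+x\<in>E. ennreal (f x) \<partial>lborel) = (\<integral>\<^sup>+t\<in>{0<..}. emeasure lborel (E \<inter> {x. t < f x}) \<partial>lborel)"
proof -
  have "(\<integral>\<^sup>+x\<in>E. ennreal (f x) \<partial>lborel) = (\<integral>\<^sup>+x. ennreal (f x * indicator E x) \<partial>lborel)"
    by (intro nn_integral_cong) (auto simp: indicator_def)
  also have "\<dots> = (\<integral>\<^sup>+t\<in>{0<..}. emeasure lborel {x\<in>space lborel. t < f x * indicator E x} \<partial>lborel)"
    by (rule lborel.nn_integral_layer_cake) measurable
  also have "\<dots> = (\<integral>\<^sup>+t\<in>{0<..}. emeasure lborel (E \<inter> {x. t < f x}) \<partial>lborel)"
  proof (rule nn_integral_cong)
    fix t :: real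
    have "{x\<in>space lborel. t < f x * indicator E x} = E \<inter> {x. t < f x}" if "t > 0"
      using that by (auto simp: indicator_def split: if_splits)
    then show "emeasure lborel {x\<in>space lborel. t < f x * indicator E x} * indicator {0<..} t
        = emeasure lborel (E \<inter> {x. t < f x}) * indicator {0<..} t"
      by (cases "t > 0") auto
  qed
  finally show ?thesis .
qed

context equality_case
begin

text \<open>\<open>E\<close> has little volume far away, so the continuous function
  \<open>F e\<close> comes below and above any value strictly between 0 and V.\<close>

lemma F_surj:
  assumes e: "e \<in> Basis" and v: "0 < v" "v < V"
  shows "\<exists>c. F e c = v"
proof -
  have "\<exists>r0. \<forall>r\<ge>r0. emeasure (density lborel (indicator E)) {x. r \<le> norm x} \<le> ennreal (min v (V - v))"
    by (rule finite_measure_tail) (use E fin v in \<open>auto simp: emeasure_density\<close>)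
  then obtain r where r: "emeasure (density lborel (indicator E)) {x. r \<le> norm x} \<le> ennreal (min v (V - v))" by blast
  let ?T = "E \<inter> {x. r \<le> norm x}"
  have cl: "{x::real^'n. r \<le> norm x} \<in> sets borel" by (intro borel_closed closed_Collect_le continuous_intros)
  have Tf: "?T \<in> lmeasurable" by (rule fmeasurable_Int_fmeasurable[OF E_lmeasurable]) (use cl in auto)
  have "emeasure (density lborel (indicator E)) {x. r \<le> norm x} = emeasure lborel ?T"
    using cl E by (simp add: emeasure_density Int_commute flip: indicator_inter_arith)
  then have "ennreal (measure lebesgue ?T) \<le> ennreal (min v (V - v))"
    using r emeasure_eq_measure2[OF Tf] cl E by simp
  then have T: "measure lebesgue ?T \<le> min v (V - v)" using v by (subst (asm) ennreal_le_iff) auto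
  have ab: "\<bar>x \<bullet> e\<bar> \<le> norm x" for x by (rule Basis_le_norm[OF e])
  have "F e (- r) \<le> measure lebesgue ?T"
    unfolding F_def
  proof (rule measure_mono_fmeasurable[OF _ _ Tf])
    show "E \<inter> {x. x \<bullet> e < - r} \<subseteq> ?T"
    proof safe
      fix x assume "x \<bullet> e < - r"
      then show "r \<le> norm x" using ab[of x] by linarith
    qed
  qed (use E in \<open>auto intro!: sets.Int\<close>)
  then have 1: "F e (- r) \<le> v" using T by simp
  have "V - F e r \<le> measure lebesgue ?T"
    unfolding measure_upper(1)[OF e, symmetric]
  proof (rule measure_mono_fmeasurable[OF _ _ Tf])
    show "E \<inter> {x. r < x \<bullet> e} \<subseteq> ?T"
    proof safe
      fix x assume "r < x \<bullet> e"
      then show "r \<le> norm x" using ab[of x] by linarith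
    qed
  qed (use E in \<open>auto intro!: sets.Int\<close>)
  then have 2: "v \<le> F e r" using T by simp
  show ?thesis
  proof (cases "- r \<le> r")
    case True
    then show ?thesis using IVT'[of "F e" "- r" v r] 1 2 continuous_on_F(1)[OF e] by blast
  next
    case False
    then show ?thesis using 1 2 F_mono[of r "- r" e] by (intro exI[of _ r]) auto
  qed
qed

text \<open>\<open>S\<close> sends a height of the ball to a height of \<open>E\<close> with the
  same volume below. By \<open>F_increment\<close> the volume of a thin slab of the ball is at least
  about its section area times the growth of \<open>S\<close>, so locally \<open>S\<close> grows at
  a rate of at most 1 + \<epsilon>; bisection makes this global.\<close>

lemma F_FB_contraction:
  assumes e: "e \<in> Basis" and S: "\<And>s. - \<rho> < s \<Longrightarrow> s < \<rho> \<Longrightarrow> F e (S s) = FB e s"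
    and s: "- \<rho> < s0" "s0 \<le> s1" "s1 < \<rho>"
  shows "S s1 - S s0 \<le> s1 - s0"
proof -
  let ?n = "CARD('n) - 1"
  have n: "?n > 0" using N by simp
  define g where "g t = sqrt (\<rho>\<^sup>2 - t\<^sup>2)" for t
  have sq: "t\<^sup>2 < \<rho>\<^sup>2" if "- \<rho> < t" "t < \<rho>" for t
  proof -
    have "\<bar>t\<bar> < \<bar>\<rho>\<bar>" using that by auto
    then show ?thesis using abs_le_square_iff[of \<rho> t] by linarith
  qed
  have gpos: "g t > 0" if "- \<rho> < t" "t < \<rho>" for t using sq[OF that] by (simp add: g_def)
  have est: "S s1 - S s0 \<le> (1 + \<epsilon>) * (s1 - s0)" if \<epsilon>: "\<epsilon> > 0" for \<epsilon>
    using s(2)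
  proof (induction rule: Bolzano)
    case (trans a b c)
    then show ?case by (simp add: algebra_simps)
  next
    case (local x)
    \<comment> \<open>On a short interval the section radius stays within a factor q of its value at
      \<open>x\<close>, so the section areas differ at most by the factor q^(2(N - 1)) = 1 +
      \<epsilon>.\<close>
    define q where "q = root (2 * ?n) (1 + \<epsilon>)"
    have q: "q > 1" "q ^ (2 * ?n) = 1 + \<epsilon>" using \<epsilon> n by (auto simp: q_def)
    have xr: "- \<rho> < x" "x < \<rho>" using local s by auto
    have "isCont g x" unfolding g_def by (intro continuous_intros)
    moreover have "g x / q < g x" "g x < q * g x" using gpos[OF xr] q(1) by (auto simp: divide_less_eq)
    ultimately have "\<forall>\<^sub>F t in at x. g x / q < g t" "\<forall>\<^sub>F t in at x. g t < q * g x"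
      unfolding isCont_def by (auto intro: order_tendstoD)
    then have "\<forall>\<^sub>F t in at x. g x / q < g t \<and> g t < q * g x" by eventually_elim auto
    then obtain d0 where d0: "d0 > 0" "\<And>t. t \<noteq> x \<Longrightarrow> dist t x < d0 \<Longrightarrow> g x / q < g t \<and> g t < q * g x"
      unfolding eventually_at by auto
    have d0': "g x / q < g t \<and> g t < q * g x" if "dist t x < d0" for t
      using d0(2)[of t] that \<open>g x / q < g x\<close> \<open>g x < q * g x\<close> by (cases "t = x") auto
    define d where "d = min d0 (min (x + \<rho>) (\<rho> - x))"
    have d: "d > 0" "d \<le> d0" "d \<le> x + \<rho>" "d \<le> \<rho> - x" using d0(1) xr by (auto simp: d_def)
    show ?case
    proof (intro exI[of _ d] conjI allI impI d(1))
      fix a b assume ab: "a \<le> x \<and> x \<le> b \<and> b - a < d"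
      show "S b - S a \<le> (1 + \<epsilon>) * (b - a)"
      proof (cases "a < b")
        case True
        have ar: "- \<rho> < a" "b < \<rho>" "a < \<rho>" "- \<rho> < b" using ab d True by auto
        have near: "g x / q < g t \<and> g t < q * g x" if "a \<le> t" "t \<le> b" for t
          using that ab d by (intro d0') (auto simp: dist_real_def)
        have FBab: "FB e a < FB e b" using ar True by (intro FB_strict[OF e]) auto
        have SS: "S a < S b"
        proof (rule ccontr)
          assume "\<not> S a < S b"
          then have "F e (S b) \<le> F e (S a)" by (intro F_mono) auto
          then show False using FBab S ar by simp
        qed
        define u where "u = unit_cyl_vol e"
        have u: "u > 0" unfolding u_def by (rule unit_cyl_vol_pos[OF e])
        define \<beta> where "\<beta> = u * (g x / q) ^ ?n"
        have gx: "g x > 0" by (rule gpos[OF xr])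
        have "\<beta> > 0" using u gx q(1) by (simp add: \<beta>_def)
        have "(S b - S a) * \<beta> \<le> F e (S b) - F e (S a)"
        proof (rule F_increment[OF e SS _ _ _ _ _ \<open>\<beta> > 0\<close>])
          show "\<beta> \<le> section_area e \<rho> t" if "a \<le> t" "t \<le> b" for t
          proof -
            have "(g x / q) ^ ?n \<le> g t ^ ?n" using near[OF that] gx q(1) by (intro power_mono) auto
            then show ?thesis using u by (simp add: \<beta>_def u_def section_area_def g_def)
          qed
        qed (use ar S True in auto)
        also have "\<dots> = measure lebesgue (B \<inter> slab e a b)"
          using S ar measure_halfspace_diff[OF B_lmeasurable e, of a b] True by (simp add: FB_def)
        also have "\<dots> \<le> (b - a) * (u * (q * g x) ^ (DIM(real^'n) - 1))"
          unfolding u_def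
        proof (rule measure_ball_slab_le[OF e True])
          show "q * g x > 0" using gx q by simp
          fix t assume t: "a < t" "t < b"
          have "g t ^ 2 \<le> (q * g x) ^ 2" using near[of t] t gpos[of t] ar by (intro power_mono) auto
          moreover have "g t ^ 2 = \<rho>\<^sup>2 - t\<^sup>2" using sq[of t] t ar by (simp add: g_def)
          ultimately show "\<rho>\<^sup>2 - t\<^sup>2 \<le> (q * g x)\<^sup>2" by simp
        qed
        also have "\<dots> = (b - a) * (1 + \<epsilon>) * \<beta>"
        proof -
          have "(q * g x) ^ m = q ^ (2 * m) * (g x / q) ^ m" for m
            using q(1) by (simp add: power_mult_distrib power_divide mult_2 power_add)
          then have "(q * g x) ^ ?n = (1 + \<epsilon>) * (g x / q) ^ ?n" unfolding q(2)[symmetric] .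
          then show ?thesis by (simp add: \<beta>_def mult_ac)
        qed
        finally show ?thesis using \<open>\<beta> > 0\<close> by (simp add: mult.commute)
      next
        case False
        then have "a = b" using ab by linarith
        then show ?thesis by simp
      qed
    qed
  qed
  show ?thesis
  proof (rule tendsto_lowerbound[of _ _ "at_right (0::real)"])
    show "((\<lambda>\<epsilon>. (1 + \<epsilon>) * (s1 - s0)) \<longlongrightarrow> s1 - s0) (at_right 0)"
      by (rule tendsto_eq_intros refl | simp)+
    show "\<forall>\<^sub>F \<epsilon> in at_right 0. S s1 - S s0 \<le> (1 + \<epsilon>) * (s1 - s0)"
      by (rule eventually_mono[OF eventually_at_right_less est])
  qed simp
qed

text \<open>The height \<open>S 0\<close> matches the centre of the ball. As \<open>S\<close> is a
  contraction, matching cuts of \<open>E\<close> are at least as close to it as those of the ball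
  are to the centre, so less volume lies beyond a given distance.\<close>

lemma tail_comparison:
  assumes e: "e \<in> Basis"
  shows "\<exists>x0. \<forall>r\<ge>0. measure lebesgue (E \<inter> {x. r < \<bar>x \<bullet> e - x0\<bar>}) \<le> measure lebesgue (B \<inter> {x. r < \<bar>x \<bullet> e\<bar>})"
proof -
  have "\<exists>c. F e c = FB e s" if "- \<rho> < s" "s < \<rho>" for s
    using F_surj[OF e, of "FB e s"] FB_strict[OF e, of "- \<rho>" s] FB_strict[OF e, of s \<rho>] FB_ends[OF e] that by simp
  then obtain S where S: "\<And>s. - \<rho> < s \<Longrightarrow> s < \<rho> \<Longrightarrow> F e (S s) = FB e s" by metis
  define x0 where "x0 = S 0"
  have split: "measure lebesgue (A \<inter> {x. r < \<bar>x \<bullet> e - a\<bar>}) =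
      measure lebesgue (A \<inter> {x. x \<bullet> e < a - r}) + measure lebesgue (A \<inter> {x. a + r < x \<bullet> e})"
    if A: "A \<in> lmeasurable" and r: "r \<ge> 0" for A r a
  proof -
    have "A \<inter> {x. r < \<bar>x \<bullet> e - a\<bar>} = (A \<inter> {x. x \<bullet> e < a - r}) \<union> (A \<inter> {x. a + r < x \<bullet> e})" by auto
    moreover have "(A \<inter> {x. x \<bullet> e < a - r}) \<inter> (A \<inter> {x. a + r < x \<bullet> e}) = {}" using r by auto
    moreover have "A \<inter> {x. x \<bullet> e < a - r} \<in> lmeasurable" "A \<inter> {x. a + r < x \<bullet> e} \<in> lmeasurable"
      by (auto intro!: fmeasurable_Int_fmeasurable A)
    ultimately show ?thesis by (simp add: measure_Un3)
  qed
  have lo: "F e (x0 - r) \<le> FB e (- r)" and up: "FB e r \<le> F e (x0 + r)" if r: "0 \<le> r" "r < \<rho>" for r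
  proof -
    have "S 0 - S (- r) \<le> 0 - (- r)" using r by (intro F_FB_contraction[OF e S]) auto
    then have "F e (x0 - r) \<le> F e (S (- r))" by (intro F_mono) (simp add: x0_def)
    then show "F e (x0 - r) \<le> FB e (- r)" using S[of "- r"] r by simp
    have "S r - S 0 \<le> r - 0" using r \<rho> by (intro F_FB_contraction[OF e S]) auto
    then have "F e (S r) \<le> F e (x0 + r)" by (intro F_mono) (simp add: x0_def)
    then show "FB e r \<le> F e (x0 + r)" using S[of r] r by simp
  qed
  have at_left: "((\<lambda>r. r) \<longlongrightarrow> \<rho>) (at_left \<rho>)" by (rule tendsto_ident_at)
  have ev: "\<forall>\<^sub>F r in at_left \<rho>. r \<in> {0<..<\<rho>}" using \<rho> by (rule eventually_at_left_real)
  have ctsF: "isCont (F e) t" "isCont (FB e) t" for t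
    using continuous_on_F[OF e, of UNIV] by (simp_all add: continuous_on_eq_continuous_at)
  \<comment> \<open>\<open>S\<close> is chosen on the open interval only, so the radius \<rho> is
    reached as a limit; beyond it \<open>E\<close> has no volume.\<close>
  have upR: "V \<le> F e (x0 + \<rho>)"
  proof (rule tendsto_le[of "at_left \<rho>"])
    show "((\<lambda>r. F e (x0 + r)) \<longlongrightarrow> F e (x0 + \<rho>)) (at_left \<rho>)"
      by (rule isCont_tendsto_compose[OF ctsF(1)]) (intro tendsto_intros at_left)
    show "((\<lambda>r. FB e r) \<longlongrightarrow> V) (at_left \<rho>)"
      using isCont_tendsto_compose[OF ctsF(2) at_left] FB_ends[OF e] by simp
    show "\<forall>\<^sub>F r in at_left \<rho>. FB e r \<le> F e (x0 + r)" using ev by eventually_elim (auto intro: up)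
  qed simp
  have loR: "F e (x0 - \<rho>) \<le> 0"
  proof (rule tendsto_le[of "at_left \<rho>"])
    show "((\<lambda>r. F e (x0 - r)) \<longlongrightarrow> F e (x0 - \<rho>)) (at_left \<rho>)"
      by (rule isCont_tendsto_compose[OF ctsF(1)]) (intro tendsto_intros at_left)
    have "((\<lambda>r. FB e (- r)) \<longlongrightarrow> FB e (- \<rho>)) (at_left \<rho>)"
      by (rule isCont_tendsto_compose[OF ctsF(2)]) (intro tendsto_intros at_left)
    then show "((\<lambda>r. FB e (- r)) \<longlongrightarrow> 0) (at_left \<rho>)" using FB_ends[OF e] by simp
    show "\<forall>\<^sub>F r in at_left \<rho>. F e (x0 - r) \<le> FB e (- r)" using ev by eventually_elim (auto intro: lo)
  qed simp
  have "measure lebesgue (E \<inter> {x. r < \<bar>x \<bullet> e - x0\<bar>}) \<le> measure lebesgue (B \<inter> {x. r < \<bar>x \<bullet> e\<bar>})" if r: "r \<ge> 0" for r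
  proof -
    have eqE: "measure lebesgue (E \<inter> {x. r < \<bar>x \<bullet> e - x0\<bar>}) = F e (x0 - r) + (V - F e (x0 + r))"
      using split[OF E_lmeasurable r, of x0] measure_upper(1)[OF e, of "x0 + r"] by (simp add: F_def)
    have eqB: "measure lebesgue (B \<inter> {x. r < \<bar>x \<bullet> e\<bar>}) = FB e (- r) + (V - FB e r)"
      using split[OF B_lmeasurable r, of 0] measure_upper(2)[OF e, of r] by (simp add: FB_def)
    show ?thesis
    proof (cases "r < \<rho>")
      case True
      then show ?thesis unfolding eqE eqB using lo[OF r] up[OF r] by linarith
    next
      case False
      then have "F e (x0 - r) \<le> 0" "V \<le> F e (x0 + r)"
        using loR upR F_mono[of "x0 - r" "x0 - \<rho>" e] F_mono[of "x0 + \<rho>" "x0 + r" e] by auto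
      then have "measure lebesgue (E \<inter> {x. r < \<bar>x \<bullet> e - x0\<bar>}) \<le> 0" unfolding eqE by linarith
      then show ?thesis using measure_nonneg[of lebesgue "B \<inter> {x. r < \<bar>x \<bullet> e\<bar>}"] by linarith
    qed
  qed
  then show ?thesis by blast
qed

text \<open>By the layer cake formula the tails control each coordinate's share of the second moment
  about \<open>a\<close>, and among sets of given volume only the ball about \<open>a\<close> has
  the least second moment.\<close>

theorem equality_ball: "\<exists>a. sym_diff E (ball a \<rho>) \<in> null_sets lborel"
proof -
  obtain x0 where x0: "\<And>e r. e \<in> Basis \<Longrightarrow> 0 \<le> r \<Longrightarrow>
      measure lebesgue (E \<inter> {x. r < \<bar>x \<bullet> e - x0 e\<bar>}) \<le> measure lebesgue (B \<inter> {x. r < \<bar>x \<bullet> e\<bar>})"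
    using tail_comparison by metis
  define a where "a = (\<Sum>e\<in>Basis. x0 e *\<^sub>R e)"
  have ae: "a \<bullet> e = x0 e" if "e \<in> Basis" for e using that by (simp add: a_def)
  note E [measurable]
  have ball_borel [measurable]: "ball c r \<in> sets borel" for c r by simp
  have moment: "(\<integral>\<^sup>+x\<in>E. ennreal (((x - a) \<bullet> e)\<^sup>2) \<partial>lborel) \<le> (\<integral>\<^sup>+x\<in>B. ennreal ((x \<bullet> e)\<^sup>2) \<partial>lborel)" if e: "e \<in> Basis" for e
  proof -
    have "(\<integral>\<^sup>+x\<in>E. ennreal (((x - a) \<bullet> e)\<^sup>2) \<partial>lborel) = (\<integral>\<^sup>+t\<in>{0<..}. emeasure lborel (E \<inter> {x. t < ((x - a) \<bullet> e)\<^sup>2}) \<partial>lborel)"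
      by (rule set_nn_integral_layer_cake) measurable
    also have "\<dots> \<le> (\<integral>\<^sup>+t\<in>{0<..}. emeasure lborel (B \<inter> {x. t < (x \<bullet> e)\<^sup>2}) \<partial>lborel)"
    proof (rule nn_integral_mono)
      fix t :: real
      show "emeasure lborel (E \<inter> {x. t < ((x - a) \<bullet> e)\<^sup>2}) * indicator {0<..} t \<le> emeasure lborel (B \<inter> {x. t < (x \<bullet> e)\<^sup>2}) * indicator {0<..} t"
      proof (cases "t > 0")
        case True
        have "t < z\<^sup>2 \<longleftrightarrow> sqrt t < \<bar>z\<bar>" for z
          using True by (metis real_sqrt_abs real_sqrt_less_iff)
        then have eq: "E \<inter> {x. t < ((x - a) \<bullet> e)\<^sup>2} = E \<inter> {x. sqrt t < \<bar>x \<bullet> e - x0 e\<bar>}"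
          "B \<inter> {x. t < (x \<bullet> e)\<^sup>2} = B \<inter> {x. sqrt t < \<bar>x \<bullet> e\<bar>}" by (auto simp: inner_diff_left ae[OF e])
        have o: "open {x::real^'n. sqrt t < \<bar>x \<bullet> e - x0 e\<bar>}" "open {x::real^'n. sqrt t < \<bar>x \<bullet> e\<bar>}"
          by (intro open_Collect_less continuous_intros)+
        have f: "E \<inter> {x. sqrt t < \<bar>x \<bullet> e - x0 e\<bar>} \<in> lmeasurable" "B \<inter> {x. sqrt t < \<bar>x \<bullet> e\<bar>} \<in> lmeasurable"
          by (rule fmeasurable_Int_fmeasurable; use E_lmeasurable o in auto)+
        have "emeasure lebesgue (E \<inter> {x. sqrt t < \<bar>x \<bullet> e - x0 e\<bar>}) \<le> emeasure lebesgue (B \<inter> {x. sqrt t < \<bar>x \<bullet> e\<bar>})"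
          unfolding emeasure_eq_measure2[OF f(1)] emeasure_eq_measure2[OF f(2)] using x0[OF e, of "sqrt t"] True
          by (intro ennreal_leI) auto
        moreover have "E \<inter> {x. sqrt t < \<bar>x \<bullet> e - x0 e\<bar>} \<in> sets lborel" "B \<inter> {x. sqrt t < \<bar>x \<bullet> e\<bar>} \<in> sets lborel"
          using o E by auto
        ultimately show ?thesis using True unfolding eq by simp
      qed simp
    qed
    also have "\<dots> = (\<integral>\<^sup>+x\<in>B. ennreal ((x \<bullet> e)\<^sup>2) \<partial>lborel)"
      by (rule set_nn_integral_layer_cake[symmetric]) measurable
    finally show ?thesis .
  qed
  have norm_sum: "ennreal ((norm z)\<^sup>2) = (\<Sum>e\<in>Basis. ennreal ((z \<bullet> e)\<^sup>2))" for z :: "real^'n"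
  proof -
    have "(norm z)\<^sup>2 = (\<Sum>e\<in>Basis. (z \<bullet> e)\<^sup>2)"
      unfolding power2_norm_eq_inner by (subst euclidean_inner) (simp add: power2_eq_square)
    then show ?thesis by (simp add: sum_ennreal)
  qed
  have "(\<integral>\<^sup>+x\<in>E. ennreal ((norm (x - a))\<^sup>2) \<partial>lborel) = (\<Sum>e\<in>Basis. (\<integral>\<^sup>+x\<in>E. ennreal (((x - a) \<bullet> e)\<^sup>2) \<partial>lborel))"
    unfolding norm_sum sum_distrib_right by (rule nn_integral_sum) measurable
  also have "\<dots> \<le> (\<Sum>e\<in>Basis. (\<integral>\<^sup>+x\<in>B. ennreal ((x \<bullet> e)\<^sup>2) \<partial>lborel))" by (intro sum_mono moment)
  also have "\<dots> = (\<integral>\<^sup>+x\<in>B. ennreal ((norm x)\<^sup>2) \<partial>lborel)"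
    unfolding norm_sum sum_distrib_right by (rule nn_integral_sum[symmetric]) measurable
  also have "\<dots> = (\<integral>\<^sup>+x. ennreal ((norm (x - a))\<^sup>2) * indicator (ball a \<rho>) x \<partial>lborel)"
  proof -
    have "(\<integral>\<^sup>+x. ennreal ((norm (x - a))\<^sup>2) * indicator (ball a \<rho>) x \<partial>lborel)
      = (\<integral>\<^sup>+x. ennreal ((norm ((a - x) - a))\<^sup>2) * indicator (ball a \<rho>) (a - x) \<partial>lborel)"
      by (rule nn_integral_lborel_reflect[of "\<lambda>x. ennreal ((norm (x - a))\<^sup>2) * indicator (ball a \<rho>) x" a, symmetric]) measurable
    also have "\<dots> = (\<integral>\<^sup>+x\<in>B. ennreal ((norm x)\<^sup>2) \<partial>lborel)"
      by (intro nn_integral_cong) (auto simp: indicator_def dist_norm)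
    finally show ?thesis ..
  qed
  finally have mom: "(\<integral>\<^sup>+x\<in>E. ennreal ((norm (x - a))\<^sup>2) \<partial>lborel) \<le> (\<integral>\<^sup>+x\<in>ball a \<rho>. ennreal ((norm (x - a))\<^sup>2) \<partial>lborel)" .
  have bf: "emeasure lborel (ball a \<rho>) < \<infinity>" by (rule emeasure_lborel_ball_finite)
  have "(\<integral>\<^sup>+x\<in>ball a \<rho>. ennreal ((norm (x - a))\<^sup>2) \<partial>lborel) \<le> (\<integral>\<^sup>+x\<in>ball a \<rho>. ennreal (\<rho>\<^sup>2) \<partial>lborel)"
  proof (rule nn_integral_mono)
    fix x
    show "ennreal ((norm (x - a))\<^sup>2) * indicator (ball a \<rho>) x \<le> ennreal (\<rho>\<^sup>2) * indicator (ball a \<rho>) x"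
      by (auto simp: indicator_def dist_norm norm_minus_commute intro!: ennreal_leI power_mono)
  qed
  also have "\<dots> < \<infinity>" using bf by (subst nn_integral_cmult_indicator) (auto simp: ennreal_mult_less_top)
  finally have bfin: "(\<integral>\<^sup>+x\<in>ball a \<rho>. ennreal ((norm (x - a))\<^sup>2) \<partial>lborel) < \<infinity>" .
  have int: "integrable lborel (\<lambda>x. indicator A x * (norm (x - a))\<^sup>2)"
    "ennreal (LINT x|lborel. indicator A x * (norm (x - a))\<^sup>2) = (\<integral>\<^sup>+x\<in>A. ennreal ((norm (x - a))\<^sup>2) \<partial>lborel)"
    if [measurable]: "A \<in> sets borel" and fA: "(\<integral>\<^sup>+x\<in>A. ennreal ((norm (x - a))\<^sup>2) \<partial>lborel) < \<infinity>" for A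
  proof -
    have eq: "(\<integral>\<^sup>+x\<in>A. ennreal ((norm (x - a))\<^sup>2) \<partial>lborel) = (\<integral>\<^sup>+x. ennreal (indicator A x * (norm (x - a))\<^sup>2) \<partial>lborel)"
      by (intro nn_integral_cong) (auto simp: indicator_def)
    show i: "integrable lborel (\<lambda>x. indicator A x * (norm (x - a))\<^sup>2)"
      using fA unfolding eq by (intro integrableI_nonneg) auto
    show "ennreal (LINT x|lborel. indicator A x * (norm (x - a))\<^sup>2) = (\<integral>\<^sup>+x\<in>A. ennreal ((norm (x - a))\<^sup>2) \<partial>lborel)"
      unfolding eq using i by (intro nn_integral_eq_integral[symmetric]) auto
  qed
  note bm = ball_borel[of a \<rho>]
  note iE = int[OF E le_less_trans[OF mom bfin]] and iB = int[OF bm bfin]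
  have le: "(LINT x|lborel. indicator E x * (norm (x - a))\<^sup>2) \<le> (LINT x|lborel. indicator (ball a \<rho>) x * (norm (x - a))\<^sup>2)"
    using mom unfolding iE(2)[symmetric] iB(2)[symmetric] by (subst (asm) ennreal_le_iff) (auto intro!: Bochner_Integration.integral_nonneg)
  have volb: "measure lborel (ball a \<rho>) = measure lborel E"
    using vol content_ball[of \<rho> a] content_ball[of \<rho> "0::real^'n"] \<rho> E by simp
  have indE: "integrable lborel (indicat_real E)" "integrable lborel (indicat_real (ball a \<rho>))"
    using fin bf E by (auto intro!: integrable_real_indicator)
  have hE: "indicat_real A x * ((norm (x - a))\<^sup>2 - \<rho>\<^sup>2) = indicator A x * (norm (x - a))\<^sup>2 - \<rho>\<^sup>2 * indicator A x" for A x
    by (simp add: algebra_simps)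
  have D: "ball a \<rho> - E \<in> null_sets lborel"
  \<comment> \<open>Subtracting \<rho>^2 makes the integrand negative exactly on the ball; it
    changes both integrals by the same amount, as the volumes agree.\<close>
  proof (rule bathtub(2)[where h="\<lambda>x. (norm (x - a))\<^sup>2 - \<rho>\<^sup>2"])
    show "integrable lborel (\<lambda>x. indicat_real E x * ((norm (x - a))\<^sup>2 - \<rho>\<^sup>2))"
      "integrable lborel (\<lambda>x. indicat_real (ball a \<rho>) x * ((norm (x - a))\<^sup>2 - \<rho>\<^sup>2))"
      unfolding hE using iE(1) iB(1) indE by auto
    show "(LINT x|lborel. indicat_real E x * ((norm (x - a))\<^sup>2 - \<rho>\<^sup>2)) \<le> (LINT x|lborel. indicat_real (ball a \<rho>) x * ((norm (x - a))\<^sup>2 - \<rho>\<^sup>2))"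
      unfolding hE using le iE(1) iB(1) indE volb by simp
    show "(norm (x - a))\<^sup>2 - \<rho>\<^sup>2 < 0" if "x \<in> ball a \<rho>" for x
      using that by (simp add: dist_norm norm_minus_commute power_strict_mono)
    show "0 \<le> (norm (x - a))\<^sup>2 - \<rho>\<^sup>2" if "x \<notin> ball a \<rho>" for x
      using that \<rho> by (simp add: dist_norm norm_minus_commute power_mono)
  qed (use E in auto)
  moreover have "E - ball a \<rho> \<in> null_sets lborel"
    by (rule null_sets_Diff_swap[OF _ _ _ D]) (use E fin bf volb in \<open>auto simp: fmeasurable_def\<close>)
  ultimately show ?thesis by (intro exI[of _ a]) (rule null_sets.Un)
qed

end

section \<open>The radial change of variables\<close>

text \<open>Truncated cones stand in for polar coordinates: they generate the Borel sets, are closed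
  under intersection, and have sectors as preimages under radial maps. As \<open>sgn 0 = 0\<close>,
  a sector of positive radius contains the origin iff \<open>D\<close> does.\<close>

definition sector :: "real \<Rightarrow> 'a::euclidean_space set \<Rightarrow> 'a set" where
  "sector r D = {x. norm x < r \<and> sgn x \<in> D}"

lemma borel_measurable_sgn_vector [measurable]: "(sgn :: 'a::euclidean_space \<Rightarrow> 'a) \<in> borel_measurable borel"
  unfolding sgn_div_norm[abs_def] by measurable

lemma sector_borel [measurable]: 
  assumes [measurable]: "D \<in> sets borel"
  shows "sector r D \<in> sets borel"
  unfolding sector_def by measurable

lemma sector_UNIV: "sector r UNIV = ball 0 r"
  by (auto simp: sector_def)

lemma emeasure_sector:
  fixes D :: "'a::euclidean_space set"
  assumes [measurable]: "D \<in> sets borel" and r: "r > 0"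
  shows "emeasure lborel (sector r D) = ennreal (r ^ DIM('a)) * emeasure lborel (sector 1 D)"
proof -
  have "emeasure lborel (sector r D) = emeasure (density (distr lborel borel (\<lambda>x. 0 + r *\<^sub>R x)) (\<lambda>_. \<bar>r\<bar> ^ DIM('a))) (sector r D)"
    using lborel_affine[of r "0::'a"] r by simp
  also have "\<dots> = ennreal (r ^ DIM('a)) * emeasure lborel ((\<lambda>x. 0 + r *\<^sub>R x) -` sector r D \<inter> space lborel)"
    using r by (subst emeasure_density_const) (auto simp: emeasure_distr ennreal_power)
  also have "(\<lambda>x. 0 + r *\<^sub>R x) -` sector r D \<inter> space lborel = sector 1 D"
    using r by (auto simp: sector_def sgn_scaleR)
  finally show ?thesis .
qed

text \<open>The radial integral produced by the layer cake formula: in a sector of radius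
  \<open>r\<close>, the part where |x|^p exceeds \<open>t\<close> is, up to the origin, the sector
  of radius \<open>min r (t powr (1 / p))\<close>. The minimum switches at t = r^p.\<close>

lemma nn_integral_min_powr:
  fixes p n r :: real
  assumes p: "p < 0" "0 < n + p" and r: "r > 0"
  shows "(\<integral>\<^sup>+t\<in>{0<..}. ennreal (min r (t powr (1 / p)) powr n) \<partial>lborel) = ennreal (n / (n + p) * r powr (n + p))"
proof -
  let ?t0 = "r powr p"
  let ?g = "\<lambda>t::real. min r (t powr (1 / p)) powr n"
  have t0: "?t0 > 0" using r by simp
  have le: "t powr (1 / p) \<le> r" if "?t0 \<le> t" for t
  proof -
    have "t powr (1 / p) \<le> ?t0 powr (1 / p)" using that t0 p by (intro powr_mono2') auto
    then show ?thesis using p r by (simp add: powr_powr)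
  qed
  have ge: "r \<le> t powr (1 / p)" if "0 < t" "t \<le> ?t0" for t
  proof -
    have "?t0 powr (1 / p) \<le> t powr (1 / p)" using that t0 p by (intro powr_mono2') auto
    then show ?thesis using p r by (simp add: powr_powr)
  qed
  have "((\<lambda>t. r powr n) has_integral (?t0 - 0) *\<^sub>R r powr n) {0..?t0}"
    using t0 has_integral_const_real[of "r powr n" 0 ?t0] by simp
  then have 1: "(?g has_integral (?t0 - 0) *\<^sub>R r powr n) {0..?t0}"
    by (rule has_integral_spike_finite[of "{0}", rotated 2]) (use ge in \<open>auto simp: min_absorb1\<close>)
  have np: "n / p < - 1" using p by (simp add: field_simps)
  have "((\<lambda>t. t powr (n / p)) has_integral - (?t0 powr (n / p + 1)) / (n / p + 1)) {?t0..}"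
    by (rule has_integral_powr_to_inf[OF np t0])
  then have 2: "(?g has_integral - (?t0 powr (n / p + 1)) / (n / p + 1)) {?t0..}"
    by (rule has_integral_eq[rotated]) (use le in \<open>auto simp: min_absorb2 powr_powr\<close>)
  have "(?g has_integral (?t0 - 0) *\<^sub>R r powr n + - (?t0 powr (n / p + 1)) / (n / p + 1)) ({0..?t0} \<union> {?t0..})"
    using 1 2
  proof (rule has_integral_Un)
    have "{0..?t0} \<inter> {?t0..} = {?t0}" using t0 by auto
    then show "negligible ({0..?t0} \<inter> {?t0..})" by simp
  qed
  moreover have "{0..?t0} \<union> {?t0..} = {0..}"
  proof -
    have "0 \<le> x" if "?t0 \<le> x" for x using that t0 by linarith
    then show ?thesis by auto
  qed
  moreover have "(?t0 - 0) *\<^sub>R r powr n + - (?t0 powr (n / p + 1)) / (n / p + 1) = n / (n + p) * r powr (n + p)"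
  proof -
    have a: "?t0 powr (n / p + 1) = r powr (n + p)" using p by (simp add: powr_powr distrib_left)
    have b: "(?t0 - 0) *\<^sub>R r powr n = r powr (n + p)" by (simp add: powr_add mult.commute)
    have c: "n / p + 1 = (n + p) / p" using p by (simp add: field_simps)
    have "- (R::real) / ((n + p) / p) = - (p / (n + p)) * R" for R using p by simp
    moreover have "R + - (p / (n + p)) * R = n / (n + p) * R" for R :: real using p by (simp add: field_simps)
    ultimately show ?thesis unfolding a b unfolding c by metis
  qed
  ultimately have "(?g has_integral n / (n + p) * r powr (n + p)) {0..}" by simp
  moreover have "(?g has_integral n / (n + p) * r powr (n + p)) {0..} \<longleftrightarrow> (?g has_integral n / (n + p) * r powr (n + p)) {0<..}"
    by (rule has_integral_spike_set_eq; rule negligible_subset[OF negligible_sing[of 0]]) auto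
  ultimately have "(?g has_integral n / (n + p) * r powr (n + p)) {0<..}" by blast
  then show ?thesis by (rule nn_integral_has_integral_lebesgue'[rotated]) auto
qed

lemma nn_integral_sector:
  fixes D :: "'a::euclidean_space set" and p r :: real
  assumes D [measurable]: "D \<in> sets borel" and p: "p \<le> 0" "0 < DIM('a) + p" and r: "r > 0"
  shows "(\<integral>\<^sup>+x\<in>sector r D. ennreal (norm x powr p) \<partial>lborel) =
    ennreal (DIM('a) / (DIM('a) + p) * r powr (DIM('a) + p)) * emeasure lborel (sector 1 D)"
proof (cases "p = 0")
  case True
  have "(\<integral>\<^sup>+x\<in>sector r D. ennreal (norm x powr p) \<partial>lborel) = (\<integral>\<^sup>+x. indicator (sector r D) x \<partial>lborel)"
  proof (rule nn_integral_cong_AE)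
    \<comment> \<open>\<open>0 powr 0\<close> is 0, so the integrand differs from the indicator at
      most at the origin.\<close>
    show "AE x in lborel. ennreal (norm x powr p) * indicator (sector r D) x = indicator (sector r D) x"
      using AE_lborel_singleton[of "0::'a"]
    proof eventually_elim
      case (elim x)
      then show ?case by (simp add: True)
    qed
  qed
  also have "\<dots> = emeasure lborel (sector r D)" by (rule nn_integral_indicator) simp
  also have "\<dots> = ennreal (r ^ DIM('a)) * emeasure lborel (sector 1 D)" by (rule emeasure_sector[OF D r])
  also have "r ^ DIM('a) = DIM('a) / (DIM('a) + p) * r powr (DIM('a) + p)" using r by (simp add: True powr_realpow)
  finally show ?thesis .
next
  case False
  then have p0: "p < 0" using p by simp
  have "(\<integral>\<^sup>+x\<in>sector r D. ennreal (norm x powr p) \<partial>lborel) =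
      (\<integral>\<^sup>+t\<in>{0<..}. emeasure lborel (sector r D \<inter> {x. t < norm x powr p}) \<partial>lborel)"
    by (rule set_nn_integral_layer_cake) measurable
  also have "\<dots> = (\<integral>\<^sup>+t. (ennreal (min r (t powr (1 / p)) powr DIM('a)) * indicator {0<..} t) * emeasure lborel (sector 1 D) \<partial>lborel)"
  proof (rule nn_integral_cong)
    fix t :: real
    show "emeasure lborel (sector r D \<inter> {x. t < norm x powr p}) * indicator {0<..} t =
      (ennreal (min r (t powr (1 / p)) powr DIM('a)) * indicator {0<..} t) * emeasure lborel (sector 1 D)"
    proof (cases "t > 0")
      case True
      let ?q = "min r (t powr (1 / p))"
      have q: "?q > 0" using r True by simp
      have iff: "t < norm x powr p \<longleftrightarrow> norm x < t powr (1 / p)" if "x \<noteq> 0" for x :: 'a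
      proof -
        have *: "(t powr (1 / p)) powr p = t" using True p0 by (simp add: powr_powr)
        show ?thesis
        proof
          assume "norm x < t powr (1 / p)"
          then have "(t powr (1 / p)) powr p < norm x powr p" using that p0 by (intro powr_less_mono2_neg) auto
          then show "t < norm x powr p" by (simp add: *)
        next
          assume a: "t < norm x powr p"
          show "norm x < t powr (1 / p)"
          proof (rule ccontr)
            assume "\<not> norm x < t powr (1 / p)"
            then have "norm x powr p \<le> (t powr (1 / p)) powr p" using True p0 by (intro powr_mono2') auto
            then show False using a by (simp add: *)
          qed
        qed
      qed
      have "emeasure lborel (sector r D \<inter> {x. t < norm x powr p}) = emeasure lborel (sector ?q D)"
      proof (rule emeasure_eq_AE)
        show "AE x in lborel. x \<in> sector r D \<inter> {x. t < norm x powr p} \<longleftrightarrow> x \<in> sector ?q D"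
          using AE_lborel_singleton[of 0] by eventually_elim (auto simp: sector_def iff)
        have "{x. t < norm x powr p} \<in> sets (borel :: 'a measure)" by measurable
        then show "sector r D \<inter> {x. t < norm x powr p} \<in> sets lborel" by auto
        show "sector ?q D \<in> sets lborel" by simp
      qed
      then show ?thesis using True powr_realpow[OF q, of "DIM('a)"] unfolding emeasure_sector[OF D q] by simp
    qed simp
  qed
  also have "\<dots> = ennreal (DIM('a) / (DIM('a) + p) * r powr (DIM('a) + p)) * emeasure lborel (sector 1 D)"
    by (subst nn_integral_multc) (auto simp: nn_integral_min_powr[OF p0 p(2) r])
  finally show ?thesis .
qed

section \<open>The radial power map and its Jacobian\<close>

definition radial_map :: "real \<Rightarrow> 'a::euclidean_space \<Rightarrow> 'a" where
  "radial_map s x = norm x powr s *\<^sub>R x"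

lemma radial_map_measurable [measurable]: "radial_map s \<in> borel_measurable borel"
  unfolding radial_map_def by measurable

lemma norm_radial_map: "(s::real) > - 1 \<Longrightarrow> norm (radial_map s x) = norm x powr (1 + s)"
  by (cases "x = 0") (simp_all add: radial_map_def powr_add)

lemma sgn_radial_map: "sgn (radial_map s x) = sgn x"
  by (cases "x = 0") (simp_all add: radial_map_def sgn_scaleR)

lemma powr_less_iff_less_powr:
  fixes x r a :: real
  assumes "0 \<le> x" "0 < r" "0 < a"
  shows "x powr a < r \<longleftrightarrow> x < r powr (1 / a)"
proof
  assume "x powr a < r"
  then have "(x powr a) powr (1 / a) < r powr (1 / a)" using assms by (intro powr_less_mono2) auto
  then show "x < r powr (1 / a)" using assms by (simp add: powr_powr)
next
  assume "x < r powr (1 / a)"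
  then have "x powr a < (r powr (1 / a)) powr a" using assms by (intro powr_less_mono2) auto
  then show "x powr a < r" using assms by (simp add: powr_powr)
qed

lemma radial_map_inverse:
  fixes s :: real
  assumes s: "s > - 1"
  shows "radial_map (- s / (1 + s)) (radial_map s x) = x"
proof (cases "x = 0")
  case False
  have "norm (radial_map s x) powr (- s / (1 + s)) * norm x powr s = 1"
    using s False by (simp add: norm_radial_map powr_powr powr_minus)
  then show ?thesis by (simp add: radial_map_def[of _ "radial_map s x"]) (simp add: radial_map_def)
qed (simp add: radial_map_def)

text \<open>Norm and direction are measurable for the sigma-algebra of the sectors, and
  \<open>x\<close> is the product of the two.\<close>

lemma sets_borel_sectors: "sets (borel :: 'a::euclidean_space measure) = sigma_sets UNIV {sector r D | r D. D \<in> sets borel}"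
proof
  let ?G = "{sector r D | r D. D \<in> sets (borel :: 'a measure)}"
  let ?S = "sigma UNIV ?G"
  have S: "sets ?S = sigma_sets UNIV ?G" "space ?S = UNIV" by (auto simp: sector_def)
  have n: "norm \<in> borel_measurable ?S"
  proof (rule borel_measurableI_less)
    fix y
    have "sector y UNIV \<in> ?G" by (rule CollectI, rule exI[of _ y], rule exI[of _ "UNIV::'a set"]) simp
    then have "sector y UNIV \<in> sigma_sets UNIV ?G" by (rule sigma_sets.Basic)
    moreover have "{x \<in> space ?S. norm x < y} = sector y UNIV" unfolding S by (auto simp: sector_def)
    ultimately show "{x \<in> space ?S. norm x < y} \<in> sets ?S" by (simp only: S)
  qed
  have g: "(sgn :: 'a \<Rightarrow> 'a) \<in> borel_measurable ?S"
  proof (rule measurableI)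
    fix D :: "'a set" assume D: "D \<in> sets borel"
    have "\<exists>i::nat. norm x < real i" for x :: 'a by (rule reals_Archimedean2)
    then have "sgn -` D = (\<Union>i::nat. sector (real i) D)" by (auto simp: sector_def)
    also have "\<dots> \<in> sets ?S" unfolding S(1)
    proof (rule sigma_sets.Union)
      fix i :: nat
      have "sector (real i) D \<in> ?G" by (rule CollectI, rule exI[of _ "real i"], rule exI[of _ D]) (simp add: D)
      then show "sector (real i) D \<in> sigma_sets UNIV ?G" by (rule sigma_sets.Basic)
    qed
    finally show "sgn -` D \<inter> space ?S \<in> sets ?S" by (simp add: S)
  qed simp
  have "(\<lambda>x::'a. norm x *\<^sub>R sgn x) \<in> borel_measurable ?S" using n g by measurable
  moreover have "norm x *\<^sub>R sgn x = x" for x :: 'a by (cases "x = 0") (simp_all add: sgn_div_norm)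
  ultimately have id: "(\<lambda>x::'a. x) \<in> borel_measurable ?S" by simp
  show "sets (borel :: 'a measure) \<subseteq> sigma_sets UNIV ?G"
  proof
    fix A :: "'a set" assume "A \<in> sets borel"
    then show "A \<in> sigma_sets UNIV ?G" using measurable_sets[OF id] S by fastforce
  qed
  show "sigma_sets UNIV ?G \<subseteq> sets (borel :: 'a measure)"
    by (rule sets.sigma_sets_subset'[of _ borel UNIV, simplified]) auto
qed

text \<open>The Jacobian is (1 + s)|x|^(sN): every direction is stretched by |x|^s and the radial
  one by a further 1 + s. Comparing both measures on sectors, which determine a measure, avoids the
  singularity at the origin.\<close>

lemma distr_radial_map:
  fixes s :: real
  assumes s: "- 1 < s" "s \<le> 0"
  shows "distr (density lborel (\<lambda>x::'a::euclidean_space. ennreal ((1 + s) * norm x powr (s * DIM('a))))) borel (radial_map s) = lborel"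
    (is "?M = _")
proof (rule measure_eqI_generator_eq[where A = "\<lambda>i::nat. sector (real i) UNIV"])
  let ?G = "{sector r D | r D. D \<in> sets (borel :: 'a measure)}"
  let ?n = "real DIM('a)"
  have np: "0 < ?n + s * ?n"
  proof -
    have "0 < ?n * (1 + s)" using s by (intro mult_pos_pos) auto
    then show ?thesis by (simp add: algebra_simps)
  qed
  show "Int_stable ?G"
  proof (rule Int_stableI)
    fix A B assume "A \<in> ?G" "B \<in> ?G"
    then obtain r D r' D' where "A = sector r D" "B = sector r' D'" "D \<in> sets borel" "D' \<in> sets borel" by blast
    moreover have "sector r D \<inter> sector r' D' = sector (min r r') (D \<inter> D')" for r r' and D D' :: "'a set"
      by (auto simp: sector_def)
    ultimately show "A \<inter> B \<in> ?G" by auto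
  qed
  show eq: "emeasure ?M X = emeasure lborel X" if "X \<in> ?G" for X
  proof -
    obtain r D where X: "X = sector r D" and D [measurable]: "D \<in> sets borel" using \<open>X \<in> ?G\<close> by blast
    show ?thesis
    proof (cases "r > 0")
      case True
      let ?q = "r powr (1 / (1 + s))"
      have iff: "norm x powr (1 + s) < r \<longleftrightarrow> norm x < ?q" for x :: 'a
        using s True by (intro powr_less_iff_less_powr) auto
      have vi: "radial_map s -` sector r D = sector ?q D"
        using s True by (auto simp: sector_def norm_radial_map sgn_radial_map iff)
      have "emeasure ?M X = (\<integral>\<^sup>+x. ennreal ((1 + s) * norm x powr (s * ?n)) * indicator (sector ?q D) x \<partial>lborel)"
        unfolding X by (subst emeasure_distr) (auto simp: vi emeasure_density)
      also have "\<dots> = ennreal (1 + s) * (\<integral>\<^sup>+x\<in>sector ?q D. ennreal (norm x powr (s * ?n)) \<partial>lborel)"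
        using s by (simp add: ennreal_mult' mult.assoc nn_integral_cmult)
      also have "\<dots> = ennreal (1 + s) * (ennreal (?n / (?n + s * ?n) * ?q powr (?n + s * ?n)) * emeasure lborel (sector 1 D))"
        using s True np by (subst nn_integral_sector) (auto intro!: mult_nonpos_nonneg)
      also have "\<dots> = ennreal ((1 + s) * (?n / (?n + s * ?n) * ?q powr (?n + s * ?n))) * emeasure lborel (sector 1 D)"
      proof -
        have "ennreal (1 + s) * (ennreal b * m) = ennreal ((1 + s) * b) * m" for b m
          using s by (simp add: ennreal_mult' mult.assoc)
        then show ?thesis .
      qed
      also have "(1 + s) * (?n / (?n + s * ?n) * ?q powr (?n + s * ?n)) = r ^ DIM('a)"
      proof -
        have "?n + s * ?n = (1 + s) * ?n" by (simp add: algebra_simps)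
        then have "?q powr (?n + s * ?n) = r powr ?n" "(1 + s) * (?n / (?n + s * ?n)) = 1" using s True by (simp_all add: powr_powr)
        moreover have "(1 + s) * (?n / (?n + s * ?n) * ?q powr (?n + s * ?n)) = (1 + s) * (?n / (?n + s * ?n)) * ?q powr (?n + s * ?n)"
          by (simp only: mult.assoc)
        ultimately show ?thesis using powr_realpow[OF True] s by simp
      qed
      finally show ?thesis unfolding X emeasure_sector[OF D True] .
    next
      case False
      then have "\<not> norm x < r" for x :: 'a using norm_ge_zero[of x] by linarith
      then have "X = {}" unfolding X sector_def by simp
      then show ?thesis by simp
    qed
  qed
  show "emeasure ?M (sector (real i) UNIV) \<noteq> \<infinity>" for i
  proof -
    have "sector (real i) UNIV \<in> ?G" by (rule CollectI, rule exI[of _ "real i"], rule exI[of _ "UNIV::'a set"]) simp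
    from eq[OF this] show ?thesis
      using emeasure_lborel_ball_finite[of "0::'a" "real i"] by (simp add: sector_UNIV)
  qed
  have "x \<in> (\<Union>i::nat. sector (real i) UNIV)" for x :: 'a
    using reals_Archimedean2[of "norm x"] by (simp add: sector_def)
  then show "(\<Union>i::nat. sector (real i) UNIV) = (UNIV::'a set)" by (rule set_eqI[OF iffI[OF UNIV_I]])
  show "range (\<lambda>i::nat. sector (real i) UNIV) \<subseteq> ?G" by (rule image_subsetI, rule CollectI) (rule exI, rule exI[of _ "UNIV::'a set"], simp)
  show "sets ?M = sigma_sets UNIV ?G" "sets lborel = sigma_sets UNIV ?G"
    unfolding sets_distr sets_lborel by (rule sets_borel_sectors)+
qed simp

lemma nn_integral_radial_map:
  fixes f :: "'a::euclidean_space \<Rightarrow> ennreal" and s :: real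
  assumes s: "- 1 < s" "s \<le> 0" and [measurable]: "f \<in> borel_measurable borel"
  shows "(\<integral>\<^sup>+y. f y \<partial>lborel) = (\<integral>\<^sup>+x. ennreal ((1 + s) * norm x powr (s * DIM('a))) * f (radial_map s x) \<partial>lborel)"
  by (subst distr_radial_map[OF s, symmetric]) (simp add: nn_integral_distr nn_integral_density)

lemma integral_radial_map:
  fixes f :: "'a::euclidean_space \<Rightarrow> real" and s :: real
  assumes s: "- 1 < s" "s \<le> 0" and [measurable]: "f \<in> borel_measurable borel"
  shows "(LINT y|lborel. f y) = (LINT x|lborel. ((1 + s) * norm x powr (s * DIM('a))) * f (radial_map s x))"
  using s by (subst distr_radial_map[OF s, symmetric]) (simp add: integral_distr integral_real_density)

lemma nn_integral_ball_powr:
  fixes p r :: real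
  assumes p: "p \<le> 0" "0 < DIM('a) + p" and r: "r > 0"
  shows "(\<integral>\<^sup>+x\<in>ball (0::'a::euclidean_space) r. ennreal (norm x powr p) \<partial>lborel) =
    ennreal (DIM('a) * measure lebesgue (ball (0::'a) 1) / (DIM('a) + p) * r powr (DIM('a) + p))"
proof -
  have m: "emeasure lborel (ball (0::'a) 1) = ennreal (measure lebesgue (ball (0::'a) 1))"
    by (rule emeasure_lborel_eq_measure_lebesgue) auto
  have "(\<integral>\<^sup>+x\<in>ball (0::'a) r. ennreal (norm x powr p) \<partial>lborel) =
      ennreal (DIM('a) / (DIM('a) + p) * r powr (DIM('a) + p)) * emeasure lborel (ball (0::'a) 1)"
    unfolding sector_UNIV[symmetric] by (rule nn_integral_sector[OF _ p r]) simp
  also have "\<dots> = ennreal (DIM('a) / (DIM('a) + p) * r powr (DIM('a) + p) * measure lebesgue (ball (0::'a) 1))"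
    unfolding m by (rule ennreal_mult''[symmetric]) (rule measure_nonneg)
  also have "DIM('a) / (DIM('a) + p) * r powr (DIM('a) + p) * measure lebesgue (ball (0::'a) 1) =
      DIM('a) * measure lebesgue (ball (0::'a) 1) / (DIM('a) + p) * r powr (DIM('a) + p)" by (simp only: divide_inverse mult_ac)
  finally show ?thesis .
qed

lemma has_derivative_norm_powr:
  fixes x :: "'a::euclidean_space" and p :: real
  assumes x: "x \<noteq> 0"
  shows "((\<lambda>x. norm x powr p) has_derivative (\<lambda>h. p * norm x powr (p - 2) * (x \<bullet> h))) (at x)"
proof -
  have eq: "norm y powr q = (y \<bullet> y) powr (q / 2)" for y :: 'a and q
  proof -
    have "y \<bullet> y = norm y powr 2" by (cases "y = 0") (simp_all add: dot_square_norm)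
    then have "(y \<bullet> y) powr (q / 2) = (norm y powr 2) powr (q / 2)" by (simp only:)
    then show ?thesis by (simp add: powr_powr del: powr_numeral)
  qed
  have xx: "x \<bullet> x > 0" using x by simp
  have "((\<lambda>x. x \<bullet> x) has_derivative (\<lambda>h. x \<bullet> h + h \<bullet> x)) (at x)"
    by (rule has_derivative_inner[OF has_derivative_ident has_derivative_ident])
  then have "((\<lambda>x. (x \<bullet> x) powr (p / 2)) has_derivative
      (\<lambda>h. (x \<bullet> x) powr (p / 2) * (0 * ln (x \<bullet> x) + (x \<bullet> h + h \<bullet> x) * (p / 2) / (x \<bullet> x)))) (at x)"
    by (rule has_derivative_powr) (use xx in auto)
  moreover have "(x \<bullet> x) powr (p / 2) * (0 * ln (x \<bullet> x) + (x \<bullet> h + h \<bullet> x) * (p / 2) / (x \<bullet> x)) = p * norm x powr (p - 2) * (x \<bullet> h)" for h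
  proof -
    have "norm x powr (p - 2) = (x \<bullet> x) powr (p / 2 - 1)" unfolding eq by (simp add: diff_divide_distrib)
    also have "\<dots> = (x \<bullet> x) powr (p / 2) / (x \<bullet> x)" using xx by (simp add: powr_diff)
    finally show ?thesis by (simp add: inner_commute)
  qed
  ultimately show ?thesis unfolding eq by simp
qed

section \<open>Divergence off the origin and the Piola transform\<close>

lemma C1_compact_supportI_punctured:
  fixes v :: "real^'n::finite \<Rightarrow> real^'n"
  assumes der: "\<And>x. x \<noteq> 0 \<Longrightarrow> (v has_derivative D x) (at x)" and cont: "\<And>h. continuous_on (- {0}) (\<lambda>x. D x h)"
    and near: "\<delta> > 0" "\<And>x. norm x < \<delta> \<Longrightarrow> v x = 0" and supp: "\<And>x. R \<le> norm x \<Longrightarrow> v x = 0"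
  shows "v \<in> C1_compact_support" and "(v has_derivative (\<lambda>h. 0)) (at 0)"
proof -
  have z: "(v has_derivative (\<lambda>h. 0)) (at x)" if "norm x < \<delta>" for x
    by (rule has_derivative_transform_within_open[of "\<lambda>_. 0" "\<lambda>h. 0" x UNIV "ball 0 \<delta>"]) (use that near in auto)
  then show "(v has_derivative (\<lambda>h. 0)) (at 0)" using near by simp
  define D' where "D' x = (if x = 0 then (\<lambda>h. 0) else D x)" for x
  have D': "(v has_derivative D' x) (at x)" for x
    using der[of x] z[of 0] near by (auto simp: D'_def)
  have D'0: "D' x = (\<lambda>h. 0)" if "norm x < \<delta>" for x by (rule has_derivative_unique[OF D' z[OF that]])
  show "v \<in> C1_compact_support"
  proof (rule C1_compact_supportI[OF D' _ supp])
    fix h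
    have "continuous_on (ball 0 \<delta> \<union> - {0}) (\<lambda>x. D' x h)"
    proof (rule continuous_on_open_Un)
      show "continuous_on (ball 0 \<delta>) (\<lambda>x. D' x h)"
        by (rule continuous_on_cong[THEN iffD1, OF refl _ continuous_on_const[of _ 0]]) (simp add: D'0)
      show "continuous_on (- {0}) (\<lambda>x. D' x h)"
        by (rule continuous_on_cong[THEN iffD1, OF refl _ cont[of h]]) (simp add: D'_def)
    qed (auto simp: open_Compl)
    moreover have "ball 0 \<delta> \<union> - {0} = (UNIV :: (real^'n) set)" using near by auto
    ultimately show "continuous_on UNIV (\<lambda>x. D' x h)" by simp
  qed
qed

lemma divergence_scaleR_general:
  fixes v :: "real^'n::finite \<Rightarrow> real^'n"
  assumes f: "(f has_derivative Q) (at x)" and v: "(v has_derivative D) (at x)"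
  shows "divergence (\<lambda>x. f x *\<^sub>R v x) x = f x * divergence v x + Q (v x)"
proof -
  have lin: "linear Q" by (rule bounded_linear.linear[OF has_derivative_bounded_linear[OF f]])
  note Q = linear_axis_sum[OF lin, of "v x", unfolded real_scaleR_def]
  show ?thesis
    unfolding divergence_eq[OF has_derivative_scaleR[OF f v]] divergence_eq[OF v] Q
    by (simp add: sum.distrib sum_distrib_left mult.commute)
qed

lemma divergence_ident: "divergence (\<lambda>x::real^'n::finite. x) x = CARD('n)"
  by (subst divergence_eq[OF has_derivative_ident]) (simp add: axis_def)

lemma divergence_add:
  assumes "(v has_derivative D) (at x)" "(w has_derivative D') (at x)"
  shows "divergence (\<lambda>x. v x + w x) x = divergence v x + divergence w x"
  unfolding divergence_eq[OF has_derivative_add[OF assms]] divergence_eq[OF assms(1)] divergence_eq[OF assms(2)]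
  by (simp add: sum.distrib)

lemma inner_scaleR_norm_powr: "norm x powr (- 2) * (x \<bullet> x) = 1" if "x \<noteq> 0" for x :: "'a::euclidean_space"
  using that by (simp add: powr_minus dot_square_norm)

text \<open>Scales the component of \<open>w\<close> along \<open>x\<close> by
  \<open>\<alpha> + \<beta>\<close> and the components across it by \<alpha>. With the values 1 + s
  and -s the radial part is kept and the tangential part is multiplied by 1 + s, as in the Piola
  transform of the radial map.\<close>

definition adjust_radial :: "real \<Rightarrow> real \<Rightarrow> ('a::euclidean_space \<Rightarrow> 'a) \<Rightarrow> 'a \<Rightarrow> 'a" where
  "adjust_radial \<alpha> \<beta> w x = \<alpha> *\<^sub>R w x + (\<beta> * ((w x \<bullet> x) * norm x powr (- 2))) *\<^sub>R x"

lemma has_derivative_adjust_radial: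
  fixes w :: "'a::euclidean_space \<Rightarrow> 'a"
  assumes x: "x \<noteq> 0" and w: "(w has_derivative W) (at x)"
  shows "((\<lambda>x. \<beta> * ((w x \<bullet> x) * norm x powr (- 2))) has_derivative
      (\<lambda>h. \<beta> * ((w x \<bullet> x) * (- 2 * norm x powr (- 2 - 2) * (x \<bullet> h)) + (w x \<bullet> h + W h \<bullet> x) * norm x powr (- 2)))) (at x)"
    and "(adjust_radial \<alpha> \<beta> w has_derivative (\<lambda>h. \<alpha> *\<^sub>R W h + ((\<beta> * ((w x \<bullet> x) * norm x powr (- 2))) *\<^sub>R h +
      (\<beta> * ((w x \<bullet> x) * (- 2 * norm x powr (- 2 - 2) * (x \<bullet> h)) + (w x \<bullet> h + W h \<bullet> x) * norm x powr (- 2))) *\<^sub>R x))) (at x)"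
proof -
  show q: "((\<lambda>x. \<beta> * ((w x \<bullet> x) * norm x powr (- 2))) has_derivative
      (\<lambda>h. \<beta> * ((w x \<bullet> x) * (- 2 * norm x powr (- 2 - 2) * (x \<bullet> h)) + (w x \<bullet> h + W h \<bullet> x) * norm x powr (- 2)))) (at x)"
    by (intro has_derivative_mult_right has_derivative_mult has_derivative_inner has_derivative_norm_powr w has_derivative_ident x)
  show "(adjust_radial \<alpha> \<beta> w has_derivative (\<lambda>h. \<alpha> *\<^sub>R W h + ((\<beta> * ((w x \<bullet> x) * norm x powr (- 2))) *\<^sub>R h +
      (\<beta> * ((w x \<bullet> x) * (- 2 * norm x powr (- 2 - 2) * (x \<bullet> h)) + (w x \<bullet> h + W h \<bullet> x) * norm x powr (- 2))) *\<^sub>R x))) (at x)"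
    unfolding adjust_radial_def[abs_def]
    by (intro has_derivative_add has_derivative_scaleR_right has_derivative_scaleR q w has_derivative_ident)
qed

lemma divergence_adjust_radial:
  fixes w :: "real^'n::finite \<Rightarrow> real^'n"
  assumes x: "x \<noteq> 0" and w: "(w has_derivative W) (at x)"
  shows "divergence (adjust_radial \<alpha> \<beta> w) x = \<alpha> * divergence w x +
    \<beta> * norm x powr (- 2) * ((real CARD('n) - 1) * (w x \<bullet> x) + W x \<bullet> x)"
proof -
  note q = has_derivative_adjust_radial(1)[OF x w, of \<beta>]
  have "divergence (adjust_radial \<alpha> \<beta> w) x = divergence (\<lambda>x. \<alpha> *\<^sub>R w x) x + divergence (\<lambda>x. (\<beta> * ((w x \<bullet> x) * norm x powr (- 2))) *\<^sub>R x) x"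
    unfolding adjust_radial_def[abs_def]
    by (rule divergence_add[OF has_derivative_scaleR_right[OF w] has_derivative_scaleR[OF q has_derivative_ident]])
  also have "divergence (\<lambda>x. \<alpha> *\<^sub>R w x) x = \<alpha> * divergence w x"
    using divergence_scaleR_general[OF has_derivative_const w, of \<alpha>] by simp
  also have "divergence (\<lambda>x. (\<beta> * ((w x \<bullet> x) * norm x powr (- 2))) *\<^sub>R x) x =
     \<beta> * ((w x \<bullet> x) * norm x powr (- 2)) * CARD('n) +
     \<beta> * ((w x \<bullet> x) * (- 2 * norm x powr (- 2 - 2) * (x \<bullet> x)) + (w x \<bullet> x + W x \<bullet> x) * norm x powr (- 2))"
    using divergence_scaleR_general[OF q has_derivative_ident] by (simp add: divergence_ident)
  also have "norm x powr (- 2 - 2) = norm x powr (- 2) * norm x powr (- 2)" by (simp add: powr_add[symmetric])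
  also have "- 2 * (norm x powr (- 2) * norm x powr (- 2)) * (x \<bullet> x) = - 2 * norm x powr (- 2) * (norm x powr (- 2) * (x \<bullet> x))" by simp
  also have "norm x powr (- 2) * (x \<bullet> x) = 1" by (rule inner_scaleR_norm_powr[OF x])
  finally show ?thesis by (simp add: algebra_simps)
qed

lemma C1_compact_support_adjust_radial:
  fixes w :: "real^'n::finite \<Rightarrow> real^'n"
  assumes w: "w \<in> C1_compact_support" and near: "\<delta> > 0" "\<And>x. norm x < \<delta> \<Longrightarrow> w x = 0"
  shows "adjust_radial \<alpha> \<beta> w \<in> C1_compact_support"
proof -
  obtain D R where D: "\<And>x. (w has_derivative D x) (at x)" "\<And>h. continuous_on UNIV (\<lambda>x. D x h)"
    "\<And>x. R \<le> norm x \<Longrightarrow> w x = 0" "continuous_on UNIV w"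
    using C1_compact_supportE[OF w] by metis
  have c: "continuous_on (- {0}) w" "\<And>h. continuous_on (- {0}) (\<lambda>x. D x h)"
    using D by (auto intro: continuous_on_subset)
  show ?thesis
  proof (rule C1_compact_supportI_punctured(1)[OF has_derivative_adjust_radial(2)[OF _ D(1)] _ near(1)])
    show "adjust_radial \<alpha> \<beta> w x = 0" if "norm x < \<delta>" for x using near(2)[OF that] by (simp add: adjust_radial_def)
    show "adjust_radial \<alpha> \<beta> w x = 0" if "R \<le> norm x" for x using D(3)[OF that] by (simp add: adjust_radial_def)
  qed (use c in \<open>auto intro!: continuous_intros\<close>)
qed

lemma has_derivative_radial_map:
  fixes x :: "'a::euclidean_space" and s :: real
  assumes x: "x \<noteq> 0"
  shows "(radial_map s has_derivative (\<lambda>h. norm x powr s *\<^sub>R h + (s * norm x powr (s - 2) * (x \<bullet> h)) *\<^sub>R x)) (at x)"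
  unfolding radial_map_def[abs_def]
  by (rule has_derivative_scaleR[OF has_derivative_norm_powr[OF x] has_derivative_ident])

lemma radial_map_near_0:
  assumes s: "- 1 < (s::real)" and \<delta>: "\<delta> > 0" and x: "norm x < \<delta> powr (1 / (1 + s))"
  shows "norm (radial_map s x) < \<delta>"
  using assms powr_less_iff_less_powr[of "norm x" \<delta> "1 + s"] by (simp add: norm_radial_map)

lemma radial_map_far:
  assumes s: "- 1 < (s::real)" and R: "R > 0" and x: "R powr (1 / (1 + s)) \<le> norm x"
  shows "R \<le> norm (radial_map s x)"
  using assms powr_less_iff_less_powr[of "norm x" R "1 + s"] by (simp add: norm_radial_map not_less[symmetric])

lemma C1_compact_support_radial_map:
  fixes w :: "real^'n::finite \<Rightarrow> real^'n"
  assumes s: "- 1 < (s::real)" and w: "w \<in> C1_compact_support" and near: "\<delta> > 0" "\<And>x. norm x < \<delta> \<Longrightarrow> w x = 0"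
  shows "(\<lambda>x. w (radial_map s x)) \<in> C1_compact_support"
proof -
  obtain w' where w': "\<And>x. (w has_derivative blinfun_apply (w' x)) (at x)" "continuous_on UNIV w'"
    using w by (auto simp: C1_compact_support_def)
  obtain R where R: "R > 0" "\<And>x. R \<le> norm x \<Longrightarrow> w x = 0"
    using C1_compact_supportE[OF w] by metis
  have c: "continuous_on (- {0}) (\<lambda>x. w' (radial_map s x))"
    by (rule continuous_on_compose2[OF w'(2)]) (auto simp: radial_map_def intro!: continuous_intros)
  show ?thesis
  proof (rule C1_compact_supportI_punctured(1))
    show "((\<lambda>x. w (radial_map s x)) has_derivative (\<lambda>h. blinfun_apply (w' (radial_map s x))
       (norm x powr s *\<^sub>R h + (s * norm x powr (s - 2) * (x \<bullet> h)) *\<^sub>R x))) (at x)" if "x \<noteq> 0" for x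
      by (rule has_derivative_compose[OF has_derivative_radial_map[OF that] w'(1)])
    show "continuous_on (- {0}) (\<lambda>x. blinfun_apply (w' (radial_map s x))
       (norm x powr s *\<^sub>R h + (s * norm x powr (s - 2) * (x \<bullet> h)) *\<^sub>R x))" for h
      using c by (intro continuous_intros) auto
    show "\<delta> powr (1 / (1 + s)) > 0" using near by simp
    show "w (radial_map s x) = 0" if "norm x < \<delta> powr (1 / (1 + s))" for x
      by (rule near(2)[OF radial_map_near_0[OF s near(1) that]])
    show "w (radial_map s x) = 0" if "R powr (1 / (1 + s)) \<le> norm x" for x
      by (rule R(2)[OF radial_map_far[OF s R(1) that]])
  qed
qed

text \<open>With \<open>\<Phi> x = |x|\<^sup>s x\<close>, the field below is the Piola transform of \<open>w\<close> under \<open>\<Phi>\<close>; the weight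
  \<open>|x|\<^sup>k\<close> with \<open>k = s (N - 1)\<close> is exactly what makes the terms without derivatives of \<open>w\<close> cancel.\<close>

lemma divergence_radial_piola:
  fixes w :: "real^'n::finite \<Rightarrow> real^'n" and s k :: real
  assumes x: "x \<noteq> 0" and W: "(w has_derivative W) (at (radial_map s x))" and k: "k = s * (real CARD('n) - 1)"
  shows "divergence (\<lambda>x. norm x powr k *\<^sub>R adjust_radial (1 + s) (- s) (\<lambda>x. w (radial_map s x)) x) x =
    (1 + s) * norm x powr (s * CARD('n)) * divergence w (radial_map s x)"
proof -
  let ?u = "\<lambda>x. w (radial_map s x)" and ?y = "radial_map s x" and ?n = "real CARD('n)"
  let ?U = "\<lambda>h. W (norm x powr s *\<^sub>R h + (s * norm x powr (s - 2) * (x \<bullet> h)) *\<^sub>R x)"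
  have U: "(?u has_derivative ?U) (at x)"
    by (rule has_derivative_compose[OF has_derivative_radial_map[OF x] W])
  have lin: "linear W" by (rule bounded_linear.linear[OF has_derivative_bounded_linear[OF W]])
  have xx: "norm x powr (- 2) * (x \<bullet> x) = 1" by (rule inner_scaleR_norm_powr[OF x])
  have s2: "norm x powr (s - 2) = norm x powr s * norm x powr (- 2)" by (simp add: powr_add[symmetric])
  have k2: "norm x powr (k - 2) = norm x powr k * norm x powr (- 2)" by (simp add: powr_add[symmetric])
  have Wx: "(\<Sum>i\<in>UNIV. x $ i * W x $ i) = W x \<bullet> x" by (simp add: inner_vec_def mult.commute)
  have divu: "divergence ?u x = norm x powr s * divergence w ?y + s * norm x powr s * norm x powr (- 2) * (W x \<bullet> x)"
    unfolding divergence_eq[OF U] divergence_eq[OF W] Wx[symmetric]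
    by (simp add: linear_add[OF lin] linear_scale[OF lin] sum.distrib sum_distrib_left inner_axis s2 mult_ac)
  have "?U x = (norm x powr s + s * norm x powr s * (norm x powr (- 2) * (x \<bullet> x))) *\<^sub>R W x"
    unfolding s2 by (simp add: linear_add[OF lin] linear_scale[OF lin] scaleR_left_distrib mult.assoc)
  then have Ux: "?U x = ((1 + s) * norm x powr s) *\<^sub>R W x" unfolding xx by (simp add: algebra_simps)
  note A = has_derivative_adjust_radial(2)[OF x U, of "1 + s" "- s"]
  have "divergence (\<lambda>x. norm x powr k *\<^sub>R adjust_radial (1 + s) (- s) ?u x) x =
     norm x powr k * divergence (adjust_radial (1 + s) (- s) ?u) x + k * norm x powr (k - 2) * (x \<bullet> adjust_radial (1 + s) (- s) ?u x)"
    by (rule divergence_scaleR_general[OF has_derivative_norm_powr[OF x] A])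
  also have "x \<bullet> adjust_radial (1 + s) (- s) ?u x = (1 + s) * (?u x \<bullet> x) - s * (?u x \<bullet> x) * (norm x powr (- 2) * (x \<bullet> x))"
    by (simp add: adjust_radial_def inner_diff_right inner_commute)
  also have "\<dots> = ?u x \<bullet> x" unfolding xx by (simp add: algebra_simps)
  also have "divergence (adjust_radial (1 + s) (- s) ?u) x = (1 + s) * divergence ?u x + (- s) * norm x powr (- 2) * ((?n - 1) * (?u x \<bullet> x) + ?U x \<bullet> x)"
    by (rule divergence_adjust_radial[OF x U])
  finally have "divergence (\<lambda>x. norm x powr k *\<^sub>R adjust_radial (1 + s) (- s) ?u x) x =
     norm x powr k * ((1 + s) * divergence ?u x + (- s) * norm x powr (- 2) * ((?n - 1) * (?u x \<bullet> x) + (1 + s) * norm x powr s * (W x \<bullet> x)))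
      + k * (norm x powr k * norm x powr (- 2)) * (?u x \<bullet> x)" unfolding Ux k2 by simp
  also have "\<dots> = (1 + s) * (norm x powr k * norm x powr s) * divergence w ?y" unfolding divu k by (simp add: algebra_simps)
  also have "norm x powr k * norm x powr s = norm x powr (s * ?n)" by (simp add: powr_add[symmetric] k algebra_simps)
  finally show ?thesis .
qed

lemma integral_norm_powr_ball:
  fixes p r :: real
  assumes p: "p \<le> 0" "0 < DIM('a) + p" and r: "r > 0"
  shows "integrable lborel (\<lambda>x::'a::euclidean_space. indicator (ball 0 r) x * norm x powr p)"
    and "(LINT x|lborel. indicator (ball (0::'a) r) x * norm x powr p) =
      DIM('a) * measure lebesgue (ball (0::'a) 1) / (DIM('a) + p) * r powr (DIM('a) + p)"
proof -
  let ?c = "DIM('a) * measure lebesgue (ball (0::'a) 1) / (DIM('a) + p) * r powr (DIM('a) + p)"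
  have "(\<integral>\<^sup>+x. ennreal (indicator (ball (0::'a) r) x * norm x powr p) \<partial>lborel) = (\<integral>\<^sup>+x\<in>ball (0::'a) r. ennreal (norm x powr p) \<partial>lborel)"
    by (intro nn_integral_cong) (auto simp: indicator_def)
  then have eq: "(\<integral>\<^sup>+x. ennreal (indicator (ball (0::'a) r) x * norm x powr p) \<partial>lborel) = ennreal ?c"
    unfolding nn_integral_ball_powr[OF p r] .
  have c: "0 \<le> ?c" using p by (intro mult_nonneg_nonneg divide_nonneg_pos) auto
  have [measurable]: "ball (0::'a) r \<in> sets borel" by simp
  have m: "(\<lambda>x::'a. indicator (ball 0 r) x * norm x powr p) \<in> borel_measurable lborel" by measurable
  show "integrable lborel (\<lambda>x::'a::euclidean_space. indicator (ball 0 r) x * norm x powr p)"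
    by (rule integrableI_nn_integral_finite[OF m _ eq]) auto
  show "(LINT x|lborel. indicator (ball (0::'a) r) x * norm x powr p) = ?c"
    using integral_eq_nn_integral[OF m] unfolding eq enn2real_ennreal[OF c] by simp
qed

text \<open>A cutoff at the origin can be removed from the integral of a divergence. Its gradient is
  at most 2C/|x| at every scale, so the error is dominated by |x|^(k - 1), which is integrable
  because k + N - 1 > 0, and at each point off the origin it is eventually 0.\<close>

lemma cutoff_limit:
  fixes F :: "'a::euclidean_space \<Rightarrow> 'a" and g :: "'a \<Rightarrow> real" and c k R :: real
  assumes E [measurable]: "E \<in> sets borel" and g: "integrable lborel g" and F [measurable]: "F \<in> borel_measurable borel"
    and bd: "\<And>x. x \<noteq> 0 \<Longrightarrow> norm (F x) \<le> c * (indicator (ball 0 R) x * norm x powr k)"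
    and k: "k \<le> 1" "0 < DIM('a) + k - 1" and c: "c \<ge> 0" and R: "R > 0"
  shows "(\<lambda>n. LINT x|lborel. indicator E x * ((1 - cutoff (1 / Suc n) x) * g x - cutoff' (1 / Suc n) x \<bullet> F x))
    \<longlonglongrightarrow> (LINT x|lborel. indicator E x * g x)"
proof -
  obtain C where C: "C > 0" "\<And>r x. r > 0 \<Longrightarrow> norm (cutoff' r (x::'a)) \<le> C / r" using cutoff'_bound by blast
  have [measurable]: "g \<in> borel_measurable borel" using g by auto
  have [measurable]: "cutoff r \<in> borel_measurable borel" "cutoff' r \<in> borel_measurable borel" for r
    using C1_gradientD(4,5)[OF C1_gradient_cutoff] by auto
  have rpos: "1 / real (Suc n) > 0" for n by simp
  show ?thesis
  proof (rule integral_dominated_convergence[where w="\<lambda>x. \<bar>g x\<bar> + 2 * C * c * (indicator (ball 0 R) x * norm x powr (k - 1))"])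
    show "integrable lborel (\<lambda>x. \<bar>g x\<bar> + 2 * C * c * (indicator (ball (0::'a) R) x * norm x powr (k - 1)))"
      using g k R by (intro Bochner_Integration.integrable_add integrable_mult_right integral_norm_powr_ball(1)) auto
    show "AE x in lborel. (\<lambda>n. indicator E x * ((1 - cutoff (1 / Suc n) x) * g x - cutoff' (1 / Suc n) x \<bullet> F x)) \<longlonglongrightarrow> indicator E x * g x"
      using AE_lborel_singleton[of "0::'a"]
    proof eventually_elim
      case (elim x)
      have "\<forall>\<^sub>F n in sequentially. 1 / real (Suc n) < norm x / 2"
        using order_tendstoD(2)[OF LIMSEQ_inverse_real_of_nat, of "norm x / 2"] elim by (simp add: inverse_eq_divide)
      then have "\<forall>\<^sub>F n in sequentially. indicator E x * ((1 - cutoff (1 / Suc n) x) * g x - cutoff' (1 / Suc n) x \<bullet> F x) = indicator E x * g x"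
      proof eventually_elim
        case (elim n)
        then have "2 * (1 / real (Suc n)) \<le> norm x" by linarith
        then show ?case using cutoff_simps(4,6)[OF rpos[of n], of x] by simp
      qed
      then show ?case by (rule tendsto_eventually)
    qed
    show "AE x in lborel. norm (indicator E x * ((1 - cutoff (1 / Suc n) x) * g x - cutoff' (1 / Suc n) x \<bullet> F x))
      \<le> \<bar>g x\<bar> + 2 * C * c * (indicator (ball 0 R) x * norm x powr (k - 1))" for n
      using AE_lborel_singleton[of "0::'a"]
    proof eventually_elim
      case (elim x)
      let ?r = "1 / real (Suc n)"
      have nx: "norm x > 0" using elim by simp
      have 1: "\<bar>(1 - cutoff ?r x) * g x\<bar> \<le> \<bar>g x\<bar>"
        using cutoff_simps(1,2)[OF rpos[of n], of x] unfolding abs_mult by (intro mult_left_le_one_le) auto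
      have 2: "norm (cutoff' ?r x) \<le> 2 * C / norm x"
      proof (cases "2 * ?r \<le> norm x")
        case True
        then show ?thesis using cutoff_simps(6)[OF rpos[of n] True] C(1) by simp
      next
        case False
        have "C / ?r = 2 * C / (2 * ?r)" by simp
        also have "\<dots> \<le> 2 * C / norm x" using False nx C by (intro divide_left_mono) auto
        finally show ?thesis using C(2)[OF rpos[of n], of x] by linarith
      qed
      have "\<bar>cutoff' ?r x \<bullet> F x\<bar> \<le> norm (cutoff' ?r x) * norm (F x)" by (rule Cauchy_Schwarz_ineq2)
      also have "\<dots> \<le> (2 * C / norm x) * (c * (indicator (ball 0 R) x * norm x powr k))"
        by (rule mult_mono[OF 2 bd[OF elim]]) (use C nx in auto)
      also have "\<dots> = 2 * C * c * (indicator (ball 0 R) x * (norm x powr k / norm x))" by simp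
      also have "norm x powr k / norm x = norm x powr (k - 1)" using nx by (simp add: powr_diff)
      finally have 3: "\<bar>cutoff' ?r x \<bullet> F x\<bar> \<le> 2 * C * c * (indicator (ball 0 R) x * norm x powr (k - 1))" .
      have "norm (indicator E x * ((1 - cutoff ?r x) * g x - cutoff' ?r x \<bullet> F x)) \<le> \<bar>(1 - cutoff ?r x) * g x - cutoff' ?r x \<bullet> F x\<bar>"
        by (simp add: indicator_def)
      also have "\<dots> \<le> \<bar>(1 - cutoff ?r x) * g x\<bar> + \<bar>cutoff' ?r x \<bullet> F x\<bar>" by (rule abs_triangle_ineq4)
      finally show ?case using 1 3 by linarith
    qed
  qed measurable
qed

lemma adjust_radial_scaleR: "adjust_radial \<alpha> \<beta> (\<lambda>x. f x *\<^sub>R w x) x = f x *\<^sub>R adjust_radial \<alpha> \<beta> w x"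
  by (simp add: adjust_radial_def scaleR_right_distrib mult_ac)

lemma norm_adjust_radial_le: "norm (adjust_radial \<alpha> \<beta> w x) \<le> (\<bar>\<alpha>\<bar> + \<bar>\<beta>\<bar>) * norm (w x)"
proof (cases "x = 0")
  case True
  then show ?thesis by (simp add: adjust_radial_def distrib_right)
next
  case False
  have "\<bar>w x \<bullet> x\<bar> * norm x powr (- 2) * norm x \<le> (norm (w x) * norm x) * norm x powr (- 2) * norm x"
    by (intro mult_right_mono Cauchy_Schwarz_ineq2) auto
  also have "\<dots> = norm (w x)" using False by (simp add: powr_minus power2_eq_square divide_simps)
  finally have "\<bar>\<beta>\<bar> * (\<bar>w x \<bullet> x\<bar> * norm x powr (- 2) * norm x) \<le> \<bar>\<beta>\<bar> * norm (w x)" by (intro mult_left_mono) auto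
  moreover have "norm (adjust_radial \<alpha> \<beta> w x) \<le> \<bar>\<alpha>\<bar> * norm (w x) + \<bar>\<beta>\<bar> * (\<bar>w x \<bullet> x\<bar> * norm x powr (- 2) * norm x)"
    unfolding adjust_radial_def by (rule norm_triangle_le) (simp add: abs_mult mult.assoc)
  ultimately show ?thesis by (simp add: algebra_simps)
qed

lemma adjust_radial_radial_map: "adjust_radial \<alpha> \<beta> (\<lambda>x. w (radial_map s x)) x = adjust_radial \<alpha> \<beta> w (radial_map s x)"
proof (cases "x = 0")
  case True
  then show ?thesis by (simp add: adjust_radial_def radial_map_def)
next
  case False
  define c where "c = norm x powr s"
  have c: "c > 0" using False by (simp add: c_def)
  have y: "radial_map s x = c *\<^sub>R x" by (simp add: radial_map_def c_def)
  have "c * ((c * norm x) powr (- 2)) * c = norm x powr (- 2)"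
    using c False by (simp add: powr_mult powr_minus power2_eq_square)
  then have "(\<beta> * (w (c *\<^sub>R x) \<bullet> (c *\<^sub>R x) * norm (c *\<^sub>R x) powr (- 2))) *\<^sub>R (c *\<^sub>R x) = (\<beta> * (w (c *\<^sub>R x) \<bullet> x * norm x powr (- 2))) *\<^sub>R x"
    using c by (simp add: mult_ac)
  then show ?thesis unfolding adjust_radial_def y by (simp only:)
qed

text \<open>Tangential and radial factors multiply separately: the assumptions amount to \<alpha> a
  = 1 and (\<alpha> + \<beta>)(a + b) = 1.\<close>

lemma adjust_radial_compose:
  assumes "\<alpha> * a = 1" "\<alpha> * b + \<beta> * (a + b) = 0"
  shows "adjust_radial \<alpha> \<beta> (adjust_radial a b w) x = w x"
proof (cases "x = 0")
  case True
  then show ?thesis using assms by (simp add: adjust_radial_def)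
next
  case False
  have "adjust_radial a b w x \<bullet> x = a * (w x \<bullet> x) + b * (w x \<bullet> x) * (norm x powr (- 2) * (x \<bullet> x))"
    by (simp add: adjust_radial_def inner_left_distrib)
  then have i: "adjust_radial a b w x \<bullet> x = (a + b) * (w x \<bullet> x)" unfolding inner_scaleR_norm_powr[OF False] by (simp add: distrib_right)
  have "adjust_radial \<alpha> \<beta> (adjust_radial a b w) x = (\<alpha> * a) *\<^sub>R w x + ((\<alpha> * b + \<beta> * (a + b)) * ((w x \<bullet> x) * norm x powr (- 2))) *\<^sub>R x"
    unfolding adjust_radial_def[of \<alpha> \<beta>] i by (simp add: adjust_radial_def algebra_simps)
  then show ?thesis using assms by simp
qed

section \<open>Transfer of the weighted perimeter to a Euclidean one\<close>

text \<open>\<open>E\<close> is a Borel version of the image of \<open>M\<close> under the radial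
  map; only its preimage up to null sets matters.\<close>

locale weighted_transfer =
  fixes k s P :: real and M E :: "(real^'n::finite) set"
  assumes N: "CARD('n) \<ge> 2" and k: "k \<le> 0" "0 < k + real CARD('n) - 1"
    and M: "M \<in> sets lebesgue" and E: "E \<in> sets borel"
    and P: "weighted_perimeter k M \<le> ereal P"
    and s_eq: "s = k / (real CARD('n) - 1)"
    and EM: "AE x in lborel. radial_map s x \<in> E \<longleftrightarrow> x \<in> M"
begin

lemma s: "- 1 < s" "s \<le> 0" "k = s * (real CARD('n) - 1)"
  using N k by (auto simp: s_eq field_simps)

text \<open>A field that vanishes near 0 has a C^1 Piola transform.
  \<open>divergence_radial_piola\<close> and the change of variables turn the weighted divergence
  over \<open>M\<close> into the divergence of \<open>w\<close> over \<open>E\<close>;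
  \<open>bd\<close> says that the transformed field has length at most 1.\<close>

lemma vanishing_field:
  assumes w: "w \<in> C1_compact_support" and near: "\<delta> > 0" "\<And>x. norm x < \<delta> \<Longrightarrow> w x = 0"
    and bd: "\<And>x. norm (adjust_radial (1 + s) (- s) w x) \<le> 1"
  shows "(LINT y|lborel. indicator E y * divergence w y) \<le> P"
proof -
  define v where "v = adjust_radial (1 + s) (- s) (\<lambda>x. w (radial_map s x))"
  define \<delta>' where "\<delta>' = \<delta> powr (1 / (1 + s))"
  have \<delta>': "\<delta>' > 0" using near by (simp add: \<delta>'_def)
  have u0: "w (radial_map s x) = 0" if "norm x < \<delta>'" for x
    using that unfolding \<delta>'_def by (rule near(2)[OF radial_map_near_0[OF s(1) near(1)]])
  have v: "v \<in> C1_compact_support"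
    unfolding v_def by (rule C1_compact_support_adjust_radial[OF C1_compact_support_radial_map[OF s(1) w near] \<delta>' u0])
  have v1: "norm (v x) \<le> 1" for x unfolding v_def adjust_radial_radial_map by (rule bd)
  have v0: "v x = 0" if "norm x < \<delta>'" for x using u0[OF that] by (simp add: v_def adjust_radial_def)
  obtain D where D: "\<And>x. (w has_derivative D x) (at x)" using C1_compact_supportE[OF w] by metis
  have dw: "divergence w \<in> borel_measurable borel"
    by (rule borel_measurable_continuous_onI[OF continuous_on_divergence(1)[OF w]])
  let ?G = "\<lambda>x. (1 + s) * norm x powr (s * CARD('n)) * divergence w (radial_map s x)"
  have div: "divergence (\<lambda>y. norm y powr k *\<^sub>R v y) x = ?G x" for x
  proof (cases "x = 0")
    case True
    have "((\<lambda>y. norm y powr k *\<^sub>R v y) has_derivative (\<lambda>h. 0)) (at 0)"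
      by (rule has_derivative_transform_within_open[of "\<lambda>_. 0" "\<lambda>h. 0" 0 UNIV "ball 0 \<delta>'"]) (use \<delta>' v0 in auto)
    then show ?thesis using True by (simp add: divergence_eq)
  next
    case False
    show ?thesis unfolding v_def by (rule divergence_radial_piola[OF False D s(3)])
  qed
  have "(LINT y|lborel. indicator E y * divergence w y) =
      (LINT x|lborel. ((1 + s) * norm x powr (s * DIM(real^'n))) * (indicator E (radial_map s x) * divergence w (radial_map s x)))"
    by (rule integral_radial_map[OF s(1,2)]) (use E dw in measurable)
  also have "\<dots> = (LINT x|lborel. indicator E (radial_map s x) * ?G x)"
    by (intro Bochner_Integration.integral_cong) auto
  also have "\<dots> = (LINT x|lebesgue. indicator E (radial_map s x) * ?G x)"
    by (rule integral_completion[symmetric]) (use E dw in measurable)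
  also have "\<dots> = (LINT x|lebesgue. indicator M x * ?G x)"
  proof (rule integral_cong_AE)
    have G: "?G \<in> borel_measurable borel" "(\<lambda>x. indicat_real E (radial_map s x)) \<in> borel_measurable borel" using E dw by measurable
    have G': "?G \<in> borel_measurable lebesgue" "(\<lambda>x. indicat_real E (radial_map s x)) \<in> borel_measurable lebesgue"
      using G by (auto intro: measurable_completion simp: measurable_lborel1)
    show "(\<lambda>x. indicator E (radial_map s x) * ?G x) \<in> borel_measurable lebesgue"
      "(\<lambda>x. indicator M x * ?G x) \<in> borel_measurable lebesgue"
      using G' M by (auto intro!: borel_measurable_times)
    show "AE x in lebesgue. indicator E (radial_map s x) * ?G x = indicator M x * ?G x"
      using AE_completion[OF EM] by eventually_elim (auto simp: indicator_def)
  qed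
  also have "\<dots> = (LINT x:M|lebesgue. divergence (\<lambda>y. norm y powr k *\<^sub>R v y) x)"
    unfolding set_lebesgue_integral_def div by simp
  finally have eq: "(LINT y|lborel. indicator E y * divergence w y) = (LINT x:M|lebesgue. divergence (\<lambda>y. norm y powr k *\<^sub>R v y) x)" .
  have "ereal (LINT x:M|lebesgue. divergence (\<lambda>y. norm y powr k *\<^sub>R v y) x) \<le> weighted_perimeter k M"
    unfolding weighted_perimeter_def by (rule SUP_upper) (use v v1 in auto)
  also have "\<dots> \<le> ereal P" by (rule P)
  finally show ?thesis unfolding eq by simp
qed

text \<open>The field \<open>adjust_radial \<alpha> \<beta> q\<close> need not be C^1 at 0, so it is
  cut off there and \<open>cutoff_limit\<close> removes the cutoff. It serves twice: with \<alpha> =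
  1 and \<beta> = 0 for the Euclidean perimeter, and with the inverse adjustment for balls off the
  origin.\<close>

lemma adjusted_field:
  fixes q :: "real^'n \<Rightarrow> real^'n"
  assumes q: "q \<in> C1_compact_support" and D: "\<And>x. (q has_derivative D x) (at x)"
    and bd: "\<And>x. norm (adjust_radial (1 + s) (- s) (adjust_radial \<alpha> \<beta> q) x) \<le> 1"
  shows "(LINT y|lborel. indicator E y * (\<alpha> * divergence q y +
    \<beta> * norm y powr (- 2) * ((real CARD('n) - 1) * (q y \<bullet> y) + D y y \<bullet> y))) \<le> P"
proof -
  let ?N = "real CARD('n)"
  obtain D' R where D': "\<And>x. (q has_derivative D' x) (at x)" "\<And>h. continuous_on UNIV (\<lambda>x. D' x h)"
    and R: "R > 0" "\<And>x. R \<le> norm x \<Longrightarrow> q x = 0" "\<And>x h. R \<le> norm x \<Longrightarrow> D' x h = 0" and qc: "continuous_on UNIV q"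
    using C1_compact_supportE[OF q] by metis
  have DD: "D' = D" using has_derivative_unique[OF D D'(1)] by auto
  note Dc = D'(2)[unfolded DD] and D0 = R(3)[unfolded DD]
  have [measurable]: "q \<in> borel_measurable borel" using qc by (rule borel_measurable_continuous_onI)
  obtain K where K: "K \<ge> 0" "\<And>x. norm (q x) \<le> K * indicator (ball 0 R) x"
    using bounded_by_indicator_ball[OF qc R(2)] by blast
  have lin: "linear (D x)" for x by (rule bounded_linear.linear[OF has_derivative_bounded_linear[OF D]])
  have Dx: "D x x = (\<Sum>i\<in>UNIV. (x $ i) *\<^sub>R D x (axis i 1))" for x by (rule linear_axis_sum[OF lin])
  have Dxc: "continuous_on UNIV (\<lambda>x. D x x)" unfolding Dx by (intro continuous_intros Dc)
  then have [measurable]: "(\<lambda>x. D x x) \<in> borel_measurable borel" by (rule borel_measurable_continuous_onI)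
  let ?S = "\<lambda>x. \<Sum>i\<in>(UNIV::'n set). norm (D x (axis i 1))"
  have Si: "integrable lborel ?S"
    by (rule integrable_continuous_bounded_support[of _ R]) (auto intro!: continuous_intros Dc simp: D0)
  let ?g1 = "\<lambda>y. norm y powr (- 2) * (q y \<bullet> y)" and ?g2 = "\<lambda>y. norm y powr (- 2) * (D y y \<bullet> y)"
  have pw: "norm x powr (- 2) * norm x * norm x = 1" if "x \<noteq> 0" for x :: "real^'n"
    using inner_scaleR_norm_powr[OF that] by (simp add: dot_square_norm power2_eq_square mult.assoc)
  have g1: "integrable lborel ?g1"
  proof (rule Bochner_Integration.integrable_bound[where f="\<lambda>x. K * (indicator (ball (0::real^'n) R) x * norm x powr (- 1))"])
    show "integrable lborel (\<lambda>x. K * (indicator (ball (0::real^'n) R) x * norm x powr (- 1)))"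
      by (rule integrable_mult_right[OF integral_norm_powr_ball(1)]) (use N R in auto)
    show "AE x in lborel. norm (?g1 x) \<le> norm (K * (indicator (ball 0 R) x * norm x powr (- 1)))"
      using AE_lborel_singleton[of "0::real^'n"]
    proof eventually_elim
      case (elim x)
      have "norm (?g1 x) \<le> norm x powr (- 2) * (norm (q x) * norm x)"
        using Cauchy_Schwarz_ineq2[of "q x" x] by (simp add: abs_mult mult_left_mono)
      also have "\<dots> \<le> norm x powr (- 2) * ((K * indicator (ball 0 R) x) * norm x)"
        by (intro mult_left_mono mult_right_mono K) auto
      also have "\<dots> = K * (indicator (ball 0 R) x * (norm x powr (- 2) * norm x))" by (simp add: mult_ac)
      also have "norm x powr (- 2) * norm x = norm x powr (- 1)"
        using elim by (simp add: powr_minus power2_eq_square)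
      finally show ?case using K(1) by simp
    qed
  qed measurable
  have g2: "integrable lborel ?g2"
  proof (rule Bochner_Integration.integrable_bound[OF Si])
    show "AE x in lborel. norm (?g2 x) \<le> norm (?S x)"
      using AE_lborel_singleton[of "0::real^'n"]
    proof eventually_elim
      case (elim x)
      have "norm (D x x) \<le> (\<Sum>i\<in>UNIV. norm x * norm (D x (axis i 1)))"
        unfolding Dx by (rule sum_norm_le) (auto intro!: mult_right_mono component_le_norm_cart)
      also have "\<dots> = norm x * ?S x" by (simp add: sum_distrib_left)
      finally have Dn: "norm (D x x) \<le> norm x * ?S x" .
      have "norm (?g2 x) \<le> norm x powr (- 2) * (norm (D x x) * norm x)"
        using Cauchy_Schwarz_ineq2[of "D x x" x] by (simp add: abs_mult mult_left_mono)
      also have "\<dots> \<le> norm x powr (- 2) * ((norm x * ?S x) * norm x)"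
        by (intro mult_left_mono mult_right_mono Dn) auto
      also have "\<dots> = (norm x powr (- 2) * norm x * norm x) * ?S x" by (simp add: mult_ac)
      finally show ?case unfolding pw[OF elim] by (simp add: sum_nonneg)
    qed
  qed measurable
  define g where "g y = \<alpha> * divergence q y + \<beta> * norm y powr (- 2) * ((?N - 1) * (q y \<bullet> y) + D y y \<bullet> y)" for y
  have gi: "integrable lborel g"
  proof -
    have "g = (\<lambda>y. \<alpha> * divergence q y + (\<beta> * (?N - 1) * ?g1 y + \<beta> * ?g2 y))"
      by (auto simp: g_def algebra_simps)
    then show ?thesis using g1 g2 continuous_on_divergence(2)[OF q]
      by (simp add: Bochner_Integration.integrable_add integrable_mult_right)
  qed
  let ?F = "adjust_radial \<alpha> \<beta> q"
  have lim: "(\<lambda>n. LINT x|lborel. indicator E x * ((1 - cutoff (1 / Suc n) x) * g x - cutoff' (1 / Suc n) x \<bullet> ?F x))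
    \<longlonglongrightarrow> (LINT x|lborel. indicator E x * g x)"
  proof (rule cutoff_limit[OF E gi])
    show "?F \<in> borel_measurable borel" unfolding adjust_radial_def[abs_def] by measurable
    show "norm (?F x) \<le> (\<bar>\<alpha>\<bar> + \<bar>\<beta>\<bar>) * K * (indicator (ball 0 R) x * norm x powr 0)" if "x \<noteq> 0" for x
    proof -
      have "norm (?F x) \<le> (\<bar>\<alpha>\<bar> + \<bar>\<beta>\<bar>) * norm (q x)" by (rule norm_adjust_radial_le)
      also have "\<dots> \<le> (\<bar>\<alpha>\<bar> + \<bar>\<beta>\<bar>) * (K * indicator (ball 0 R) x)" by (intro mult_left_mono K) auto
      finally show ?thesis using that by (simp add: mult.assoc)
    qed
  qed (use N K R in auto)
  show ?thesis unfolding g_def[symmetric]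
  proof (rule LIMSEQ_le_const2[OF lim], intro exI[of _ 0] allI impI)
    fix n :: nat
    let ?r = "1 / real (Suc n)"
    have r: "?r > 0" by simp
    let ?p = "\<lambda>x. (1 - cutoff ?r x) *\<^sub>R q x"
    have c1: "C1_gradient (\<lambda>x. 1 - cutoff ?r x) (\<lambda>x. - cutoff' ?r (x::real^'n))"
      by (rule C1_gradient_intros(5)[OF C1_gradient_cutoff C1_gradient_cutoff])
    have p: "?p \<in> C1_compact_support" by (rule C1_compact_support_scaleR(1)[OF c1 q])
    have p0: "?p x = 0" if "norm x < ?r" for x using cutoff_simps(3)[OF r, of x] that by simp
    define w where "w = adjust_radial \<alpha> \<beta> ?p"
    have w: "w \<in> C1_compact_support" unfolding w_def by (rule C1_compact_support_adjust_radial[OF p r p0])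
    have w0: "w x = 0" if "norm x < ?r" for x using p0[OF that] unfolding w_def adjust_radial_def by (simp only:) simp
    have weq: "w = (\<lambda>x. (1 - cutoff ?r x) *\<^sub>R ?F x)" by (auto simp: w_def adjust_radial_scaleR)
    have wbd: "norm (adjust_radial (1 + s) (- s) w x) \<le> 1" for x
    proof -
      have "norm (adjust_radial (1 + s) (- s) w x) = \<bar>1 - cutoff ?r x\<bar> * norm (adjust_radial (1 + s) (- s) ?F x)"
        unfolding weq adjust_radial_scaleR by simp
      also have "\<dots> \<le> 1 * 1" by (rule mult_mono[OF _ bd]) (use cutoff_simps(1,2)[OF r, of x] in auto)
      finally show ?thesis by simp
    qed
    have dw: "divergence w x = (1 - cutoff ?r x) * g x - cutoff' ?r x \<bullet> ?F x" for x
    proof (cases "x = 0")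
      case True
      have "(w has_derivative (\<lambda>h. 0)) (at 0)"
        by (rule has_derivative_transform_within_open[of "\<lambda>_. 0" "\<lambda>h. 0" 0 UNIV "ball 0 ?r"]) (use r w0 in auto)
      then have "divergence w 0 = 0" by (simp add: divergence_eq)
      moreover have "cutoff ?r (0::real^'n) = 1" "cutoff' ?r (0::real^'n) = 0" using cutoff_simps(3,5)[OF r, of 0] by auto
      ultimately show ?thesis using True by simp
    next
      case False
      have "divergence w x = (1 - cutoff ?r x) * divergence ?F x + (- cutoff' ?r x) \<bullet> ?F x"
        unfolding weq by (rule divergence_scaleR(2)[OF C1_gradientD(1)[OF c1] has_derivative_adjust_radial(2)[OF False D]])
      then show ?thesis unfolding divergence_adjust_radial[OF False D] g_def by simp
    qed
    show "(LINT x|lborel. indicator E x * ((1 - cutoff ?r x) * g x - cutoff' ?r x \<bullet> ?F x)) \<le> P"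
      using vanishing_field[OF w r w0 wbd] unfolding dw .
  qed
qed

text \<open>For -1 < s \<le> 0 the adjustment is a contraction, as |1 + s| + |-s| = 1, so every
  Euclidean test field is admissible for the weight.\<close>

lemma perimeter_le: "perimeter_le E P"
  unfolding perimeter_le_def
proof (intro ballI impI)
  fix v :: "real^'n \<Rightarrow> real^'n" assume v: "v \<in> C1_compact_support" and v1: "\<forall>x. norm (v x) \<le> 1"
  obtain D where D: "\<And>x. (v has_derivative D x) (at x)" using C1_compact_supportE[OF v] by metis
  have id: "adjust_radial 1 0 v = v" by (auto simp: adjust_radial_def)
  have "(LINT y|lborel. indicator E y * (1 * divergence v y + 0 * norm y powr (- 2) * ((real CARD('n) - 1) * (v y \<bullet> y) + D y y \<bullet> y))) \<le> P"
  proof (rule adjusted_field[OF v D])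
    show "norm (adjust_radial (1 + s) (- s) (adjust_radial 1 0 v) x) \<le> 1" for x
      using norm_adjust_radial_le[of "1 + s" "- s" v x] s v1 unfolding id by (simp add: abs_of_nonneg abs_of_nonpos order_trans)
  qed
  then show "(LINT x|lborel. indicator E x * divergence v x) \<le> P" by simp
qed

end

section \<open>The weighted perimeter of the unit ball\<close>

text \<open>Translation invariance: shifting \<open>w\<close> by \<open>t *\<^sub>R e\<close> leaves
  its integral unchanged, while to first order the change is \<open>t\<close> times the integral in
  question.\<close>

lemma integral_gradient_eq_0:
  fixes w :: "'a::euclidean_space \<Rightarrow> real"
  assumes w: "C1_gradient w w'" and supp: "\<And>x. R \<le> norm x \<Longrightarrow> w x = 0 \<and> w' x = 0"
  shows "(LINT x|lborel. w' x \<bullet> e) = 0"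
proof -
  note c = C1_gradientD(2,3)[OF w, of UNIV]
  have iw: "integrable lborel w" by (rule integrable_continuous_bounded_support[OF c(2)]) (use supp in blast)
  have iw': "integrable lborel (\<lambda>x. w' x \<bullet> e)"
    by (rule integrable_continuous_bounded_support[of _ R]) (use c supp in \<open>auto intro!: continuous_intros\<close>)
  let ?I = "LINT x|lborel. w' x \<bullet> e" and ?B = "cball (0::'a) (\<bar>R\<bar> + 1)"
  have est: "\<bar>?I\<bar> \<le> \<delta> * (norm e * measure lborel ?B)" if \<delta>: "\<delta> > 0" for \<delta>
  proof -
    obtain d where d: "d > 0" "\<And>x h. norm h < d \<Longrightarrow> \<bar>w (x + h) - w x - w' x \<bullet> h\<bar> \<le> \<delta> * norm h"
      using C1_gradient_uniform_taylor[OF w supp \<delta>] by blast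
    define t where "t = min (d / 2) 1 / (norm e + 1)"
    have e1: "norm e + 1 > 0" by (simp add: add_nonneg_pos)
    have t0: "t > 0" using d e1 by (simp add: t_def)
    have te: "norm (t *\<^sub>R e) < d" "norm (t *\<^sub>R e) \<le> 1"
    proof -
      have "t * norm e \<le> t * (norm e + 1)" using t0 by simp
      also have "\<dots> = min (d / 2) 1" using e1 by (simp add: t_def)
      finally show "norm (t *\<^sub>R e) < d" "norm (t *\<^sub>R e) \<le> 1" using d t0 by auto
    qed
    let ?f = "\<lambda>x. w (x + t *\<^sub>R e) - w x - t * (w' x \<bullet> e)"
    have iwt: "integrable lborel (\<lambda>x. w (x + t *\<^sub>R e))"
      by (rule integrable_continuous_bounded_support[of _ "\<bar>R\<bar> + 1"])
        (use c supp te in \<open>auto intro!: continuous_on_compose2[OF c(2)] continuous_intros supp[THEN conjunct1] order_trans[OF _ norm_diff_ineq]\<close>)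
    have "(LINT x|lborel. w (x + t *\<^sub>R e)) = (LINT x|lborel. w x)"
    proof -
      have "(LINT x|lborel. w x) = (LINT x|distr lborel borel ((+) (t *\<^sub>R e)). w x)" by (simp add: lborel_distr_plus)
      also have "\<dots> = (LINT x|lborel. w (t *\<^sub>R e + x))"
        using iw by (intro integral_distr) auto
      finally show ?thesis by (simp add: add.commute)
    qed
    then have "(LINT x|lborel. ?f x) = - t * ?I" using iw iwt iw' by simp
    moreover have "norm (LINT x|lborel. ?f x) \<le> (\<delta> * t * norm e) * measure lborel ?B"
    proof (rule norm_integral_le_cball)
      show "integrable lborel ?f" using iw iwt iw' by (intro Bochner_Integration.integrable_diff integrable_mult_right)
      fix x
      show "norm (?f x) \<le> (\<delta> * t * norm e) * indicator ?B x"
      proof (cases "norm x \<le> \<bar>R\<bar> + 1")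
        case True
        then show ?thesis using d(2)[OF te(1), of x] t0 by (simp add: mult_ac)
      next
        case False
        then have "R \<le> norm x" "R \<le> norm (x + t *\<^sub>R e)" using norm_diff_ineq[of x "t *\<^sub>R e"] te by linarith+
        then show ?thesis using supp False by simp
      qed
    qed
    ultimately have "t * \<bar>?I\<bar> \<le> t * (\<delta> * (norm e * measure lborel ?B))" using t0 by (simp add: abs_mult mult_ac)
    then show ?thesis using t0 by simp
  qed
  have "\<bar>?I\<bar> \<le> 0"
  proof (rule tendsto_lowerbound[of _ _ "at_right (0::real)"])
    show "((\<lambda>\<delta>. \<delta> * (norm e * measure lborel ?B)) \<longlongrightarrow> 0) (at_right 0)"
      by (rule tendsto_eq_intros refl | simp)+
    show "\<forall>\<^sub>F \<delta> in at_right 0. \<bar>?I\<bar> \<le> \<delta> * (norm e * measure lborel ?B)"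
      by (rule eventually_mono[OF eventually_at_right_less est])
  qed simp
  then show ?thesis by simp
qed

lemma integral_divergence_eq_0:
  fixes v :: "real^'n::finite \<Rightarrow> real^'n"
  assumes v: "v \<in> C1_compact_support"
  shows "(LINT x|lborel. divergence v x) = 0"
proof -
  obtain D R where D: "\<And>x. (v has_derivative D x) (at x)" "\<And>h. continuous_on UNIV (\<lambda>x. D x h)"
    and R: "\<And>x. R \<le> norm x \<Longrightarrow> v x = 0" "\<And>x h. R \<le> norm x \<Longrightarrow> D x h = 0"
    using C1_compact_supportE[OF v] by metis
  have lin: "linear (D x)" for x by (rule bounded_linear.linear[OF has_derivative_bounded_linear[OF D(1)]])
  let ?w = "\<lambda>i x. \<Sum>j\<in>UNIV. (D x (axis j 1) $ i) *\<^sub>R axis j 1 :: real^'n"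
  have wi: "?w i x \<bullet> axis i 1 = D x (axis i 1) $ i" for i x
    by (simp add: inner_axis)  (simp add: axis_def if_distrib cong: if_cong)
  have c1: "C1_gradient (\<lambda>x. v x $ i) (?w i)" for i
    unfolding C1_gradient_def
  proof (intro conjI allI)
    fix x
    have "D x h $ i = ?w i x \<bullet> h" for h
      by (subst linear_axis_sum[OF lin, of x h]) (simp add: inner_sum_left inner_axis' mult.commute)
    then have "(\<lambda>h. D x h $ i) = (\<lambda>h. ?w i x \<bullet> h)" by (rule ext)
    with bounded_linear.has_derivative[OF bounded_linear_vec_nth D(1), of i x]
    show "((\<lambda>x. v x $ i) has_derivative (\<lambda>h. ?w i x \<bullet> h)) (at x)" by simp
  qed (intro continuous_intros D(2))
  have "(LINT x|lborel. D x (axis i 1) $ i) = 0" for i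
    using integral_gradient_eq_0[OF c1[of i], of R "axis i 1"] R unfolding wi by simp
  moreover have "integrable lborel (\<lambda>x. D x (axis i 1) $ i)" for i
    by (rule integrable_continuous_bounded_support[of _ R]) (auto intro!: continuous_intros D(2) simp: R)
  ultimately show ?thesis unfolding divergence_eq[OF D(1)] by simp
qed

context
  fixes u :: "real^'n::finite \<Rightarrow> real^'n" and p k c R :: real
  assumes u: "u \<in> C1_compact_support" and k: "k \<le> 0" "0 < k + real CARD('n) - 1"
    and p: "p \<le> 0" "0 < p + real CARD('n)" and R: "R > 0" and c: "c \<ge> 0"
    and bd: "\<And>x. x \<noteq> 0 \<Longrightarrow> norm x powr p * norm (u x) \<le> c * (indicator (ball 0 R) x * norm x powr k)"
begin

text \<open>Off the origin the integrand is the divergence of |x|^p u. The context bounds |x|^p |u|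
  by a multiple of |x|^k, so that p = k - 1 is allowed for fields of size |x|, such as the cut-off
  radial field.\<close>

lemma integrable_divergence_powr:
  "integrable lborel (\<lambda>x. norm x powr p * divergence u x + p * norm x powr (p - 2) * (x \<bullet> u x))"
proof -
  obtain D R' where D: "\<And>x. (u has_derivative D x) (at x)" and R': "R' > 0" "\<And>x h. R' \<le> norm x \<Longrightarrow> D x h = 0" and uc: "continuous_on UNIV u"
    using C1_compact_supportE[OF u] by metis
  have [measurable]: "u \<in> borel_measurable borel" "divergence u \<in> borel_measurable borel"
    using uc continuous_on_divergence(1)[OF u] by (auto intro: borel_measurable_continuous_onI)
  have d0: "divergence u x = 0" if "R' \<le> norm x" for x using R'(2)[OF that] by (simp add: divergence_eq[OF D])
  obtain K where K: "\<And>x. \<bar>divergence u x\<bar> \<le> K * indicator (ball 0 R') x"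
    using bounded_by_indicator_ball[OF continuous_on_divergence(1)[OF u] d0] unfolding real_norm_def by blast
  show ?thesis
  proof (rule Bochner_Integration.integrable_bound)
    show "integrable lborel (\<lambda>x::real^'n. K * (indicator (ball 0 R') x * norm x powr p) + \<bar>p\<bar> * c * (indicator (ball 0 R) x * norm x powr (k - 1)))"
      by (intro Bochner_Integration.integrable_add integrable_mult_right integral_norm_powr_ball(1)) (use k p R R' in auto)
    show "AE x in lborel. norm (norm x powr p * divergence u x + p * norm x powr (p - 2) * (x \<bullet> u x))
      \<le> norm (K * (indicator (ball 0 R') x * norm x powr p) + \<bar>p\<bar> * c * (indicator (ball 0 R) x * norm x powr (k - 1)))"
      using AE_lborel_singleton[of "0::real^'n"]
    proof eventually_elim
      case (elim x)
      have nx: "norm x > 0" using elim by simp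
      have "\<bar>norm x powr p * divergence u x\<bar> \<le> norm x powr p * (K * indicator (ball 0 R') x)"
        unfolding abs_mult by (intro mult_mono K) auto
      moreover have "\<bar>p * norm x powr (p - 2) * (x \<bullet> u x)\<bar> \<le> \<bar>p\<bar> * c * (indicator (ball 0 R) x * norm x powr (k - 1))"
      proof -
        have "\<bar>p * norm x powr (p - 2) * (x \<bullet> u x)\<bar> \<le> \<bar>p\<bar> * norm x powr (p - 2) * (norm x * norm (u x))"
          unfolding abs_mult by (intro mult_mono Cauchy_Schwarz_ineq2) auto
        also have "\<dots> = \<bar>p\<bar> * ((norm x powr p * norm (u x)) / norm x)"
          using nx by (simp add: powr_diff power2_eq_square)
        also have "\<dots> \<le> \<bar>p\<bar> * (c * (indicator (ball 0 R) x * norm x powr k) / norm x)"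
          by (intro mult_left_mono divide_right_mono bd elim) auto
        also have "\<dots> = \<bar>p\<bar> * c * (indicator (ball 0 R) x * (norm x powr k / norm x))" by simp
        also have "norm x powr k / norm x = norm x powr (k - 1)" using nx by (simp add: powr_diff)
        finally show ?thesis .
      qed
      ultimately have "\<bar>norm x powr p * divergence u x + p * norm x powr (p - 2) * (x \<bullet> u x)\<bar> \<le>
        norm x powr p * (K * indicator (ball 0 R') x) + \<bar>p\<bar> * c * (indicator (ball 0 R) x * norm x powr (k - 1))"
        using abs_triangle_ineq[of "norm x powr p * divergence u x" "p * norm x powr (p - 2) * (x \<bullet> u x)"] by linarith
      then show ?case unfolding real_norm_def by (simp add: mult_ac)
    qed
  qed measurable
qed

text \<open>The field cut off at 0 is C^1 with compact support, so its divergence integrates to 0;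
  \<open>cutoff_limit\<close> removes the cutoff.\<close>

lemma integral_divergence_powr:
  "(LINT x|lborel. norm x powr p * divergence u x + p * norm x powr (p - 2) * (x \<bullet> u x)) = 0"
proof -
  let ?F = "\<lambda>x. norm x powr p *\<^sub>R u x" and ?g = "\<lambda>x. norm x powr p * divergence u x + p * norm x powr (p - 2) * (x \<bullet> u x)"
  obtain D R' where D: "\<And>x. (u has_derivative D x) (at x)" "\<And>h. continuous_on UNIV (\<lambda>x. D x h)"
    and R': "\<And>x. R' \<le> norm x \<Longrightarrow> u x = 0" and uc: "continuous_on UNIV u"
    using C1_compact_supportE[OF u] by metis
  have [measurable]: "u \<in> borel_measurable borel" using uc by (rule borel_measurable_continuous_onI)
  have lim: "(\<lambda>n. LINT x|lborel. indicator UNIV x * ((1 - cutoff (1 / Suc n) x) * ?g x - cutoff' (1 / Suc n) x \<bullet> ?F x))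
    \<longlonglongrightarrow> (LINT x|lborel. indicator UNIV x * ?g x)"
    by (rule cutoff_limit[OF _ integrable_divergence_powr, where c=c and k=k and R=R]) (use bd k c R in auto)
  have "(LINT x|lborel. indicator UNIV x * ((1 - cutoff (1 / Suc n) x) * ?g x - cutoff' (1 / Suc n) x \<bullet> ?F x)) = 0" for n :: nat
  proof -
    let ?r = "1 / real (Suc n)"
    have r: "?r > 0" by simp
    let ?w = "\<lambda>x. (1 - cutoff ?r x) *\<^sub>R ?F x"
    have c1: "C1_gradient (\<lambda>x. 1 - cutoff ?r x) (\<lambda>x. - cutoff' ?r (x::real^'n))"
      by (rule C1_gradient_intros(5)[OF C1_gradient_cutoff C1_gradient_cutoff])
    note dF = has_derivative_scaleR[OF has_derivative_norm_powr D(1)]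
    note dw = divergence_scaleR(1)[OF C1_gradientD(1)[OF c1] dF]
    have w0: "?w x = 0" if "norm x < ?r" for x using cutoff_simps(3)[OF r, of x] that by simp
    have cc: "continuous_on (- {0}) (\<lambda>x. 1 - cutoff ?r (x::real^'n))" "continuous_on (- {0}) (\<lambda>x. - cutoff' ?r (x::real^'n))"
      "continuous_on (- {0}) u" "\<And>h. continuous_on (- {0}) (\<lambda>x. D x h)"
      using C1_gradientD(2,3)[OF c1, of UNIV] uc D(2) by (auto intro: continuous_on_subset)
    have cD: "continuous_on (- {0}) (\<lambda>x. (1 - cutoff ?r x) *\<^sub>R (norm x powr p *\<^sub>R D x h + (p * norm x powr (p - 2) * (x \<bullet> h)) *\<^sub>R u x)
        + (- cutoff' ?r x \<bullet> h) *\<^sub>R ?F x)" for h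
      by (intro continuous_intros cc) auto
    have wR: "?w x = 0" if "R' \<le> norm x" for x using R'[OF that] by simp
    note w = C1_compact_supportI_punctured(1)[OF dw cD r w0 wR]
      and dw0 = C1_compact_supportI_punctured(2)[OF dw cD r w0 wR]
    have "divergence ?w x = (1 - cutoff ?r x) * ?g x - cutoff' ?r x \<bullet> ?F x" for x
    proof (cases "x = 0")
      case True
      have "divergence ?w 0 = 0" using divergence_eq[OF dw0] by simp
      moreover have "cutoff ?r (0::real^'n) = 1" "cutoff' ?r (0::real^'n) = 0" using cutoff_simps(3,5)[OF r, of 0] by auto
      ultimately show ?thesis using True by simp
    next
      case False
      have "divergence ?F x = ?g x"
        using divergence_scaleR_general[OF has_derivative_norm_powr[OF False] D(1)] by simp
      then show ?thesis using divergence_scaleR(2)[OF C1_gradientD(1)[OF c1] dF[OF False]] by simp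
    qed
    then show ?thesis using integral_divergence_eq_0[OF w] by simp
  qed
  then have "(\<lambda>n. 0) \<longlonglongrightarrow> (LINT x|lborel. ?g x)" using lim by simp
  then show ?thesis by (rule LIMSEQ_unique[OF tendsto_const, symmetric])
qed

end

text \<open>Calibration by the radial field |x|^(k - 1) x. With a cutoff \<eta> to the ball, the
  divergences of \<eta> |x|^k v and of \<eta> |x|^(k - 1) x both integrate to 0. The gradient of
  \<eta> points inwards, so the bound of v \<bullet> x by |x| compares the terms that contain it.
  What remains is N + k - 1 times the integral of |x|^(k - 1) over the ball, and this is N times its
  volume.\<close>

lemma weighted_perimeter_ball_le:
  fixes k :: real
  assumes N: "CARD('n::finite) \<ge> 2" and k: "k \<le> 0" "0 < k + real CARD('n) - 1"
  shows "weighted_perimeter k (ball (0::real^'n) 1) \<le> ereal (CARD('n) * measure lebesgue (ball (0::real^'n) 1))"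
  unfolding weighted_perimeter_def
proof (rule SUP_least)
  let ?B = "ball (0::real^'n) 1" and ?N = "real CARD('n)"
  fix v :: "real^'n \<Rightarrow> real^'n" assume "v \<in> {v \<in> C1_compact_support. \<forall>x\<in>?B. norm (v x) \<le> 1}"
  then have v: "v \<in> C1_compact_support" and v1: "\<And>x. norm x < 1 \<Longrightarrow> norm (v x) \<le> 1" by auto
  obtain D R where D: "\<And>x. (v has_derivative D x) (at x)" and R: "R > 0" "\<And>x. R \<le> norm x \<Longrightarrow> v x = 0" and vc: "continuous_on UNIV v"
    using C1_compact_supportE[OF v] by metis
  have [measurable]: "v \<in> borel_measurable borel" "divergence v \<in> borel_measurable borel"
    using vc continuous_on_divergence(1)[OF v] by (auto intro: borel_measurable_continuous_onI)
  let ?g = "\<lambda>u p x. norm x powr p * divergence u x + p * norm x powr (p - 2) * (x \<bullet> u x)"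
  obtain K where K: "K \<ge> 0" "\<And>x. norm (v x) \<le> K * indicator (ball 0 R) x"
    using bounded_by_indicator_ball[OF vc R(2)] by blast
  have kN: "0 < k + real CARD('n)" using k N by auto
  have gv: "integrable lborel (?g v k)"
  proof (rule integrable_divergence_powr[OF v k k(1) kN R(1) K(1)])
    show "norm x powr k * norm (v x) \<le> K * (indicator (ball 0 R) x * norm x powr k)" for x
      using mult_left_mono[OF K(2), of "norm x powr k" x] by (simp add: mult_ac)
  qed
  have B [measurable]: "?B \<in> sets borel" by simp
  have g [measurable]: "?g v k \<in> borel_measurable borel" by measurable
  \<comment> \<open>The negative divisor reverses the step: \<eta> vanishes outside the open unit
    ball, equals 1 where |x|^2 \<le> 1 - 1/(n + 1), and so converges to the indicator of the
    ball.\<close>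
  define \<eta> where "\<eta> n x = smooth_step ((x \<bullet> x - 1) / (- (1 / real (Suc n))))" for n and x :: "real^'n"
  define \<eta>' where "\<eta>' n x = smooth_step' ((x \<bullet> x - 1) / (- (1 / real (Suc n)))) *\<^sub>R ((2 / (- (1 / real (Suc n)))) *\<^sub>R x)" for n and x :: "real^'n"
  have \<eta>C: "C1_gradient (\<eta> n) (\<eta>' n)" for n
    unfolding \<eta>_def \<eta>'_def by (rule C1_gradient_compose[OF DERIV_smooth_step continuous_on_smooth_step' C1_gradient_square])
  have \<eta>01: "0 \<le> \<eta> n x" "\<eta> n x \<le> 1" for n x by (simp_all add: \<eta>_def)
  have [measurable]: "\<eta> n \<in> borel_measurable borel" for n using C1_gradientD(4)[OF \<eta>C] .
  have xx: "x \<bullet> x < 1 \<longleftrightarrow> norm x < 1" for x :: "real^'n"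
    by (simp add: dot_square_norm abs_square_less_1)
  have \<eta>0: "\<eta> n x = 0" "\<eta>' n x = 0" if "\<not> norm x < 1" for n x
  proof -
    have "1 \<le> x \<bullet> x" using that xx[of x] by linarith
    then have "(x \<bullet> x - 1) / (- (1 / real (Suc n))) \<le> 0" by (intro divide_nonneg_neg) auto
    then show "\<eta> n x = 0" "\<eta>' n x = 0" unfolding \<eta>_def \<eta>'_def by simp_all
  qed
  have \<eta>lim: "(\<lambda>n. \<eta> n x) \<longlonglongrightarrow> indicator ?B x" for x
  proof (cases "norm x < 1")
    case True
    obtain m where m: "1 / (1 - x \<bullet> x) < real m" using reals_Archimedean2 by blast
    have "\<eta> n x = 1" if "n \<ge> m" for n
    proof -
      have a: "0 < 1 - x \<bullet> x" using True xx[of x] by simp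
      have "1 / (1 - x \<bullet> x) \<le> real (Suc n)" using m that by linarith
      then have "1 \<le> real (Suc n) * (1 - x \<bullet> x)" using a by (simp add: pos_divide_le_eq)
      also have "\<dots> = (x \<bullet> x - 1) / (- (1 / real (Suc n)))" by (simp add: field_simps)
      finally show ?thesis unfolding \<eta>_def by simp
    qed
    then have "\<forall>\<^sub>F n in sequentially. \<eta> n x = indicator ?B x" using True unfolding eventually_sequentially by auto
    then show ?thesis by (rule tendsto_eventually)
  next
    case False
    then show ?thesis using \<eta>0(1)[OF False] by simp
  qed
  have bound: "(LINT x|lborel. \<eta> n x * ?g v k x) \<le> ?N * measure lebesgue ?B" for n
  proof -
    let ?u = "\<lambda>x. \<eta> n x *\<^sub>R v x" and ?z = "\<lambda>x. \<eta> n x *\<^sub>R x"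
    note u = C1_compact_support_scaleR[OF \<eta>C[of n] v]
    note dz = divergence_scaleR[OF C1_gradientD(1)[OF \<eta>C[of n]] has_derivative_ident]
    have z: "?z \<in> C1_compact_support"
    proof (rule C1_compact_supportI[OF dz(1), of 1])
      show "continuous_on UNIV (\<lambda>x. \<eta> n x *\<^sub>R h + (\<eta>' n x \<bullet> h) *\<^sub>R x)" for h
        using C1_gradientD(2,3)[OF \<eta>C[of n], of UNIV] by (intro continuous_intros)
      show "\<eta> n x *\<^sub>R x = 0" if "1 \<le> norm x" for x using \<eta>0(1)[of x n] that by simp
    qed
    have k1: "k - 1 \<le> 0" "0 < k - 1 + real CARD('n)" using k by auto
    have ub: "norm x powr k * norm (?u x) \<le> 1 * (indicator (ball 0 1) x * norm x powr k)" for x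
    proof (cases "norm x < 1")
      case True
      have "norm (?u x) \<le> 1 * 1" unfolding norm_scaleR by (intro mult_mono v1 True) (use \<eta>01[of n x] in auto)
      then show ?thesis using True by (simp add: mult_left_le)
    next
      case False
      then show ?thesis using \<eta>0(1)[OF False] by simp
    qed
    have zb: "norm x powr (k - 1) * norm (?z x) \<le> 1 * (indicator (ball 0 1) x * norm x powr k)" if "x \<noteq> 0" for x
    proof (cases "norm x < 1")
      case True
      have "norm x powr (k - 1) * norm (?z x) = \<eta> n x * norm x powr k"
        using that \<eta>01(1)[of n x] by (simp add: powr_diff)
      also have "\<dots> \<le> 1 * (indicator (ball 0 1) x * norm x powr k)"
        using True \<eta>01[of n x] by (simp add: mult_left_le_one_le)
      finally show ?thesis .
    next
      case False
      then show ?thesis using \<eta>0(1)[OF False] by simp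
    qed
    note iu = integrable_divergence_powr[OF u(1) k k(1) kN zero_less_one zero_le_one ub]
      and Iu = integral_divergence_powr[OF u(1) k k(1) kN zero_less_one zero_le_one ub]
      and iz = integrable_divergence_powr[OF z k k1 zero_less_one zero_le_one zb]
      and Iz = integral_divergence_powr[OF z k k1 zero_less_one zero_le_one zb]
    let ?h = "\<lambda>x::real^'n. (?N + k - 1) * (indicator ?B x * norm x powr (k - 1))"
    have ih: "integrable lborel ?h"
      by (intro integrable_mult_right integral_norm_powr_ball(1)) (use k in auto)
    have "(LINT x|lborel. \<eta> n x * ?g v k x) \<le> (LINT x|lborel. (?g ?u k x - ?g ?z (k - 1) x) + ?h x)"
    proof (rule integral_mono_AE)
      show "integrable lborel (\<lambda>x. \<eta> n x * ?g v k x)"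
        by (rule Bochner_Integration.integrable_bound[OF gv])
          (use \<eta>01 in \<open>auto simp: abs_mult intro!: mult_left_le_one_le\<close>)
      show "integrable lborel (\<lambda>x. (?g ?u k x - ?g ?z (k - 1) x) + ?h x)"
        by (intro Bochner_Integration.integrable_add Bochner_Integration.integrable_diff iu iz ih)
      show "AE x in lborel. \<eta> n x * ?g v k x \<le> (?g ?u k x - ?g ?z (k - 1) x) + ?h x"
        using AE_lborel_singleton[of "0::real^'n"]
      proof eventually_elim
        case (elim x)
        have nx: "norm x > 0" using elim by simp
        have gu: "?g ?u k x = \<eta> n x * ?g v k x + norm x powr k * (\<eta>' n x \<bullet> v x)"
          unfolding u(2) by (simp add: algebra_simps)
        have "norm x powr (k - 1 - 2) * (x \<bullet> x) = norm x powr (k - 1)"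
        proof -
          have "norm x powr (k - 1 - 2) = norm x powr (k - 1) * norm x powr (- 2)" by (simp add: powr_add[symmetric])
          then show ?thesis using inner_scaleR_norm_powr[OF elim] by (simp add: mult.assoc)
        qed
        then have "(k - 1) * norm x powr (k - 1 - 2) * (x \<bullet> ?z x) = (k - 1) * \<eta> n x * norm x powr (k - 1)"
          by (simp add: mult_ac)
        then have gz: "?g ?z (k - 1) x = (?N + k - 1) * (\<eta> n x * norm x powr (k - 1)) + norm x powr (k - 1) * (\<eta>' n x \<bullet> x)"
          unfolding dz(2) divergence_ident by (simp add: algebra_simps)
        have h: "(?N + k - 1) * (\<eta> n x * norm x powr (k - 1)) \<le> ?h x"
          using \<eta>01[of n x] \<eta>0(1)[of x n] k by (cases "norm x < 1") (auto intro!: mult_left_mono mult_left_le_one_le)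
        have "norm x powr (k - 1) * (\<eta>' n x \<bullet> x) \<le> norm x powr k * (\<eta>' n x \<bullet> v x)"
        proof (cases "norm x < 1")
          case True
          define a where "a = smooth_step' ((x \<bullet> x - 1) / (- (1 / real (Suc n)))) * (2 * real (Suc n))"
          have a: "a \<ge> 0" by (simp add: a_def)
          have e: "\<eta>' n x = (- a) *\<^sub>R x" by (simp add: \<eta>'_def a_def algebra_simps)
          have "x \<bullet> v x \<le> norm x * norm (v x)" by (rule norm_cauchy_schwarz)
          also have "\<dots> \<le> norm x * 1" using v1[OF True] by (intro mult_left_mono) auto
          finally have "norm x powr k * (x \<bullet> v x) \<le> norm x powr k * norm x" by (simp add: mult_left_mono)
          also have "\<dots> = norm x powr (k - 1) * (x \<bullet> x)" using nx by (simp add: powr_diff dot_square_norm power2_eq_square)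
          finally have "a * (norm x powr k * (x \<bullet> v x)) \<le> a * (norm x powr (k - 1) * (x \<bullet> x))" using a by (rule mult_left_mono)
          then show ?thesis unfolding e by (simp add: mult_ac)
        next
          case False
          then show ?thesis using \<eta>0(2)[OF False] by simp
        qed
        then show ?case using gu gz h by linarith
      qed
    qed
    also have "\<dots> = (LINT x|lborel. ?g ?u k x - ?g ?z (k - 1) x) + (LINT x|lborel. ?h x)"
      by (rule Bochner_Integration.integral_add[OF Bochner_Integration.integrable_diff[OF iu iz] ih])
    also have "(LINT x|lborel. ?g ?u k x - ?g ?z (k - 1) x) = 0"
      using Bochner_Integration.integral_diff[OF iu iz] Iu Iz by simp
    also have "(LINT x|lborel. ?h x) = (?N + k - 1) * (?N * measure lebesgue ?B / (?N + (k - 1)))"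
      using integral_norm_powr_ball(2)[of "k - 1" 1, where 'a="real^'n"] k by simp
    also have "\<dots> = ?N * measure lebesgue ?B" using k by (simp add: divide_simps)
    finally show ?thesis by simp
  qed
  have lim: "(\<lambda>n. LINT x|lborel. \<eta> n x * ?g v k x) \<longlonglongrightarrow> (LINT x|lborel. indicator ?B x * ?g v k x)"
  proof (rule integral_dominated_convergence[where w="\<lambda>x. \<bar>?g v k x\<bar>"])
    show "AE x in lborel. (\<lambda>n. \<eta> n x * ?g v k x) \<longlonglongrightarrow> indicator ?B x * ?g v k x"
      by (intro AE_I2 tendsto_mult \<eta>lim tendsto_const)
    show "AE x in lborel. norm (\<eta> n x * ?g v k x) \<le> \<bar>?g v k x\<bar>" for n
      using \<eta>01 by (auto simp: abs_mult intro!: AE_I2 mult_left_le_one_le)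
  qed (use gv in \<open>simp_all, measurable\<close>)
  have le: "(LINT x|lborel. indicator ?B x * ?g v k x) \<le> ?N * measure lebesgue ?B"
    by (rule LIMSEQ_le_const2[OF lim]) (use bound in blast)
  have "(LINT x:?B|lebesgue. divergence (\<lambda>y. norm y powr k *\<^sub>R v y) x) = (LINT x|lebesgue. indicator ?B x * ?g v k x)"
    unfolding set_lebesgue_integral_def
  proof (rule integral_cong_AE)
    let ?d = "\<lambda>x. divergence (\<lambda>y. norm y powr k *\<^sub>R v y) x"
    have eq: "?d x = ?g v k x" if "x \<noteq> 0" for x
      using divergence_scaleR_general[OF has_derivative_norm_powr[OF that] D] by simp
    \<comment> \<open>At the origin the divergence may have an unspecified value; naming this value
      in a case distinction gives measurability.\<close>
    have "(\<lambda>x. indicator ?B x *\<^sub>R (if x = 0 then ?d 0 else ?g v k x)) \<in> borel_measurable borel" by measurable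
    also have "(\<lambda>x. indicator ?B x *\<^sub>R (if x = 0 then ?d 0 else ?g v k x)) = (\<lambda>x. indicator ?B x *\<^sub>R ?d x)" using eq by auto
    finally show "(\<lambda>x. indicator ?B x *\<^sub>R ?d x) \<in> borel_measurable lebesgue"
      by (intro measurable_completion) (simp add: measurable_lborel1)
    have "(\<lambda>x. indicator ?B x * ?g v k x) \<in> borel_measurable borel" by measurable
    then show "(\<lambda>x. indicator ?B x * ?g v k x) \<in> borel_measurable lebesgue"
      by (intro measurable_completion) (simp add: measurable_lborel1)
    show "AE x in lebesgue. indicator ?B x *\<^sub>R ?d x = indicator ?B x * ?g v k x"
      using AE_completion[OF AE_lborel_singleton[of "0::real^'n"]] by eventually_elim (simp add: eq)
  qed
  also have "\<dots> = (LINT x|lborel. indicator ?B x * ?g v k x)"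
    by (rule integral_completion) measurable
  finally show "ereal (LINT x:?B|lebesgue. divergence (\<lambda>y. norm y powr k *\<^sub>R v y) x) \<le> ereal (?N * measure lebesgue ?B)"
    using le by simp
qed

section \<open>The weighted isoperimetric inequality\<close>

lemma integral_lborel_uminus:
  fixes f :: "'a::euclidean_space \<Rightarrow> real"
  assumes [measurable]: "f \<in> borel_measurable borel"
  shows "(LINT x|lborel. f (- x)) = (LINT x|lborel. f x)"
proof -
  have "lborel = distr lborel borel (uminus :: 'a \<Rightarrow> 'a)"
    using lborel_affine[of "- 1" "0::'a"] by (simp add: density_1)
  then have "(LINT x|lborel. f x) = (LINT x|distr lborel borel uminus. f x)" by (rule arg_cong)
  also have "\<dots> = (LINT x|lborel. f (- x))" by (rule integral_distr) auto
  finally show ?thesis ..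
qed

text \<open>The integrand is odd, so twice the integral is the integral over the ball minus that
  over its mirror image. Where a \<bullet> y > 0 the point \<open>y\<close> is closer to
  \<open>a\<close> than to \<open>- a\<close>, and conversely, so the difference is nowhere
  negative.\<close>

lemma integral_off_centre_ball_pos:
  fixes a :: "'a::euclidean_space"
  assumes N: "DIM('a) \<ge> 2" and \<rho>: "\<rho> > 0" and a: "a \<noteq> 0"
  shows "integrable lborel (\<lambda>y. indicator (ball a \<rho>) y * ((a \<bullet> y) * norm y powr (- 2)))"
    and "0 < (LINT y|lborel. indicator (ball a \<rho>) y * ((a \<bullet> y) * norm y powr (- 2)))"
proof -
  let ?f = "\<lambda>y. (a \<bullet> y) * norm y powr (- 2)"
  have B [measurable]: "ball b \<rho> \<in> sets borel" for b :: 'a by simp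
  have int: "integrable lborel (\<lambda>y. indicator (ball b \<rho>) y * ?f y)" for b :: 'a
  proof (rule Bochner_Integration.integrable_bound)
    show "integrable lborel (\<lambda>x::'a. norm a * (indicator (ball 0 (norm b + \<rho>)) x * norm x powr (- 1)))"
      by (rule integrable_mult_right[OF integral_norm_powr_ball(1)]) (use N \<rho> in \<open>auto simp: add_nonneg_pos\<close>)
    show "AE y in lborel. norm (indicator (ball b \<rho>) y * ?f y) \<le> norm (norm a * (indicator (ball 0 (norm b + \<rho>)) y * norm y powr (- 1)))"
      using AE_lborel_singleton[of "0::'a"]
    proof eventually_elim
      case (elim y)
      have ny: "norm y > 0" using elim by simp
      have "\<bar>?f y\<bar> \<le> (norm a * norm y) * norm y powr (- 2)"
        unfolding abs_mult by (intro mult_mono Cauchy_Schwarz_ineq2) auto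
      also have "\<dots> = norm a * norm y powr (- 1)" using ny by (simp add: powr_minus power2_eq_square)
      finally have 1: "\<bar>?f y\<bar> \<le> norm a * norm y powr (- 1)" .
      have 2: "norm y < norm b + \<rho>" if "y \<in> ball b \<rho>"
        using that norm_triangle_ineq2[of y b] by (simp add: dist_norm norm_minus_commute)
      show ?case using 1 2 by (cases "y \<in> ball b \<rho>") (auto simp: indicator_def)
    qed
  qed measurable
  show "integrable lborel (\<lambda>y. indicator (ball a \<rho>) y * ?f y)" by (rule int)
  let ?I = "LINT y|lborel. indicator (ball a \<rho>) y * ?f y"
  let ?d = "\<lambda>y. indicator (ball a \<rho>) y * ?f y - indicator (ball (- a) \<rho>) y * ?f y"
  have id: "integrable lborel ?d" using int by (intro Bochner_Integration.integrable_diff)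
  have "?I = (LINT y|lborel. indicator (ball a \<rho>) (- y) * ?f (- y))"
    by (rule integral_lborel_uminus[symmetric]) measurable
  also have "\<dots> = (LINT y|lborel. - (indicator (ball (- a) \<rho>) y * ?f y))"
    by (intro Bochner_Integration.integral_cong) (auto simp: indicator_def dist_norm norm_minus_commute add.commute)
  also have "\<dots> = - (LINT y|lborel. indicator (ball (- a) \<rho>) y * ?f y)" by simp
  finally have Id: "2 * ?I = (LINT y|lborel. ?d y)" using int by simp
  have near: "dist a y < dist (- a) y" if "a \<bullet> y > 0" for y
  proof -
    have "(dist a y)\<^sup>2 = (dist (- a) y)\<^sup>2 - 4 * (a \<bullet> y)"
      unfolding dist_norm power2_norm_eq_inner by (simp add: inner_diff_left inner_diff_right inner_commute)
    then show ?thesis using that power2_less_imp_less[of "dist a y" "dist (- a) y"] by simp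
  qed
  have far: "dist (- a) y < dist a y" if "a \<bullet> y < 0" for y
    using near[of "- y"] that dist_minus[of a y] dist_minus[of "- a" y] by simp
  have d0: "0 \<le> ?d y" for y
  proof (cases "a \<bullet> y" "0::real" rule: linorder_cases)
    case greater
    then show ?thesis using near[OF greater] by (auto simp: indicator_def)
  next
    case less
    then have "?f y \<le> 0" by (simp add: mult_nonpos_nonneg)
    then show ?thesis using far[OF less] by (auto simp: indicator_def)
  qed simp
  have "0 \<le> (LINT y|lborel. ?d y)" by (rule Bochner_Integration.integral_nonneg) (rule d0)
  then have "?I \<ge> 0" using Id by linarith
  moreover have "?I \<noteq> 0"
  proof
    assume "?I = 0"
    then have "AE y in lborel. ?d y = 0" using Id id d0 by (simp add: integral_nonneg_eq_0_iff_AE)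
    define U where "U = ball a \<rho> \<inter> - cball (- a) \<rho> \<inter> {y. 0 < a \<bullet> y}"
    have "U \<in> null_sets lborel"
    proof -
      have Um: "U \<in> sets lborel" unfolding U_def by measurable
      from \<open>AE y in lborel. ?d y = 0\<close> have "AE y in lborel. y \<notin> U"
      proof eventually_elim
        case (elim y)
        show ?case
        proof
          assume y: "y \<in> U"
          then have "y \<noteq> 0" by (auto simp: U_def)
          then have "?f y > 0" using y by (simp add: U_def)
          moreover have "indicator (ball a \<rho>) y = (1::real)" "indicator (ball (- a) \<rho>) y = (0::real)" using y by (auto simp: U_def)
          ultimately have "?d y > 0" by simp
          then show False using elim by linarith
        qed
      qed
      then show ?thesis using Um by (simp add: AE_iff_null_sets)
    qed
    moreover have "open U" unfolding U_def
      by (intro open_Int open_Compl open_Collect_less continuous_intros) auto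
    moreover have "U \<noteq> {}"
    proof -
      \<comment> \<open>The point at distance \<open>t\<close> beyond \<open>a\<close> lies in the
        ball about \<open>a\<close> if t < \<rho>, and outside the closed mirror ball if 2|a| + t >
        \<rho>; \<open>t\<close> is the midpoint of the admissible interval.\<close>
      define t where "t = (max 0 (\<rho> - 2 * norm a) + \<rho>) / 2"
      have na: "norm a > 0" using a by simp
      have t: "0 < t" "t < \<rho>" "\<rho> - 2 * norm a < t" using \<rho> na by (auto simp: t_def max_def)
      let ?y = "(1 + t / norm a) *\<^sub>R a"
      have "dist a ?y = t" "dist (- a) ?y = 2 * norm a + t"
      proof -
        have "a - ?y = (- (t / norm a)) *\<^sub>R a" "- a - ?y = (- (2 + t / norm a)) *\<^sub>R a"
          by (simp_all add: scaleR_left_distrib scaleR_left_diff_distrib scaleR_2)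
        then have "dist a ?y = \<bar>- (t / norm a)\<bar> * norm a" "dist (- a) ?y = \<bar>- (2 + t / norm a)\<bar> * norm a"
          by (simp_all only: dist_norm norm_scaleR)
        moreover have "t / norm a \<ge> 0" using t na by simp
        ultimately show "dist a ?y = t" "dist (- a) ?y = 2 * norm a + t" using t na by (simp_all add: algebra_simps)
      qed
      moreover have "0 < a \<bullet> ?y" using t na by (simp add: add_pos_pos)
      ultimately have "?y \<in> U" using t by (simp add: U_def)
      then show ?thesis by blast
    qed
    ultimately show False
      using open_not_negligible negligible_iff_null_sets null_sets_completionI by metis
  qed
  ultimately show "0 < ?I" by simp
qed

context weighted_transfer
begin

text \<open>After the inverse adjustment and the Piola transform, the field (y - a)/\<rho> still has
  length at most 1. The adjustment adds -\<beta> (N - 1)(a \<bullet> y)/(\<rho> |y|^2) to its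
  divergence. As \<beta> < 0 and the integral of (a \<bullet> y)/|y|^2 over an off-centre ball is
  positive, the perimeter would exceed \<open>P\<close>.\<close>

lemma ball_centre_eq_0:
  assumes k0: "k < 0" and \<rho>: "\<rho> > 0" and Eball: "sym_diff E (ball a \<rho>) \<in> null_sets lborel"
    and P_eq: "P = CARD('n) * measure lebesgue (ball a \<rho>) / \<rho>"
  shows "a = 0"
proof (rule ccontr)
  assume a: "a \<noteq> 0"
  let ?N = "real CARD('n)" and ?B = "ball a \<rho>"
  let ?f = "\<lambda>y. (a \<bullet> y) * norm y powr (- 2)"
  define \<alpha> \<beta> where "\<alpha> = 1 / (1 + s)" and "\<beta> = s / (1 + s)"
  have s0: "s < 0" using s(3) k0 N by (simp add: s_eq divide_neg_pos)
  have \<alpha>\<beta>: "\<alpha> + \<beta> = 1" "\<beta> < 0" using s(1) s0 by (auto simp: \<alpha>_def \<beta>_def add_divide_distrib[symmetric] divide_neg_pos)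
  let ?I = "LINT y|lborel. indicator ?B y * ?f y"
  have I: "?I > 0" "integrable lborel (\<lambda>y. indicator ?B y * ?f y)"
    using integral_off_centre_ball_pos[OF _ \<rho> a] N by simp_all
  have Bf: "emeasure lborel ?B < \<infinity>" by (rule emeasure_lborel_ball_finite)
  have iB: "integrable lborel (indicat_real ?B)" using Bf by (intro integrable_real_indicator) auto
  let ?m = "measure lborel ?B"
  \<comment> \<open>The factor \<theta> < 1 leaves room to cut the field off between the radii
    \<rho> and \<rho>/\<theta> while its length stays at most 1; \<open>d\<close> is the difference
    of the squares of these radii.\<close>
  have est: "\<theta> / \<rho> * (?N * ?m - \<beta> * (?N - 1) * ?I) \<le> P" if \<theta>: "0 < \<theta>" "\<theta> < 1" for \<theta>
  proof -
    define d where "d = \<rho>\<^sup>2 / \<theta>\<^sup>2 - \<rho>\<^sup>2"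
    have d: "d > 0"
    proof -
      have "\<theta>\<^sup>2 < 1" using \<theta> by (simp add: power_less_one_iff)
      then have "\<rho>\<^sup>2 < \<rho>\<^sup>2 / \<theta>\<^sup>2" using \<theta> \<rho> by (simp add: less_divide_eq)
      then show ?thesis by (simp add: d_def)
    qed
    define \<psi> where "\<psi> y = 1 - smooth_step (((y - a) \<bullet> (y - a) - \<rho>\<^sup>2) / d)" for y :: "real^'n"
    define \<psi>' where "\<psi>' y = - (smooth_step' (((y - a) \<bullet> (y - a) - \<rho>\<^sup>2) / d) *\<^sub>R ((2 / d) *\<^sub>R (y - a)))" for y :: "real^'n"
    have \<psi>C: "C1_gradient \<psi> \<psi>'"
    proof -
      have "C1_gradient (\<lambda>x::real^'n. ((x - a) \<bullet> (x - a) - \<rho>\<^sup>2) / d) (\<lambda>x. (2 / d) *\<^sub>R (x - a))"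
        unfolding C1_gradient_def using d
        by (intro conjI allI continuous_intros) (auto intro!: derivative_eq_intros simp: fun_eq_iff inner_commute divide_simps)
      note step = C1_gradient_compose[OF DERIV_smooth_step continuous_on_smooth_step' this]
      show ?thesis unfolding \<psi>_def[abs_def] \<psi>'_def[abs_def] by (rule C1_gradient_intros(5)[OF step step])
    qed
    have \<psi>01: "0 \<le> \<psi> y" "\<psi> y \<le> 1" for y by (simp_all add: \<psi>_def)
    have \<psi>1: "\<psi> y = 1" if "norm (y - a) \<le> \<rho>" for y
    proof -
      have "(y - a) \<bullet> (y - a) \<le> \<rho>\<^sup>2" using that \<rho> by (simp add: dot_square_norm power_mono)
      then show ?thesis using d by (simp add: \<psi>_def divide_nonpos_pos)
    qed
    have \<psi>0: "\<psi> y = 0" if "\<rho> / \<theta> \<le> norm (y - a)" for y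
    proof -
      have "(\<rho> / \<theta>)\<^sup>2 \<le> (y - a) \<bullet> (y - a)" using that \<rho> \<theta> unfolding dot_square_norm by (intro power_mono) auto
      then have "1 \<le> ((y - a) \<bullet> (y - a) - \<rho>\<^sup>2) / d" using d by (simp add: d_def power_divide le_divide_eq)
      then show ?thesis by (simp add: \<psi>_def)
    qed
    let ?p = "\<lambda>y::real^'n. (\<theta> / \<rho>) *\<^sub>R (y - a)"
    define q where "q y = \<psi> y *\<^sub>R ?p y" for y
    have dp: "(?p has_derivative (\<lambda>h. (\<theta> / \<rho>) *\<^sub>R h)) (at y)" for y
      by (auto intro!: derivative_eq_intros)
    define D where "D y h = \<psi> y *\<^sub>R ((\<theta> / \<rho>) *\<^sub>R h) + (\<psi>' y \<bullet> h) *\<^sub>R ?p y" for y h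
    have dq: "(q has_derivative D y) (at y)" for y
      unfolding q_def[abs_def] D_def[abs_def] by (rule divergence_scaleR(1)[OF C1_gradientD(1)[OF \<psi>C] dp])
    have q: "q \<in> C1_compact_support"
    proof (rule C1_compact_supportI[OF dq, of "\<rho> / \<theta> + norm a"])
      show "continuous_on UNIV (\<lambda>y. D y h)" for h
        unfolding D_def using C1_gradientD(2,3)[OF \<psi>C, of UNIV] by (intro continuous_intros)
      show "q y = 0" if "\<rho> / \<theta> + norm a \<le> norm y" for y
        using \<psi>0[of y] that norm_triangle_ineq2[of y a] by (simp add: q_def)
    qed
    have q1: "norm (q y) \<le> 1" for y
    proof (cases "\<rho> / \<theta> \<le> norm (y - a)")
      case True
      then show ?thesis using \<psi>0 by (simp add: q_def)
    next
      case False
      have "\<theta> / \<rho> * norm (y - a) \<le> \<theta> / \<rho> * (\<rho> / \<theta>)" using False \<theta> \<rho> by (intro mult_left_mono) auto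
      then have "norm (?p y) \<le> 1" using \<theta> \<rho> by simp
      then have "\<psi> y * norm (?p y) \<le> 1 * 1" using \<psi>01 by (intro mult_mono) auto
      moreover have "norm (q y) = \<psi> y * norm (?p y)" using \<psi>01(1)[of y] unfolding q_def norm_scaleR[of "\<psi> y"] by simp
      ultimately show ?thesis by simp
    qed
    have c: "(1 + s) * \<alpha> = 1" "(1 + s) * \<beta> + (- s) * (\<alpha> + \<beta>) = 0"
      using s(1) \<alpha>\<beta>(1) by (auto simp: \<alpha>_def \<beta>_def)
    have main: "(LINT y|lborel. indicator E y * (\<alpha> * divergence q y + \<beta> * norm y powr (- 2) * ((?N - 1) * (q y \<bullet> y) + D y y \<bullet> y))) \<le> P"
      by (rule adjusted_field[OF q dq]) (simp add: adjust_radial_compose[OF c] q1)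
    have val: "\<alpha> * divergence q y + \<beta> * norm y powr (- 2) * ((?N - 1) * (q y \<bullet> y) + D y y \<bullet> y) = \<theta> / \<rho> * (?N - \<beta> * (?N - 1) * ?f y)"
      if y: "y \<in> ?B" and y0: "y \<noteq> 0" for y
    proof -
      have ny: "norm (y - a) < \<rho>" using y by (simp add: dist_norm norm_minus_commute)
      have q_y: "q y = ?p y" using \<psi>1[of y] ny by (simp add: q_def)
      have "(y - a) \<bullet> (y - a) < \<rho>\<^sup>2" using ny by (simp add: dot_square_norm power_strict_mono)
      then have "((y - a) \<bullet> (y - a) - \<rho>\<^sup>2) / d \<le> 0" using d by (intro divide_nonpos_pos) auto
      then have "\<psi>' y = 0" by (simp add: \<psi>'_def)
      then have Dy: "D y h = (\<theta> / \<rho>) *\<^sub>R h" for h using \<psi>1[of y] ny by (simp add: D_def)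
      have div: "divergence q y = ?N * (\<theta> / \<rho>)" unfolding divergence_eq[OF dq] Dy by (simp add: axis_def)
      have "\<beta> * norm y powr (- 2) * ((?N - 1) * (q y \<bullet> y) + D y y \<bullet> y) =
        \<beta> * (\<theta> / \<rho>) * (?N * (norm y powr (- 2) * (y \<bullet> y)) - (?N - 1) * ?f y)"
        unfolding q_y Dy by (simp add: inner_diff_left algebra_simps add_divide_distrib diff_divide_distrib)
      then have "\<alpha> * divergence q y + \<beta> * norm y powr (- 2) * ((?N - 1) * (q y \<bullet> y) + D y y \<bullet> y) =
        \<theta> / \<rho> * ((\<alpha> + \<beta>) * ?N - \<beta> * (?N - 1) * ?f y)"
        unfolding inner_scaleR_norm_powr[OF y0] div by (simp add: algebra_simps)
      then show ?thesis unfolding \<alpha>\<beta>(1) by simp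
    qed
    have [measurable]: "q \<in> borel_measurable borel" "divergence q \<in> borel_measurable borel" "(\<lambda>y. D y y) \<in> borel_measurable borel"
      "\<psi> \<in> borel_measurable borel" "\<psi>' \<in> borel_measurable borel"
    proof -
      show q': "q \<in> borel_measurable borel" and "divergence q \<in> borel_measurable borel"
        using continuous_on_divergence(1)[OF q] has_derivative_continuous[OF dq]
        by (auto intro!: borel_measurable_continuous_onI continuous_at_imp_continuous_on)
      show m: "\<psi> \<in> borel_measurable borel" "\<psi>' \<in> borel_measurable borel" using C1_gradientD(4,5)[OF \<psi>C] .
      show "(\<lambda>y. D y y) \<in> borel_measurable borel" unfolding D_def using m by measurable
    qed
    have "(LINT y|lborel. indicator E y * (\<alpha> * divergence q y + \<beta> * norm y powr (- 2) * ((?N - 1) * (q y \<bullet> y) + D y y \<bullet> y)))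
      = (LINT y|lborel. indicator ?B y * (\<theta> / \<rho> * (?N - \<beta> * (?N - 1) * ?f y)))"
    proof (rule integral_cong_AE)
      note E [measurable]
      have B [measurable]: "?B \<in> sets borel" by simp
      show "(\<lambda>y. indicator E y * (\<alpha> * divergence q y + \<beta> * norm y powr (- 2) * ((?N - 1) * (q y \<bullet> y) + D y y \<bullet> y))) \<in> borel_measurable lborel"
        "(\<lambda>y. indicator ?B y * (\<theta> / \<rho> * (?N - \<beta> * (?N - 1) * ?f y))) \<in> borel_measurable lborel" by measurable
      show "AE y in lborel. indicator E y * (\<alpha> * divergence q y + \<beta> * norm y powr (- 2) * ((?N - 1) * (q y \<bullet> y) + D y y \<bullet> y)) =
        indicator ?B y * (\<theta> / \<rho> * (?N - \<beta> * (?N - 1) * ?f y))"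
        using AE_lborel_singleton[of "0::real^'n"] AE_not_in[OF Eball]
      proof eventually_elim
        case (elim y)
        then have "y \<in> E \<longleftrightarrow> y \<in> ?B" by blast
        then show ?case using val[of y] elim(1) by (cases "y \<in> ?B") simp_all
      qed
    qed
    also have "\<dots> = (LINT y|lborel. \<theta> / \<rho> * (?N * indicator ?B y - \<beta> * (?N - 1) * (indicator ?B y * ?f y)))"
      by (intro Bochner_Integration.integral_cong) (auto simp: algebra_simps)
    also have "\<dots> = \<theta> / \<rho> * (?N * ?m - \<beta> * (?N - 1) * ?I)"
      using I(2) iB by simp
    finally show ?thesis using main by simp
  qed
  have lim: "((\<lambda>\<theta>. \<theta> / \<rho> * (?N * ?m - \<beta> * (?N - 1) * ?I)) \<longlongrightarrow> 1 / \<rho> * (?N * ?m - \<beta> * (?N - 1) * ?I)) (at_left 1)"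
    using \<rho> by (intro tendsto_intros) auto
  have "1 / \<rho> * (?N * ?m - \<beta> * (?N - 1) * ?I) \<le> P"
  proof (rule tendsto_upperbound[OF lim])
    have "\<forall>\<^sub>F \<theta> in at_left (1::real). \<theta> \<in> {0<..<1}" by (rule eventually_at_left_real) simp
    then show "\<forall>\<^sub>F \<theta> in at_left 1. \<theta> / \<rho> * (?N * ?m - \<beta> * (?N - 1) * ?I) \<le> P"
      by eventually_elim (rule est, simp_all)
  qed simp
  also have "P = ?N * ?m / \<rho>" unfolding P_eq by simp
  finally have "(?N * ?m - \<beta> * (?N - 1) * ?I) \<le> ?N * ?m" using \<rho> by (simp add: divide_le_cancel)
  moreover have "\<beta> * (?N - 1) * ?I < 0" using \<alpha>\<beta> N I by (intro mult_neg_pos) auto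
  ultimately show False by linarith
qed

end

section \<open>The radial constant and the comparison with the centred ball\<close>

text \<open>The base of the power is the weighted volume of the unit ball and the right-hand side
  its weighted perimeter, so this identifies \<open>radial_const\<close> as the ratio of the unit
  ball.\<close>

lemma radial_const_mult:
  fixes k l :: real
  assumes "0 < l + real CARD('n::finite)"
  shows "radial_const TYPE('n) k l *
    (CARD('n) * measure lebesgue (ball (0::real^'n) 1) / (l + real CARD('n))) powr ((k + real CARD('n) - 1) / (l + real CARD('n)))
    = CARD('n) * measure lebesgue (ball (0::real^'n) 1)"
proof -
  let ?A = "CARD('n) * measure lebesgue (ball (0::real^'n) 1)" and ?b = "l + real CARD('n)"
  let ?e = "(k + real CARD('n) - 1) / ?b"
  have "measure lebesgue (ball (0::real^'n) 1) > 0" by (rule measure_pos_open[of _ 0]) auto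
  then have A: "?A > 0" by simp
  have e: "(l - k + 1) / ?b = 1 - ?e" using assms by (simp add: field_simps)
  have "radial_const TYPE('n) k l = ?A powr (1 - ?e) * ?b powr ?e"
    unfolding radial_const_def Let_def e by (simp add: add.commute)
  moreover have "(?A / ?b) powr ?e = ?A powr ?e / ?b powr ?e" by (rule powr_divide)
  moreover have "?A powr (1 - ?e) = ?A / ?A powr ?e" using A by (simp add: powr_diff)
  ultimately show ?thesis using A assms by simp
qed

lemma radial_const_pos:
  assumes "0 < l + real CARD('n::finite)"
  shows "radial_const TYPE('n) k l > 0"
proof -
  have "measure lebesgue (ball (0::real^'n) 1) > 0" by (rule measure_pos_open[of _ 0]) auto
  then show ?thesis using assms unfolding radial_const_def Let_def by (simp add: add.commute)
qed

text \<open>\<open>nu\<close> is the weighted volume \<mu> of \<open>M\<close> transported to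
  \<open>E\<close>: dividing the weight |x|^l by the Jacobian leaves |y|^\<gamma> up to the factor 1
  + s. The origin is excluded from \<open>E\<close> because the power of its norm is 0 for every
  exponent.\<close>

locale weighted_isoperimetric = weighted_transfer k s P M E
  for k s P :: real and M E :: "(real^'n::finite) set" +
  fixes l \<mu> :: real
  assumes l: "l * ((real CARD('n) - 1) / real CARD('n)) \<le> k" "k \<le> l + 1" "0 < l + real CARD('n)"
    and zero: "0 \<notin> E" and \<mu>: "\<mu> > 0"
    and nu: "(\<integral>\<^sup>+y\<in>E. ennreal (norm y powr ((l - s * real CARD('n)) / (1 + s))) \<partial>lborel) = ennreal ((1 + s) * \<mu>)"
begin

definition \<gamma> :: real where "\<gamma> = (l - s * real CARD('n)) / (1 + s)"

definition \<omega> :: real where "\<omega> = measure lebesgue (ball (0::real^'n) 1)"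

lemma \<gamma>: "- 1 \<le> \<gamma>" "\<gamma> \<le> 0" "(1 + s) * \<gamma> = l - s * real CARD('n)" "0 < real CARD('n) + \<gamma>"
  "(1 + s) * (real CARD('n) + \<gamma>) = l + real CARD('n)"
proof -
  show m: "(1 + s) * \<gamma> = l - s * real CARD('n)" using s(1) by (simp add: \<gamma>_def)
  then show a: "(1 + s) * (real CARD('n) + \<gamma>) = l + real CARD('n)" by (simp add: algebra_simps)
  have "l * (real CARD('n) - 1) \<le> k * real CARD('n)" using l(1) N by (simp add: divide_le_eq)
  also have "\<dots> = s * real CARD('n) * (real CARD('n) - 1)" unfolding s(3) by simp
  finally have "l \<le> s * real CARD('n)" using N by simp
  then show "\<gamma> \<le> 0" using s(1) by (simp add: \<gamma>_def divide_nonpos_pos)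
  have "s * (real CARD('n) - 1) \<le> l + 1" using l(2) unfolding s(3) .
  then have "- (1 + s) \<le> l - s * real CARD('n)" by (simp add: algebra_simps)
  then show "- 1 \<le> \<gamma>" using s(1) by (simp add: \<gamma>_def le_divide_eq)
  then show "0 < real CARD('n) + \<gamma>" using N by linarith
qed

lemma \<omega>_pos: "\<omega> > 0"
  unfolding \<omega>_def by (rule measure_pos_open[of _ 0]) auto

text \<open>|y|^\<gamma> dominates 1/(1 + |y|): for |y| \<le> 1 because \<gamma> \<le> 0, for |y| >
  1 because \<gamma> \<ge> -1.\<close>

lemma hypothesis_finite: "(\<integral>\<^sup>+y\<in>E. ennreal (1 / (1 + norm y)) \<partial>lborel) < \<infinity>"
proof -
  have "(\<integral>\<^sup>+y\<in>E. ennreal (1 / (1 + norm y)) \<partial>lborel) \<le> (\<integral>\<^sup>+y\<in>E. ennreal (norm y powr \<gamma>) \<partial>lborel)"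
  proof (rule nn_integral_mono)
    fix y
    show "ennreal (1 / (1 + norm y)) * indicator E y \<le> ennreal (norm y powr \<gamma>) * indicator E y"
    proof (cases "y \<in> E")
      case True
      then have ny: "norm y > 0" using zero by auto
      have "1 / (1 + norm y) \<le> norm y powr \<gamma>"
      proof (cases "norm y \<le> 1")
        case True
        have "1 / (1 + norm y) \<le> 1" using ny by (simp del: zero_less_norm_iff)
        also have "1 \<le> norm y powr \<gamma>" using powr_mono2'[of \<gamma> "norm y" 1] True ny \<gamma> by simp
        finally show ?thesis .
      next
        case False
        have "1 / (1 + norm y) \<le> 1 / norm y" using ny by (intro divide_left_mono mult_pos_pos) (simp_all del: zero_less_norm_iff)
        also have "\<dots> = norm y powr (- 1)" using ny by (simp add: powr_minus divide_inverse)
        also have "\<dots> \<le> norm y powr \<gamma>" using False \<gamma> by (intro powr_mono) auto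
        finally show ?thesis .
      qed
      then show ?thesis by (intro mult_right_mono ennreal_leI) auto
    qed simp
  qed
  also have "\<dots> < \<infinity>" using nu by (simp add: \<gamma>_def)
  finally show ?thesis .
qed

text \<open>The isoperimetric inequality with the fixed bound \<open>P\<close>, applied to the
  bounded parts of \<open>E\<close>, bounds all their volumes by one constant.\<close>

lemma finite_volume: "emeasure lborel E < \<infinity>"
proof -
  let ?n = "CARD('n)" and ?c = "CARD('n) * root CARD('n) \<omega>"
  have c: "?c > 0" using \<omega>_pos by simp
  \<comment> \<open>\<open>T \<ge> 1\<close> lets a bound on the power n - 1 of a root be read as a
    bound on the root itself.\<close>
  obtain T where T: "T \<ge> 1" "?c * T > P"
  proof -
    obtain m :: nat where m: "P / ?c < real m" using reals_Archimedean2 by blast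
    have "P < ?c * real (Suc m)"
    proof -
      have "P < ?c * real m" using m c by (simp add: pos_divide_less_eq mult.commute)
      also have "\<dots> \<le> ?c * real (Suc m)" using c by (intro mult_left_mono) auto
      finally show ?thesis .
    qed
    then show ?thesis by (intro that[of "real (Suc m)"]) auto
  qed
  have "emeasure lborel (E \<inter> ball 0 (real i)) \<le> ennreal (T ^ ?n)" for i :: nat
  proof -
    let ?S = "E \<inter> ball 0 (real i)"
    have S: "?S \<in> sets borel" "bounded ?S" using E by (auto intro: bounded_subset)
    have eS: "emeasure lborel ?S = ennreal (measure lebesgue ?S)" by (rule emeasure_lborel_eq_measure_lebesgue[OF S])
    have "?c * root ?n (measure lebesgue ?S) ^ (?n - 1) \<le> P"
      unfolding \<omega>_def
      by (rule isoperimetric_perimeter_le[OF N E perimeter_le hypothesis_finite S(1)]) (use eS in auto)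
    then have lt: "root ?n (measure lebesgue ?S) ^ (?n - 1) < T"
      using T(2) c by (smt (verit) mult_left_mono)
    have "root ?n (measure lebesgue ?S) < T"
    proof (rule ccontr)
      assume "\<not> root ?n (measure lebesgue ?S) < T"
      then have le: "T \<le> root ?n (measure lebesgue ?S)" by simp
      have "root ?n (measure lebesgue ?S) ^ 1 \<le> root ?n (measure lebesgue ?S) ^ (?n - 1)"
      proof (rule power_increasing)
        show "1 \<le> root ?n (measure lebesgue ?S)" using le T(1) by (rule order_trans[rotated])
      qed (use N in auto)
      then show False using lt le by simp
    qed
    then have "root ?n (measure lebesgue ?S) ^ ?n \<le> T ^ ?n" by (intro power_mono) auto
    then show ?thesis unfolding eS by (intro ennreal_leI) simp
  qed
  then have "(SUP i. emeasure lborel (E \<inter> ball 0 (real i))) \<le> ennreal (T ^ ?n)" by (intro SUP_least)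
  moreover have "(SUP i. emeasure lborel (E \<inter> ball 0 (real i))) = emeasure lborel (\<Union>i. E \<inter> ball 0 (real i))"
    by (rule SUP_emeasure_incseq) (use E in \<open>auto simp: incseq_def\<close>)
  moreover have "(\<Union>i. E \<inter> ball 0 (real i)) = E" using reals_Archimedean2 by auto
  ultimately show ?thesis by (simp add: le_less_trans)
qed

definition \<rho> :: real where "\<rho> = root CARD('n) (measure lebesgue E / \<omega>)"

lemma emeasure_E: "emeasure lborel E = ennreal (measure lebesgue E)"
  using finite_volume E by (simp add: emeasure_eq_ennreal_measure)

lemma volume_pos: "measure lebesgue E > 0"
proof (rule ccontr)
  assume "\<not> measure lebesgue E > 0"
  then have "measure lebesgue E = 0" using measure_nonneg[of lebesgue E] by linarith
  then have "E \<in> null_sets lborel" using emeasure_E E by (auto intro: null_setsI)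
  then have "AE y in lborel. y \<notin> E" by (rule AE_not_in)
  then have "(\<integral>\<^sup>+y\<in>E. ennreal (norm y powr ((l - s * real CARD('n)) / (1 + s))) \<partial>lborel) = (\<integral>\<^sup>+y. 0 \<partial>(lborel :: (real^'n) measure))"
    by (intro nn_integral_cong_AE) (auto elim!: eventually_mono)
  then show False using nu s(1) \<mu> by (simp add: ennreal_eq_0_iff mult_le_0_iff)
qed

lemma \<rho>: "\<rho> > 0" "measure lebesgue E = \<omega> * \<rho> ^ CARD('n)"
  using volume_pos \<omega>_pos by (auto simp: \<rho>_def)

lemma measure_ball: "measure lebesgue (ball (a::real^'n) \<rho>) = \<omega> * \<rho> ^ CARD('n)"
  using content_ball[of \<rho> a] content_ball[of 1 "0::real^'n"] \<rho>(1) by (simp add: \<omega>_def)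

lemma power_pred: "\<rho> ^ CARD('n) = \<rho> * \<rho> ^ (CARD('n) - 1)"
  using N by (simp add: power_eq_if)

lemma perimeter_lower: "real CARD('n) * \<omega> * \<rho> ^ (CARD('n) - 1) \<le> P"
proof -
  let ?n = "CARD('n)"
  have "?n * root ?n \<omega> * root ?n (measure lebesgue E) ^ (?n - 1) \<le> P"
    unfolding \<omega>_def
    by (rule isoperimetric_perimeter_le[OF N E perimeter_le hypothesis_finite E]) (use finite_volume in auto)
  moreover have "root ?n (measure lebesgue E) = root ?n \<omega> * \<rho>"
    unfolding \<rho>(2) using \<rho>(1) by (simp add: real_root_mult real_root_power_cancel)
  moreover have "root ?n \<omega> * root ?n \<omega> ^ (?n - 1) = \<omega>"
  proof -
    have "root ?n \<omega> ^ ?n = root ?n \<omega> * root ?n \<omega> ^ (?n - 1)" using N by (simp add: power_eq_if)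
    then show ?thesis using \<omega>_pos by simp
  qed
  ultimately show ?thesis by (simp add: power_mult_distrib mult.assoc[symmetric])  (simp add: mult_ac)
qed

lemma integral_E: "integrable lborel (\<lambda>y. indicator E y * norm y powr \<gamma>)"
  "(LINT y|lborel. indicator E y * norm y powr \<gamma>) = (1 + s) * \<mu>"
proof -
  note E [measurable]
  have m: "(\<lambda>y. indicator E y * norm y powr \<gamma>) \<in> borel_measurable lborel" by measurable
  have eq: "(\<integral>\<^sup>+y. ennreal (indicator E y * norm y powr \<gamma>) \<partial>lborel) = ennreal ((1 + s) * \<mu>)"
    unfolding nu[symmetric] \<gamma>_def by (intro nn_integral_cong) (auto simp: indicator_def)
  show "integrable lborel (\<lambda>y. indicator E y * norm y powr \<gamma>)"
    by (rule integrableI_nn_integral_finite[OF m _ eq]) auto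
  have "0 \<le> (1 + s) * \<mu>" using s(1) \<mu> by simp
  from enn2real_ennreal[OF this]
  show "(LINT y|lborel. indicator E y * norm y powr \<gamma>) = (1 + s) * \<mu>"
    using integral_eq_nn_integral[OF m] unfolding eq by simp
qed

text \<open>The bathtub principle for |y|^\<gamma>, which for \<gamma> < 0 decreases with the
  distance from 0; comparison with \<rho>^\<gamma> makes the ball the set where the integrand is
  negative. For \<gamma> = 0 both sides are the volume of \<open>E\<close>, so equality then carries
  no information.\<close>

lemma radial_mass: "(1 + s) * \<mu> \<le> CARD('n) * \<omega> / (CARD('n) + \<gamma>) * \<rho> powr (CARD('n) + \<gamma>)"
  and radial_mass_eq: "\<gamma> < 0 \<Longrightarrow> (1 + s) * \<mu> = CARD('n) * \<omega> / (CARD('n) + \<gamma>) * \<rho> powr (CARD('n) + \<gamma>) \<Longrightarrow>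
    sym_diff E (ball 0 \<rho>) \<in> null_sets lborel"
proof -
  let ?n = "real CARD('n)" and ?B = "ball (0::real^'n) \<rho>"
  note E [measurable]
  have B [measurable]: "?B \<in> sets borel" by simp
  \<comment> \<open>At the origin \<open>0 powr \<gamma>\<close> is 0, which makes the integrand
    positive there, so this point is left out of the ball.\<close>
  let ?D = "?B - {0}" and ?h = "\<lambda>y::real^'n. \<rho> powr \<gamma> - norm y powr \<gamma>"
  have D [measurable]: "?D \<in> sets borel" by measurable
  have z: "AE y in lborel. y \<noteq> (0::real^'n)" by (rule AE_lborel_singleton)
  have IB: "(LINT y|lborel. indicator ?B y * norm y powr \<gamma>) = ?n * \<omega> / (?n + \<gamma>) * \<rho> powr (?n + \<gamma>)"
    using integral_norm_powr_ball(2)[of \<gamma> \<rho>, where 'a="real^'n"] \<gamma>(2,4) \<rho>(1) by (simp add: \<omega>_def)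
  have iB: "integrable lborel (\<lambda>y::real^'n. indicator ?B y * norm y powr \<gamma>)"
    by (rule integral_norm_powr_ball(1)) (use \<gamma>(2,4) \<rho>(1) in auto)
  have fB: "emeasure lborel ?B < \<infinity>" by (rule emeasure_lborel_ball_finite)
  have i1: "integrable lborel (indicat_real E)" "integrable lborel (indicat_real ?B)"
    using finite_volume fB E by (auto intro!: integrable_real_indicator)
  have vol: "measure lborel E = measure lborel ?B" using \<rho>(2) measure_ball[of 0] E by simp
  have hE: "integrable lborel (\<lambda>y. indicator E y * ?h y)"
    "(LINT y|lborel. indicator E y * ?h y) = \<rho> powr \<gamma> * measure lborel E - (1 + s) * \<mu>"
  proof -
    have eq: "indicator E y * ?h y = \<rho> powr \<gamma> * indicator E y - indicator E y * norm y powr \<gamma>" for y by (simp add: algebra_simps)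
    show "integrable lborel (\<lambda>y. indicator E y * ?h y)" unfolding eq using i1 integral_E by simp
    show "(LINT y|lborel. indicator E y * ?h y) = \<rho> powr \<gamma> * measure lborel E - (1 + s) * \<mu>"
      unfolding eq using i1 integral_E E by simp
  qed
  have hB: "integrable lborel (\<lambda>y. indicator ?B y * ?h y)"
    "(LINT y|lborel. indicator ?B y * ?h y) = \<rho> powr \<gamma> * measure lborel ?B - ?n * \<omega> / (?n + \<gamma>) * \<rho> powr (?n + \<gamma>)"
  proof -
    have eq: "indicator ?B y * ?h y = \<rho> powr \<gamma> * indicator ?B y - indicator ?B y * norm y powr \<gamma>" for y by (simp add: algebra_simps)
    show "integrable lborel (\<lambda>y. indicator ?B y * ?h y)" unfolding eq using i1 iB by simp
    show "(LINT y|lborel. indicator ?B y * ?h y) = \<rho> powr \<gamma> * measure lborel ?B - ?n * \<omega> / (?n + \<gamma>) * \<rho> powr (?n + \<gamma>)"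
      unfolding eq using i1 iB IB by simp
  qed
  have DB: "AE y in lborel. indicator ?B y * ?h y = indicator ?D y * ?h y"
    using z by eventually_elim (simp add: indicator_def)
  have mB: "(\<lambda>y. indicator ?B y * ?h y) \<in> borel_measurable lborel" "(\<lambda>y. indicator ?D y * ?h y) \<in> borel_measurable lborel"
    by measurable
  have hD: "integrable lborel (\<lambda>y. indicator ?D y * ?h y)"
    "(LINT y|lborel. indicator ?D y * ?h y) = \<rho> powr \<gamma> * measure lborel ?B - ?n * \<omega> / (?n + \<gamma>) * \<rho> powr (?n + \<gamma>)"
    using integrable_cong_AE[OF mB DB] integral_cong_AE[OF mB DB] hB by simp_all
  have neg: "?h y < 0" if "y \<in> ?D" "\<gamma> < 0" for y
    using powr_less_mono2_neg[OF that(2), of "norm y" \<rho>] that by simp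
  have pos: "0 \<le> ?h y" if "y \<notin> ?D" for y
    using that powr_mono2'[OF \<gamma>(2) \<rho>(1), of "norm y"] by (cases "y = 0") auto
  have bt: "(LINT y|lborel. indicator ?D y * ?h y) \<le> (LINT y|lborel. indicator E y * ?h y)"
    "(LINT y|lborel. indicator E y * ?h y) \<le> (LINT y|lborel. indicator ?D y * ?h y) \<Longrightarrow> ?D - E \<in> null_sets lborel" if g: "\<gamma> < 0"
    using bathtub[of E lborel ?D ?h, OF _ _ hE(1) hD(1) neg[OF _ g] pos] E D by auto
  show "(1 + s) * \<mu> \<le> ?n * \<omega> / (?n + \<gamma>) * \<rho> powr (?n + \<gamma>)"
  proof (cases "\<gamma> < 0")
    case True
    then show ?thesis using bt(1)[OF True] unfolding hE(2) hD(2) vol by linarith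
  next
    case False
    then have g: "\<gamma> = 0" using \<gamma>(2) by simp
    \<comment> \<open>\<open>0 powr 0\<close> is 0, but \<open>E\<close> does not contain the
      origin.\<close>
    have "(LINT y|lborel. indicator E y * norm y powr \<gamma>) = (LINT y|lborel. indicator E y)"
      using zero by (intro Bochner_Integration.integral_cong) (auto simp: g indicator_def)
    then have "(1 + s) * \<mu> = measure lebesgue E" unfolding integral_E using E by simp
    then show ?thesis unfolding \<rho>(2) g using \<rho>(1) by (simp add: powr_realpow)
  qed
  assume g: "\<gamma> < 0" and eq: "(1 + s) * \<mu> = ?n * \<omega> / (?n + \<gamma>) * \<rho> powr (?n + \<gamma>)"
  have "?D - E \<in> null_sets lborel" by (rule bt(2)[OF g]) (simp only: hE(2) hD(2) vol eq order_refl)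
  then have U: "(?D - E) \<union> {0} \<in> null_sets lborel"
    by (rule null_sets.Un) (rule finite_imp_null_set_lborel, simp)
  have "?B - E \<in> sets lborel" using E by auto
  moreover have "?B - E \<subseteq> (?D - E) \<union> {0}" by auto
  ultimately have 1: "?B - E \<in> null_sets lborel" by (rule null_sets_subset[OF U])
  have "E - ?B \<in> null_sets lborel"
    by (rule null_sets_Diff_swap[OF _ _ _ 1]) (use E finite_volume fB vol in \<open>auto simp: fmeasurable_def\<close>)
  then show "sym_diff E ?B \<in> null_sets lborel" using 1 by (rule null_sets.Un)
qed

definition e :: real where "e = (k + real CARD('n) - 1) / (l + real CARD('n))"

text \<open>The second identity is homogeneity: a mass of order \<rho>^(N + \<gamma>), raised to the
  power \<open>e\<close>, scales like a Euclidean perimeter.\<close>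

lemma e: "e > 0" "(real CARD('n) + \<gamma>) * e = real CARD('n) - 1"
proof -
  show "e > 0" using k l by (simp add: e_def)
  have "k + real CARD('n) - 1 = (1 + s) * (real CARD('n) - 1)" unfolding s(3) by (simp add: algebra_simps)
  then show "(real CARD('n) + \<gamma>) * e = real CARD('n) - 1" unfolding e_def \<gamma>(5)[symmetric] using s(1) \<gamma>(4) by simp
qed

lemma comparison_mass: "\<mu> \<le> real CARD('n) * \<omega> / (l + real CARD('n)) * \<rho> powr (real CARD('n) + \<gamma>)"
  "(\<mu> = real CARD('n) * \<omega> / (l + real CARD('n)) * \<rho> powr (real CARD('n) + \<gamma>)) \<longleftrightarrow>
    (1 + s) * \<mu> = CARD('n) * \<omega> / (CARD('n) + \<gamma>) * \<rho> powr (CARD('n) + \<gamma>)"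
proof -
  let ?n = "real CARD('n)"
  have "(1 + s) * (?n * \<omega> / (l + ?n) * \<rho> powr (?n + \<gamma>)) = ?n * \<omega> / (?n + \<gamma>) * \<rho> powr (?n + \<gamma>)"
    unfolding \<gamma>(5)[symmetric] using s(1) by simp
  then show "\<mu> \<le> ?n * \<omega> / (l + ?n) * \<rho> powr (?n + \<gamma>)"
    "(\<mu> = ?n * \<omega> / (l + ?n) * \<rho> powr (?n + \<gamma>)) \<longleftrightarrow> (1 + s) * \<mu> = ?n * \<omega> / (?n + \<gamma>) * \<rho> powr (?n + \<gamma>)"
    using radial_mass s(1) by (smt (verit) mult_left_mono mult_less_cancel_left_pos)+
qed

lemma radial_value: "radial_const TYPE('n) k l * (real CARD('n) * \<omega> / (l + real CARD('n)) * \<rho> powr (real CARD('n) + \<gamma>)) powr e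
  = real CARD('n) * \<omega> * \<rho> ^ (CARD('n) - 1)"
proof -
  let ?n = "real CARD('n)"
  have "(?n * \<omega> / (l + ?n) * \<rho> powr (?n + \<gamma>)) powr e = (?n * \<omega> / (l + ?n)) powr e * (\<rho> powr (?n + \<gamma>)) powr e"
    by (rule powr_mult)
  also have "(\<rho> powr (?n + \<gamma>)) powr e = \<rho> powr (real (CARD('n) - 1))"
    using e(2) N by (simp add: powr_powr of_nat_diff)
  also have "\<dots> = \<rho> ^ (CARD('n) - 1)" by (rule powr_realpow[OF \<rho>(1)])
  finally show ?thesis using radial_const_mult[OF l(3), of k] unfolding \<omega>_def[symmetric] e_def[symmetric] by (simp add: mult.assoc[symmetric])
qed

lemma isoperimetric_inequality: "radial_const TYPE('n) k l * \<mu> powr e \<le> P"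
proof -
  have "\<mu> powr e \<le> (real CARD('n) * \<omega> / (l + real CARD('n)) * \<rho> powr (real CARD('n) + \<gamma>)) powr e"
    using comparison_mass(1) \<mu> e(1) by (intro powr_mono2) auto
  then have "radial_const TYPE('n) k l * \<mu> powr e \<le> real CARD('n) * \<omega> * \<rho> ^ (CARD('n) - 1)"
    unfolding radial_value[symmetric] using radial_const_pos[OF l(3), of k] by (intro mult_left_mono) auto
  then show ?thesis using perimeter_lower by linarith
qed

text \<open>Equality forces equality both in the Euclidean inequality and in the comparison of
  masses. If \<gamma> < 0 the latter yields the centred ball. If \<gamma> = 0 the former yields a
  ball, and since \<open>k = 0\<close> would then entail \<open>l = 0\<close>, the excluded pair
  leaves k < 0.\<close>

lemma equality_ball_image:
  assumes eq: "radial_const TYPE('n) k l * \<mu> powr e = P"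
  shows "\<exists>a. sym_diff E (ball a \<rho>) \<in> null_sets lborel \<and> ((k, l) \<noteq> (0, 0) \<longrightarrow> a = 0)"
proof -
  let ?c = "real CARD('n) * \<omega> / (l + real CARD('n)) * \<rho> powr (real CARD('n) + \<gamma>)"
  have C: "radial_const TYPE('n) k l > 0" by (rule radial_const_pos[OF l(3)])
  have P_eq: "P = real CARD('n) * \<omega> * \<rho> ^ (CARD('n) - 1)" and "\<mu> = ?c"
  proof -
    have le: "\<mu> powr e \<le> ?c powr e" using comparison_mass(1) \<mu> e(1) by (intro powr_mono2) auto
    then have "radial_const TYPE('n) k l * \<mu> powr e \<le> radial_const TYPE('n) k l * ?c powr e" using C by (intro mult_left_mono) auto
    then show P: "P = real CARD('n) * \<omega> * \<rho> ^ (CARD('n) - 1)"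
      using eq perimeter_lower unfolding radial_value by linarith
    show "\<mu> = ?c"
    proof (rule ccontr)
      assume "\<mu> \<noteq> ?c"
      then have "\<mu> < ?c" using comparison_mass(1) by linarith
      then have "\<mu> powr e < ?c powr e" using \<mu> e(1) by (intro powr_less_mono2) auto
      then have "radial_const TYPE('n) k l * \<mu> powr e < radial_const TYPE('n) k l * ?c powr e" using C by simp
      then show False using eq unfolding radial_value P by simp
    qed
  qed
  show ?thesis
  proof (cases "\<gamma> < 0")
    case True
    then have "sym_diff E (ball 0 \<rho>) \<in> null_sets lborel" using \<open>\<mu> = ?c\<close> comparison_mass(2) by (intro radial_mass_eq) auto
    then show ?thesis by blast
  next
    case False
    then have g: "\<gamma> = 0" using \<gamma>(2) by simp
    have P_eq': "P = CARD('n) * measure lebesgue E / \<rho>"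
      unfolding P_eq \<rho>(2) power_pred using \<rho>(1) by simp
    have "equality_case E \<rho>"
    proof
      show "measure lebesgue E = measure lebesgue (ball (0::real^'n) \<rho>)" using \<rho>(2) measure_ball by simp
      show "perimeter_le E (CARD('n) * measure lebesgue E / \<rho>)" using perimeter_le unfolding P_eq' .
    qed (use N E finite_volume \<rho> in auto)
    from equality_case.equality_ball[OF this] obtain a where a: "sym_diff E (ball a \<rho>) \<in> null_sets lborel" by blast
    have "a = 0" if kl: "(k, l) \<noteq> (0, 0)"
    proof (rule ball_centre_eq_0[OF _ \<rho>(1) a])
      show "P = CARD('n) * measure lebesgue (ball a \<rho>) / \<rho>" unfolding P_eq' \<rho>(2) measure_ball ..
      show "k < 0"
      proof (rule ccontr)
        assume "\<not> k < 0"
        then have "k = 0" using k(1) by simp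
        then have "l = 0" using \<gamma>(3) g by (simp add: s_eq)
        then show False using kl \<open>k = 0\<close> by simp
      qed
    qed
    then show ?thesis using a by blast
  qed
qed

text \<open>The density of the change of variables is positive off the origin, so null sets pull
  back to null sets. A centred ball pulls back to a centred ball; for k = l = 0 the map is the
  identity and the centre stays arbitrary.\<close>

lemma equality_ball_source:
  assumes eq: "radial_const TYPE('n) k l * \<mu> powr e = P"
  shows "\<exists>a R. R > 0 \<and> sym_diff M (ball a R) \<in> null_sets lebesgue \<and> ((k, l) \<noteq> (0, 0) \<longrightarrow> a = 0)"
proof -
  obtain a where a: "sym_diff E (ball a \<rho>) \<in> null_sets lborel" and a0: "(k, l) \<noteq> (0, 0) \<longrightarrow> a = 0"
    using equality_ball_image[OF eq] by blast
  let ?S = "sym_diff E (ball a \<rho>)" and ?R = "\<rho> powr (1 / (1 + s))"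
  have S [measurable]: "?S \<in> sets borel" using E by auto
  have "(\<integral>\<^sup>+y. indicator ?S y \<partial>lborel) = (\<integral>\<^sup>+x. ennreal ((1 + s) * norm x powr (s * DIM(real^'n))) * indicator ?S (radial_map s x) \<partial>lborel)"
    by (rule nn_integral_radial_map[OF s(1,2)]) measurable
  moreover have "(\<integral>\<^sup>+y. indicator ?S y \<partial>lborel) = 0" using a by (simp add: null_setsD1)
  ultimately have "(\<integral>\<^sup>+x. ennreal ((1 + s) * norm x powr (s * DIM(real^'n))) * indicator ?S (radial_map s x) \<partial>lborel) = 0" by metis
  moreover have "(\<lambda>x. ennreal ((1 + s) * norm x powr (s * DIM(real^'n))) * indicator ?S (radial_map s x)) \<in> borel_measurable lborel" by measurable
  ultimately have AE0: "AE x in lborel. ennreal ((1 + s) * norm x powr (s * DIM(real^'n))) * indicator ?S (radial_map s x) = (0::ennreal)"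
    using nn_integral_0_iff_AE by blast
  have iff: "radial_map s x \<in> ball a \<rho> \<longleftrightarrow> x \<in> ball a ?R" for x
  proof (cases "(k, l) = (0, 0)")
    case True
    then have s0: "s = 0" by (simp add: s_eq)
    have "radial_map s x = x" by (cases "x = 0") (simp_all add: s0 radial_map_def)
    then show ?thesis using \<rho>(1) by (simp add: s0)
  next
    case False
    have "norm x powr (1 + s) < \<rho> \<longleftrightarrow> norm x < ?R"
      using s(1) \<rho>(1) by (intro powr_less_iff_less_powr) auto
    then show ?thesis using a0 False norm_radial_map[OF s(1), of x] by simp
  qed
  have "AE x in lborel. x \<in> M \<longleftrightarrow> x \<in> ball a ?R"
    using AE0 EM AE_lborel_singleton[of "0::real^'n"]
  proof eventually_elim
    case (elim x)
    have "radial_map s x \<notin> ?S" using elim(1,3) s(1) by (auto simp: indicator_def ennreal_eq_0_iff mult_le_0_iff split: if_splits)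
    then have "radial_map s x \<in> E \<longleftrightarrow> radial_map s x \<in> ball a \<rho>" by blast
    then show ?case using elim(2) iff[of x] by blast
  qed
  then have "AE x in lborel. x \<notin> sym_diff M (ball a ?R)"
  proof eventually_elim
    case (elim x)
    then show ?case by blast
  qed
  then have "AE x in lebesgue. x \<notin> sym_diff M (ball a ?R)" by (rule AE_completion)
  moreover have "sym_diff M (ball a ?R) \<in> sets lebesgue" using M by (intro sets.Un sets.Diff) auto
  ultimately have "sym_diff M (ball a ?R) \<in> null_sets lebesgue" by (subst AE_iff_null_sets)
  then show ?thesis using \<rho>(1) a0 by (intro exI[of _ a] exI[of _ ?R]) auto
qed

end

lemma emeasure_weighted_measure:
  "M \<in> sets lebesgue \<Longrightarrow> emeasure (weighted_measure l) M = (\<integral>\<^sup>+x\<in>M. ennreal (norm x powr l) \<partial>lebesgue)"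
  unfolding weighted_measure_def by (rule emeasure_density) (auto intro!: measurable_completion)

lemma weighted_measure_ball:
  fixes l :: real
  assumes l: "l \<le> 0" "0 < l + real CARD('n::finite)"
  shows "emeasure (weighted_measure l) (ball (0::real^'n) 1) = ennreal (CARD('n) * measure lebesgue (ball (0::real^'n) 1) / (l + real CARD('n)))"
proof -
  have [measurable]: "ball (0::real^'n) 1 \<in> sets borel" by simp
  have "emeasure (weighted_measure l) (ball (0::real^'n) 1) = (\<integral>\<^sup>+x\<in>ball (0::real^'n) 1. ennreal (norm x powr l) \<partial>lborel)"
    by (subst emeasure_weighted_measure, simp, rule nn_integral_completion) 
  also have "\<dots> = ennreal (CARD('n) * measure lebesgue (ball (0::real^'n) 1) / (l + real CARD('n)))"
    using nn_integral_ball_powr[of l 1, where 'a="real^'n"] l by (simp add: add.commute)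
  finally show ?thesis .
qed

lemma weighted_isoperimetric_exists:
  fixes k l P :: real and M :: "(real^'n::finite) set"
  assumes N: "CARD('n) \<ge> 2" and k: "k \<le> 0" "0 < k + real CARD('n) - 1"
    and l: "l * ((real CARD('n) - 1) / real CARD('n)) \<le> k" "k \<le> l + 1" "0 < l + real CARD('n)"
    and M: "M \<in> admissible_sets l" and P: "weighted_perimeter k M \<le> ereal P"
  shows "\<exists>E. weighted_isoperimetric k (k / (real CARD('n) - 1)) P M E l (measure (weighted_measure l) M)"
proof -
  define s where "s = k / (real CARD('n) - 1)"
  have s: "- 1 < s" "s \<le> 0" using N k by (auto simp: s_def field_simps)
  have Ml: "M \<in> sets lebesgue" and Mfin: "0 < emeasure (weighted_measure l) M" "emeasure (weighted_measure l) M < \<infinity>"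
    using M by (auto simp: admissible_sets_def)
  \<comment> \<open>\<open>M\<close> is only Lebesgue measurable; its Borel main part differs from
    it by a null set.\<close>
  define M0 where "M0 = main_part lborel M"
  have M0: "M0 \<in> sets borel" using main_part_sets[of M lborel] Ml by (simp add: M0_def)
  have AEM: "AE x in lborel. x \<in> M0 \<longleftrightarrow> x \<in> M"
    using AE_notin_null_part[OF Ml]
  proof eventually_elim
    case (elim x)
    then show ?case using main_part_null_part_Un[OF Ml] by (auto simp: M0_def)
  qed
  \<comment> \<open>The image of \<open>M0\<close>, written as a preimage under the inverse map,
    which makes it Borel at once.\<close>
  define E where "E = radial_map (- s / (1 + s)) -` M0 - {0}"
  have E: "E \<in> sets borel"
    using measurable_sets[OF radial_map_measurable M0, of "- s / (1 + s)"] by (auto simp: E_def)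
  have EM0: "radial_map s x \<in> E \<longleftrightarrow> x \<in> M0" if "x \<noteq> 0" for x
  proof -
    have "radial_map s x \<noteq> 0" using that by (simp add: radial_map_def)
    then show ?thesis using radial_map_inverse[OF s(1), of x] by (simp add: E_def)
  qed
  have EM: "AE x in lborel. radial_map s x \<in> E \<longleftrightarrow> x \<in> M"
    using AEM AE_lborel_singleton[of "0::real^'n"]
  proof eventually_elim
    case (elim x)
    then show ?case using EM0[of x] by simp
  qed
  let ?g = "(l - s * real CARD('n)) / (1 + s)" and ?m = "measure (weighted_measure l) M"
  have m: "emeasure (weighted_measure l) M = ennreal ?m"
    using Mfin(2) by (simp add: emeasure_eq_ennreal_measure)
  have mpos: "?m > 0" using Mfin(1) unfolding m by simp
  note E [measurable] M0 [measurable]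
  have "(\<integral>\<^sup>+y\<in>E. ennreal (norm y powr ?g) \<partial>lborel) =
      (\<integral>\<^sup>+x. ennreal ((1 + s) * norm x powr (s * DIM(real^'n))) * (ennreal (norm (radial_map s x) powr ?g) * indicator E (radial_map s x)) \<partial>lborel)"
    by (rule nn_integral_radial_map[OF s]) measurable
  also have "\<dots> = (\<integral>\<^sup>+x. ennreal (1 + s) * (ennreal (norm x powr l) * indicator M0 x) \<partial>lborel)"
  proof (rule nn_integral_cong_AE)
    show "AE x in lborel. ennreal ((1 + s) * norm x powr (s * DIM(real^'n))) * (ennreal (norm (radial_map s x) powr ?g) * indicator E (radial_map s x))
      = ennreal (1 + s) * (ennreal (norm x powr l) * indicator M0 x)"
      using AE_lborel_singleton[of "0::real^'n"]
    proof eventually_elim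
      case (elim x)
      have "norm x powr (s * real CARD('n)) * norm (radial_map s x) powr ?g = norm x powr l"
        using s(1) by (simp add: norm_radial_map powr_powr powr_add[symmetric])
      then have "ennreal ((1 + s) * norm x powr (s * real CARD('n))) * ennreal (norm (radial_map s x) powr ?g) = ennreal (1 + s) * ennreal (norm x powr l)"
        using s(1) by (simp add: ennreal_mult'[symmetric] mult.assoc)
      then show ?case using EM0[OF elim] by (simp add: indicator_def)
    qed
  qed
  also have "\<dots> = ennreal (1 + s) * (\<integral>\<^sup>+x\<in>M0. ennreal (norm x powr l) \<partial>lborel)"
    by (rule nn_integral_cmult) measurable
  also have "(\<integral>\<^sup>+x\<in>M0. ennreal (norm x powr l) \<partial>lborel) = (\<integral>\<^sup>+x\<in>M0. ennreal (norm x powr l) \<partial>lebesgue)"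
    by (rule nn_integral_completion[symmetric])
  also have "\<dots> = (\<integral>\<^sup>+x\<in>M. ennreal (norm x powr l) \<partial>lebesgue)"
  proof (rule nn_integral_cong_AE)
    show "AE x in lebesgue. ennreal (norm x powr l) * indicator M0 x = ennreal (norm x powr l) * indicator M x"
      using AE_completion[OF AEM] by eventually_elim (simp add: indicator_def)
  qed
  also have "\<dots> = ennreal ?m" using emeasure_weighted_measure[OF Ml, of l] m by simp
  also have "ennreal (1 + s) * ennreal ?m = ennreal ((1 + s) * ?m)" using s(1) by (simp add: ennreal_mult')
  finally have nu: "(\<integral>\<^sup>+y\<in>E. ennreal (norm y powr ?g) \<partial>lborel) = ennreal ((1 + s) * ?m)" .
  have "weighted_isoperimetric k s P M E l ?m"
    by unfold_locales (use N k l Ml E P EM nu mpos in \<open>auto simp: s_def E_def\<close>)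
  then show ?thesis unfolding s_def by blast
qed

text \<open>Tested with the zero field. This rules out the value -\<infinity>, so that a perimeter
  other than \<infinity> is a real number.\<close>

lemma weighted_perimeter_nonneg: "0 \<le> weighted_perimeter k (M :: (real^'n::finite) set)"
proof -
  have z: "(\<lambda>_. 0) \<in> (C1_compact_support :: (real^'n \<Rightarrow> real^'n) set)"
    by (rule C1_compact_supportI[of _ "\<lambda>_ _. 0" 0]) auto
  have "((\<lambda>y::real^'n. norm y powr k *\<^sub>R (0::real^'n)) has_derivative (\<lambda>h. 0)) (at x)" for x by simp
  from divergence_eq[OF this] have "divergence (\<lambda>y::real^'n. norm y powr k *\<^sub>R (0::real^'n)) x = 0" for x by simp
  then have "ereal 0 = ereal (LINT x:M|lebesgue. divergence (\<lambda>y. norm y powr k *\<^sub>R 0) x)"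
    by (simp add: set_lebesgue_integral_def)
  also have "\<dots> \<le> weighted_perimeter k M"
    unfolding weighted_perimeter_def by (rule SUP_upper2[of "\<lambda>_. 0"]) (use z in auto)
  finally show ?thesis by (simp add: zero_ereal_def)
qed

theorem theorem5p2:
  fixes k l :: real
  assumes "CARD('n::finite) \<ge> 2"
    and "k + real CARD('n) - 1 > 0"
    and "l + real CARD('n) > 0"
    and "l * ((real CARD('n) - 1) / real CARD('n)) \<le> k"
    and "k \<le> min 0 (l + 1)"
  shows "isoperimetric_const TYPE('n) k l = ereal (radial_const TYPE('n) k l)
    \<and> (\<forall>M \<in> (admissible_sets l :: (real^'n) set set).
         isoperimetric_ratio k l M = ereal (radial_const TYPE('n) k l) \<longrightarrow>
           (\<exists>a R. R > 0 \<and> sym_diff M (ball a R) \<in> null_sets lebesgue \<and>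
                  ((k, l) \<noteq> (0, 0) \<longrightarrow> a = 0)))"
proof -
  let ?C = "radial_const TYPE('n) k l" and ?e = "(k + real CARD('n) - 1) / (l + real CARD('n))"
  let ?m = "\<lambda>M :: (real^'n) set. measure (weighted_measure l) M"
  have k: "k \<le> 0" "0 < k + real CARD('n) - 1" and l: "k \<le> l + 1" "0 < l + real CARD('n)" using assms by auto
  \<comment> \<open>The weighted volume of the unit ball is computed for nonpositive
    exponents.\<close>
  have l0: "l \<le> 0"
  proof (rule ccontr)
    assume "\<not> l \<le> 0"
    then have "l * ((real CARD('n) - 1) / real CARD('n)) > 0" using assms(1) by (intro mult_pos_pos divide_pos_pos) auto
    then show False using assms(4) k(1) by linarith
  qed
  have ratio: "\<exists>P E. weighted_perimeter k M = ereal P \<and> ?m M > 0 \<and>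
      isoperimetric_ratio k l M = ereal (P / ?m M powr ?e) \<and> weighted_isoperimetric k (k / (real CARD('n) - 1)) P M E l (?m M)"
    if M: "M \<in> admissible_sets l" and fin: "weighted_perimeter k M \<noteq> \<infinity>" for M :: "(real^'n) set"
  proof -
    obtain P where P: "weighted_perimeter k M = ereal P"
      using fin weighted_perimeter_nonneg[of k M] by (cases "weighted_perimeter k M") auto
    obtain E where E: "weighted_isoperimetric k (k / (real CARD('n) - 1)) P M E l (?m M)"
      using weighted_isoperimetric_exists[OF assms(1) k assms(4) l M] P by auto
    have "?m M > 0" by (rule weighted_isoperimetric.\<mu>[OF E])
    moreover have "isoperimetric_ratio k l M = ereal (P / ?m M powr ?e)"
      using \<open>?m M > 0\<close> by (simp add: isoperimetric_ratio_def P)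
    ultimately show ?thesis using P E by blast
  qed
  have lower: "ereal ?C \<le> isoperimetric_ratio k l M" if M: "M \<in> admissible_sets l" for M :: "(real^'n) set"
  proof (cases "weighted_perimeter k M = \<infinity>")
    case True
    have "?m M > 0"
      using M by (auto simp: admissible_sets_def emeasure_eq_ennreal_measure)
    then show ?thesis by (simp add: isoperimetric_ratio_def True)
  next
    case False
    from ratio[OF M False] obtain P E where *: "?m M > 0" "isoperimetric_ratio k l M = ereal (P / ?m M powr ?e)"
      "weighted_isoperimetric k (k / (real CARD('n) - 1)) P M E l (?m M)" by auto
    have "?C * ?m M powr ?e \<le> P"
      using weighted_isoperimetric.isoperimetric_inequality[OF *(3)] unfolding weighted_isoperimetric.e_def[OF *(3)] .
    then show ?thesis using *(1) unfolding *(2) by (simp add: le_divide_eq)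
  qed
  let ?B = "ball (0::real^'n) 1" and ?A = "CARD('n) * measure lebesgue (ball (0::real^'n) 1)"
  have "measure lebesgue ?B > 0" by (rule measure_pos_open[of _ 0]) auto
  then have A: "?A > 0" by simp
  note eB = weighted_measure_ball[OF l0 l(2)]
  have mB: "?m ?B = ?A / (l + real CARD('n))" unfolding measure_def eB using A l by simp
  have B: "?B \<in> admissible_sets l" unfolding admissible_sets_def using eB A l by simp
  \<comment> \<open>For the unit ball only this upper bound is computed directly; the reverse bound
    is the inequality just proved.\<close>
  have fB: "weighted_perimeter k ?B \<le> ereal ?A" by (rule weighted_perimeter_ball_le[OF assms(1) k])
  then have "weighted_perimeter k ?B \<noteq> \<infinity>" by auto
  from ratio[OF B this] obtain P where P: "weighted_perimeter k ?B = ereal P" "?m ?B > 0"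
    "isoperimetric_ratio k l ?B = ereal (P / ?m ?B powr ?e)" by auto
  have "P \<le> ?A" using fB P(1) by simp
  also have "?A = ?C * ?m ?B powr ?e" unfolding mB by (rule radial_const_mult[OF l(2), symmetric])
  finally have upper: "isoperimetric_ratio k l ?B \<le> ereal ?C" unfolding P(3) using P(2) by (simp add: divide_le_eq)
  have "isoperimetric_const TYPE('n) k l = ereal ?C"
    unfolding isoperimetric_const_def
  proof (rule antisym)
    show "(INF M\<in>admissible_sets l. isoperimetric_ratio k l (M :: (real^'n) set)) \<le> ereal ?C"
      using B upper by (rule INF_lower2)
    show "ereal ?C \<le> (INF M\<in>admissible_sets l. isoperimetric_ratio k l (M :: (real^'n) set))"
      by (rule INF_greatest) (rule lower)
  qed
  moreover have "\<exists>a R. R > 0 \<and> sym_diff M (ball a R) \<in> null_sets lebesgue \<and> ((k, l) \<noteq> (0, 0) \<longrightarrow> a = 0)"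
    if M: "M \<in> admissible_sets l" and eq: "isoperimetric_ratio k l M = ereal ?C" for M :: "(real^'n) set"
  proof -
    have "weighted_perimeter k M \<noteq> \<infinity>"
    proof
      assume inf: "weighted_perimeter k M = \<infinity>"
      have "?m M > 0"
        using M by (auto simp: admissible_sets_def emeasure_eq_ennreal_measure)
      then show False using eq by (simp add: isoperimetric_ratio_def inf)
    qed
    from ratio[OF M this] obtain P E where *: "?m M > 0" "isoperimetric_ratio k l M = ereal (P / ?m M powr ?e)"
      "weighted_isoperimetric k (k / (real CARD('n) - 1)) P M E l (?m M)" by auto
    have "?C * ?m M powr ?e = P" using eq *(1) unfolding *(2) by (simp add: divide_eq_eq)
    then show ?thesis
      by (intro weighted_isoperimetric.equality_ball_source[OF *(3)]) (simp only: weighted_isoperimetric.e_def[OF *(3)])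
  qed
  ultimately show ?thesis by blast
qed

end
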